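(* Let $X$ be the symplectic smoothing of a toric Gorenstein Fano surface $X_\Delta$, with its monotone Lagrangian torus $\mathbf{L}_0$ and immersed Lagrangian spheres $\mathbf{L}_{i,j}$, $j=1,\dots,n_i+1$. Then the Floer-theoretical mirror space (glued from the deformation spaces of $\mathbf{L}_0$ and all $\mathbf{L}_{i,j}$) is equal to $\check X_\Lambda=\check X+\Lambda_+^2$, where $\check X$ is given as follows. First, take the (multiple) blowing up of the toric variety $X_{\check\Delta}$ at every special point $z_i=-1$ in the $i$-th toric divisor $(n_i+1)$ times (where $n_i+1$ is the multiplicity of the $i$-th toric fixed point of $X_\Delta$). Then $\check X$ is the complement of the strict transform of all the toric divisors of $X_{\check\Delta}$.
   Context: Novikov ring $\Lambda_0=\{\sum_{k\ge0}a_k\mathbf{T}^{A_k}: a_k\in\mathbb{C},\ A_k\ge 0\text{ increasing to }+\infty\}$; $\Lambda_+$ is the subset with all $A_k>0$; $\Lambda$ allows all real $A_k$ increasing to $+\infty$; $\Lambda_0^\times$ is the group of invertible elements of $\Lambda_0$ (valuation zero); $\mathrm{val}$ is the valuation. Toric data: $\Delta\subset\mathbb{R}^2$ is an integral polygon with the origin as its unique interior lattice point, $M_0=X_\Delta$ the toric Gorenstein Fano surface with its toric K\"ahler form. $\check\Delta$ is the polar dual polygon and $X_{\check\Delta}$ its toric variety over $\mathbb{C}$. The toric fixed points of $X_\Delta$ are labelled by $i$ (counterclockwise); the $i$-th one is an $A_{n_i}$ singularity, $n_i\ge0$ ($n_i=0$: smooth point). They correspond bijectively to the toric prime divisors of $X_{\check\Delta}$;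 $z_i$ is the toric coordinate on the $i$-th such divisor; its special point is $z_i=-1$. "Blowing up $(n_i+1)$ times" means iterated blow-ups at the point lying on the (strict transform of the) $i$-th toric divisor over $z_i=-1$. Symplectic smoothing and Lagrangians: the toric chart at the $i$-th fixed point, $S_0=\{XY=Z^{n_i+1}\}\subset\mathbb{C}^3$, is smoothed to $S_\epsilon=\{XY=\prod_{k=1}^{n_i+1}(Z-\epsilon_k)\}$, $\epsilon_1<\dots<\epsilon_{n_i+1}$ real. Using a symplectomorphism, equivariant for $(e^{\mathrm{i}\theta}X,e^{-\mathrm{i}\theta}Y,Z)$ and for $(X,Y,Z)\mapsto(\bar Y,\bar X,\bar Z)$, between $U_\epsilon$ minus the vanishing spheres over the segments $[\epsilon_k,\epsilon_{k+1}]$ and $S_0-\{0\}$, for a neighbourhood $U_\epsilon\subset S_\epsilon$ of these spheres, one glues $U_\epsilon$ to $M_0$ minus the fixed point; doing so at all singular fixed points gives $X$. $\mathbf{L}_0\subset X$ is the torus corresponding to the moment fibre over the origin. Locally, with $\mu=|X|^2-|Y|^2$, $\mathbf{L}_0=Z^{-1}(C)\cap\mu^{-1}(0)$ for a conjugation-invariant simple loop $C$ around all $\epsilon_k$. Choose a diffeomorphism $\rho$ of $\mathbb{C}$ commuting with conjugation, identity outside a compact set, with $\rho(C)$ a circle centred on $\mathbb{R}$; let $C'_k$ be the circle centred on $\mathbb{R}$ with leftmost point $\rho(\epsilon_k)$, meeting $\rho(C)$ in two points, such that the two strips bounded by $\rho(C)$ and $C'_k$ have equal area for $(\rho^{-1})^*\omega_{\mathrm{red}}$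 ($\omega_{\mathrm{red}}$ the reduced symplectic form on $\mathbb{C}_Z$). Then $\mathbf{L}_{i,k}=Z^{-1}(\rho^{-1}(C'_k))\cap\mu^{-1}(0)$, an immersed Lagrangian sphere with one nodal point. Floer-theoretical mirror space: the space over $\Lambda$ glued from the chart $(\Lambda_0^\times)^2$ of flat $\Lambda_0^\times$-connections on $\mathbf{L}_0$ and the charts $\{(u_{i,j},v_{i,j})\in\Lambda_0^2:\mathrm{val}(u_{i,j}v_{i,j})>0\}$ of unobstructed boundary deformations $u_{i,j}U_{i,j}+v_{i,j}V_{i,j}$ of $\mathbf{L}_{i,j}$ ($U_{i,j},V_{i,j}$ the two degree one immersed generators at the node), with transition maps solving the Floer-theoretic isomorphism equations. For each $i$ these are $w_i=u_{i,1}$, $z_i=u_{i,1}v_{i,1}-1$ between $\mathbf{L}_0$ and $\mathbf{L}_{i,1}$, where $z_i$ is the holonomy along the local circle action orbit (the vanishing cycle) and $w_i$ the complementary holonomy, and $v_{i,j}=u_{i,j+1}^{-1}$, $u_{i,j}=u_{i,j+1}^2v_{i,j+1}$ between $\mathbf{L}_{i,j}$ and $\mathbf{L}_{i,j+1}$. Novikov extension: for a complex manifold $M$ of dimension $n$, $M+\Lambda_+^n$ is the union of charts $U+\Lambda_+^n$ ($U\subset\mathbb{C}^n$ charts of $M$) glued by the same (analytic) transition functions as $M$. *)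

theory Defs
  imports "HOL-Analysis.Analysis"
begin

section \<open>The Novikov field\<close>

text \<open>An element \<open>\<Sum>k. a k * T powr A k\<close> with exponents increasing to infinity is represented by its
  coefficient function \<open>A \<mapsto> coefficient of T powr A\<close>: below every bound only finitely many
  coefficients are nonzero.\<close>

typedef novikov = "{f :: real \<Rightarrow> complex. \<forall>B. finite {A. A \<le> B \<and> f A \<noteq> 0}}"
  morphisms ncoeff Abs_novikov
  by (rule exI[of _ "\<lambda>_. 0"]) simp

setup_lifting type_definition_novikov

lemma novikov_eqI: "(\<And>A. ncoeff x A = ncoeff y A) \<Longrightarrow> x = y"
  by (simp add: ncoeff_inject[symmetric] fun_eq_iff)

lemma finite_ncoeff: "finite {A. A \<le> B \<and> ncoeff x A \<noteq> 0}"
  using ncoeff[of x] by simp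

lemma ncoeff_lower_bound: "\<exists>L. \<forall>A<L. ncoeff x A = 0"
proof -
  let ?S = "{A. A \<le> 0 \<and> ncoeff x A \<noteq> 0}"
  have fin: "finite ?S" by (rule finite_ncoeff)
  show ?thesis
  proof (cases "?S = {}")
    case True
    then show ?thesis by (intro exI[of _ 0]) force
  next
    case False
    have "ncoeff x A = 0" if "A < Min ?S" for A
    proof (rule ccontr)
      assume nz: "ncoeff x A \<noteq> 0"
      have "Min ?S \<le> 0" using Min_in[OF fin False] by simp
      with that nz have "A \<in> ?S" by simp
      then show False using Min_le[OF fin] that by fastforce
    qed
    then show ?thesis by blast
  qed
qed

text \<open>\<open>nmonom c A\<close> is \<open>c * T powr A\<close>.\<close>

lift_definition nmonom :: "complex \<Rightarrow> real \<Rightarrow> novikov" is "\<lambda>c A B. if B = A then c else 0"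
  by (rule finite_subset[of _ "{A}" for A]) (auto split: if_splits)

definition conv :: "(real \<Rightarrow> complex) \<Rightarrow> (real \<Rightarrow> complex) \<Rightarrow> real \<Rightarrow> complex" where
  "conv f g A = (\<Sum>B | f B \<noteq> 0 \<and> g (A - B) \<noteq> 0. f B * g (A - B))"

lemma conv_eq_double:
  assumes "finite F" "finite G"
    and "\<And>B C. f B \<noteq> 0 \<Longrightarrow> g C \<noteq> 0 \<Longrightarrow> B + C = A \<Longrightarrow> B \<in> F \<and> C \<in> G"
  shows "conv f g A = (\<Sum>B\<in>F. \<Sum>C\<in>G. if B + C = A then f B * g C else 0)"
proof -
  have "(\<Sum>C\<in>G. if B + C = A then f B * g C else 0) = f B * g (A - B)" if "B \<in> F" for B
  proof -
    have "(\<Sum>C\<in>G. if B + C = A then f B * g C else 0) = (\<Sum>C\<in>G. if C = A - B then f B * g (A - B) else 0)"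
      by (rule sum.cong) (auto simp: algebra_simps)
    also have "\<dots> = (if A - B \<in> G then f B * g (A - B) else 0)"
      using assms(2) by (simp add: sum.delta)
    also have "\<dots> = f B * g (A - B)"
      using assms(3)[of B "A - B"] by auto
    finally show ?thesis .
  qed
  then have "(\<Sum>B\<in>F. \<Sum>C\<in>G. if B + C = A then f B * g C else 0) = (\<Sum>B\<in>F. f B * g (A - B))"
    by simp
  also have "\<dots> = conv f g A"
    unfolding conv_def
  proof (rule sum.mono_neutral_right)
    show "{B. f B \<noteq> 0 \<and> g (A - B) \<noteq> 0} \<subseteq> F"
    proof
      fix B assume "B \<in> {B. f B \<noteq> 0 \<and> g (A - B) \<noteq> 0}"
      then show "B \<in> F" using assms(3)[of B "A - B"] by simp
    qed
  qed (use assms(1) in auto)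
  finally show ?thesis by simp
qed

lemma conv_nz: "conv f g A \<noteq> 0 \<Longrightarrow> \<exists>B. f B \<noteq> 0 \<and> g (A - B) \<noteq> 0"
proof (rule ccontr)
  assume nz: "conv f g A \<noteq> 0" and "\<not> (\<exists>B. f B \<noteq> 0 \<and> g (A - B) \<noteq> 0)"
  then have empty: "{B. f B \<noteq> 0 \<and> g (A - B) \<noteq> 0} = {}" by blast
  show False using nz unfolding conv_def empty by simp
qed

lemma conv_finite:
  assumes "\<forall>B. finite {A. A \<le> B \<and> f A \<noteq> 0}" "\<forall>B. finite {A. A \<le> B \<and> g A \<noteq> 0}"
  shows "\<forall>B. finite {A. A \<le> B \<and> conv f g A \<noteq> 0}"
proof -
  have "f = ncoeff (Abs_novikov f)" "g = ncoeff (Abs_novikov g)"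
    using assms by (simp_all add: Abs_novikov_inverse)
  then obtain x y where xy: "f = ncoeff x" "g = ncoeff y" by blast
  show "\<forall>B. finite {A. A \<le> B \<and> conv f g A \<noteq> 0}"
  proof
    fix K
    obtain L where L: "\<And>A. A < L \<Longrightarrow> ncoeff x A = 0" using ncoeff_lower_bound by blast
    obtain M where M: "\<And>A. A < M \<Longrightarrow> ncoeff y A = 0" using ncoeff_lower_bound by blast
    let ?F = "{A. A \<le> K - M \<and> ncoeff x A \<noteq> 0}" and ?G = "{A. A \<le> K - L \<and> ncoeff y A \<noteq> 0}"
    have "{A. A \<le> K \<and> conv f g A \<noteq> 0} \<subseteq> (\<lambda>(B,C). B + C) ` (?F \<times> ?G)"
    proof
      fix A assume A: "A \<in> {A. A \<le> K \<and> conv f g A \<noteq> 0}"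
      then obtain B where B: "f B \<noteq> 0" "g (A - B) \<noteq> 0" using conv_nz by blast
      have "B \<ge> L" using L[of B] B xy by (simp only: not_less[symmetric]) blast
      moreover have "A - B \<ge> M" using M[of "A - B"] B xy by (simp only: not_less[symmetric]) blast
      ultimately have "B \<in> ?F" "A - B \<in> ?G" using A B xy by auto
      then show "A \<in> (\<lambda>(B,C). B + C) ` (?F \<times> ?G)"
        by (intro image_eqI[of _ _ "(B, A - B)"]) auto
    qed
    then show "finite {A. A \<le> K \<and> conv f g A \<noteq> 0}"
      by (rule finite_subset) (intro finite_imageI finite_cartesian_product finite_ncoeff)
  qed
qed

lift_definition ntimes :: "novikov \<Rightarrow> novikov \<Rightarrow> novikov" is conv
  using conv_finite by blast

lemma plus_finite:
  assumes "\<forall>B. finite {A. A \<le> B \<and> f A \<noteq> 0}" "\<forall>B. finite {A. A \<le> B \<and> g A \<noteq> 0}"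
  shows "\<forall>B. finite {A. A \<le> B \<and> f A + g A \<noteq> (0 :: complex)}"
proof
  fix B
  have "finite ({A. A \<le> B \<and> f A \<noteq> 0} \<union> {A. A \<le> B \<and> g A \<noteq> 0})" using assms by simp
  then show "finite {A. A \<le> B \<and> f A + g A \<noteq> 0}" by (rule rev_finite_subset) auto
qed

instantiation novikov :: "{zero,one,plus,minus,uminus,times}"
begin
lift_definition zero_novikov :: novikov is "\<lambda>_. 0" by simp
definition one_novikov :: novikov where "1 = nmonom 1 0"
lift_definition plus_novikov :: "novikov \<Rightarrow> novikov \<Rightarrow> novikov" is "\<lambda>f g A. f A + g A"
  using plus_finite by blast
lift_definition uminus_novikov :: "novikov \<Rightarrow> novikov" is "\<lambda>f A. - f A" by simp
definition minus_novikov :: "novikov \<Rightarrow> novikov \<Rightarrow> novikov" where "minus_novikov x y = x + (- y)"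
definition times_novikov :: "novikov \<Rightarrow> novikov \<Rightarrow> novikov" where "times_novikov = ntimes"
instance ..
end

lemma ncoeff_simps [simp]:
  "ncoeff 0 A = 0" "ncoeff (x + y) A = ncoeff x A + ncoeff y A"
  "ncoeff (- x) A = - ncoeff x A" "ncoeff (x - y) A = ncoeff x A - ncoeff y A"
  "ncoeff 1 A = (if A = 0 then 1 else 0)" "ncoeff (nmonom c B) A = (if A = B then c else 0)"
  by (simp_all add: zero_novikov.rep_eq plus_novikov.rep_eq uminus_novikov.rep_eq
      minus_novikov_def one_novikov_def nmonom.rep_eq)

lemma ncoeff_times: "ncoeff (x * y) = conv (ncoeff x) (ncoeff y)"
  by (simp add: times_novikov_def ntimes.rep_eq)

lemma ncoeff_times_eq:
  assumes "finite F" "finite G"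
    and "\<And>B C. ncoeff x B \<noteq> 0 \<Longrightarrow> ncoeff y C \<noteq> 0 \<Longrightarrow> B + C = A \<Longrightarrow> B \<in> F \<and> C \<in> G"
  shows "ncoeff (x * y) A = (\<Sum>B\<in>F. \<Sum>C\<in>G. if B + C = A then ncoeff x B * ncoeff y C else 0)"
  unfolding ncoeff_times by (rule conv_eq_double[OF assms])

lemma ncoeff_times_nz:
  "ncoeff (x * y) A \<noteq> 0 \<Longrightarrow> \<exists>B C. ncoeff x B \<noteq> 0 \<and> ncoeff y C \<noteq> 0 \<and> B + C = A"
  using conv_nz[of "ncoeff x" "ncoeff y" A] unfolding ncoeff_times by (metis add_diff_cancel_left' add.commute diff_add_cancel)

definition ncut :: "novikov \<Rightarrow> real \<Rightarrow> real set" where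
  "ncut x K = {A. A \<le> K \<and> ncoeff x A \<noteq> 0}"

lemma finite_ncut [simp]: "finite (ncut x K)"
  unfolding ncut_def by (rule finite_ncoeff)

lemma ncoeff_times_trunc:
  assumes "\<And>A. A < L \<Longrightarrow> ncoeff x A = 0" "\<And>A. A < M \<Longrightarrow> ncoeff y A = 0"
    "A - M \<le> K" "A - L \<le> K'"
  shows "ncoeff (x * y) A = (\<Sum>B\<in>ncut x K. \<Sum>C\<in>ncut y K'. if B + C = A then ncoeff x B * ncoeff y C else 0)"
proof (rule ncoeff_times_eq)
  fix B C assume *: "ncoeff x B \<noteq> 0" "ncoeff y C \<noteq> 0" "B + C = A"
  have "B \<ge> L" "C \<ge> M" using assms(1,2) * by (meson not_less)+
  with * assms(3,4) show "B \<in> ncut x K \<and> C \<in> ncut y K'" by (auto simp: ncut_def)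
qed simp_all

lemma novikov_times_comm: "x * y = y * (x :: novikov)"
proof (rule novikov_eqI)
  fix A
  obtain L where L: "\<And>A. A < L \<Longrightarrow> ncoeff x A = 0" using ncoeff_lower_bound by blast
  obtain M where M: "\<And>A. A < M \<Longrightarrow> ncoeff y A = 0" using ncoeff_lower_bound by blast
  let ?h = "\<lambda>B C. if B + C = A then ncoeff x B * ncoeff y C else 0"
  have "ncoeff (x * y) A = (\<Sum>B\<in>ncut x (A - M). \<Sum>C\<in>ncut y (A - L). ?h B C)"
    by (rule ncoeff_times_trunc[OF L M order_refl order_refl])
  also have "\<dots> = (\<Sum>C\<in>ncut y (A - L). \<Sum>B\<in>ncut x (A - M). ?h B C)"
    by (rule sum.swap)
  also have "\<dots> = (\<Sum>C\<in>ncut y (A - L). \<Sum>B\<in>ncut x (A - M).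
      if C + B = A then ncoeff y C * ncoeff x B else 0)"
    by (intro sum.cong refl) (simp add: add.commute mult.commute)
  also have "\<dots> = ncoeff (y * x) A"
    by (rule ncoeff_times_trunc[OF M L order_refl order_refl, symmetric])
  finally show "ncoeff (x * y) A = ncoeff (y * x) A" .
qed

lemma novikov_times_lower:
  assumes "\<And>A. A < L \<Longrightarrow> ncoeff x A = 0" "\<And>A. A < M \<Longrightarrow> ncoeff y A = 0" "A < L + M"
  shows "ncoeff (x * y) A = 0"
proof (rule ccontr)
  assume "ncoeff (x * y) A \<noteq> 0"
  then obtain B C where "ncoeff x B \<noteq> 0" "ncoeff y C \<noteq> 0" "B + C = A" using ncoeff_times_nz by blast
  moreover have "B \<ge> L" "C \<ge> M" using assms(1,2) calculation by (meson not_less)+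
  ultimately show False using assms(3) by linarith
qed

lemma novikov_times_assoc: "(x * y) * z = x * (y * (z :: novikov))"
proof -
  have key: "ncoeff ((x * y) * z) A =
      (\<Sum>B\<in>ncut x K. \<Sum>C\<in>ncut y K. \<Sum>D\<in>ncut z K. if B + C + D = A then ncoeff x B * ncoeff y C * ncoeff z D else 0)"
    if L: "\<And>A. A < L \<Longrightarrow> ncoeff x A = 0" and M: "\<And>A. A < M \<Longrightarrow> ncoeff y A = 0"
      and N: "\<And>A. A < N \<Longrightarrow> ncoeff z A = 0"
      and K: "A - M - N \<le> K" "A - L - N \<le> K" "A - L - M \<le> K" for x y z A K L M N
  proof -
    let ?P = "(\<lambda>(B,C). B + C) ` (ncut x K \<times> ncut y K)"
    have fP: "finite ?P" by simp
    have sub: "B \<in> ncut x K" "C \<in> ncut y K" "D \<in> ncut z K"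
      if "ncoeff x B \<noteq> 0" "ncoeff y C \<noteq> 0" "ncoeff z D \<noteq> 0" "B + C + D = A" for B C D
    proof -
      have "B \<ge> L" "C \<ge> M" "D \<ge> N" using L M N that by (meson not_less)+
      then show "B \<in> ncut x K" "C \<in> ncut y K" "D \<in> ncut z K"
        using K that by (auto simp: ncut_def)
    qed
    have "ncoeff ((x * y) * z) A = (\<Sum>X\<in>?P. \<Sum>D\<in>ncut z K. if X + D = A then ncoeff (x * y) X * ncoeff z D else 0)"
    proof (rule ncoeff_times_eq)
      fix X D assume *: "ncoeff (x * y) X \<noteq> 0" "ncoeff z D \<noteq> 0" "X + D = A"
      then obtain B C where "ncoeff x B \<noteq> 0" "ncoeff y C \<noteq> 0" "B + C = X" using ncoeff_times_nz by blast
      with sub[of B C D] * show "X \<in> ?P \<and> D \<in> ncut z K"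
        by (auto intro!: image_eqI[of _ _ "(B,C)"])
    qed (use fP in simp_all)
    also have "\<dots> = (\<Sum>X\<in>?P. \<Sum>D\<in>ncut z K. if X + D = A then
        (\<Sum>B\<in>ncut x K. \<Sum>C\<in>ncut y K. if B + C = X then ncoeff x B * ncoeff y C else 0) * ncoeff z D else 0)"
    proof (intro sum.cong refl, goal_cases)
      case (1 X D)
      show ?case
      proof (cases "X + D = A \<and> ncoeff z D \<noteq> 0")
        case True
        have "ncoeff (x * y) X = (\<Sum>B\<in>ncut x K. \<Sum>C\<in>ncut y K. if B + C = X then ncoeff x B * ncoeff y C else 0)"
          by (rule ncoeff_times_eq) (use sub[of _ _ D] True in auto)
        then show ?thesis by simp
      qed auto
    qed
    also have "\<dots> = (\<Sum>X\<in>?P. \<Sum>D\<in>ncut z K. \<Sum>B\<in>ncut x K. \<Sum>C\<in>ncut y K.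
        if B + C = X then (if B + C + D = A then ncoeff x B * ncoeff y C * ncoeff z D else 0) else 0)"
    proof (intro sum.cong refl, goal_cases)
      case (1 X D)
      show ?case
      proof (cases "X + D = A")
        case True
        then show ?thesis
          by (auto simp: sum_distrib_right intro!: sum.cong)
      next
        case False
        have "(if B + C = X then (if B + C + D = A then ncoeff x B * ncoeff y C * ncoeff z D else 0) else 0) = 0" for B C
          using False by auto
        then show ?thesis using False by (simp only: if_False sum.neutral_const)
      qed
    qed
    also have "\<dots> = (\<Sum>D\<in>ncut z K. \<Sum>B\<in>ncut x K. \<Sum>C\<in>ncut y K. \<Sum>X\<in>?P.
        if B + C = X then (if B + C + D = A then ncoeff x B * ncoeff y C * ncoeff z D else 0) else 0)"
      by (rule trans[OF sum.swap], rule sum.cong[OF refl], rule trans[OF sum.swap], rule sum.cong[OF refl], rule sum.swap)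
    also have "\<dots> = (\<Sum>D\<in>ncut z K. \<Sum>B\<in>ncut x K. \<Sum>C\<in>ncut y K.
        if B + C + D = A then ncoeff x B * ncoeff y C * ncoeff z D else 0)"
    proof (intro sum.cong refl, goal_cases)
      case (1 D B C)
      then have "B + C \<in> ?P" by (intro image_eqI[of _ _ "(B,C)"]) auto
      then show ?case using fP by (subst sum.delta') auto
    qed
    also have "\<dots> = (\<Sum>B\<in>ncut x K. \<Sum>C\<in>ncut y K. \<Sum>D\<in>ncut z K.
        if B + C + D = A then ncoeff x B * ncoeff y C * ncoeff z D else 0)"
      by (rule trans[OF sum.swap], rule sum.cong[OF refl], rule sum.swap)
    finally show ?thesis .
  qed
  show ?thesis
  proof (rule novikov_eqI)
    fix A
    obtain L where L: "\<And>A. A < L \<Longrightarrow> ncoeff x A = 0" using ncoeff_lower_bound by blast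
    obtain M where M: "\<And>A. A < M \<Longrightarrow> ncoeff y A = 0" using ncoeff_lower_bound by blast
    obtain N where N: "\<And>A. A < N \<Longrightarrow> ncoeff z A = 0" using ncoeff_lower_bound by blast
    define K where "K = max (A - M - N) (max (A - L - N) (A - L - M))"
    have "ncoeff (x * (y * z)) A = ncoeff ((y * z) * x) A" by (simp only: novikov_times_comm)
    also have "\<dots> = (\<Sum>B\<in>ncut y K. \<Sum>C\<in>ncut z K. \<Sum>D\<in>ncut x K. if B + C + D = A then ncoeff y B * ncoeff z C * ncoeff x D else 0)"
      by (rule key[OF M N L]) (auto simp: K_def)
    also have "\<dots> = (\<Sum>D\<in>ncut x K. \<Sum>B\<in>ncut y K. \<Sum>C\<in>ncut z K. if B + C + D = A then ncoeff y B * ncoeff z C * ncoeff x D else 0)"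
      by (rule trans[OF sum.cong[OF refl sum.swap] sum.swap])
    also have "\<dots> = (\<Sum>B\<in>ncut x K. \<Sum>C\<in>ncut y K. \<Sum>D\<in>ncut z K. if B + C + D = A then ncoeff x B * ncoeff y C * ncoeff z D else 0)"
      by (intro sum.cong refl) (auto simp: algebra_simps)
    also have "\<dots> = ncoeff ((x * y) * z) A"
      by (rule key[OF L M N, symmetric]) (auto simp: K_def)
    finally show "ncoeff ((x * y) * z) A = ncoeff (x * (y * z)) A" by simp
  qed
qed

lemma ncoeff_nmonom_times: "ncoeff (nmonom c B * x) A = c * ncoeff x (A - B)"
proof -
  have "ncoeff (nmonom c B * x) A = (\<Sum>B'\<in>{B}. \<Sum>C\<in>{A - B}. if B' + C = A then ncoeff (nmonom c B) B' * ncoeff x C else 0)"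
    by (rule ncoeff_times_eq) (auto split: if_splits)
  then show ?thesis by simp
qed

lemma novikov_distrib: "(x + y) * z = x * z + y * (z :: novikov)"
proof (rule novikov_eqI)
  fix A
  obtain L where L: "\<And>A. A < L \<Longrightarrow> ncoeff x A = 0" using ncoeff_lower_bound by blast
  obtain M where M: "\<And>A. A < M \<Longrightarrow> ncoeff y A = 0" using ncoeff_lower_bound by blast
  obtain N where N: "\<And>A. A < N \<Longrightarrow> ncoeff z A = 0" using ncoeff_lower_bound by blast
  define F where "F = ncut x (A - N) \<union> ncut y (A - N)"
  define G where "G = ncut z (A - min L M)"
  have fin: "finite F" "finite G" by (auto simp: F_def G_def)
  have z: "C \<ge> N" if "ncoeff z C \<noteq> 0" for C using N that by (meson not_less)
  have x: "B \<ge> min L M" if "ncoeff x B \<noteq> 0 \<or> ncoeff y B \<noteq> 0" for B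
    using L M that by (meson not_less min_less_iff_conj)
  have in_FG: "B \<in> F \<and> C \<in> G" if "ncoeff x B \<noteq> 0 \<or> ncoeff y B \<noteq> 0" "ncoeff z C \<noteq> 0" "B + C = A" for B C
    using x[OF that(1)] z[OF that(2)] that by (auto simp: F_def G_def ncut_def)
  have 1: "ncoeff (x * z) A = (\<Sum>B\<in>F. \<Sum>C\<in>G. if B + C = A then ncoeff x B * ncoeff z C else 0)"
    by (rule ncoeff_times_eq[OF fin]) (use in_FG in auto)
  have 2: "ncoeff (y * z) A = (\<Sum>B\<in>F. \<Sum>C\<in>G. if B + C = A then ncoeff y B * ncoeff z C else 0)"
    by (rule ncoeff_times_eq[OF fin]) (use in_FG in auto)
  have 3: "ncoeff ((x + y) * z) A = (\<Sum>B\<in>F. \<Sum>C\<in>G. if B + C = A then ncoeff (x + y) B * ncoeff z C else 0)"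
  proof (rule ncoeff_times_eq[OF fin])
    fix B C assume *: "ncoeff (x + y) B \<noteq> 0" "ncoeff z C \<noteq> 0" "B + C = A"
    then have "ncoeff x B \<noteq> 0 \<or> ncoeff y B \<noteq> 0" by auto
    then show "B \<in> F \<and> C \<in> G" using in_FG * by blast
  qed
  show "ncoeff ((x + y) * z) A = ncoeff (x * z + y * z) A"
    unfolding ncoeff_simps(2)[of "x * z"] 1 2 3
    by (simp add: sum.distrib[symmetric] distrib_right if_distrib cong: if_cong)
qed

instance novikov :: comm_ring_1
proof
  fix x y z :: novikov
  show "x * y * z = x * (y * z)" by (rule novikov_times_assoc)
  show "x * y = y * x" by (rule novikov_times_comm)
  show "1 * x = x" by (rule novikov_eqI) (simp add: one_novikov_def ncoeff_nmonom_times)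
  show "(x + y) * z = x * z + y * z" by (rule novikov_distrib)
  show "x + y + z = x + (y + z)" "x + y = y + x" "0 + x = x" "- x + x = 0" "x - y = x + - y"
    by (rule novikov_eqI, simp)+
  have "ncoeff (0 :: novikov) 0 \<noteq> ncoeff 1 0" by simp
  then show "(0 :: novikov) \<noteq> 1" by metis
qed

lemma novikov_times_cong:
  assumes "\<And>A. A < L \<Longrightarrow> ncoeff x A = 0" "\<And>C. C \<le> A - L \<Longrightarrow> ncoeff y C = ncoeff y' C"
  shows "ncoeff (x * y) A = ncoeff (x * y') A"
proof -
  have "ncoeff (x * (y - y')) A = 0"
  proof (rule ccontr)
    assume "ncoeff (x * (y - y')) A \<noteq> 0"
    then obtain B C where BC: "ncoeff x B \<noteq> 0" "ncoeff (y - y') C \<noteq> 0" "B + C = A"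
      using ncoeff_times_nz by blast
    then have "L \<le> B" using assms(1) by (meson not_less)
    then have "C \<le> A - L" using BC by simp
    then show False using assms(2) BC by simp
  qed
  moreover have "x * (y - y') = x * y - x * y'" by (simp add: right_diff_distrib)
  ultimately show ?thesis by simp
qed

lemma novikov_inverse_exists:
  fixes x :: novikov
  assumes "x \<noteq> 0"
  shows "\<exists>y. x * y = 1"
proof -
  obtain A0 where A0: "ncoeff x A0 \<noteq> 0" using assms novikov_eqI[of x 0] by auto
  define a where "a = Min (ncut x A0)"
  have ne: "ncut x A0 \<noteq> {}" using A0 by (auto simp: ncut_def)
  have a_in: "a \<in> ncut x A0" unfolding a_def by (rule Min_in) (use ne in auto)
  have a_nz: "ncoeff x a \<noteq> 0" and a_le: "a \<le> A0" using a_in by (auto simp: ncut_def)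
  have a_min: "ncoeff x A = 0" if "A < a" for A
  proof (rule ccontr)
    assume "ncoeff x A \<noteq> 0"
    then have "A \<in> ncut x A0" using that a_le by (auto simp: ncut_def)
    then have "a \<le> A" by (simp add: a_def)
    then show False using that by simp
  qed
  define m where "m = nmonom (1 / ncoeff x a) (- a)"
  define y where "y = 1 - m * x"
  have cy: "ncoeff y A = (if A = 0 then 1 else 0) - ncoeff x (A + a) / ncoeff x a" for A
    by (simp add: y_def m_def ncoeff_nmonom_times)
  define S where "S = ncut y 1"
  define d where "d = (if S = {} then 1 else Min S)"
  have y0: "ncoeff y A = 0" if "A \<le> 0" for A
    using a_min[of "A + a"] a_nz that by (cases "A = 0") (auto simp: cy)
  have dpos: "d > 0"
  proof (cases "S = {}")
    case False
    have "Min S \<in> S" by (rule Min_in) (use False in \<open>auto simp: S_def\<close>)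
    then have "ncoeff y (Min S) \<noteq> 0" by (auto simp: S_def ncut_def)
    then have "Min S > 0" using y0 by (meson not_less)
    then show ?thesis by (simp add: d_def False)
  qed (simp add: d_def)
  have d1: "d \<le> 1"
  proof (cases "S = {}")
    case False
    have "Min S \<in> S" by (rule Min_in) (use False in \<open>auto simp: S_def\<close>)
    then show ?thesis by (auto simp: d_def S_def ncut_def)
  qed (simp add: d_def)
  have yd: "ncoeff y A = 0" if "A < d" for A
  proof (rule ccontr)
    assume *: "ncoeff y A \<noteq> 0"
    then have "A \<in> S" using that d1 by (auto simp: S_def ncut_def)
    moreover have "finite S" by (simp add: S_def)
    ultimately have "d \<le> A" by (auto simp: d_def)
    then show False using that by simp
  qed
  have pw: "A < real k * d \<Longrightarrow> ncoeff (y ^ k) A = 0" for k A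
  proof (induction k arbitrary: A)
    case (Suc k)
    show ?case unfolding power_Suc
      by (rule novikov_times_lower[OF yd Suc.IH]) (use Suc.prems in \<open>auto simp: algebra_simps\<close>)
  qed auto
  define K where "K = (\<lambda>A. nat \<lceil>A / d\<rceil> + 1)"
  have Kgt: "A < real k * d" if "K A \<le> k" for A k
  proof -
    have "A / d < real (K A)" unfolding K_def by linarith
    also have "\<dots> \<le> real k" using that by simp
    finally show ?thesis using dpos by (simp add: field_simps)
  qed
  define g where "g = (\<lambda>A. \<Sum>k<K A. ncoeff (y ^ k) A)"
  have gK: "g A = ncoeff (\<Sum>k<k0. y ^ k) A" if "K A \<le> k0" for A k0
  proof -
    have cs: "ncoeff (\<Sum>k\<in>I. h k) A = (\<Sum>k\<in>I. ncoeff (h k) A)" if "finite I" for I and h :: "nat \<Rightarrow> novikov"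
      using that by (induction I) auto
    have "g A = (\<Sum>k<k0. ncoeff (y ^ k) A)"
      unfolding g_def by (rule sum.mono_neutral_left) (use that pw Kgt in auto)
    then show ?thesis by (simp add: cs)
  qed
  have Kmono: "K A \<le> K B" if "A \<le> B" for A B
  proof -
    have "A / d \<le> B / d" using that dpos by (simp add: divide_right_mono)
    then have "nat \<lceil>A / d\<rceil> \<le> nat \<lceil>B / d\<rceil>" by (intro nat_mono ceiling_mono)
    then show ?thesis by (simp add: K_def)
  qed
  have fin: "\<forall>B. finite {A. A \<le> B \<and> g A \<noteq> 0}"
  proof
    fix B
    have "{A. A \<le> B \<and> g A \<noteq> 0} \<subseteq> ncut (\<Sum>k<K B. y ^ k) B"
    proof
      fix A assume "A \<in> {A. A \<le> B \<and> g A \<noteq> 0}"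
      then show "A \<in> ncut (\<Sum>k<K B. y ^ k) B"
        using gK[OF Kmono[of A B]] by (simp add: ncut_def)
    qed
    then show "finite {A. A \<le> B \<and> g A \<noteq> 0}" using finite_subset finite_ncut by blast
  qed
  define G where "G = Abs_novikov g"
  have cG: "ncoeff G = g" unfolding G_def using fin by (simp add: Abs_novikov_inverse)
  have "(1 - y) * G = 1"
  proof (rule novikov_eqI)
    fix A
    let ?k = "K A"
    have "ncoeff ((1 - y) * G) A = ncoeff ((1 - y) * (\<Sum>k<?k. y ^ k)) A"
    proof (rule novikov_times_cong[where L = 0])
      show "ncoeff (1 - y) C = 0" if "C < 0" for C using that y0 by simp
      show "ncoeff G C = ncoeff (\<Sum>k<?k. y ^ k) C" if "C \<le> A - 0" for C
        using gK[of C ?k] Kmono[of C A] that by (simp add: cG)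
    qed
    also have "(1 - y) * (\<Sum>k<?k. y ^ k) = 1 - y ^ ?k"
      by (simp add: one_diff_power_eq)
    also have "ncoeff (1 - y ^ ?k) A = ncoeff 1 A"
      using pw[OF Kgt[OF order_refl]] by simp
    finally show "ncoeff ((1 - y) * G) A = ncoeff 1 A" .
  qed
  then have "x * (m * G) = 1" by (simp add: y_def ac_simps)
  then show ?thesis by blast
qed

instantiation novikov :: field
begin
definition inverse_novikov :: "novikov \<Rightarrow> novikov" where
  "inverse_novikov x = (if x = 0 then 0 else SOME y. x * y = 1)"
definition divide_novikov :: "novikov \<Rightarrow> novikov \<Rightarrow> novikov" where
  "divide_novikov x y = x * inverse y"
instance
proof
  fix x y :: novikov
  show "inverse x * x = 1" if "x \<noteq> 0"
  proof -
    have "x * inverse x = 1"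
      using someI_ex[OF novikov_inverse_exists[OF that]] that by (simp add: inverse_novikov_def)
    then show ?thesis by (simp only: mult.commute)
  qed
qed (simp_all add: inverse_novikov_def divide_novikov_def)
end

text \<open>The T-adic topology; infinite sums in the Novikov field are taken with respect to it.\<close>

instantiation novikov :: t2_space
begin
definition open_novikov :: "novikov set \<Rightarrow> bool" where
  "open U \<longleftrightarrow> (\<forall>x\<in>U. \<exists>B. \<forall>y. (\<forall>A\<le>B. ncoeff y A = ncoeff x A) \<longrightarrow> y \<in> U)"
instance
proof
  show "open (UNIV :: novikov set)" by (simp add: open_novikov_def)
next
  fix S T :: "novikov set" assume S: "open S" and T: "open T"
  show "open (S \<inter> T)" unfolding open_novikov_def
  proof
    fix x assume x: "x \<in> S \<inter> T"
    obtain B where B: "\<And>y. (\<forall>A\<le>B. ncoeff y A = ncoeff x A) \<Longrightarrow> y \<in> S"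
      using S x unfolding open_novikov_def by blast
    obtain C where C: "\<And>y. (\<forall>A\<le>C. ncoeff y A = ncoeff x A) \<Longrightarrow> y \<in> T"
      using T x unfolding open_novikov_def by blast
    show "\<exists>B. \<forall>y. (\<forall>A\<le>B. ncoeff y A = ncoeff x A) \<longrightarrow> y \<in> S \<inter> T"
      by (rule exI[of _ "max B C"]) (use B C in auto)
  qed
next
  fix K :: "novikov set set" assume K: "\<forall>S\<in>K. open S"
  show "open (\<Union>K)" unfolding open_novikov_def
  proof
    fix x assume "x \<in> \<Union>K"
    then obtain S where S: "S \<in> K" "x \<in> S" by blast
    then have "open S" using K by blast
    then obtain B where B: "\<And>y. (\<forall>A\<le>B. ncoeff y A = ncoeff x A) \<Longrightarrow> y \<in> S"
      using S(2) unfolding open_novikov_def by blast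
    show "\<exists>B. \<forall>y. (\<forall>A\<le>B. ncoeff y A = ncoeff x A) \<longrightarrow> y \<in> \<Union>K"
      by (rule exI[of _ B]) (use B S(1) in blast)
  qed
next
  fix x y :: novikov assume "x \<noteq> y"
  then obtain A where A: "ncoeff x A \<noteq> ncoeff y A" using novikov_eqI by blast
  let ?U = "\<lambda>x. {z. ncoeff z A = ncoeff x A}"
  have op: "open (?U w)" for w unfolding open_novikov_def by (auto intro!: exI[of _ A])
  show "\<exists>U V. open U \<and> open V \<and> x \<in> U \<and> y \<in> V \<and> U \<inter> V = {}"
    by (rule exI[of _ "?U x"], rule exI[of _ "?U y"]) (use A op in auto)
qed
end


definition nconst :: "complex \<Rightarrow> novikov" where
  "nconst c = nmonom c 0"

definition nval :: "novikov \<Rightarrow> ereal" where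
  "nval x = (INF A\<in>{A. ncoeff x A \<noteq> 0}. ereal A)"

definition Lam0 :: "novikov set" where
  "Lam0 = {x. \<forall>A. ncoeff x A \<noteq> 0 \<longrightarrow> 0 \<le> A}"

definition Lam_plus :: "novikov set" where
  "Lam_plus = {x. \<forall>A. ncoeff x A \<noteq> 0 \<longrightarrow> 0 < A}"

definition Lam0_units :: "novikov set" where
  "Lam0_units = {x \<in> Lam0. \<exists>y\<in>Lam0. x * y = 1}"

type_synonym novikov2 = "novikov \<times> novikov"

text \<open>Every element of \<open>Lam0\<close> is uniquely a complex number plus an element of \<open>Lam_plus\<close>; the complex
  number is its residue.  Hence \<open>U + Lam_plus\<^sup>2\<close> is the set of points of \<open>Lam0\<^sup>2\<close> with residue in
  \<open>U\<close>, see \<open>thickening\<close> and \<open>thickening_eq\<close>.\<close>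

definition residue :: "novikov \<Rightarrow> complex" where
  "residue x = ncoeff x 0"

definition residue2 :: "novikov2 \<Rightarrow> complex \<times> complex" where
  "residue2 P = (residue (fst P), residue (snd P))"

definition thickening :: "(complex \<times> complex) set \<Rightarrow> novikov2 set" where
  "thickening U = {P \<in> Lam0 \<times> Lam0. residue2 P \<in> U}"

lemma thickening_eq:
  "thickening U = {(nconst a + x, nconst b + y) | a b x y. (a, b) \<in> U \<and> x \<in> Lam_plus \<and> y \<in> Lam_plus}"
    (is "?L = ?R")
proof
  show "?L \<subseteq> ?R"
  proof
    fix P assume P: "P \<in> ?L"
    obtain x y where xy: "P = (x, y)" by (cases P)
    have lp: "z - nconst (residue z) \<in> Lam_plus" if "z \<in> Lam0" for z
      using that by (auto simp: Lam_plus_def Lam0_def nconst_def residue_def less_le)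
    have "x \<in> Lam0" "y \<in> Lam0" "(residue x, residue y) \<in> U"
      using P by (auto simp: xy thickening_def residue2_def)
    moreover have "P = (nconst (residue x) + (x - nconst (residue x)), nconst (residue y) + (y - nconst (residue y)))"
      by (simp add: xy)
    ultimately show "P \<in> ?R" using lp by blast
  qed
  have "nconst a + x \<in> Lam0 \<and> residue (nconst a + x) = a" if x: "x \<in> Lam_plus" for a x
  proof -
    have nz: "0 < A" if "ncoeff x A \<noteq> 0" for A using x that by (simp add: Lam_plus_def)
    have "ncoeff x 0 = 0" using nz[of 0] by auto
    moreover have "0 \<le> A" if "ncoeff (nconst a + x) A \<noteq> 0" for A
      using nz[of A] that by (cases "A = 0") (auto simp: nconst_def)
    ultimately show ?thesis by (simp add: Lam0_def residue_def nconst_def)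
  qed
  then show "?R \<subseteq> ?L" by (auto simp: thickening_def residue2_def)
qed


section \<open>Complex surfaces and their blow-ups\<close>

text \<open>A surface is a set of points with an atlas of its regular locus; a chart is a pair of its domain
  and its coordinate map into \<open>\<complex>\<^sup>2\<close>.  Points lying in no chart domain are singular points.
  Toric surfaces may have them, and they all get removed in the end.\<close>

type_synonym 'p chart = "'p set \<times> ('p \<Rightarrow> complex \<times> complex)"

record 'p surface =
  points :: "'p set"
  atlas :: "'p chart set"

definition restrict_surface :: "'p surface \<Rightarrow> 'p set \<Rightarrow> 'p surface" where
  "restrict_surface S W = \<lparr>points = points S \<inter> W, atlas = {(U \<inter> W, \<phi>) | U \<phi>. (U, \<phi>) \<in> atlas S}\<rparr>"

definition surface_closure :: "'p surface \<Rightarrow> 'p set \<Rightarrow> 'p set" where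
  "surface_closure S A =
     A \<union> {q \<in> points S. \<exists>(U, \<phi>) \<in> atlas S. q \<in> U \<and> \<phi> q \<in> closure (\<phi> ` (U \<inter> A))}"

text \<open>Points of iterated blow-ups: \<open>Dir p l\<close> is the point of the exceptional curve over \<open>p\<close> in the
  tangent direction \<open>l\<close>.  The direction spanned by \<open>(1, s)\<close> in the coordinates of the chart used for
  the blow-up is \<open>Some s\<close>, the direction spanned by \<open>(0, 1)\<close> is \<open>None\<close>.\<close>

datatype 'p bpoint = Pt 'p | Dir "'p bpoint" "complex option"

primrec bpoint_base :: "'p bpoint \<Rightarrow> 'p" where
  "bpoint_base (Pt x) = x"
| "bpoint_base (Dir p l) = bpoint_base p"

primrec bpoint_dir :: "'p bpoint \<Rightarrow> complex option" where
  "bpoint_dir (Pt x) = None"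
| "bpoint_dir (Dir p l) = l"

text \<open>With \<open>(x, y) = \<phi> q - \<phi> p\<close>, the blow-up at \<open>p\<close> has the two additional coordinate systems
  \<open>(x, y / x)\<close> and \<open>(y, x / y)\<close>, extended over the exceptional curve.\<close>

definition blowup_chart1 :: "'p bpoint \<Rightarrow> 'p bpoint chart \<Rightarrow> 'p bpoint chart" where
  "blowup_chart1 p c = (case c of (U, \<phi>) \<Rightarrow>
     ({q \<in> U. fst (\<phi> q) \<noteq> fst (\<phi> p)} \<union> {Dir p (Some s) | s. True},
      \<lambda>q. if q \<in> range (Dir p) then (0, the (bpoint_dir q))
           else (let (x, y) = \<phi> q - \<phi> p in (x, y / x))))"

definition blowup_chart2 :: "'p bpoint \<Rightarrow> 'p bpoint chart \<Rightarrow> 'p bpoint chart" where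
  "blowup_chart2 p c = (case c of (U, \<phi>) \<Rightarrow>
     ({q \<in> U. snd (\<phi> q) \<noteq> snd (\<phi> p)} \<union> {Dir p l | l. l \<noteq> Some 0},
      \<lambda>q. if q \<in> range (Dir p) then (0, case bpoint_dir q of None \<Rightarrow> 0 | Some s \<Rightarrow> 1 / s)
           else (let (x, y) = \<phi> q - \<phi> p in (y, x / y))))"

text \<open>Blow-up of \<open>S\<close> at the regular point \<open>p\<close>, where \<open>c\<close> is a chart around \<open>p\<close>.\<close>

definition blowup :: "'p bpoint surface \<Rightarrow> 'p bpoint \<Rightarrow> 'p bpoint chart \<Rightarrow> 'p bpoint surface" where
  "blowup S p c =
     \<lparr>points = points S - {p} \<union> range (Dir p),
      atlas = {(U - {p}, \<phi>) | U \<phi>. (U, \<phi>) \<in> atlas S} \<union> {blowup_chart1 p c, blowup_chart2 p c}\<rparr>"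

definition strict_transform ::
  "'p bpoint surface \<Rightarrow> 'p bpoint \<Rightarrow> 'p bpoint chart \<Rightarrow> 'p bpoint set \<Rightarrow> 'p bpoint set" where
  "strict_transform S p c D = surface_closure (blowup S p c) (D - {p})"


section \<open>Toric surfaces of polygons\<close>

type_synonym lat = "int \<times> int"

definition lat_real :: "lat \<Rightarrow> real \<times> real" where
  "lat_real m = (of_int (fst m), of_int (snd m))"

definition lat_pair :: "lat \<Rightarrow> lat \<Rightarrow> int" where
  "lat_pair m n = fst m * fst n + snd m * snd n"

definition lat_det :: "lat \<Rightarrow> lat \<Rightarrow> int" where
  "lat_det m n = fst m * snd n - snd m * fst n"

definition lat_scale :: "int \<Rightarrow> lat \<Rightarrow> lat" where
  "lat_scale k m = (k * fst m, k * snd m)"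

definition lattice_polygon :: "(real \<times> real) set \<Rightarrow> bool" where
  "lattice_polygon \<Delta> \<longleftrightarrow> (\<exists>V. finite V \<and> \<Delta> = convex hull (lat_real ` V)) \<and> aff_dim \<Delta> = 2"

definition lattice_vertices :: "(real \<times> real) set \<Rightarrow> lat set" where
  "lattice_vertices \<Delta> = {v. lat_real v extreme_point_of \<Delta>}"

definition polar_dual :: "(real \<times> real) set \<Rightarrow> (real \<times> real) set" where
  "polar_dual \<Delta> = {y. \<forall>x\<in>\<Delta>. x \<bullet> y \<ge> -1}"

text \<open>The lattice points of the cone generated by \<open>P - F\<close>, for a face \<open>F\<close> of \<open>P\<close>; the affine toric
  chart of \<open>F\<close> is the spectrum of the algebra of this monoid.\<close>

definition face_monoid :: "(real \<times> real) set \<Rightarrow> (real \<times> real) set \<Rightarrow> lat set" where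
  "face_monoid P F = {m. \<exists>t\<ge>0. \<exists>p\<in>P. \<exists>q\<in>F. lat_real m = t *\<^sub>R (p - q)}"

text \<open>A complex point of that affine chart is a monoid homomorphism from \<open>face_monoid P F\<close> to
  \<open>(\<complex>, *)\<close>; it lies in the torus orbit of \<open>F\<close> iff it is nonzero exactly at the units of the monoid.
  Each point of the toric variety lies in one orbit and is represented by the homomorphism on the
  (largest) monoid of that orbit; its restriction to the monoid of a smaller face \<open>G\<close> is the same
  point seen in the affine chart of \<open>G\<close>.  So the affine chart of \<open>G\<close> consists of the points whose
  domain contains \<open>face_monoid P G\<close>.\<close>

type_synonym toric_point = "lat \<rightharpoonup> complex"

definition torus_orbit :: "(real \<times> real) set \<Rightarrow> (real \<times> real) set \<Rightarrow> toric_point set" where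
  "torus_orbit P F = {x. dom x = face_monoid P F \<and> x 0 = Some 1
     \<and> (\<forall>m\<in>dom x. \<forall>m'\<in>dom x. the (x (m + m')) = the (x m) * the (x m'))
     \<and> (\<forall>m\<in>dom x. the (x m) \<noteq> 0 \<longleftrightarrow> - m \<in> dom x)}"

definition toric_variety :: "(real \<times> real) set \<Rightarrow> toric_point set" where
  "toric_variety P = (\<Union>F\<in>{F. F face_of P \<and> F \<noteq> {}}. torus_orbit P F)"

text \<open>The smooth affine toric charts: those whose monoid is generated by a lattice basis \<open>a, b\<close>, where
  a basis vector may also be invertible in the monoid.\<close>

definition toric_charts :: "(real \<times> real) set \<Rightarrow> toric_point chart set" where
  "toric_charts P = {({x \<in> toric_variety P. face_monoid P F \<subseteq> dom x}, \<lambda>x. (the (x a), the (x b))) | F a b.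
     F face_of P \<and> F \<noteq> {} \<and>
     (\<exists>I\<in>{UNIV, {0..}}. \<exists>J\<in>{UNIV, {0..}}.
        face_monoid P F = {lat_scale i a + lat_scale j b | i j. i \<in> I \<and> j \<in> J})}"

type_synonym tpoint = "toric_point bpoint"

definition toric_surface :: "(real \<times> real) set \<Rightarrow> tpoint surface" where
  "toric_surface P = \<lparr>points = Pt ` toric_variety P,
                      atlas = {(Pt ` U, \<phi> \<circ> bpoint_base) | U \<phi>. (U, \<phi>) \<in> toric_charts P}\<rparr>"

definition torus_chart :: "(real \<times> real) set \<Rightarrow> tpoint chart" where
  "torus_chart P = (Pt ` torus_orbit P P, (\<lambda>x. (the (x (1, 0)), the (x (0, 1)))) \<circ> bpoint_base)"

text \<open>The toric fixed points of the toric surface of \<open>\<Delta>\<close> are labelled by the vertices of \<open>\<Delta>\<close>.  The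
  fixed point \<open>v\<close> is an \<open>A\<^sub>n\<close> singularity \<open>X Y = Z ^ (n + 1)\<close> if the monoid at \<open>v\<close> is generated by the
  exponents \<open>a, b, c\<close> of \<open>X, Y, Z\<close>.\<close>

definition A_singularity :: "(real \<times> real) set \<Rightarrow> lat \<Rightarrow> nat \<Rightarrow> bool" where
  "A_singularity \<Delta> v n \<longleftrightarrow> (\<exists>a b c. a + b = lat_scale (int n + 1) c \<and> lat_det a b \<noteq> 0 \<and>
     face_monoid \<Delta> {lat_real v} =
       {lat_scale (int i) a + lat_scale (int j) b + lat_scale (int k) c | i j k. True})"

text \<open>The edge of the polar dual polygon corresponding to the vertex \<open>v\<close> of \<open>\<Delta>\<close>, and the toric prime
  divisor of that edge.\<close>

definition dual_edge :: "(real \<times> real) set \<Rightarrow> lat \<Rightarrow> (real \<times> real) set" where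
  "dual_edge \<Delta> v = {y \<in> polar_dual \<Delta>. lat_real v \<bullet> y = -1}"

definition toric_divisor :: "(real \<times> real) set \<Rightarrow> lat \<Rightarrow> toric_point set" where
  "toric_divisor \<Delta> v =
     (\<Union>G\<in>{G. G face_of polar_dual \<Delta> \<and> G \<noteq> {} \<and> G \<subseteq> dual_edge \<Delta> v}. torus_orbit (polar_dual \<Delta>) G)"

text \<open>\<open>e v\<close> and \<open>f v\<close> are the exponents of the coordinates \<open>z\<close> and \<open>w\<close> belonging to the vertex \<open>v\<close>:
  \<open>z\<close> is the toric coordinate along the divisor of \<open>v\<close>, and \<open>w\<close> completes it to a coordinate system of
  the torus and vanishes to first order on that divisor.\<close>

definition toric_coordinates :: "(real \<times> real) set \<Rightarrow> (lat \<Rightarrow> lat) \<Rightarrow> (lat \<Rightarrow> lat) \<Rightarrow> bool" where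
  "toric_coordinates \<Delta> e f \<longleftrightarrow> (\<forall>v\<in>lattice_vertices \<Delta>.
     lat_pair v (e v) = 0 \<and> lat_pair v (f v) = 1 \<and> \<bar>lat_det (e v) (f v)\<bar> = 1)"

definition special_point :: "(real \<times> real) set \<Rightarrow> (lat \<Rightarrow> lat) \<Rightarrow> lat \<Rightarrow> toric_point \<Rightarrow> bool" where
  "special_point \<Delta> e v x \<longleftrightarrow> x \<in> torus_orbit (polar_dual \<Delta>) (dual_edge \<Delta> v) \<and> x (e v) = Some (-1)"

text \<open>\<open>special_blowups \<Delta> e k B D\<close>: the surface \<open>B\<close> arises from the toric surface of the polar dual of
  \<open>\<Delta>\<close> by blowing up, \<open>k v\<close> times for each vertex \<open>v\<close>, a point on the strict transform of the divisor
  of \<open>v\<close> that lies over its special point; \<open>D v\<close> is the strict transform in \<open>B\<close> of that divisor.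
  The order of the blow-ups and the charts used for them are arbitrary.\<close>

inductive special_blowups ::
  "(real \<times> real) set \<Rightarrow> (lat \<Rightarrow> lat) \<Rightarrow> (lat \<Rightarrow> nat) \<Rightarrow> tpoint surface \<Rightarrow> (lat \<Rightarrow> tpoint set) \<Rightarrow> bool"
  for \<Delta> e where
  start: "special_blowups \<Delta> e (\<lambda>_. 0) (toric_surface (polar_dual \<Delta>)) (\<lambda>v. Pt ` toric_divisor \<Delta> v)"
| step: "\<lbrakk>special_blowups \<Delta> e k B D; v \<in> lattice_vertices \<Delta>;
          p \<in> D v; special_point \<Delta> e v (bpoint_base p); c \<in> atlas B; p \<in> fst c\<rbrakk>
         \<Longrightarrow> special_blowups \<Delta> e (k(v := Suc (k v))) (blowup B p c) (\<lambda>u. strict_transform B p c (D u))"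


section \<open>Gluing and Novikov extensions\<close>

text \<open>The quotient of \<open>A\<close> by the equivalence relation generated by \<open>R\<close>.\<close>

definition glue_class :: "'x set \<Rightarrow> ('x \<times> 'x) set \<Rightarrow> 'x \<Rightarrow> 'x set" where
  "glue_class A R x = {y \<in> A. (x, y) \<in> (R \<union> R\<inverse>)\<^sup>*}"

definition glue :: "'x set \<Rightarrow> ('x \<times> 'x) set \<Rightarrow> 'x set set" where
  "glue A R = glue_class A R ` A"

definition holomorphic2_on :: "(complex \<times> complex \<Rightarrow> complex \<times> complex) \<Rightarrow> (complex \<times> complex) set \<Rightarrow> bool" where
  "holomorphic2_on g W \<longleftrightarrow> open W \<and> (\<forall>p\<in>W. \<exists>L. (g has_derivative L) (at p) \<and>
     (\<forall>c a b. L (c * a, c * b) = (c * fst (L (a, b)), c * snd (L (a, b)))))"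

definition biholomorphic2_on :: "(complex \<times> complex \<Rightarrow> complex \<times> complex) \<Rightarrow> (complex \<times> complex) set \<Rightarrow> bool" where
  "biholomorphic2_on g W \<longleftrightarrow> holomorphic2_on g W \<and> inj_on g W \<and> holomorphic2_on (inv_into W g) (g ` W)"

text \<open>A holomorphic function extends to the thickening of its domain by its Taylor expansions.\<close>

definition taylor_coeff :: "(complex \<times> complex \<Rightarrow> complex) \<Rightarrow> complex \<times> complex \<Rightarrow> nat \<Rightarrow> nat \<Rightarrow> complex" where
  "taylor_coeff g p m n =
     (deriv ^^ m) (\<lambda>s. (deriv ^^ n) (\<lambda>t. g (s, t)) (snd p)) (fst p) / (fact m * fact n)"

definition novikov_fun :: "(complex \<times> complex \<Rightarrow> complex) \<Rightarrow> novikov2 \<Rightarrow> novikov" where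
  "novikov_fun g P = (\<Sum>\<^sub>\<infinity>(m, n)\<in>UNIV. nconst (taylor_coeff g (residue2 P) m n)
      * (fst P - nconst (residue (fst P))) ^ m * (snd P - nconst (residue (snd P))) ^ n)"

definition novikov_map :: "(complex \<times> complex \<Rightarrow> complex \<times> complex) \<Rightarrow> novikov2 \<Rightarrow> novikov2" where
  "novikov_map g P = (novikov_fun (fst \<circ> g) P, novikov_fun (snd \<circ> g) P)"

text \<open>The Novikov extension \<open>M + Lam_plus\<^sup>2\<close> of a complex surface.\<close>

definition extension_points :: "'p surface \<Rightarrow> ('p chart \<times> novikov2) set" where
  "extension_points M = {(c, P). c \<in> atlas M \<and> P \<in> thickening (snd c ` fst c)}"

definition extension_gluing :: "'p surface \<Rightarrow> (('p chart \<times> novikov2) \<times> ('p chart \<times> novikov2)) set" where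
  "extension_gluing M = {((c, P), (d, Q)). (c, P) \<in> extension_points M \<and> d \<in> atlas M \<and>
     residue2 P \<in> snd c ` (fst c \<inter> fst d) \<and> Q = novikov_map (snd d \<circ> inv_into (fst c) (snd c)) P}"

abbreviation novikov_extension :: "'p surface \<Rightarrow> ('p chart \<times> novikov2) set set" where
  "novikov_extension M \<equiv> glue (extension_points M) (extension_gluing M)"

abbreviation extension_class :: "'p surface \<Rightarrow> 'p chart \<times> novikov2 \<Rightarrow> ('p chart \<times> novikov2) set" where
  "extension_class M \<equiv> glue_class (extension_points M) (extension_gluing M)"


section \<open>The Floer-theoretical mirror space\<close>

text \<open>The Lagrangians \<open>L\<^sub>0\<close> and \<open>L\<^sub>v\<^sub>,\<^sub>j\<close> as labels of the charts formed by their deformations.\<close>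

datatype lagrangian = Torus | Sphere lat nat

definition deformations :: "lagrangian \<Rightarrow> novikov2 set" where
  "deformations l = (case l of
      Torus \<Rightarrow> Lam0_units \<times> Lam0_units
    | Sphere v j \<Rightarrow> {(x, y) \<in> Lam0 \<times> Lam0. nval (x * y) > 0})"

definition mirror_points :: "(real \<times> real) set \<Rightarrow> (lat \<Rightarrow> nat) \<Rightarrow> (lagrangian \<times> novikov2) set" where
  "mirror_points \<Delta> n = {(l, P). P \<in> deformations l \<and>
     (l = Torus \<or> (\<exists>v\<in>lattice_vertices \<Delta>. \<exists>j\<in>{1..n v + 1}. l = Sphere v j))}"

text \<open>A flat connection on the torus \<open>L\<^sub>0\<close>, whose first homology is the cocharacter lattice of the
  torus of the toric surface of \<open>\<Delta>\<close>, i.e. the character lattice \<open>\<int>\<^sup>2\<close> of that of the polar dual, is given by its holonomies along the standard basis;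
  \<open>holonomy P m\<close> is its holonomy along the class \<open>m\<close>.  The vanishing cycle at the vertex \<open>v\<close> is \<open>e v\<close>.\<close>

definition holonomy :: "novikov2 \<Rightarrow> lat \<Rightarrow> novikov" where
  "holonomy P m = fst P powi fst m * snd P powi snd m"

text \<open>The gluing by the solutions of the Floer-theoretic isomorphism equations: \<open>w = u\<^sub>1\<close>,
  \<open>z = u\<^sub>1 v\<^sub>1 - 1\<close> between \<open>L\<^sub>0\<close> and \<open>L\<^sub>v\<^sub>,\<^sub>1\<close>, and \<open>v\<^sub>j = 1 / u\<^sub>j\<^sub>+\<^sub>1\<close>, \<open>u\<^sub>j = u\<^sub>j\<^sub>+\<^sub>1\<^sup>2 v\<^sub>j\<^sub>+\<^sub>1\<close> between
  \<open>L\<^sub>v\<^sub>,\<^sub>j\<close> and \<open>L\<^sub>v\<^sub>,\<^sub>j\<^sub>+\<^sub>1\<close>.  The Floer theory of the smoothing enters the mirror space only through these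
  maps, which are taken as its definition; the mirror space is
  \<open>glue (mirror_points \<Delta> n) (mirror_gluing \<Delta> n e f)\<close>.\<close>

definition mirror_gluing ::
  "(real \<times> real) set \<Rightarrow> (lat \<Rightarrow> nat) \<Rightarrow> (lat \<Rightarrow> lat) \<Rightarrow> (lat \<Rightarrow> lat)
     \<Rightarrow> ((lagrangian \<times> novikov2) \<times> (lagrangian \<times> novikov2)) set" where
  "mirror_gluing \<Delta> n e f =
     (mirror_points \<Delta> n \<times> mirror_points \<Delta> n) \<inter>
     ({((Torus, P), (Sphere v 1, (x, y))) | P v x y.
         holonomy P (f v) = x \<and> holonomy P (e v) = x * y - 1} \<union>
      {((Sphere v j, (x, y)), (Sphere v (Suc j), (x', y'))) | v j x y x' y'.
         x' \<noteq> 0 \<and> y = inverse x' \<and> x = x'\<^sup>2 * y'})"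

abbreviation mirror_class ::
  "(real \<times> real) set \<Rightarrow> (lat \<Rightarrow> nat) \<Rightarrow> (lat \<Rightarrow> lat) \<Rightarrow> (lat \<Rightarrow> lat)
     \<Rightarrow> lagrangian \<times> novikov2 \<Rightarrow> (lagrangian \<times> novikov2) set" where
  "mirror_class \<Delta> n e f \<equiv> glue_class (mirror_points \<Delta> n) (mirror_gluing \<Delta> n e f)"

text \<open>Identification of the space glued from charts \<open>A\<close> along \<open>R\<close> with the Novikov extension of \<open>M\<close>:
  a bijection that near every residue is, in charts, the extension of a biholomorphic map
  between open subsets of \<open>\<complex>\<^sup>2\<close>.  (The residues occurring in a chart of \<open>A\<close> need not form an open
  set, as for the spheres \<open>L\<^sub>v\<^sub>,\<^sub>j\<close>, where they form the cross \<open>u v = 0\<close>.)\<close>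

definition extension_isomorphism ::
  "('l \<times> novikov2) set \<Rightarrow> (('l \<times> novikov2) \<times> ('l \<times> novikov2)) set \<Rightarrow> 'p surface
     \<Rightarrow> (('l \<times> novikov2) set \<Rightarrow> ('p chart \<times> novikov2) set) \<Rightarrow> bool" where
  "extension_isomorphism A R M \<Phi> \<longleftrightarrow>
     bij_betw \<Phi> (glue A R) (novikov_extension M) \<and>
     (\<forall>(l, P)\<in>A. \<exists>c\<in>atlas M. \<exists>W g. residue2 P \<in> W \<and> biholomorphic2_on g W \<and> g ` W \<subseteq> snd c ` fst c \<and>
        (\<forall>Q. (l, Q) \<in> A \<and> residue2 Q \<in> W \<longrightarrow> \<Phi> (glue_class A R (l, Q)) = extension_class M (c, novikov_map g Q)))"

end

theory Submission
  imports Defs "HOL-Complex_Analysis.Cauchy_Integral_Formula"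
begin

text \<open>Near the special point of a divisor, with coordinates \<open>s = z + 1\<close> along the divisor and \<open>t = w\<close>
  across it, the point blown up is always the origin of the current chart \<open>(s, t)\<close>: the strict
  transform of the divisor is \<open>t = 0\<close>, and of its points only the origin lies over the special point.
  The blow-up replaces this chart by \<open>(s, t / s)\<close>, where the divisor is again \<open>t = 0\<close>, and the chart
  \<open>(t, s / t)\<close>, which is disjoint from the divisor.  After \<open>j - 1\<close> blow-ups \<open>t = w / (z + 1) ^ (j - 1)\<close>, so the
  latter are the coordinates \<open>u\<^sub>j = w / (z + 1) ^ (j - 1)\<close>, \<open>v\<^sub>j = (z + 1) ^ j / w\<close>, which satisfy the
  gluing equations \<open>w = u\<^sub>1\<close>, \<open>z = u\<^sub>1 v\<^sub>1 - 1\<close>, \<open>v\<^sub>j = 1 / u\<^sub>j\<^sub>+\<^sub>1\<close>, \<open>u\<^sub>j = u\<^sub>j\<^sub>+\<^sub>1\<^sup>2 v\<^sub>j\<^sub>+\<^sub>1\<close> of the Lagrangians.  Together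
  with the torus these charts cover the complement of the divisors.  The part of the chart
  \<open>(u\<^sub>j, v\<^sub>j)\<close> with \<open>u\<^sub>j v\<^sub>j \<noteq> 0\<close> lies in the torus, so nothing is lost by restricting to residues with
  \<open>u\<^sub>j v\<^sub>j = 0\<close>.

  All transition maps involved are rational without poles on their domains, and for such maps Hadamard's lemma
  shows that the extension by Taylor series is evaluation of the rational expression in the Novikov
  field.  Hence the gluing by Taylor series and the algebraic gluing of the mirror space agree.\<close>

section \<open>Arithmetic of the Novikov field\<close>

text \<open>The blow-ups in \<open>special_blowups\<close> come in any order and use any chart at
  the centre, so the atlas of the final surface cannot be written down. Explicit model charts are
  carried along instead, with the invariant (\<open>blowup_stage\<close>) that near each point every
  chart of the surface is related to them by a rational change of coordinates. A point
  \<open>Dir p l\<close> names its direction in whatever chart was used, hence blowing up a model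
  chart means renaming directions by the differential of the coordinate change; Hadamard quotients
  supply this differential together with its extension to a neighbourhood of the exceptional curve.
  Torus fixed points may be singular; they are kept in a separate set on which no compatibility of
  charts is claimed and which disappears with the divisors. On the gluing side, the relation
  generated by the Floer equations has to be shown large enough: each mirror point is moved to a
  normal form, on the torus or on one curve \<open>u = 0\<close>, and these pieces are pairwise
  disjoint.\<close>

definition val_ge :: "real \<Rightarrow> novikov set" where
  "val_ge L = {x. \<forall>A<L. ncoeff x A = 0}"

lemma val_geI: "(\<And>A. A < L \<Longrightarrow> ncoeff x A = 0) \<Longrightarrow> x \<in> val_ge L"
  by (simp add: val_ge_def)

lemma val_geD: "x \<in> val_ge L \<Longrightarrow> A < L \<Longrightarrow> ncoeff x A = 0"
  by (simp add: val_ge_def)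

lemma val_ge_antimono: "x \<in> val_ge L \<Longrightarrow> M \<le> L \<Longrightarrow> x \<in> val_ge M"
  by (auto simp: val_ge_def)

lemma val_ge_add: "x \<in> val_ge L \<Longrightarrow> y \<in> val_ge L \<Longrightarrow> x + y \<in> val_ge L"
  by (simp add: val_ge_def)

lemma val_ge_diff: "x \<in> val_ge L \<Longrightarrow> y \<in> val_ge L \<Longrightarrow> x - y \<in> val_ge L"
  by (simp add: val_ge_def)

lemma val_ge_0 [simp]: "0 \<in> val_ge L"
  by (simp add: val_ge_def)

lemma val_ge_mult: "x \<in> val_ge L \<Longrightarrow> y \<in> val_ge M \<Longrightarrow> x * y \<in> val_ge (L + M)"
  by (rule val_geI) (rule novikov_times_lower[where L = L and M = M], auto dest: val_geD)

lemma val_ge_sum: "(\<And>i. i \<in> I \<Longrightarrow> f i \<in> val_ge L) \<Longrightarrow> sum f I \<in> val_ge L"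
  by (induction I rule: infinite_finite_induct) (auto intro: val_ge_add)

lemma Lam0_eq: "Lam0 = val_ge 0"
  unfolding Lam0_def val_ge_def by (auto simp: not_less[symmetric])

lemma val_ge_power: "x \<in> val_ge d \<Longrightarrow> x ^ n \<in> val_ge (real n * d)"
proof (induction n)
  case (Suc n)
  then show ?case using val_ge_mult[of x d "x ^ n" "real n * d"] by (simp add: algebra_simps)
qed (simp add: val_ge_def)

lemma ncoeff_nconst [simp]: "ncoeff (nconst c) A = (if A = 0 then c else 0)"
  by (simp add: nconst_def)

lemma nconst_0 [simp]: "nconst 0 = 0" and nconst_1 [simp]: "nconst 1 = 1"
  by (rule novikov_eqI, simp)+

lemma nconst_add: "nconst (a + b) = nconst a + nconst b"
  by (rule novikov_eqI) simp

lemma nconst_minus: "nconst (- a) = - nconst a"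
  by (rule novikov_eqI) simp

lemma nconst_mult: "nconst (a * b) = nconst a * nconst b"
  by (rule novikov_eqI) (simp add: nconst_def ncoeff_nmonom_times)

lemma nconst_eq_0_iff [simp]: "nconst a = 0 \<longleftrightarrow> a = 0"
  by (metis ncoeff_nconst ncoeff_simps(1) nconst_0)

lemma nconst_inverse: "nconst (inverse a) = inverse (nconst a)"
proof (cases "a = 0")
  case False
  then have "nconst a * nconst (inverse a) = 1" by (simp add: nconst_mult[symmetric])
  then show ?thesis by (simp add: inverse_unique)
qed simp

text \<open>Exponents below \<open>L\<close> and \<open>M\<close> do not occur, so the only pair
  with sum \<open>L + M\<close> is \<open>(L, M)\<close> itself. For \<open>L = M = 0\<close> this
  is multiplicativity of the residue.\<close>

lemma ncoeff_lowest_mult: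
  assumes "x \<in> val_ge L" "y \<in> val_ge M"
  shows "ncoeff (x * y) (L + M) = ncoeff x L * ncoeff y M"
proof -
  have "ncoeff (x * y) (L + M) =
    (\<Sum>B\<in>{L}. \<Sum>C\<in>{M}. if B + C = L + M then ncoeff x B * ncoeff y C else 0)"
  proof (rule ncoeff_times_eq)
    fix B C assume *: "ncoeff x B \<noteq> 0" "ncoeff y C \<noteq> 0" "B + C = L + M"
    then have "L \<le> B" "M \<le> C" using assms by (meson not_less val_geD)+
    then show "B \<in> {L} \<and> C \<in> {M}" using * by simp
  qed auto
  then show ?thesis by simp
qed

text \<open>The support has finitely many elements below any bound; once it contains some
  \<open>A0\<close>, its minimum is found among the exponents up to \<open>A0\<close>.\<close>

lemma novikov_lowest:
  assumes "x \<noteq> 0"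
  obtains a where "ncoeff x a \<noteq> 0" "x \<in> val_ge a"
proof -
  obtain A0 where A0: "ncoeff x A0 \<noteq> 0" using assms novikov_eqI[of x 0] by auto
  define a where "a = Min (ncut x A0)"
  have "ncut x A0 \<noteq> {}" using A0 by (auto simp: ncut_def)
  then have "a \<in> ncut x A0" unfolding a_def by (intro Min_in) auto
  moreover have "x \<in> val_ge a"
  proof (rule val_geI, rule ccontr)
    fix A assume A: "A < a" "ncoeff x A \<noteq> 0"
    with calculation have "A \<in> ncut x A0" by (auto simp: ncut_def)
    then have "a \<le> A" by (simp add: a_def)
    with A show False by simp
  qed
  ultimately show ?thesis using that by (auto simp: ncut_def)
qed

lemma Lam0_simps [simp]:
  "nconst c \<in> Lam0" "0 \<in> Lam0" "1 \<in> Lam0"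
  by (auto simp: Lam0_def)

lemma Lam0_add [simp]: "x \<in> Lam0 \<Longrightarrow> y \<in> Lam0 \<Longrightarrow> x + y \<in> Lam0"
  and Lam0_diff [simp]: "x \<in> Lam0 \<Longrightarrow> y \<in> Lam0 \<Longrightarrow> x - y \<in> Lam0"
  by (simp_all add: Lam0_eq val_ge_add val_ge_diff)

lemma Lam0_mult [simp]: "x \<in> Lam0 \<Longrightarrow> y \<in> Lam0 \<Longrightarrow> x * y \<in> Lam0"
  using val_ge_mult[of x 0 y 0] by (simp add: Lam0_eq)

lemma residue_simps [simp]:
  "residue 0 = 0" "residue 1 = 1" "residue (nconst c) = c"
  "residue (x + y) = residue x + residue y" "residue (x - y) = residue x - residue y"
  by (simp_all add: residue_def)

lemma residue_mult [simp]: "x \<in> Lam0 \<Longrightarrow> y \<in> Lam0 \<Longrightarrow> residue (x * y) = residue x * residue y"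
  using ncoeff_lowest_mult[of x 0 y 0] by (simp add: Lam0_eq residue_def)

lemma residue_power [simp]: "x \<in> Lam0 \<Longrightarrow> x ^ n \<in> Lam0 \<and> residue (x ^ n) = residue x ^ n"
  by (induction n) auto

text \<open>With \<open>a\<close> the leading exponent of \<open>inverse x\<close>, the product with
  \<open>x\<close> has a nonzero coefficient at \<open>0 + a\<close>; since the product is 1,
  \<open>a = 0\<close>.\<close>

lemma Lam0_inverse:
  assumes "x \<in> Lam0" "residue x \<noteq> 0"
  shows "inverse x \<in> Lam0" "residue (inverse x) = inverse (residue x)"
proof -
  have nz: "x \<noteq> 0" using assms(2) by auto
  then obtain a where a: "ncoeff (inverse x) a \<noteq> 0" "inverse x \<in> val_ge a"
    using novikov_lowest[of "inverse x"] by auto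
  have "ncoeff (x * inverse x) (0 + a) \<noteq> 0"
    using ncoeff_lowest_mult[of x 0 "inverse x" a] a assms by (simp add: Lam0_eq residue_def)
  then have "a = 0" using nz by (simp split: if_splits)
  with a show 1: "inverse x \<in> Lam0" by (simp add: Lam0_eq)
  have "residue x * residue (inverse x) = 1"
    using residue_mult[OF assms(1) 1] nz by simp
  then show "residue (inverse x) = inverse (residue x)" by (simp add: inverse_unique)
qed

lemma Lam0_units_eq: "Lam0_units = {x \<in> Lam0. residue x \<noteq> 0}"
proof (intro set_eqI iffI)
  fix x assume "x \<in> Lam0_units"
  then obtain y where "x \<in> Lam0" "y \<in> Lam0" "x * y = 1" by (auto simp: Lam0_units_def)
  then show "x \<in> {x \<in> Lam0. residue x \<noteq> 0}"
    using residue_mult[of x y] by auto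
next
  fix x assume "x \<in> {x \<in> Lam0. residue x \<noteq> 0}"
  then show "x \<in> Lam0_units"
    unfolding Lam0_units_def using Lam0_inverse[of x] by (auto intro!: bexI[of _ "inverse x"] right_inverse)
qed

text \<open>Supports being discrete, the absence of a constant term leaves a gap
  \<open>d > 0\<close> and not merely positive exponents. This uniform gap makes the Taylor series
  converge.\<close>

lemma residue_zero_val_ge:
  assumes "x \<in> Lam0" "residue x = 0"
  obtains d where "d > 0" "x \<in> val_ge d"
proof (cases "x = 0")
  case True
  then show ?thesis using that[of 1] by simp
next
  case False
  then obtain a where a: "ncoeff x a \<noteq> 0" "x \<in> val_ge a" using novikov_lowest by blast
  then have "a \<ge> 0" "a \<noteq> 0" using assms by (auto simp: Lam0_def residue_def)
  then show ?thesis using that[of a] a by simp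
qed

lemma nval_pos_iff:
  assumes "x \<in> Lam0"
  shows "nval x > 0 \<longleftrightarrow> residue x = 0"
proof
  assume "residue x = 0"
  then obtain d where d: "d > 0" "x \<in> val_ge d" using residue_zero_val_ge assms by blast
  have "ereal d \<le> nval x" unfolding nval_def
    by (rule INF_greatest) (use d in \<open>auto simp: not_less[symmetric] dest: val_geD\<close>)
  then show "nval x > 0" using d(1) by (metis ereal_less(2) less_le_trans)
next
  assume "nval x > 0"
  show "residue x = 0"
  proof (rule ccontr)
    assume "residue x \<noteq> 0"
    then have "nval x \<le> ereal 0" unfolding nval_def by (intro INF_lower) (simp add: residue_def)
    with \<open>nval x > 0\<close> show False by (simp add: zero_ereal_def)
  qed
qed

section \<open>Rational functions and their extensions\<close>

text \<open>A rational expression without poles on \<open>V\<close>, as a function on \<open>\<complex>\<^sup>2\<close> and over the Novikov field.\<close>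

inductive nrat :: "(complex \<times> complex) set \<Rightarrow> (complex \<times> complex \<Rightarrow> complex) \<Rightarrow> (novikov2 \<Rightarrow> novikov) \<Rightarrow> bool"
  for V where
  nrat_const: "nrat V (\<lambda>_. c) (\<lambda>_. nconst c)"
| nrat_fst: "nrat V fst fst"
| nrat_snd: "nrat V snd snd"
| nrat_add: "nrat V f F \<Longrightarrow> nrat V g G \<Longrightarrow> nrat V (\<lambda>p. f p + g p) (\<lambda>P. F P + G P)"
| nrat_mult: "nrat V f F \<Longrightarrow> nrat V g G \<Longrightarrow> nrat V (\<lambda>p. f p * g p) (\<lambda>P. F P * G P)"
| nrat_inverse: "nrat V f F \<Longrightarrow> (\<And>p. p \<in> V \<Longrightarrow> f p \<noteq> 0) \<Longrightarrow> nrat V (\<lambda>p. inverse (f p)) (\<lambda>P. inverse (F P))"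

lemma nrat_one: "nrat V (\<lambda>_. 1) (\<lambda>_. 1)" and nrat_zero: "nrat V (\<lambda>_. 0) (\<lambda>_. 0)"
  using nrat_const[of V 1] nrat_const[of V 0] by simp_all

lemma nrat_uminus: "nrat V f F \<Longrightarrow> nrat V (\<lambda>p. - f p) (\<lambda>P. - F P)"
  using nrat_mult[OF nrat_const[of V "-1"], of f F] by (simp add: nconst_minus)

lemma nrat_diff: "nrat V f F \<Longrightarrow> nrat V g G \<Longrightarrow> nrat V (\<lambda>p. f p - g p) (\<lambda>P. F P - G P)"
  using nrat_add[of V f F, OF _ nrat_uminus[of V g G]] by simp

lemma nrat_divide:
  "nrat V f F \<Longrightarrow> nrat V g G \<Longrightarrow> (\<And>p. p \<in> V \<Longrightarrow> g p \<noteq> 0) \<Longrightarrow> nrat V (\<lambda>p. f p / g p) (\<lambda>P. F P / G P)"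
  using nrat_mult[of V f F, OF _ nrat_inverse[of V g G]] by (simp add: divide_inverse)

lemma nrat_power: "nrat V f F \<Longrightarrow> nrat V (\<lambda>p. f p ^ n) (\<lambda>P. F P ^ n)"
  by (induction n) (auto intro: nrat_one nrat_mult)

lemma nrat_powi:
  "nrat V f F \<Longrightarrow> (\<And>p. p \<in> V \<Longrightarrow> f p \<noteq> 0) \<Longrightarrow> nrat V (\<lambda>p. f p powi i) (\<lambda>P. F P powi i)"
  unfolding power_int_def by (cases "i \<ge> 0") (auto intro!: nrat_power nrat_inverse)

lemmas nrat_intros = nrat_const nrat_fst nrat_snd nrat_one nrat_zero nrat_add nrat_mult nrat_uminus
  nrat_diff nrat_divide nrat_inverse nrat_power nrat_powi

lemma nrat_subset: "nrat V f F \<Longrightarrow> W \<subseteq> V \<Longrightarrow> nrat W f F"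
proof (induction rule: nrat.induct)
  case (nrat_inverse f F)
  then show ?case by (intro nrat.nrat_inverse) blast+
qed (auto intro: nrat.intros)

lemma nrat_compose:
  assumes "nrat W f F" "nrat V g1 G1" "nrat V g2 G2" "\<And>p. p \<in> V \<Longrightarrow> (g1 p, g2 p) \<in> W"
  shows "nrat V (\<lambda>p. f (g1 p, g2 p)) (\<lambda>P. F (G1 P, G2 P))"
  using assms(1)
proof induction
  case (nrat_inverse f F)
  then show ?case using assms(4) by (intro nrat.nrat_inverse) blast+
qed (use assms(2,3) in \<open>auto intro: nrat.intros\<close>)

text \<open>The induction needs both conclusions at once: a denominator without zeros on
  \<open>V\<close> has nonzero residue at \<open>P\<close>, so its inverse stays in
  \<open>Lam0\<close>.\<close>

lemma nrat_residue:
  assumes "nrat V f F" "P \<in> thickening V"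
  shows "F P \<in> Lam0 \<and> residue (F P) = f (residue2 P)"
  using assms(1)
proof induction
  case (nrat_inverse f F)
  then show ?case using Lam0_inverse[of "F P"] assms(2) by (auto simp: thickening_def)
qed (use assms(2) in \<open>auto simp: thickening_def residue2_def\<close>)

text \<open>\<open>holomorphic2_on\<close> asks for a total derivative that is complex homogeneous,
  while \<open>has_derivative\<close> yields only a real linear one; homogeneity is therefore
  carried along the expression.\<close>

lemma nrat_has_derivative:
  assumes "nrat V f F" "p \<in> V"
  shows "\<exists>L. (f has_derivative L) (at p) \<and> (\<forall>c a b. L (c * a, c * b) = c * L (a, b))"
  using assms(1)
proof induction
  case (nrat_const c)
  show ?case by (intro exI[of _ "\<lambda>_. 0"]) (auto intro!: derivative_eq_intros)
next
  case nrat_fst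
  show ?case by (intro exI[of _ fst]) (auto intro!: derivative_eq_intros)
next
  case nrat_snd
  show ?case by (intro exI[of _ snd]) (auto intro!: derivative_eq_intros)
next
  case (nrat_add f F g G)
  then obtain L M where "(f has_derivative L) (at p)" "(g has_derivative M) (at p)"
    "\<And>c a b. L (c * a, c * b) = c * L (a, b)" "\<And>c a b. M (c * a, c * b) = c * M (a, b)" by blast
  then show ?case
    by (intro exI[of _ "\<lambda>x. L x + M x"]) (auto intro!: derivative_eq_intros simp: algebra_simps)
next
  case (nrat_mult f F g G)
  then obtain L M where "(f has_derivative L) (at p)" "(g has_derivative M) (at p)"
    "\<And>c a b. L (c * a, c * b) = c * L (a, b)" "\<And>c a b. M (c * a, c * b) = c * M (a, b)" by blast
  then show ?case
    by (intro exI[of _ "\<lambda>x. f p * M x + L x * g p"]) (auto intro!: derivative_eq_intros simp: algebra_simps)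
next
  case (nrat_inverse f F)
  then obtain L where "(f has_derivative L) (at p)" "\<And>c a b. L (c * a, c * b) = c * L (a, b)" by blast
  moreover have "f p \<noteq> 0" using nrat_inverse assms(2) by blast
  ultimately show ?case
    by (intro exI[of _ "\<lambda>x. - (inverse (f p) * L x * inverse (f p))"])
      (auto intro!: derivative_eq_intros simp: algebra_simps)
qed

lemma nrat_continuous_on: "nrat V f F \<Longrightarrow> continuous_on V f"
  by (meson continuous_at_imp_continuous_on has_derivative_continuous nrat_has_derivative)

text \<open>Differentiation introduces no new zeros of denominators, so the class is closed under
  partial derivatives and the derivatives in a Taylor coefficient can be iterated inside it.\<close>

lemma nrat_partial_derivatives:
  assumes "nrat V f F"
  shows "\<exists>f1 F1 f2 F2. nrat V f1 F1 \<and> nrat V f2 F2 \<and>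
    (\<forall>s t. (s, t) \<in> V \<longrightarrow> ((\<lambda>s. f (s, t)) has_field_derivative f1 (s, t)) (at s) \<and>
       ((\<lambda>t. f (s, t)) has_field_derivative f2 (s, t)) (at t))"
  using assms
proof induction
  case (nrat_const c)
  show ?case using nrat_zero[of V] by (auto intro!: exI)
next
  case nrat_fst
  have "((\<lambda>t. fst (s, t)) has_field_derivative 0) (at t)" for s t :: complex by simp
  then show ?case using nrat_zero[of V] nrat_one[of V]
    by (intro exI[of _ "\<lambda>_. 1"] exI[of _ "\<lambda>_. 0"] exI) (auto intro!: derivative_eq_intros)
next
  case nrat_snd
  then show ?case using nrat_zero[of V] nrat_one[of V]
    by (intro exI[of _ "\<lambda>_. 1"] exI[of _ "\<lambda>_. 0"] exI) (auto intro!: derivative_eq_intros)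
next
  case (nrat_add f F g G)
  from nrat_add.IH(1) obtain f1 F1 f2 F2 where f: "nrat V f1 F1" "nrat V f2 F2"
    "\<forall>s t. (s, t) \<in> V \<longrightarrow> ((\<lambda>s. f (s, t)) has_field_derivative f1 (s, t)) (at s) \<and>
       ((\<lambda>t. f (s, t)) has_field_derivative f2 (s, t)) (at t)" by (elim exE conjE)
  from nrat_add.IH(2) obtain g1 G1 g2 G2 where g: "nrat V g1 G1" "nrat V g2 G2"
    "\<forall>s t. (s, t) \<in> V \<longrightarrow> ((\<lambda>s. g (s, t)) has_field_derivative g1 (s, t)) (at s) \<and>
       ((\<lambda>t. g (s, t)) has_field_derivative g2 (s, t)) (at t)" by (elim exE conjE)
  note * = f(1,2) g(1,2) f(3)[rule_format, THEN conjunct1] f(3)[rule_format, THEN conjunct2]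
    g(3)[rule_format, THEN conjunct1] g(3)[rule_format, THEN conjunct2]
  show ?case
    by (intro exI conjI, rule nrat.nrat_add[OF *(1,3)], rule nrat.nrat_add[OF *(2,4)])
      (auto intro!: derivative_eq_intros *)
next
  case (nrat_mult f F g G)
  from nrat_mult.IH(1) obtain f1 F1 f2 F2 where f: "nrat V f1 F1" "nrat V f2 F2"
    "\<forall>s t. (s, t) \<in> V \<longrightarrow> ((\<lambda>s. f (s, t)) has_field_derivative f1 (s, t)) (at s) \<and>
       ((\<lambda>t. f (s, t)) has_field_derivative f2 (s, t)) (at t)" by (elim exE conjE)
  from nrat_mult.IH(2) obtain g1 G1 g2 G2 where g: "nrat V g1 G1" "nrat V g2 G2"
    "\<forall>s t. (s, t) \<in> V \<longrightarrow> ((\<lambda>s. g (s, t)) has_field_derivative g1 (s, t)) (at s) \<and>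
       ((\<lambda>t. g (s, t)) has_field_derivative g2 (s, t)) (at t)" by (elim exE conjE)
  note * = f(1,2) g(1,2) f(3)[rule_format, THEN conjunct1] f(3)[rule_format, THEN conjunct2]
    g(3)[rule_format, THEN conjunct1] g(3)[rule_format, THEN conjunct2]
  show ?case
    by (intro exI conjI,
        rule nrat.nrat_add[OF nrat.nrat_mult[OF *(1) nrat_mult.hyps(2)] nrat.nrat_mult[OF *(3) nrat_mult.hyps(1)]],
        rule nrat.nrat_add[OF nrat.nrat_mult[OF *(2) nrat_mult.hyps(2)] nrat.nrat_mult[OF *(4) nrat_mult.hyps(1)]])
      (auto intro!: derivative_eq_intros *)
next
  case (nrat_inverse f F)
  from nrat_inverse.IH obtain f1 F1 f2 F2 where f: "nrat V f1 F1" "nrat V f2 F2"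
    "\<forall>s t. (s, t) \<in> V \<longrightarrow> ((\<lambda>s. f (s, t)) has_field_derivative f1 (s, t)) (at s) \<and>
       ((\<lambda>t. f (s, t)) has_field_derivative f2 (s, t)) (at t)" by (elim exE conjE)
  note * = f(1,2) f(3)[rule_format, THEN conjunct1] f(3)[rule_format, THEN conjunct2]
  have i: "nrat V (\<lambda>p. inverse (f p)) (\<lambda>P. inverse (F P))"
    using nrat_inverse.hyps by (rule nrat.nrat_inverse)
  show ?case
    by (intro exI conjI,
        rule nrat_uminus[OF nrat.nrat_mult[OF nrat.nrat_mult[OF i *(1)] i]],
        rule nrat_uminus[OF nrat.nrat_mult[OF nrat.nrat_mult[OF i *(2)] i]])
      (auto intro!: derivative_eq_intros * simp: nrat_inverse.hyps)
qed

text \<open>The identity over the Novikov field does not follow from the complex one, so both are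
  built in parallel from the same quotients: for a product from
  \<open>f g - f(p) g(p) = (f - f(p)) g + f(p) (g - g(p))\<close>, for an inverse from
  \<open>1/f - 1/f(p) = - (f - f(p)) / (f f(p))\<close>. Since the quotients are again rational
  without poles on \<open>V\<close>, the decomposition can be iterated.\<close>

lemma nrat_hadamard:
  assumes "nrat V f F" "p \<in> V"
  shows "\<exists>a A b B. nrat V a A \<and> nrat V b B \<and>
    (\<forall>q\<in>V. f q = f p + (fst q - fst p) * a q + (snd q - snd p) * b q) \<and>
    (\<forall>Q\<in>thickening V. F Q = nconst (f p) + (fst Q - nconst (fst p)) * A Q + (snd Q - nconst (snd p)) * B Q)"
  using assms(1)
proof induction
  case (nrat_const c)
  show ?case using nrat_zero[of V] by (auto intro!: exI)
next
  case nrat_fst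
  show ?case using nrat_zero[of V] nrat_one[of V]
    by (intro exI[of _ "\<lambda>_. 1"] exI[of _ "\<lambda>_. 0"]) auto
next
  case nrat_snd
  show ?case using nrat_zero[of V] nrat_one[of V]
    by (intro exI[of _ "\<lambda>_. 1"] exI[of _ "\<lambda>_. 0"]) auto
next
  case (nrat_add f F g G)
  from nrat_add.IH(1) obtain a A b B where f: "nrat V a A" "nrat V b B"
    "\<forall>q\<in>V. f q = f p + (fst q - fst p) * a q + (snd q - snd p) * b q"
    "\<forall>Q\<in>thickening V. F Q = nconst (f p) + (fst Q - nconst (fst p)) * A Q + (snd Q - nconst (snd p)) * B Q"
    by (elim exE conjE)
  from nrat_add.IH(2) obtain a' A' b' B' where g: "nrat V a' A'" "nrat V b' B'"
    "\<forall>q\<in>V. g q = g p + (fst q - fst p) * a' q + (snd q - snd p) * b' q"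
    "\<forall>Q\<in>thickening V. G Q = nconst (g p) + (fst Q - nconst (fst p)) * A' Q + (snd Q - nconst (snd p)) * B' Q"
    by (elim exE conjE)
  note * = f(1,2) g(1,2) f(3)[rule_format] g(3)[rule_format] f(4)[rule_format] g(4)[rule_format]
  show ?case
    by (intro exI conjI, rule nrat.nrat_add[OF *(1,3)], rule nrat.nrat_add[OF *(2,4)])
      (auto simp: *(5-8) nconst_add algebra_simps)
next
  case (nrat_mult f F g G)
  from nrat_mult.IH(1) obtain a A b B where f: "nrat V a A" "nrat V b B"
    "\<forall>q\<in>V. f q = f p + (fst q - fst p) * a q + (snd q - snd p) * b q"
    "\<forall>Q\<in>thickening V. F Q = nconst (f p) + (fst Q - nconst (fst p)) * A Q + (snd Q - nconst (snd p)) * B Q"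
    by (elim exE conjE)
  from nrat_mult.IH(2) obtain a' A' b' B' where g: "nrat V a' A'" "nrat V b' B'"
    "\<forall>q\<in>V. g q = g p + (fst q - fst p) * a' q + (snd q - snd p) * b' q"
    "\<forall>Q\<in>thickening V. G Q = nconst (g p) + (fst Q - nconst (fst p)) * A' Q + (snd Q - nconst (snd p)) * B' Q"
    by (elim exE conjE)
  note * = f(1,2) g(1,2) f(3)[rule_format] g(3)[rule_format] f(4)[rule_format] g(4)[rule_format]
  have "f q * g q = f p * g p + (fst q - fst p) * (a q * g q + f p * a' q) + (snd q - snd p) * (b q * g q + f p * b' q)"
    if "q \<in> V" for q
  proof -
    have "f q * g q - f p * g p = (f q - f p) * g q + f p * (g q - g p)" by (simp add: algebra_simps)
    also have "f q - f p = (fst q - fst p) * a q + (snd q - snd p) * b q" using *(5)[OF that] by simp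
    also have "g q - g p = (fst q - fst p) * a' q + (snd q - snd p) * b' q" using *(6)[OF that] by simp
    finally show ?thesis by (simp add: algebra_simps)
  qed
  moreover have "F Q * G Q = nconst (f p * g p) + (fst Q - nconst (fst p)) * (A Q * G Q + nconst (f p) * A' Q)
      + (snd Q - nconst (snd p)) * (B Q * G Q + nconst (f p) * B' Q)" if "Q \<in> thickening V" for Q
  proof -
    have "F Q * G Q - nconst (f p) * nconst (g p) = (F Q - nconst (f p)) * G Q + nconst (f p) * (G Q - nconst (g p))"
      by (simp add: algebra_simps)
    also have "F Q - nconst (f p) = (fst Q - nconst (fst p)) * A Q + (snd Q - nconst (snd p)) * B Q"
      using *(7)[OF that] by simp
    also have "G Q - nconst (g p) = (fst Q - nconst (fst p)) * A' Q + (snd Q - nconst (snd p)) * B' Q"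
      using *(8)[OF that] by simp
    finally show ?thesis by (simp add: algebra_simps nconst_mult)
  qed
  ultimately show ?case
    apply -
    by (intro exI conjI ballI,
        rule nrat.nrat_add[OF nrat.nrat_mult[OF *(1) nrat_mult.hyps(2)] nrat.nrat_mult[OF nrat.nrat_const *(3)]],
        rule nrat.nrat_add[OF nrat.nrat_mult[OF *(2) nrat_mult.hyps(2)] nrat.nrat_mult[OF nrat.nrat_const *(4)]])
      simp_all
next
  case (nrat_inverse f F)
  from nrat_inverse.IH obtain a A b B where f: "nrat V a A" "nrat V b B"
    "\<forall>q\<in>V. f q = f p + (fst q - fst p) * a q + (snd q - snd p) * b q"
    "\<forall>Q\<in>thickening V. F Q = nconst (f p) + (fst Q - nconst (fst p)) * A Q + (snd Q - nconst (snd p)) * B Q"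
    by (elim exE conjE)
  note * = f(1,2) f(3)[rule_format] f(4)[rule_format]
  have i: "nrat V (\<lambda>q. inverse (f q)) (\<lambda>Q. inverse (F Q))"
    using nrat_inverse.hyps by (rule nrat.nrat_inverse)
  define c where "c = - inverse (f p)"
  have fp: "f p \<noteq> 0" using nrat_inverse.hyps assms(2) by blast
  have "inverse (f q) = inverse (f p) + (fst q - fst p) * (c * (a q * inverse (f q))) + (snd q - snd p) * (c * (b q * inverse (f q)))"
    if "q \<in> V" for q
  proof -
    have fq: "f q \<noteq> 0" using nrat_inverse.hyps that by blast
    have "inverse (f q) - inverse (f p) = c * (f q - f p) * inverse (f q)"
      using fp fq by (simp add: c_def field_simps)
    also have "f q - f p = (fst q - fst p) * a q + (snd q - snd p) * b q" using *(3)[OF that] by simp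
    finally show ?thesis by (simp add: algebra_simps)
  qed
  moreover have "inverse (F Q) = nconst (inverse (f p)) + (fst Q - nconst (fst p)) * (nconst c * (A Q * inverse (F Q)))
      + (snd Q - nconst (snd p)) * (nconst c * (B Q * inverse (F Q)))" if "Q \<in> thickening V" for Q
  proof -
    have "f (residue2 Q) \<noteq> 0" using nrat_inverse.hyps that by (simp add: thickening_def)
    then have FQ: "F Q \<noteq> 0" using nrat_residue[OF nrat_inverse.hyps(1) that] by auto
    have "inverse (F Q) - nconst (inverse (f p)) = nconst c * (F Q - nconst (f p)) * inverse (F Q)"
      using fp FQ by (simp add: c_def nconst_minus nconst_inverse) (simp add: field_simps)
    also have "F Q - nconst (f p) = (fst Q - nconst (fst p)) * A Q + (snd Q - nconst (snd p)) * B Q"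
      using *(4)[OF that] by simp
    finally show ?thesis by (simp add: algebra_simps)
  qed
  ultimately show ?case
    apply -
    by (intro exI conjI ballI,
        rule nrat.nrat_mult[OF nrat.nrat_const[of V c] nrat.nrat_mult[OF *(1) i]],
        rule nrat.nrat_mult[OF nrat.nrat_const[of V c] nrat.nrat_mult[OF *(2) i]])
      simp_all
qed

section \<open>Taylor expansions of rational functions\<close>

lemma higher_deriv_cmult':
  assumes "h holomorphic_on S" "open S" "z \<in> S"
  shows "(deriv ^^ n) (\<lambda>w. c * h w) z = c * (deriv ^^ n) h z"
proof -
  have "(deriv ^^ n) (\<lambda>w. c * h w) z =
      (\<Sum>i=0..n. of_nat (n choose i) * (deriv ^^ i) (\<lambda>_. c) z * (deriv ^^ (n - i)) h z)"
    using assms by (intro higher_deriv_mult) auto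
  also have "\<dots> = (\<Sum>i\<in>{0}. of_nat (n choose i) * (deriv ^^ i) (\<lambda>_. c) z * (deriv ^^ (n - i)) h z)"
    by (rule sum.mono_neutral_right) auto
  finally show ?thesis by simp
qed

text \<open>In the Leibniz sum only the first derivative of \<open>w - z\<close> survives at
  \<open>z\<close>. For \<open>n = 0\<close> the factor \<open>of_nat n\<close> makes the truncated
  \<open>n - 1\<close> harmless.\<close>

lemma higher_deriv_linear_factor:
  assumes "h holomorphic_on S" "open S" "z \<in> S"
  shows "(deriv ^^ n) (\<lambda>w. (w - z) * h w) z = of_nat n * (deriv ^^ (n - 1)) h z"
proof -
  have lin: "(deriv ^^ i) (\<lambda>w. w - z) z = (if i = 1 then 1 else 0)" for i
  proof -
    have "(deriv ^^ i) (\<lambda>w. w - z) z = (deriv ^^ i) (\<lambda>w. w) z - (deriv ^^ i) (\<lambda>w. z) z"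
      by (rule higher_deriv_diff[of _ UNIV]) (auto intro: holomorphic_intros)
    then show ?thesis by simp
  qed
  have "(deriv ^^ n) (\<lambda>w. (w - z) * h w) z =
      (\<Sum>i=0..n. of_nat (n choose i) * (deriv ^^ i) (\<lambda>w. w - z) z * (deriv ^^ (n - i)) h z)"
    using assms by (intro higher_deriv_mult) (auto intro!: holomorphic_intros)
  also have "\<dots> = (\<Sum>i=0..n. if i = 1 then of_nat n * (deriv ^^ (n - 1)) h z else 0)"
    by (rule sum.cong) (auto simp: lin)
  also have "\<dots> = of_nat n * (deriv ^^ (n - 1)) h z"
    by (subst sum.delta) (auto simp: Suc_le_eq)
  finally show ?thesis .
qed

lemma open_slices:
  assumes "open (V :: (complex \<times> complex) set)"
  shows "open {t. (s, t) \<in> V}" "open {s. (s, t) \<in> V}"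
proof -
  have "open ((\<lambda>t. (s, t)) -` V)" "open ((\<lambda>s. (s, t)) -` V)"
    using assms by (auto intro!: continuous_open_vimage continuous_intros)
  then show "open {t. (s, t) \<in> V}" "open {s. (s, t) \<in> V}" by (simp_all add: vimage_def)
qed

lemma nrat_slices_holomorphic:
  assumes "nrat V f F"
  shows "(\<lambda>t. f (s, t)) holomorphic_on {t. (s, t) \<in> V}" "(\<lambda>s. f (s, t)) holomorphic_on {s. (s, t) \<in> V}"
  using nrat_partial_derivatives[OF assms]
  by (auto simp: holomorphic_on_def field_differentiable_def intro: has_field_derivative_at_within)

text \<open>Taylor coefficients differentiate first in the second variable; the result has to be a
  rational function of both variables again before the first variable can be treated.\<close>

lemma nrat_higher_deriv:
  assumes "nrat V f F" "open V"
  shows "\<exists>g G. nrat V g G \<and> (\<forall>s t. (s, t) \<in> V \<longrightarrow> (deriv ^^ n) (\<lambda>t. f (s, t)) t = g (s, t))"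
proof (induction n)
  case 0
  then show ?case using assms(1) by auto
next
  case (Suc n)
  then obtain g G where g: "nrat V g G" "\<And>s t. (s, t) \<in> V \<Longrightarrow> (deriv ^^ n) (\<lambda>t. f (s, t)) t = g (s, t)" by blast
  obtain g2 G2 where g2: "nrat V g2 G2"
    "\<And>s t. (s, t) \<in> V \<Longrightarrow> ((\<lambda>t. g (s, t)) has_field_derivative g2 (s, t)) (at t)"
    using nrat_partial_derivatives[OF g(1)] by blast
  have "(deriv ^^ Suc n) (\<lambda>t. f (s, t)) t = g2 (s, t)" if "(s, t) \<in> V" for s t
  proof -
    have "((deriv ^^ n) (\<lambda>t. f (s, t)) has_field_derivative g2 (s, t)) (at t)"
      by (rule has_field_derivative_transform_within_open[OF g2(2)[OF that] open_slices(1)[OF assms(2)]])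
        (use that g(2) in auto)
    then show ?thesis by (simp add: DERIV_imp_deriv)
  qed
  then show ?case using g2(1) by blast
qed

lemma inner_taylor_holomorphic:
  assumes "nrat V f F" "open V"
  shows "(\<lambda>s. (deriv ^^ n) (\<lambda>t. f (s, t)) t0) holomorphic_on {s. (s, t0) \<in> V}"
proof -
  obtain g G where g: "nrat V g G" "\<And>s t. (s, t) \<in> V \<Longrightarrow> (deriv ^^ n) (\<lambda>t. f (s, t)) t = g (s, t)"
    using nrat_higher_deriv[OF assms] by blast
  show ?thesis
    by (rule holomorphic_transform[OF nrat_slices_holomorphic(2)[OF g(1), of t0]]) (use g(2) in auto)
qed

text \<open>Joint agreement near \<open>p\<close> is split by the product filter: for all
  \<open>s\<close> near the first coordinate the two slices agree near the second, which equates the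
  inner derivatives before the outer ones are taken.\<close>

lemma taylor_coeff_cong:
  assumes "eventually (\<lambda>q. f q = g q) (nhds p)"
  shows "taylor_coeff f p m n = taylor_coeff g p m n"
proof -
  have "eventually (\<lambda>(s, t). f (s, t) = g (s, t)) (nhds (fst p) \<times>\<^sub>F nhds (snd p))"
    using assms by (cases p) (simp add: nhds_prod case_prod_unfold)
  then have "eventually (\<lambda>s. eventually (\<lambda>t. f (s, t) = g (s, t)) (nhds (snd p))) (nhds (fst p))"
    by (auto simp: eventually_prod_filter elim!: eventually_mono)
  then have "eventually (\<lambda>s. (deriv ^^ n) (\<lambda>t. f (s, t)) (snd p) = (deriv ^^ n) (\<lambda>t. g (s, t)) (snd p)) (nhds (fst p))"
    by eventually_elim (rule higher_deriv_cong_ev, auto)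
  then show ?thesis unfolding taylor_coeff_def by (simp add: higher_deriv_cong_ev)
qed

context
  fixes V :: "(complex \<times> complex) set" and p :: "complex \<times> complex"
  assumes V: "open V" "p \<in> V"
begin

lemma taylor_coeff_cong_on: "(\<And>q. q \<in> V \<Longrightarrow> f q = g q) \<Longrightarrow> taylor_coeff f p m n = taylor_coeff g p m n"
  by (rule taylor_coeff_cong, rule eventually_mono[OF eventually_nhds_in_open[OF V]]) simp

lemma taylor_coeff_add:
  assumes f: "nrat V f F" and g: "nrat V g G"
  shows "taylor_coeff (\<lambda>q. f q + g q) p m n = taylor_coeff f p m n + taylor_coeff g p m n"
proof -
  let ?S = "{s. (s, snd p) \<in> V}"
  note h = nrat_slices_holomorphic(1)
  have 1: "(deriv ^^ n) (\<lambda>t. f (s, t) + g (s, t)) (snd p) =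
      (deriv ^^ n) (\<lambda>t. f (s, t)) (snd p) + (deriv ^^ n) (\<lambda>t. g (s, t)) (snd p)" if "s \<in> ?S" for s
    using that by (intro higher_deriv_add[OF h[OF f] h[OF g] open_slices(1)[OF V(1)]]) simp
  have "(deriv ^^ m) (\<lambda>s. (deriv ^^ n) (\<lambda>t. f (s, t) + g (s, t)) (snd p)) (fst p) =
     (deriv ^^ m) (\<lambda>s. (deriv ^^ n) (\<lambda>t. f (s, t)) (snd p) + (deriv ^^ n) (\<lambda>t. g (s, t)) (snd p)) (fst p)"
    by (intro higher_deriv_cong_ev refl eventually_mono[OF eventually_nhds_in_open[OF open_slices(2)[OF V(1)]]] 1)
      (use V in auto)
  also have "\<dots> = (deriv ^^ m) (\<lambda>s. (deriv ^^ n) (\<lambda>t. f (s, t)) (snd p)) (fst p)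
       + (deriv ^^ m) (\<lambda>s. (deriv ^^ n) (\<lambda>t. g (s, t)) (snd p)) (fst p)"
    using V by (intro higher_deriv_add[OF inner_taylor_holomorphic[OF f] inner_taylor_holomorphic[OF g]
          open_slices(2)]) auto
  finally show ?thesis unfolding taylor_coeff_def by (simp add: add_divide_distrib)
qed

lemma taylor_coeff_const: "taylor_coeff (\<lambda>_. c) p m n = (if m = 0 \<and> n = 0 then c else 0)"
  by (auto simp: taylor_coeff_def)

text \<open>The factor is constant for the inner derivative and a linear factor for the outer one;
  the \<open>m\<close> it produces turns \<open>fact m\<close> into
  \<open>fact (m - 1)\<close>.\<close>

lemma taylor_coeff_shift_fst:
  assumes f: "nrat V f F"
  shows "taylor_coeff (\<lambda>q. (fst q - fst p) * f q) p m n = (case m of 0 \<Rightarrow> 0 | Suc m' \<Rightarrow> taylor_coeff f p m' n)"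
proof -
  let ?S = "{s. (s, snd p) \<in> V}"
  let ?D = "\<lambda>s. (deriv ^^ n) (\<lambda>t. f (s, t)) (snd p)"
  have 1: "(deriv ^^ n) (\<lambda>t. (s - fst p) * f (s, t)) (snd p) = (s - fst p) * ?D s" if "s \<in> ?S" for s
    using that by (intro higher_deriv_cmult'[OF nrat_slices_holomorphic(1)[OF f] open_slices(1)[OF V(1)]]) simp
  have "(deriv ^^ m) (\<lambda>s. (deriv ^^ n) (\<lambda>t. (s - fst p) * f (s, t)) (snd p)) (fst p) =
     (deriv ^^ m) (\<lambda>s. (s - fst p) * ?D s) (fst p)"
    by (intro higher_deriv_cong_ev refl eventually_mono[OF eventually_nhds_in_open[OF open_slices(2)[OF V(1)]]] 1)
      (use V in auto)
  also have "\<dots> = of_nat m * (deriv ^^ (m - 1)) ?D (fst p)"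
    using V by (intro higher_deriv_linear_factor[OF inner_taylor_holomorphic[OF f] open_slices(2)]) auto
  finally show ?thesis unfolding taylor_coeff_def by (cases m) (auto simp del: of_nat_Suc)
qed

lemma taylor_coeff_shift_snd:
  assumes f: "nrat V f F"
  shows "taylor_coeff (\<lambda>q. (snd q - snd p) * f q) p m n = (case n of 0 \<Rightarrow> 0 | Suc n' \<Rightarrow> taylor_coeff f p m n')"
proof -
  let ?S = "{s. (s, snd p) \<in> V}"
  let ?D = "\<lambda>s. (deriv ^^ (n - 1)) (\<lambda>t. f (s, t)) (snd p)"
  have 1: "(deriv ^^ n) (\<lambda>t. (t - snd p) * f (s, t)) (snd p) = of_nat n * ?D s" if "s \<in> ?S" for s
    using that by (intro higher_deriv_linear_factor[OF nrat_slices_holomorphic(1)[OF f] open_slices(1)[OF V(1)]]) simp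
  have "(deriv ^^ m) (\<lambda>s. (deriv ^^ n) (\<lambda>t. (t - snd p) * f (s, t)) (snd p)) (fst p) =
     (deriv ^^ m) (\<lambda>s. of_nat n * ?D s) (fst p)"
    by (intro higher_deriv_cong_ev refl eventually_mono[OF eventually_nhds_in_open[OF open_slices(2)[OF V(1)]]] 1)
      (use V in auto)
  also have "\<dots> = of_nat n * (deriv ^^ m) ?D (fst p)"
    using V by (intro higher_deriv_cmult'[OF inner_taylor_holomorphic[OF f] open_slices(2)]) auto
  finally show ?thesis unfolding taylor_coeff_def by (cases n) (auto simp del: of_nat_Suc)
qed

end


section \<open>Convergence of the Taylor series over the Novikov field\<close>

lemma finite_degree_less: "finite {(m, n). m + n < (K :: nat)}"
  by (rule finite_subset[of _ "{..<K} \<times> {..<K}"]) auto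

text \<open>Terms with \<open>m = 0\<close> vanish and the others are reindexed along
  \<open>Suc\<close>, which lowers the degree bound by one; this is the summed form of the shift of
  coefficients.\<close>

lemma sum_degree_shift_fst:
  "(\<Sum>(m, n)\<in>{(m, n). m + n < Suc K}. nconst (case m of 0 \<Rightarrow> 0 | Suc m' \<Rightarrow> c m' n) * X ^ m * Y ^ n) =
    X * (\<Sum>(m, n)\<in>{(m, n). m + n < K}. nconst (c m n) * X ^ m * Y ^ n)"
proof -
  have "(\<Sum>(m, n)\<in>{(m, n). m + n < Suc K}. nconst (case m of 0 \<Rightarrow> 0 | Suc m' \<Rightarrow> c m' n) * X ^ m * Y ^ n) =
     (\<Sum>(m, n)\<in>map_prod Suc id ` {(m, n). m + n < K}. nconst (case m of 0 \<Rightarrow> 0 | Suc m' \<Rightarrow> c m' n) * X ^ m * Y ^ n)"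
    by (rule sum.mono_neutral_right[OF finite_degree_less]) (force simp: gr0_conv_Suc split: nat.split)+
  also have "\<dots> = (\<Sum>(m, n)\<in>{(m, n). m + n < K}. X * (nconst (c m n) * X ^ m * Y ^ n))"
    by (subst sum.reindex) (auto simp: inj_on_def algebra_simps intro!: sum.cong)
  finally show ?thesis by (simp add: sum_distrib_left case_prod_unfold)
qed

lemma sum_degree_shift_snd:
  "(\<Sum>(m, n)\<in>{(m, n). m + n < Suc K}. nconst (case n of 0 \<Rightarrow> 0 | Suc n' \<Rightarrow> c m n') * X ^ m * Y ^ n) =
    Y * (\<Sum>(m, n)\<in>{(m, n). m + n < K}. nconst (c m n) * X ^ m * Y ^ n)"
proof -
  have "(\<Sum>(m, n)\<in>{(m, n). m + n < Suc K}. nconst (case n of 0 \<Rightarrow> 0 | Suc n' \<Rightarrow> c m n') * X ^ m * Y ^ n) =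
     (\<Sum>(m, n)\<in>map_prod id Suc ` {(m, n). m + n < K}. nconst (case n of 0 \<Rightarrow> 0 | Suc n' \<Rightarrow> c m n') * X ^ m * Y ^ n)"
    by (rule sum.mono_neutral_right[OF finite_degree_less]) (force simp: gr0_conv_Suc split: nat.split)+
  also have "\<dots> = (\<Sum>(m, n)\<in>{(m, n). m + n < K}. Y * (nconst (c m n) * X ^ m * Y ^ n))"
    by (subst sum.reindex) (auto simp: inj_on_def algebra_simps intro!: sum.cong)
  finally show ?thesis by (simp add: sum_distrib_left case_prod_unfold)
qed

text \<open>The induction is on the order, with \<open>f\<close> arbitrary. Hadamard's decomposition
  writes the remainder of order \<open>Suc K\<close> of \<open>f\<close> as \<open>X\<close> times
  that of order \<open>K\<close> of \<open>a\<close> plus \<open>Y\<close> times that of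
  \<open>b\<close>, and each of \<open>X\<close>, \<open>Y\<close> contributes another
  \<open>d\<close>. At order 0 only the membership of \<open>F P\<close> in \<open>Lam0\<close> is
  left.\<close>

lemma nrat_taylor_truncation:
  assumes V: "open V" "P \<in> thickening V" and d: "d \<ge> 0"
    and X: "fst P - nconst (residue (fst P)) \<in> val_ge d" and Y: "snd P - nconst (residue (snd P)) \<in> val_ge d"
    and f: "nrat V f F"
  shows "F P - (\<Sum>(m, n)\<in>{(m, n). m + n < K}. nconst (taylor_coeff f (residue2 P) m n)
      * (fst P - nconst (residue (fst P))) ^ m * (snd P - nconst (residue (snd P))) ^ n) \<in> val_ge (real K * d)"
  using f
proof (induction K arbitrary: f F)
  case 0
  then show ?case using nrat_residue[of V f F P] V by (simp add: Lam0_eq)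
next
  case (Suc K)
  define p where "p = residue2 P"
  let ?X = "fst P - nconst (fst p)" and ?Y = "snd P - nconst (snd p)"
  let ?S = "\<lambda>K c. \<Sum>(m, n)\<in>{(m, n). m + n < K}. nconst (c m n) * ?X ^ m * ?Y ^ n"
  have p: "p \<in> V" using V by (simp add: thickening_def p_def)
  have res: "residue (fst P) = fst p" "residue (snd P) = snd p" by (simp_all add: p_def residue2_def)
  obtain a A b B where a: "nrat V a A" and b: "nrat V b B"
    and fq: "\<forall>q\<in>V. f q = f p + (fst q - fst p) * a q + (snd q - snd p) * b q"
    and FQ: "\<forall>Q\<in>thickening V. F Q = nconst (f p) + (fst Q - nconst (fst p)) * A Q + (snd Q - nconst (snd p)) * B Q"
    using nrat_hadamard[OF Suc.prems p] by (elim exE conjE)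
  let ?T = "\<lambda>g m n. taylor_coeff g p m n"
  have na: "nrat V (\<lambda>q. (fst q - fst p) * a q) (\<lambda>Q. (fst Q - nconst (fst p)) * A Q)"
    and nb: "nrat V (\<lambda>q. (snd q - snd p) * b q) (\<lambda>Q. (snd Q - nconst (snd p)) * B Q)"
    by (intro nrat_intros a b)+
  have T: "?T f m n = (if m = 0 \<and> n = 0 then f p else 0) + (case m of 0 \<Rightarrow> 0 | Suc m' \<Rightarrow> ?T a m' n)
      + (case n of 0 \<Rightarrow> 0 | Suc n' \<Rightarrow> ?T b m n')" for m n
  proof -
    have "?T f m n = ?T (\<lambda>q. (f p + (fst q - fst p) * a q) + (snd q - snd p) * b q) m n"
      by (rule taylor_coeff_cong_on[OF V(1) p]) (use fq in auto)
    also have "\<dots> = ?T (\<lambda>q. f p + (fst q - fst p) * a q) m n + ?T (\<lambda>q. (snd q - snd p) * b q) m n"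
      by (rule taylor_coeff_add[OF V(1) p nrat_add[OF nrat_const na] nb])
    also have "?T (\<lambda>q. f p + (fst q - fst p) * a q) m n = ?T (\<lambda>q. f p) m n + ?T (\<lambda>q. (fst q - fst p) * a q) m n"
      by (rule taylor_coeff_add[OF V(1) p nrat_const na])
    finally show ?thesis
      by (simp add: taylor_coeff_const[OF V(1) p] taylor_coeff_shift_fst[OF V(1) p a] taylor_coeff_shift_snd[OF V(1) p b])
  qed
  have S1: "?S (Suc K) (\<lambda>m n. if m = 0 \<and> n = 0 then f p else 0) = nconst (f p)"
  proof -
    have "?S (Suc K) (\<lambda>m n. if m = 0 \<and> n = 0 then f p else 0) =
        (\<Sum>(m, n)\<in>{(0, 0)}. nconst (if m = 0 \<and> n = 0 then f p else 0) * ?X ^ m * ?Y ^ n)"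
      by (rule sum.mono_neutral_right[OF finite_degree_less]) (auto split: if_splits)
    then show ?thesis by simp
  qed
  have "?S (Suc K) (?T f) = nconst (f p) + ?X * ?S K (?T a) + ?Y * ?S K (?T b)"
    unfolding T nconst_add distrib_right sum.distrib case_prod_unfold
    using S1 sum_degree_shift_fst[of "?T a" ?X ?Y K] sum_degree_shift_snd[of "?T b" ?X ?Y K]
    by (simp add: case_prod_unfold)
  moreover have "F P = nconst (f p) + ?X * A P + ?Y * B P" using FQ V(2) by blast
  ultimately have "F P - ?S (Suc K) (?T f) = ?X * (A P - ?S K (?T a)) + ?Y * (B P - ?S K (?T b))"
    by (simp add: algebra_simps)
  moreover have "?X * (A P - ?S K (?T a)) \<in> val_ge (d + real K * d)"
    using Suc.IH[OF a] X by (intro val_ge_mult) (simp_all add: res p_def[symmetric])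
  moreover have "?Y * (B P - ?S K (?T b)) \<in> val_ge (d + real K * d)"
    using Suc.IH[OF b] Y by (intro val_ge_mult) (simp_all add: res p_def[symmetric])
  ultimately have "F P - ?S (Suc K) (?T f) \<in> val_ge (d + real K * d)" by (simp only: val_ge_add)
  moreover have "d + real K * d = real (Suc K) * d" by (simp add: algebra_simps)
  ultimately show ?case by (simp only: res p_def[symmetric])
qed

lemma novikov_fun_nrat:
  assumes V: "open V" "P \<in> thickening V" and f: "nrat V f F"
  shows "novikov_fun f P = F P"
proof -
  let ?X = "fst P - nconst (residue (fst P))" and ?Y = "snd P - nconst (residue (snd P))"
  let ?g = "\<lambda>(m, n). nconst (taylor_coeff f (residue2 P) m n) * ?X ^ m * ?Y ^ n"
  have "?X \<in> Lam0" "residue ?X = 0" "?Y \<in> Lam0" "residue ?Y = 0"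
    using V by (auto simp: thickening_def)
  then obtain d1 d2 where d12: "d1 > 0" "?X \<in> val_ge d1" "d2 > 0" "?Y \<in> val_ge d2"
    by (metis residue_zero_val_ge)
  define d where "d = min d1 d2"
  have d: "d > 0" "?X \<in> val_ge d" "?Y \<in> val_ge d"
    using d12 by (auto simp: d_def intro: val_ge_antimono)
  have "(?g has_sum F P) UNIV"
    unfolding has_sum_def
  proof (rule topological_tendstoI)
    fix S assume S: "open S" "F P \<in> S"
    then obtain B where B: "\<And>y. (\<forall>A\<le>B. ncoeff y A = ncoeff (F P) A) \<Longrightarrow> y \<in> S"
      unfolding open_novikov_def by blast
    \<comment> \<open>From this degree on, all terms and the truncation error have valuation at
      least \<open>real K * d\<close>, so they cannot affect the coefficients up to \<open>B\<close>
      that the neighbourhood controls.\<close>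
    obtain K where K: "B < real K * d" using reals_Archimedean3[OF d(1)] by blast
    let ?I = "{(m, n). m + n < K}"
    have "sum ?g Z \<in> S" if Z: "finite Z" "?I \<subseteq> Z" for Z
    proof (rule B, intro allI impI)
      fix A assume A: "A \<le> B"
      have "?g i \<in> val_ge (real K * d)" if "i \<in> Z - ?I" for i
      proof -
        obtain m n where i: "i = (m, n)" "K \<le> m + n" using \<open>i \<in> Z - ?I\<close> by (cases i) auto
        have "nconst (taylor_coeff f (residue2 P) m n) * ?X ^ m * ?Y ^ n \<in> val_ge (0 + real m * d + real n * d)"
          by (intro val_ge_mult val_ge_power d) (simp add: val_ge_def)
        moreover have "real K * d \<le> 0 + real m * d + real n * d"
          using i d(1) by (simp add: distrib_right[symmetric] flip: of_nat_add)
        ultimately show ?thesis using i by (auto intro: val_ge_antimono)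
      qed
      then have "sum ?g (Z - ?I) \<in> val_ge (real K * d)" by (rule val_ge_sum)
      moreover have "F P - sum ?g ?I \<in> val_ge (real K * d)"
        using nrat_taylor_truncation[OF V less_imp_le[OF d(1)] d(2,3) f, of K] by simp
      ultimately have "ncoeff (sum ?g (Z - ?I)) A = 0" "ncoeff (F P - sum ?g ?I) A = 0"
        using A K by (auto dest!: val_geD[of _ _ A])
      moreover have "sum ?g Z = sum ?g (Z - ?I) + sum ?g ?I"
        using sum.subset_diff[OF Z(2,1)] .
      ultimately show "ncoeff (sum ?g Z) A = ncoeff (F P) A" by simp
    qed
    then show "\<forall>\<^sub>F Z in finite_subsets_at_top UNIV. sum ?g Z \<in> S"
      unfolding eventually_finite_subsets_at_top using finite_degree_less[of K] by blast
  qed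
  then show ?thesis unfolding novikov_fun_def by (rule infsumI)
qed

lemma novikov_fun_cong:
  assumes "eventually (\<lambda>q. f q = g q) (nhds (residue2 P))"
  shows "novikov_fun f P = novikov_fun g P"
  unfolding novikov_fun_def using taylor_coeff_cong[OF assms] by simp

lemma novikov_map_cong:
  assumes "eventually (\<lambda>q. f q = g q) (nhds (residue2 P))"
  shows "novikov_map f P = novikov_map g P"
  unfolding novikov_map_def
  by (intro arg_cong2[of _ _ _ _ Pair] novikov_fun_cong) (use assms in \<open>auto elim!: eventually_mono\<close>)


section \<open>Rational isomorphisms between charts\<close>

definition rat_map :: "(complex \<times> complex) set \<Rightarrow> (complex \<times> complex \<Rightarrow> complex \<times> complex)
    \<Rightarrow> (novikov2 \<Rightarrow> novikov2) \<Rightarrow> bool" where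
  "rat_map V g G \<longleftrightarrow> nrat V (\<lambda>p. fst (g p)) (\<lambda>P. fst (G P)) \<and> nrat V (\<lambda>p. snd (g p)) (\<lambda>P. snd (G P))"

lemma rat_map_pair: "nrat V f F \<Longrightarrow> nrat V g G \<Longrightarrow> rat_map V (\<lambda>p. (f p, g p)) (\<lambda>P. (F P, G P))"
  by (simp add: rat_map_def)

lemma rat_map_id: "rat_map V (\<lambda>p. p) (\<lambda>P. P)"
  using nrat_fst nrat_snd by (simp add: rat_map_def)

lemma rat_map_subset: "rat_map V g G \<Longrightarrow> W \<subseteq> V \<Longrightarrow> rat_map W g G"
  by (auto simp: rat_map_def intro: nrat_subset)

lemma rat_map_compose:
  assumes "rat_map W k K" "rat_map V g G" "\<And>p. p \<in> V \<Longrightarrow> g p \<in> W"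
  shows "rat_map V (\<lambda>p. k (g p)) (\<lambda>P. K (G P))"
  using nrat_compose[of W "\<lambda>p. fst (k p)" "\<lambda>P. fst (K P)" V "\<lambda>p. fst (g p)" "\<lambda>P. fst (G P)" "\<lambda>p. snd (g p)" "\<lambda>P. snd (G P)"]
    nrat_compose[of W "\<lambda>p. snd (k p)" "\<lambda>P. snd (K P)" V "\<lambda>p. fst (g p)" "\<lambda>P. fst (G P)" "\<lambda>p. snd (g p)" "\<lambda>P. snd (G P)"]
    assms
  by (simp add: rat_map_def)

lemma rat_map_residue:
  assumes "rat_map V g G" "P \<in> thickening V"
  shows "G P \<in> Lam0 \<times> Lam0" "residue2 (G P) = g (residue2 P)"
  using nrat_residue[of V "\<lambda>p. fst (g p)" "\<lambda>P. fst (G P)" P] nrat_residue[of V "\<lambda>p. snd (g p)" "\<lambda>P. snd (G P)" P] assms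
  by (auto simp: rat_map_def residue2_def mem_Times_iff prod_eq_iff)

lemma rat_map_continuous_on: "rat_map V g G \<Longrightarrow> continuous_on V g"
  using continuous_on_Pair[of V "\<lambda>p. fst (g p)" "\<lambda>p. snd (g p)"]
  by (auto simp: rat_map_def dest: nrat_continuous_on)

lemma rat_map_open_preimage: "rat_map V g G \<Longrightarrow> open V \<Longrightarrow> open W \<Longrightarrow> open {p \<in> V. g p \<in> W}"
  using continuous_open_preimage[OF rat_map_continuous_on] by (simp add: Int_def vimage_def)

lemma rat_map_holomorphic:
  assumes "rat_map V g G" "open V"
  shows "holomorphic2_on g V"
  unfolding holomorphic2_on_def
proof (intro conjI ballI)
  fix p assume p: "p \<in> V"
  obtain L where L: "((\<lambda>p. fst (g p)) has_derivative L) (at p)" "\<forall>c a b. L (c * a, c * b) = c * L (a, b)"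
    using nrat_has_derivative[OF _ p, of "\<lambda>p. fst (g p)"] assms unfolding rat_map_def by blast
  obtain M where M: "((\<lambda>p. snd (g p)) has_derivative M) (at p)" "\<forall>c a b. M (c * a, c * b) = c * M (a, b)"
    using nrat_has_derivative[OF _ p, of "\<lambda>p. snd (g p)"] assms unfolding rat_map_def by blast
  show "\<exists>L. (g has_derivative L) (at p) \<and>
            (\<forall>c a b. L (c * a, c * b) = (c * fst (L (a, b)), c * snd (L (a, b))))"
    by (rule exI[of _ "\<lambda>x. (L x, M x)"]) (use has_derivative_Pair[OF L(1) M(1)] L(2) M(2) in simp)
qed (fact assms(2))

lemma novikov_map_rat:
  assumes "rat_map V g G" "open V" "P \<in> thickening V"
  shows "novikov_map g P = G P"
  using novikov_fun_nrat[OF assms(2,3), of "\<lambda>p. fst (g p)" "\<lambda>P. fst (G P)"]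
    novikov_fun_nrat[OF assms(2,3), of "\<lambda>p. snd (g p)" "\<lambda>P. snd (G P)"] assms(1)
  by (simp add: novikov_map_def rat_map_def comp_def prod_eq_iff)

text \<open>The inverse is part of the data and rational as well, so symmetry is immediate and
  biholomorphy needs no inverse function theorem.\<close>

definition rat_iso :: "(complex \<times> complex) set \<Rightarrow> (complex \<times> complex \<Rightarrow> complex \<times> complex)
    \<Rightarrow> (complex \<times> complex) set \<Rightarrow> (complex \<times> complex \<Rightarrow> complex \<times> complex) \<Rightarrow> bool" where
  "rat_iso V g V' h \<longleftrightarrow> open V \<and> open V' \<and> (\<exists>G. rat_map V g G) \<and> (\<exists>H. rat_map V' h H) \<and>
     (\<forall>p\<in>V. g p \<in> V' \<and> h (g p) = p) \<and> (\<forall>p\<in>V'. h p \<in> V \<and> g (h p) = p)"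

lemma rat_isoI:
  assumes "open V" "open V'" "rat_map V g G" "rat_map V' h H"
    "\<And>p. p \<in> V \<Longrightarrow> g p \<in> V'" "\<And>p. p \<in> V' \<Longrightarrow> h p \<in> V"
    "\<And>p. p \<in> V \<Longrightarrow> h (g p) = p" "\<And>p. p \<in> V' \<Longrightarrow> g (h p) = p"
  shows "rat_iso V g V' h"
  using assms by (auto simp: rat_iso_def)

lemma rat_iso_sym: "rat_iso V g V' h \<Longrightarrow> rat_iso V' h V g"
  by (auto simp: rat_iso_def)

lemma rat_iso_compose:
  assumes "rat_iso V g V' h" "rat_iso W k W' l"
  shows "rat_iso {p \<in> V. g p \<in> W} (\<lambda>p. k (g p)) {p \<in> W'. l p \<in> V'} (\<lambda>p. h (l p))"
proof -
  obtain G H K L where *: "rat_map V g G" "rat_map V' h H" "rat_map W k K" "rat_map W' l L"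
    using assms by (auto simp: rat_iso_def)
  have op: "open V" "open V'" "open W" "open W'" using assms by (auto simp: rat_iso_def)
  show ?thesis
  proof (rule rat_isoI)
    show "open {p \<in> V. g p \<in> W}" "open {p \<in> W'. l p \<in> V'}"
      using rat_map_open_preimage * op by blast+
    show "rat_map {p \<in> V. g p \<in> W} (\<lambda>p. k (g p)) (\<lambda>P. K (G P))"
      by (rule rat_map_compose[OF *(3) rat_map_subset[OF *(1)]]) auto
    show "rat_map {p \<in> W'. l p \<in> V'} (\<lambda>p. h (l p)) (\<lambda>P. H (L P))"
      by (rule rat_map_compose[OF *(2) rat_map_subset[OF *(4)]]) auto
  qed (use assms in \<open>auto simp: rat_iso_def\<close>)
qed

lemma rat_iso_biholomorphic:
  assumes "rat_iso V g V' h"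
  shows "biholomorphic2_on g V" "g ` V = V'"
proof -
  obtain G H where *: "rat_map V g G" "rat_map V' h H" "open V" "open V'"
    using assms by (auto simp: rat_iso_def)
  have inj: "inj_on g V" using assms unfolding rat_iso_def by (metis inj_onI)
  show im: "g ` V = V'" using assms unfolding rat_iso_def by (auto simp: image_iff) metis
  have inv: "inv_into V g q = h q" if "q \<in> V'" for q
    using assms that inv_into_f_eq[OF inj, of "h q" q] by (auto simp: rat_iso_def)
  have "holomorphic2_on h V'" using rat_map_holomorphic * by blast
  \<comment> \<open>\<open>inv_into V g\<close> is known to agree with \<open>h\<close> on
    \<open>V'\<close> only; openness of \<open>V'\<close> lets the derivative be
    transferred.\<close>
  then have "holomorphic2_on (inv_into V g) V'"
    unfolding holomorphic2_on_def
    by (metis (no_types, lifting) inv has_derivative_transform_within_open)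
  then show "biholomorphic2_on g V"
    unfolding biholomorphic2_on_def im using inj rat_map_holomorphic * by blast
qed

text \<open>\<open>V\<close> need not lie in the image of \<open>c\<close>: what matters is that the
  points over \<open>V\<close> in \<open>c\<close> and over \<open>V'\<close> in \<open>d\<close>
  are the same. The condition thus survives restriction of both charts with unchanged data and
  allows \<open>V = UNIV\<close>.\<close>

definition chart_iso :: "'p chart \<Rightarrow> 'p chart \<Rightarrow> (complex \<times> complex) set \<Rightarrow> (complex \<times> complex \<Rightarrow> complex \<times> complex)
    \<Rightarrow> (complex \<times> complex) set \<Rightarrow> (complex \<times> complex \<Rightarrow> complex \<times> complex) \<Rightarrow> bool" where
  "chart_iso c d V g V' h \<longleftrightarrow> rat_iso V g V' h \<and>
     (\<forall>r. r \<in> fst c \<and> snd c r \<in> V \<longleftrightarrow> r \<in> fst d \<and> snd d r \<in> V') \<and>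
     (\<forall>r\<in>fst c. snd c r \<in> V \<longrightarrow> snd d r = g (snd c r))"

text \<open>Compatibility at a single point. This local form is an equivalence on the charts around
  \<open>q\<close> and never needs a description of the whole overlap.\<close>

definition chart_rel :: "'p \<Rightarrow> 'p chart \<Rightarrow> 'p chart \<Rightarrow> bool" where
  "chart_rel q c d \<longleftrightarrow> q \<in> fst c \<and> (\<exists>V g V' h. chart_iso c d V g V' h \<and> snd c q \<in> V)"

lemma chart_isoD:
  assumes "chart_iso c d V g V' h" "r \<in> fst c" "snd c r \<in> V"
  shows "r \<in> fst d" "snd d r \<in> V'" "snd d r = g (snd c r)" "h (snd d r) = snd c r"
  using assms unfolding chart_iso_def rat_iso_def by (blast, blast, blast, metis)

lemma chart_relI: "chart_iso c d V g V' h \<Longrightarrow> q \<in> fst c \<Longrightarrow> snd c q \<in> V \<Longrightarrow> chart_rel q c d"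
  by (auto simp: chart_rel_def)

lemma chart_relE:
  assumes "chart_rel q c d"
  obtains V g V' h where "chart_iso c d V g V' h" "q \<in> fst c" "snd c q \<in> V" "q \<in> fst d"
    "snd d q \<in> V'" "snd d q = g (snd c q)"
  using assms unfolding chart_rel_def chart_iso_def by blast

lemma chart_iso_sym:
  assumes "chart_iso c d V g V' h"
  shows "chart_iso d c V' h V g"
proof -
  have "snd c r = h (snd d r)" if "r \<in> fst d" "snd d r \<in> V'" for r
  proof -
    have "r \<in> fst c" "snd c r \<in> V" using assms that unfolding chart_iso_def by blast+
    then show ?thesis using chart_isoD[OF assms] by simp
  qed
  then show ?thesis using assms rat_iso_sym unfolding chart_iso_def by blast
qed

lemma chart_rel_sym: "chart_rel q c d \<Longrightarrow> chart_rel q d c"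
  by (elim chart_relE) (rule chart_relI[OF chart_iso_sym])

lemma chart_iso_trans:
  assumes "chart_iso c d V g V' h" "chart_iso d e W k W' l"
  shows "chart_iso c e {p \<in> V. g p \<in> W} (\<lambda>p. k (g p)) {p \<in> W'. l p \<in> V'} (\<lambda>p. h (l p))"
  unfolding chart_iso_def
proof (intro conjI allI)
  show "rat_iso {p \<in> V. g p \<in> W} (\<lambda>p. k (g p)) {p \<in> W'. l p \<in> V'} (\<lambda>p. h (l p))"
    using assms by (auto simp: chart_iso_def intro: rat_iso_compose)
  fix r
  show "(r \<in> fst c \<and> snd c r \<in> {p \<in> V. g p \<in> W}) = (r \<in> fst e \<and> snd e r \<in> {p \<in> W'. l p \<in> V'})" (is "?L = ?R")
  proof
    assume L: ?L
    then show ?R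
      using chart_isoD[OF assms(1), of r] chart_isoD[OF assms(2), of r] by auto
  next
    assume R: ?R
    then show ?L
      using chart_isoD[OF chart_iso_sym[OF assms(1)], of r] chart_isoD[OF chart_iso_sym[OF assms(2)], of r] by auto
  qed
next
  show "\<forall>r\<in>fst c. snd c r \<in> {p \<in> V. g p \<in> W} \<longrightarrow> snd e r = k (g (snd c r))"
  proof (intro ballI impI)
    fix r assume r: "r \<in> fst c" "snd c r \<in> {p \<in> V. g p \<in> W}"
    then show "snd e r = k (g (snd c r))"
      using chart_isoD[OF assms(1), of r] chart_isoD[OF assms(2), of r] by auto
  qed
qed

lemma chart_rel_trans:
  assumes "chart_rel q c d" "chart_rel q d e"
  shows "chart_rel q c e"
proof -
  obtain V g V' h where 1: "chart_iso c d V g V' h" "q \<in> fst c" "snd c q \<in> V" "snd d q = g (snd c q)"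
    using assms(1) by (rule chart_relE)
  obtain W k W' l where 2: "chart_iso d e W k W' l" "snd d q \<in> W"
    using assms(2) by (rule chart_relE)
  show ?thesis by (rule chart_relI[OF chart_iso_trans[OF 1(1) 2(1)]]) (use 1 2 in auto)
qed

lemma rat_iso_id: "open V \<Longrightarrow> rat_iso V (\<lambda>p. p) V (\<lambda>p. p)"
  by (rule rat_isoI) (auto intro: rat_map_id)

lemma chart_rel_cong:
  assumes "fst c = fst d" "\<And>r. r \<in> fst c \<Longrightarrow> snd c r = snd d r" "q \<in> fst c"
  shows "chart_rel q c d"
proof (rule chart_relI)
  show "chart_iso c d UNIV (\<lambda>p. p) UNIV (\<lambda>p. p)"
    using assms rat_iso_id[OF open_UNIV] by (auto simp: chart_iso_def)
qed (use assms in auto)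

lemma chart_rel_refl: "q \<in> fst c \<Longrightarrow> chart_rel q c c"
  by (rule chart_rel_cong) auto

definition restrict_chart :: "'p chart \<Rightarrow> 'p set \<Rightarrow> 'p chart" where
  "restrict_chart c W = (fst c \<inter> W, snd c)"

lemma restrict_chart_simps [simp]:
  "fst (restrict_chart c W) = fst c \<inter> W" "snd (restrict_chart c W) = snd c"
  by (simp_all add: restrict_chart_def)

lemma restrict_chart_id: "fst c \<subseteq> W \<Longrightarrow> restrict_chart c W = c"
  by (auto simp: restrict_chart_def prod_eq_iff)

lemma chart_rel_restrict:
  assumes "chart_rel q c d" "q \<in> W"
  shows "chart_rel q (restrict_chart c W) (restrict_chart d W)"
proof -
  obtain V g V' h where 1: "chart_iso c d V g V' h" "q \<in> fst c" "snd c q \<in> V"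
    using assms(1) by (rule chart_relE)
  show ?thesis
  proof (rule chart_relI)
    show "chart_iso (restrict_chart c W) (restrict_chart d W) V g V' h"
      using 1(1) by (auto simp: chart_iso_def)
  qed (use 1 assms in auto)
qed

text \<open>A neighbourhood in \<open>d\<close> is pulled back along the coordinate change. Hence
  membership in \<open>surface_closure\<close> can be tested in any related chart, in particular in
  a model chart.\<close>

lemma chart_rel_closure:
  assumes "chart_rel q c d" "snd c q \<in> closure (snd c ` (fst c \<inter> A))"
  shows "snd d q \<in> closure (snd d ` (fst d \<inter> A))"
  unfolding closure_iff_nhds_not_empty
proof (intro allI impI)
  obtain V g V' h where 1: "chart_iso c d V g V' h" "q \<in> fst c" "snd c q \<in> V" "snd d q = g (snd c q)"
    using assms(1) by (rule chart_relE)
  then obtain G where G: "rat_map V g G" "open V" by (auto simp: chart_iso_def rat_iso_def)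
  fix X Y assume Y: "Y \<subseteq> X" "snd d q \<in> Y" "open Y"
  have "open {p \<in> V. g p \<in> Y}" by (rule rat_map_open_preimage[OF G Y(3)])
  moreover have "snd c q \<in> {p \<in> V. g p \<in> Y}" using 1 Y by auto
  ultimately have "snd c ` (fst c \<inter> A) \<inter> {p \<in> V. g p \<in> Y} \<noteq> {}"
    using assms(2) unfolding closure_iff_nhds_not_empty by blast
  then obtain r where r: "r \<in> fst c" "r \<in> A" "snd c r \<in> V" "g (snd c r) \<in> Y" by blast
  then have "r \<in> fst d" "snd d r = g (snd c r)" using 1(1) by (auto simp: chart_iso_def)
  then show "snd d ` (fst d \<inter> A) \<inter> X \<noteq> {}" using r Y by (metis IntI disjoint_iff image_eqI in_mono)
qed

section \<open>Novikov extensions of rational atlases\<close>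

definition rat_atlas :: "'p chart set \<Rightarrow> bool" where
  "rat_atlas \<A> \<longleftrightarrow> (\<forall>c\<in>\<A>. inj_on (snd c) (fst c) \<and> open (snd c ` fst c)) \<and>
     (\<forall>c\<in>\<A>. \<forall>d\<in>\<A>. \<forall>q\<in>fst c \<inter> fst d. chart_rel q c d)"

text \<open>The gluing relation of the Novikov extension without reference to a surface, so that it
  also applies to charts of Lagrangians outside its atlas.\<close>

definition extension_rel :: "'p chart \<Rightarrow> 'p chart \<Rightarrow> novikov2 \<Rightarrow> novikov2 \<Rightarrow> bool" where
  "extension_rel c d P Q \<longleftrightarrow> P \<in> Lam0 \<times> Lam0 \<and> residue2 P \<in> snd c ` (fst c \<inter> fst d) \<and>
     Q = novikov_map (snd d \<circ> inv_into (fst c) (snd c)) P"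

text \<open>The transition function is only known to be \<open>g\<close> near the residue, and
  \<open>inv_into\<close> is arbitrary outside the image; Taylor coefficients see only the
  germ.\<close>

lemma novikov_map_transition:
  assumes c: "inj_on (snd c) (fst c)" "open (snd c ` fst c)"
    and V: "open V" "rat_map V g G" "\<And>r. r \<in> fst c \<Longrightarrow> snd c r \<in> V \<Longrightarrow> snd d r = g (snd c r)"
    and P: "P \<in> Lam0 \<times> Lam0" "q \<in> fst c" "residue2 P = snd c q" "snd c q \<in> V"
  shows "novikov_map (snd d \<circ> inv_into (fst c) (snd c)) P = G P"
proof -
  have "eventually (\<lambda>p. p \<in> V \<inter> snd c ` fst c) (nhds (residue2 P))"
    by (rule eventually_nhds_in_open) (use c V P in auto)
  then have "eventually (\<lambda>p. (snd d \<circ> inv_into (fst c) (snd c)) p = g p) (nhds (residue2 P))"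
  proof eventually_elim
    case (elim p)
    then obtain r where "r \<in> fst c" "p = snd c r" "snd c r \<in> V" by blast
    then show ?case using V(3)[of r] c(1) by simp
  qed
  then have "novikov_map (snd d \<circ> inv_into (fst c) (snd c)) P = novikov_map g P" by (rule novikov_map_cong)
  also have "\<dots> = G P" using V P by (intro novikov_map_rat) (auto simp: thickening_def)
  finally show ?thesis .
qed

context
  fixes \<A> :: "'p chart set"
  assumes \<A>: "rat_atlas \<A>"
begin

lemma atlas_inj: "c \<in> \<A> \<Longrightarrow> inj_on (snd c) (fst c)"
  and atlas_open: "c \<in> \<A> \<Longrightarrow> open (snd c ` fst c)"
  and atlas_rel: "c \<in> \<A> \<Longrightarrow> d \<in> \<A> \<Longrightarrow> q \<in> fst c \<Longrightarrow> q \<in> fst d \<Longrightarrow> chart_rel q c d"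
  using \<A> by (auto simp: rat_atlas_def)

lemma extension_relI:
  assumes c: "c \<in> \<A>" "open V" "rat_map V g G" "\<And>r. r \<in> fst c \<Longrightarrow> snd c r \<in> V \<Longrightarrow> snd d r = g (snd c r)"
    and "P \<in> Lam0 \<times> Lam0" "q \<in> fst c" "q \<in> fst d" "residue2 P = snd c q" "snd c q \<in> V"
  shows "extension_rel c d P (G P)"
  unfolding extension_rel_def
  using novikov_map_transition[OF atlas_inj[OF c(1)] atlas_open[OF c(1)] c(2-4)] assms by auto

text \<open>Replaces the Taylor series by evaluation of a rational map, for any rational
  presentation of the transition; composition then becomes substitution.\<close>

lemma extension_rel_iff:
  assumes c: "c \<in> \<A>" "d \<in> \<A>"
  shows "extension_rel c d P Q \<longleftrightarrow> P \<in> Lam0 \<times> Lam0 \<and>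
     (\<exists>V g V' h G q. chart_iso c d V g V' h \<and> rat_map V g G \<and> q \<in> fst c \<and> q \<in> fst d \<and>
        snd c q \<in> V \<and> residue2 P = snd c q \<and> Q = G P)" (is "?L \<longleftrightarrow> ?R")
proof
  assume L: ?L
  then obtain q where q: "q \<in> fst c" "q \<in> fst d" "residue2 P = snd c q" by (auto simp: extension_rel_def)
  obtain V g V' h where 1: "chart_iso c d V g V' h" "snd c q \<in> V"
    using atlas_rel[OF c q(1,2)] by (rule chart_relE)
  then obtain G where G: "open V" "rat_map V g G" "\<And>r. r \<in> fst c \<Longrightarrow> snd c r \<in> V \<Longrightarrow> snd d r = g (snd c r)"
    by (auto simp: chart_iso_def rat_iso_def)
  have P: "P \<in> Lam0 \<times> Lam0" using L by (simp add: extension_rel_def)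
  have "Q = G P"
    using L novikov_map_transition[OF atlas_inj[OF c(1)] atlas_open[OF c(1)] G P q(1,3) 1(2)]
    by (simp add: extension_rel_def)
  with P 1 G q show ?R by blast
next
  assume ?R
  then obtain V g V' h G q where *: "P \<in> Lam0 \<times> Lam0" "chart_iso c d V g V' h" "rat_map V g G"
    "q \<in> fst c" "q \<in> fst d" "snd c q \<in> V" "residue2 P = snd c q" "Q = G P" by blast
  then show ?L using extension_relI[OF c(1) _ *(3) _ *(1,4,5,7,6)]
    by (auto simp: chart_iso_def rat_iso_def)
qed

lemma extension_rel_point:
  assumes "c \<in> \<A>" "d \<in> \<A>" "extension_rel c d P Q"
  shows "P \<in> Lam0 \<times> Lam0" "Q \<in> Lam0 \<times> Lam0"
    "\<exists>q\<in>fst c \<inter> fst d. residue2 P = snd c q \<and> residue2 Q = snd d q"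
proof -
  obtain V g V' h G q where *: "P \<in> Lam0 \<times> Lam0" "chart_iso c d V g V' h" "rat_map V g G"
    "q \<in> fst c" "q \<in> fst d" "snd c q \<in> V" "residue2 P = snd c q" "Q = G P"
    using assms(3) unfolding extension_rel_iff[OF assms(1,2)] by blast
  have "P \<in> thickening V" using * by (simp add: thickening_def)
  note r = rat_map_residue[OF *(3) this]
  show "P \<in> Lam0 \<times> Lam0" "Q \<in> Lam0 \<times> Lam0" using * r by simp_all
  have "snd d q = g (snd c q)" using * by (auto simp: chart_iso_def)
  then show "\<exists>q\<in>fst c \<inter> fst d. residue2 P = snd c q \<and> residue2 Q = snd d q" using * r by auto
qed

lemma extension_rel_refl:
  assumes "c \<in> \<A>" "P \<in> thickening (snd c ` fst c)"
  shows "extension_rel c c P P"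
proof -
  obtain q where "q \<in> fst c" "residue2 P = snd c q" "P \<in> Lam0 \<times> Lam0"
    using assms(2) by (auto simp: thickening_def)
  then show ?thesis
    using extension_relI[OF assms(1) open_UNIV rat_map_id, of c P q] by simp
qed

lemma extension_rel_trans:
  assumes A: "c \<in> \<A>" "d \<in> \<A>" "e \<in> \<A>" and 1: "extension_rel c d P Q" and 2: "extension_rel d e Q R"
  shows "extension_rel c e P R"
proof -
  obtain V g V' h G q where *: "P \<in> Lam0 \<times> Lam0" "chart_iso c d V g V' h" "rat_map V g G"
    "q \<in> fst c" "q \<in> fst d" "snd c q \<in> V" "residue2 P = snd c q" "Q = G P"
    using 1 unfolding extension_rel_iff[OF A(1,2)] by blast
  obtain W k W' l K q' where **: "chart_iso d e W k W' l" "rat_map W k K"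
    "q' \<in> fst d" "q' \<in> fst e" "snd d q' \<in> W" "residue2 Q = snd d q'" "R = K Q"
    using 2 unfolding extension_rel_iff[OF A(2,3)] by blast
  have "P \<in> thickening V" using * by (simp add: thickening_def)
  then have "residue2 Q = g (snd c q)" using rat_map_residue(2)[OF *(3)] * by simp
  also have "\<dots> = snd d q" using * by (auto simp: chart_iso_def)
  finally have dq: "snd d q = snd d q'" "g (snd c q) = snd d q" using ** * \<open>g (snd c q) = snd d q\<close> by simp_all
  then have q': "q' = q" using atlas_inj[OF A(2)] * ** by (auto dest: inj_onD)
  have r: "rat_map {p \<in> V. g p \<in> W} (\<lambda>p. k (g p)) (\<lambda>P. K (G P))"
    by (rule rat_map_compose[OF **(2) rat_map_subset[OF *(3)]]) auto
  show ?thesis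
    unfolding extension_rel_iff[OF A(1,3)]
  proof (intro conjI exI)
    show "P \<in> Lam0 \<times> Lam0" "q \<in> fst c" "residue2 P = snd c q" by (fact *)+
    show "q \<in> fst e" "R = K (G P)" using ** q' * by simp_all
    show "snd c q \<in> {p \<in> V. g p \<in> W}" using * ** dq by simp
  qed (fact chart_iso_trans[OF *(2) **(1)] r)+
qed

text \<open>The expressions for \<open>g\<close> and \<open>h\<close> need not cancel formally over
  the Novikov field. But \<open>H (G P)\<close> and \<open>P\<close> are Taylor values of maps that
  agree near the residue, which forces \<open>H (G P) = P\<close>.\<close>

lemma extension_rel_sym:
  assumes A: "c \<in> \<A>" "d \<in> \<A>" and 1: "extension_rel c d P Q"
  shows "extension_rel d c Q P"
proof -
  obtain V g V' h G q where *: "P \<in> Lam0 \<times> Lam0" "chart_iso c d V g V' h" "rat_map V g G"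
    "q \<in> fst c" "q \<in> fst d" "snd c q \<in> V" "residue2 P = snd c q" "Q = G P"
    using 1 unfolding extension_rel_iff[OF A(1,2)] by blast
  obtain H where H: "rat_map V' h H" "open V" and V: "\<And>p. p \<in> V \<Longrightarrow> g p \<in> V' \<and> h (g p) = p"
    using *(2) by (auto simp: chart_iso_def rat_iso_def)
  have P: "P \<in> thickening V" using * by (simp add: thickening_def)
  have "rat_map V (\<lambda>p. h (g p)) (\<lambda>P. H (G P))"
    by (rule rat_map_compose[OF H(1) *(3)]) (use V in auto)
  then have "H (G P) = novikov_map (\<lambda>p. h (g p)) P" using novikov_map_rat H(2) P by metis
  also have "\<dots> = novikov_map (\<lambda>p. p) P"
    by (rule novikov_map_cong, rule eventually_mono[OF eventually_nhds_in_open[OF H(2)]])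
      (use P V in \<open>auto simp: thickening_def\<close>)
  also have "\<dots> = P" using novikov_map_rat[OF rat_map_id H(2) P] .
  finally have "P = H Q" using * by simp
  moreover have "Q \<in> Lam0 \<times> Lam0" "residue2 Q = snd d q" "snd d q \<in> V'"
    using rat_map_residue[OF *(3) P] * V by (auto simp: chart_iso_def)
  ultimately show ?thesis
    unfolding extension_rel_iff[OF A(2,1)]
    using chart_iso_sym[OF *(2)] H(1) * by blast
qed

text \<open>The gluing relation of an extension is already an equivalence relation.\<close>

lemma extension_class_eq:
  assumes M: "atlas M \<subseteq> \<A>" and x: "(c, P) \<in> extension_points M"
  shows "extension_class M (c, P) = {(d, Q). d \<in> atlas M \<and> extension_rel c d P Q}"
proof -
  let ?R = "extension_gluing M"
  have pt: "(c, P) \<in> extension_points M \<longleftrightarrow> c \<in> atlas M \<and> P \<in> thickening (snd c ` fst c)" for c P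
    by (simp add: extension_points_def)
  have R: "((c, P), (d, Q)) \<in> ?R \<longleftrightarrow> c \<in> atlas M \<and> d \<in> atlas M \<and> extension_rel c d P Q" for c P d Q
    by (auto simp: extension_gluing_def extension_rel_def extension_points_def thickening_def)
  have step: "y \<in> {(d, Q). d \<in> atlas M \<and> extension_rel c d P Q}" if "((c, P), y) \<in> (?R \<union> ?R\<inverse>)\<^sup>*" for y
    using that
  proof induction
    case base
    then show ?case using x extension_rel_refl[of c P] M by (auto simp: pt)
  next
    case (step y z)
    obtain d Q e S where [simp]: "y = (d, Q)" "z = (e, S)" by (cases y, cases z) auto
    have "extension_rel d e Q S" "d \<in> atlas M" "e \<in> atlas M"
      using step(2) M extension_rel_sym[of e d S Q] by (auto simp: R)
    then show ?case using step(3) extension_rel_trans[of c d e P Q S] M x by (auto simp: pt)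
  qed
  show ?thesis
  proof (intro set_eqI iffI)
    fix y assume "y \<in> extension_class M (c, P)"
    then show "y \<in> {(d, Q). d \<in> atlas M \<and> extension_rel c d P Q}"
      using step by (simp add: glue_class_def)
  next
    fix y assume y: "y \<in> {(d, Q). d \<in> atlas M \<and> extension_rel c d P Q}"
    obtain d Q where [simp]: "y = (d, Q)" by (cases y)
    have dQ: "d \<in> atlas M" "extension_rel c d P Q" "c \<in> atlas M" using y x by (auto simp: pt)
    then have "Q \<in> Lam0 \<times> Lam0 \<and> residue2 Q \<in> snd d ` fst d"
      using extension_rel_point[of c d P Q] M by auto
    then have "y \<in> extension_points M" using dQ by (simp add: pt thickening_def)
    moreover have "((c, P), y) \<in> ?R" using dQ by (simp add: R)
    ultimately show "y \<in> extension_class M (c, P)" by (auto simp: glue_class_def)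
  qed
qed

text \<open>\<open>\<delta> l\<close> is the chart of which the \<open>l\<close>-th piece of \<open>A\<close> is a (not necessarily open) part.\<close>

lemma extension_isomorphism_exists:
  fixes A :: "('l \<times> novikov2) set" and \<delta> :: "'l \<Rightarrow> 'p chart"
  assumes M: "atlas M \<subseteq> \<A>"
    and A: "\<And>l P. (l, P) \<in> A \<Longrightarrow> \<delta> l \<in> \<A> \<and> P \<in> thickening (snd (\<delta> l) ` fst (\<delta> l))"
    and R: "R \<subseteq> A \<times> A"
      "\<And>l P l' P'. ((l, P), (l', P')) \<in> R \<Longrightarrow> extension_rel (\<delta> l) (\<delta> l') P P'"
      "\<And>l P l' P'. (l, P) \<in> A \<Longrightarrow> (l', P') \<in> A \<Longrightarrow> extension_rel (\<delta> l) (\<delta> l') P P'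
         \<Longrightarrow> ((l, P), (l', P')) \<in> (R \<union> R\<inverse>)\<^sup>*"
    and cov: "\<And>l P q. (l, P) \<in> A \<Longrightarrow> q \<in> fst (\<delta> l) \<Longrightarrow> \<exists>c\<in>atlas M. q \<in> fst c"
      "\<And>c q. c \<in> atlas M \<Longrightarrow> q \<in> fst c \<Longrightarrow> \<exists>l. \<delta> l \<in> \<A> \<and> q \<in> fst (\<delta> l) \<and>
         (\<forall>P\<in>Lam0 \<times> Lam0. residue2 P = snd (\<delta> l) q \<longrightarrow> (l, P) \<in> A)"
  shows "\<exists>\<Phi>. extension_isomorphism A R M \<Phi> \<and>
     (\<forall>l P. (l, P) \<in> A \<longrightarrow> \<delta> l \<in> atlas M \<longrightarrow> \<Phi> (glue_class A R (l, P)) = extension_class M (\<delta> l, P))"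
proof -
  have pt: "(c, P) \<in> extension_points M \<longleftrightarrow> c \<in> atlas M \<and> P \<in> thickening (snd c ` fst c)" for c P
    by (simp add: extension_points_def)
  \<comment> \<open>The generated equivalence collapses to \<open>extension_rel\<close>: one
    inclusion by transitivity, the other is the assumption that related points are joined by
    gluings.\<close>
  have cls: "glue_class A R (l, P) = {(l', P') \<in> A. extension_rel (\<delta> l) (\<delta> l') P P'}" if lP: "(l, P) \<in> A" for l P
  proof -
    have "y \<in> {(l', P') \<in> A. extension_rel (\<delta> l) (\<delta> l') P P'}" if "((l, P), y) \<in> (R \<union> R\<inverse>)\<^sup>*" for y
      using that
    proof induction
      case base
      then show ?case using lP extension_rel_refl[of "\<delta> l" P] A[OF lP] by auto
    next
      case (step y z)
      obtain d Q e S where [simp]: "y = (d, Q)" "z = (e, S)" by (cases y, cases z) auto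
      have dA: "(d, Q) \<in> A" "(e, S) \<in> A" using step(2) R(1) by auto
      have "extension_rel (\<delta> d) (\<delta> e) Q S"
        using step(2) R(2)[of d Q e S] R(2)[of e S d Q] extension_rel_sym[of "\<delta> e" "\<delta> d" S Q] A[OF dA(1)] A[OF dA(2)] by auto
      then show ?case
        using step(3) extension_rel_trans[of "\<delta> l" "\<delta> d" "\<delta> e" P Q S] A[OF lP] A[OF dA(1)] A[OF dA(2)] dA by auto
    qed
    then show ?thesis using R(3)[OF lP] unfolding glue_class_def by (auto 0 3)
  qed
  \<comment> \<open>Collecting all representatives in charts of \<open>M\<close> makes the map
    independent of choices; the collection is then seen to be a single gluing class.\<close>
  define \<Phi> where "\<Phi> X = {(c, P). c \<in> atlas M \<and> (\<exists>l Q. (l, Q) \<in> X \<and> extension_rel (\<delta> l) c Q P)}" for X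
  have \<Phi>: "\<Phi> (glue_class A R (l, Q)) = extension_class M (c, P)"
    if lQ: "(l, Q) \<in> A" and c: "c \<in> atlas M" and r: "extension_rel (\<delta> l) c Q P" for l Q c P
  proof -
    have cA: "c \<in> \<A>" using c M by blast
    have \<delta>: "\<delta> l \<in> \<A>" using A[OF lQ] by simp
    have x: "(c, P) \<in> extension_points M"
      using extension_rel_point[OF \<delta> cA r] c by (auto simp: pt thickening_def)
    have "\<Phi> (glue_class A R (l, Q)) = {(d, S). d \<in> atlas M \<and> extension_rel (\<delta> l) d Q S}"
    proof (intro set_eqI iffI)
      fix y assume y: "y \<in> \<Phi> (glue_class A R (l, Q))"
      obtain d S where [simp]: "y = (d, S)" by (cases y)
      obtain l' Q' where *: "d \<in> atlas M" "(l', Q') \<in> A" "extension_rel (\<delta> l) (\<delta> l') Q Q'" "extension_rel (\<delta> l') d Q' S"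
        using y by (auto simp: \<Phi>_def cls[OF lQ])
      then show "y \<in> {(d, S). d \<in> atlas M \<and> extension_rel (\<delta> l) d Q S}"
        using extension_rel_trans[of "\<delta> l" "\<delta> l'" d Q Q' S] \<delta> A[OF *(2)] M by auto
    next
      fix y assume "y \<in> {(d, S). d \<in> atlas M \<and> extension_rel (\<delta> l) d Q S}"
      then show "y \<in> \<Phi> (glue_class A R (l, Q))"
        using lQ A[OF lQ] extension_rel_refl[of "\<delta> l" Q] unfolding \<Phi>_def cls[OF lQ] by blast
    qed
    also have "\<dots> = {(d, S). d \<in> atlas M \<and> extension_rel c d P S}"
      using extension_rel_trans[OF \<delta> cA _ r] extension_rel_trans[OF cA \<delta> _ extension_rel_sym[OF \<delta> cA r]] M by blast
    also have "\<dots> = extension_class M (c, P)" by (rule extension_class_eq[OF M x, symmetric])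
    finally show ?thesis .
  qed
  have ex: "\<exists>c P. c \<in> atlas M \<and> extension_rel (\<delta> l) c Q P" if lQ: "(l, Q) \<in> A" for l Q
  proof -
    obtain q where q: "q \<in> fst (\<delta> l)" "residue2 Q = snd (\<delta> l) q" "Q \<in> Lam0 \<times> Lam0"
      using A[OF lQ] by (auto simp: thickening_def)
    then obtain c where "c \<in> atlas M" "q \<in> fst c" using cov(1)[OF lQ] by blast
    then show ?thesis using q unfolding extension_rel_def by blast
  qed
  have bij: "bij_betw \<Phi> (glue A R) (novikov_extension M)"
  proof (rule bij_betw_imageI)
    show "inj_on \<Phi> (glue A R)"
    proof (rule inj_onI)
      fix X Y assume X: "X \<in> glue A R" and Y: "Y \<in> glue A R" and eq: "\<Phi> X = \<Phi> Y"
      obtain l Q where lQ: "(l, Q) \<in> A" "X = glue_class A R (l, Q)" using X by (auto simp: glue_def)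
      obtain l' Q' where lQ': "(l', Q') \<in> A" "Y = glue_class A R (l', Q')" using Y by (auto simp: glue_def)
      have \<delta>: "\<delta> l \<in> \<A>" "\<delta> l' \<in> \<A>" using A lQ(1) lQ'(1) by blast+
      obtain c P where c: "c \<in> atlas M" "extension_rel (\<delta> l) c Q P" using ex[OF lQ(1)] by blast
      have "(l, Q) \<in> X" using lQ cls[OF lQ(1)] A[OF lQ(1)] extension_rel_refl by auto
      then have "(c, P) \<in> \<Phi> X" using c unfolding \<Phi>_def by blast
      then have "(c, P) \<in> \<Phi> (glue_class A R (l', Q'))" using eq lQ'(2) by simp
      then obtain l2 Q2 where 2: "(l2, Q2) \<in> A" "extension_rel (\<delta> l') (\<delta> l2) Q' Q2" "extension_rel (\<delta> l2) c Q2 P"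
        unfolding \<Phi>_def cls[OF lQ'(1)] by blast
      have \<delta>2: "\<delta> l2 \<in> \<A>" "c \<in> \<A>" using A[OF 2(1)] c M by auto
      have "extension_rel (\<delta> l') c Q' P" using extension_rel_trans[OF \<delta>(2) \<delta>2 2(2,3)] .
      \<comment> \<open>A common image point links the two representatives through \<open>c\<close>,
        so their classes agree.\<close>
      then have "extension_rel (\<delta> l) (\<delta> l') Q Q'"
        using extension_rel_trans[OF \<delta>(1) \<delta>2(2) \<delta>(2) c(2)] extension_rel_sym[OF \<delta>(2) \<delta>2(2)] by blast
      then show "X = Y"
        unfolding lQ(2) lQ'(2) cls[OF lQ(1)] cls[OF lQ'(1)]
        using extension_rel_trans[OF \<delta> _ \<open>extension_rel (\<delta> l) (\<delta> l') Q Q'\<close>]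
          extension_rel_trans[OF \<delta>(2,1) _ extension_rel_sym[OF \<delta> \<open>extension_rel (\<delta> l) (\<delta> l') Q Q'\<close>]] A by blast
    qed
    show "\<Phi> ` glue A R = novikov_extension M"
    proof (intro set_eqI iffI)
      fix Z assume "Z \<in> \<Phi> ` glue A R"
      then obtain l Q where lQ: "(l, Q) \<in> A" "Z = \<Phi> (glue_class A R (l, Q))" by (auto simp: glue_def)
      obtain c P where c: "c \<in> atlas M" "extension_rel (\<delta> l) c Q P" using ex[OF lQ(1)] by blast
      have "(c, P) \<in> extension_points M"
        using extension_rel_point[of "\<delta> l" c Q P] c A[OF lQ(1)] M by (auto simp: pt thickening_def)
      then show "Z \<in> novikov_extension M" using \<Phi>[OF lQ(1) c] lQ(2) by (auto simp: glue_def)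
    next
      fix Z assume "Z \<in> novikov_extension M"
      then obtain c P where c: "(c, P) \<in> extension_points M" "Z = extension_class M (c, P)"
        by (auto simp: glue_def)
      then have c': "c \<in> atlas M" "c \<in> \<A>" using M by (auto simp: pt)
      obtain q where q: "q \<in> fst c" "residue2 P = snd c q" "P \<in> Lam0 \<times> Lam0"
        using c by (auto simp: pt thickening_def)
      \<comment> \<open>A piece containing every Novikov point over the residue of \<open>q\<close>
        is needed: transport to \<open>\<delta> l\<close> gives control of the residue of
        \<open>Q\<close> only.\<close>
      obtain l where l: "\<delta> l \<in> \<A>" "q \<in> fst (\<delta> l)"
        "\<And>P. P \<in> Lam0 \<times> Lam0 \<Longrightarrow> residue2 P = snd (\<delta> l) q \<Longrightarrow> (l, P) \<in> A"
        using cov(2)[OF c'(1) q(1)] by blast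
      define Q where "Q = novikov_map (snd (\<delta> l) \<circ> inv_into (fst c) (snd c)) P"
      have r: "extension_rel c (\<delta> l) P Q" using q l unfolding extension_rel_def Q_def by blast
      obtain q' where q': "q' \<in> fst c" "q' \<in> fst (\<delta> l)" "residue2 P = snd c q'" "residue2 Q = snd (\<delta> l) q'" "Q \<in> Lam0 \<times> Lam0"
        using extension_rel_point[OF c'(2) l(1) r] by blast
      have "q' = q" using q q' atlas_inj[OF c'(2)] by (auto dest: inj_onD)
      then have lQ: "(l, Q) \<in> A" using l(3) q' by simp
      have "\<Phi> (glue_class A R (l, Q)) = Z"
        using \<Phi>[OF lQ c'(1) extension_rel_sym[OF c'(2) l(1) r]] c(2) by simp
      then show "Z \<in> \<Phi> ` glue A R" using lQ by (auto simp: glue_def)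
    qed
  qed
  have loc: "\<exists>c\<in>atlas M. \<exists>W g. residue2 P \<in> W \<and> biholomorphic2_on g W \<and> g ` W \<subseteq> snd c ` fst c \<and>
        (\<forall>Q. (l, Q) \<in> A \<and> residue2 Q \<in> W \<longrightarrow> \<Phi> (glue_class A R (l, Q)) = extension_class M (c, novikov_map g Q))"
    if lP: "(l, P) \<in> A" for l P
  proof -
    have \<delta>: "\<delta> l \<in> \<A>" using A[OF lP] by simp
    obtain q where q: "q \<in> fst (\<delta> l)" "residue2 P = snd (\<delta> l) q" "P \<in> Lam0 \<times> Lam0"
      using A[OF lP] by (auto simp: thickening_def)
    obtain c where c: "c \<in> atlas M" "q \<in> fst c" using cov(1)[OF lP q(1)] by blast
    have cA: "c \<in> \<A>" using c M by blast
    obtain V g V' h where 1: "chart_iso (\<delta> l) c V g V' h" "snd (\<delta> l) q \<in> V" "snd c q = g (snd (\<delta> l) q)"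
      using atlas_rel[OF \<delta> cA q(1) c(2)] by (rule chart_relE)
    let ?W = "{p \<in> V. g p \<in> snd c ` fst c}"
    have "rat_iso ?W g {p \<in> snd c ` fst c. p \<in> V'} h"
      using rat_iso_compose[of V g V' h, OF _ rat_iso_id[OF atlas_open[OF cA]]] 1(1)
      by (simp add: chart_iso_def)
    note bih = rat_iso_biholomorphic[OF this]
    obtain G where G: "rat_map V g G" "open V" "\<And>r. r \<in> fst (\<delta> l) \<Longrightarrow> snd (\<delta> l) r \<in> V \<Longrightarrow> snd c r = g (snd (\<delta> l) r)"
      using 1(1) by (auto simp: chart_iso_def rat_iso_def)
    have "\<Phi> (glue_class A R (l, Q)) = extension_class M (c, novikov_map g Q)"
      if Q: "(l, Q) \<in> A" "residue2 Q \<in> ?W" for Q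
    proof -
      obtain r where r: "r \<in> fst (\<delta> l)" "residue2 Q = snd (\<delta> l) r" "Q \<in> Lam0 \<times> Lam0"
        using A[OF Q(1)] by (auto simp: thickening_def)
      have rc: "r \<in> fst c" using Q(2) r 1(1) by (auto simp: chart_iso_def)
      have "extension_rel (\<delta> l) c Q (G Q)"
        by (rule extension_relI[OF \<delta> G(2,1,3) r(3,1) rc r(2)]) (use Q r in auto)
      moreover have "G Q = novikov_map g Q"
        using novikov_map_rat[OF G(1,2)] Q(2) r by (simp add: thickening_def)
      ultimately show ?thesis using \<Phi>[OF Q(1) c(1)] by simp
    qed
    moreover have "g (snd (\<delta> l) q) \<in> snd c ` fst c" using c(2) 1(3) by (metis imageI)
    ultimately show ?thesis
      using c bih q 1 by (intro bexI[OF _ c(1)] exI[of _ ?W] exI[of _ g]) auto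
  qed
  have "extension_isomorphism A R M \<Phi>"
    unfolding extension_isomorphism_def using bij loc by blast
  moreover have "\<Phi> (glue_class A R (l, P)) = extension_class M (\<delta> l, P)" if "(l, P) \<in> A" "\<delta> l \<in> atlas M" for l P
    using \<Phi>[OF that(1,2) extension_rel_refl] A[OF that(1)] by blast
  ultimately show ?thesis by blast
qed

end


section \<open>Blowing up a chart\<close>

text \<open>The Novikov companion is hidden behind an existential, because the geometry of blow-ups
  involves only the complex function.\<close>

definition rational_on :: "(complex \<times> complex) set \<Rightarrow> (complex \<times> complex \<Rightarrow> complex) \<Rightarrow> bool" where
  "rational_on V f \<longleftrightarrow> (\<exists>F. nrat V f F)"

lemma rational_on_intros:
  "rational_on V (\<lambda>_. k)" "rational_on V fst" "rational_on V snd"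
  "rational_on V f \<Longrightarrow> rational_on V g \<Longrightarrow> rational_on V (\<lambda>p. f p + g p)"
  "rational_on V f \<Longrightarrow> rational_on V g \<Longrightarrow> rational_on V (\<lambda>p. f p - g p)"
  "rational_on V f \<Longrightarrow> rational_on V g \<Longrightarrow> rational_on V (\<lambda>p. f p * g p)"
  "rational_on V f \<Longrightarrow> rational_on V g \<Longrightarrow> (\<And>p. p \<in> V \<Longrightarrow> g p \<noteq> 0) \<Longrightarrow> rational_on V (\<lambda>p. f p / g p)"
  "rational_on V f \<Longrightarrow> (\<And>p. p \<in> V \<Longrightarrow> f p \<noteq> 0) \<Longrightarrow> rational_on V (\<lambda>p. f p powi i)"
  "rational_on V f \<Longrightarrow> rational_on V (\<lambda>p. f p ^ n)"
  unfolding rational_on_def by (blast intro: nrat_intros)+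

lemma rational_on_subset: "rational_on V f \<Longrightarrow> W \<subseteq> V \<Longrightarrow> rational_on W f"
  unfolding rational_on_def by (blast intro: nrat_subset)

lemma rational_on_compose:
  assumes "rational_on W f" "rational_on V (\<lambda>p. fst (g p))" "rational_on V (\<lambda>p. snd (g p))" "\<And>p. p \<in> V \<Longrightarrow> g p \<in> W"
  shows "rational_on V (\<lambda>p. f (g p))"
proof -
  obtain F G1 G2 where "nrat W f F" "nrat V (\<lambda>p. fst (g p)) G1" "nrat V (\<lambda>p. snd (g p)) G2"
    using assms unfolding rational_on_def by blast
  from nrat_compose[OF this] assms(4) show ?thesis unfolding rational_on_def by auto
qed

lemma rational_on_continuous_on: "rational_on V f \<Longrightarrow> continuous_on V f"
  by (auto simp: rational_on_def intro: nrat_continuous_on)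

lemma rational_on_rat_map:
  "(\<exists>G. rat_map V g G) \<longleftrightarrow> rational_on V (\<lambda>p. fst (g p)) \<and> rational_on V (\<lambda>p. snd (g p))"
  unfolding rat_map_def rational_on_def
  by (auto intro: exI[of _ "\<lambda>P. (F P, G P)" for F G])

lemma rational_rat_isoI:
  assumes "open V" "open V'"
    "rational_on V (\<lambda>p. fst (g p))" "rational_on V (\<lambda>p. snd (g p))"
    "rational_on V' (\<lambda>p. fst (h p))" "rational_on V' (\<lambda>p. snd (h p))"
    "\<And>p. p \<in> V \<Longrightarrow> g p \<in> V'" "\<And>p. p \<in> V' \<Longrightarrow> h p \<in> V"
    "\<And>p. p \<in> V \<Longrightarrow> h (g p) = p" "\<And>p. p \<in> V' \<Longrightarrow> g (h p) = p"
  shows "rat_iso V g V' h"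
  unfolding rat_iso_def rational_on_rat_map using assms by blast

lemma rat_isoD:
  assumes "rat_iso V g V' h"
  shows "open V" "open V'"
    "rational_on V (\<lambda>p. fst (g p))" "rational_on V (\<lambda>p. snd (g p))"
    "rational_on V' (\<lambda>p. fst (h p))" "rational_on V' (\<lambda>p. snd (h p))"
    "\<And>p. p \<in> V \<Longrightarrow> g p \<in> V'" "\<And>p. p \<in> V' \<Longrightarrow> h p \<in> V"
    "\<And>p. p \<in> V \<Longrightarrow> h (g p) = p" "\<And>p. p \<in> V' \<Longrightarrow> g (h p) = p"
  using assms unfolding rat_iso_def rational_on_rat_map by blast+

lemma rational_on_open_preimage:
  assumes "open V" "rational_on V (\<lambda>p. fst (g p))" "rational_on V (\<lambda>p. snd (g p))" "open W"
  shows "open {p \<in> V. g p \<in> W}"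
  using assms rational_on_rat_map[of V g] rat_map_open_preimage by blast

lemma rational_on_open_nz: "open V \<Longrightarrow> rational_on V f \<Longrightarrow> open {p \<in> V. f p \<noteq> 0}"
  using continuous_open_preimage[OF rational_on_continuous_on, of V f "- {0}"]
  by (simp add: Int_def vimage_def open_Compl)

text \<open>The blow-down \<open>(X, Y) \<mapsto> (X, X Y)\<close>, translated so that the
  exceptional curve \<open>X = 0\<close> goes to the given centre.\<close>

definition blow_map :: "complex \<times> complex \<Rightarrow> complex \<times> complex \<Rightarrow> complex \<times> complex" where
  "blow_map x q = (fst x + fst q, snd x + fst q * snd q)"

text \<open>A rational isomorphism together with Hadamard decompositions
  \<open>g x = g x\<^sub>0 + (\<alpha>, \<beta>; \<gamma>, \<delta>) (x - x\<^sub>0)\<close> of it and, with primes, of its inverse.\<close>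

definition blow_data where
  "blow_data x0 y0 V g V' h \<alpha> \<beta> \<gamma> \<delta> \<alpha>' \<beta>' \<gamma>' \<delta>' \<longleftrightarrow> rat_iso V g V' h \<and> x0 \<in> V \<and> y0 \<in> V' \<and>
     rational_on V \<alpha> \<and> rational_on V \<beta> \<and> rational_on V \<gamma> \<and> rational_on V \<delta> \<and>
     rational_on V' \<alpha>' \<and> rational_on V' \<beta>' \<and> rational_on V' \<gamma>' \<and> rational_on V' \<delta>' \<and>
     (\<forall>x\<in>V. fst (g x) = fst y0 + (fst x - fst x0) * \<alpha> x + (snd x - snd x0) * \<beta> x) \<and>
     (\<forall>x\<in>V. snd (g x) = snd y0 + (fst x - fst x0) * \<gamma> x + (snd x - snd x0) * \<delta> x) \<and>
     (\<forall>y\<in>V'. fst (h y) = fst x0 + (fst y - fst y0) * \<alpha>' y + (snd y - snd y0) * \<beta>' y) \<and>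
     (\<forall>y\<in>V'. snd (h y) = snd x0 + (fst y - fst y0) * \<gamma>' y + (snd y - snd y0) * \<delta>' (y :: complex \<times> complex))"

lemma blow_data_sym:
  "blow_data x0 y0 V g V' h \<alpha> \<beta> \<gamma> \<delta> \<alpha>' \<beta>' \<gamma>' \<delta>' \<Longrightarrow> blow_data y0 x0 V' h V g \<alpha>' \<beta>' \<gamma>' \<delta>' \<alpha> \<beta> \<gamma> \<delta>"
  unfolding blow_data_def using rat_iso_sym by blast

lemma rational_hadamard:
  assumes "rational_on V f" "p \<in> V"
  shows "\<exists>a b. rational_on V a \<and> rational_on V b \<and> (\<forall>q\<in>V. f q = f p + (fst q - fst p) * a q + (snd q - snd p) * b q)"
proof -
  obtain F where "nrat V f F" using assms by (auto simp: rational_on_def)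
  from nrat_hadamard[OF this assms(2)] show ?thesis unfolding rational_on_def by blast
qed

lemma blow_data_exists:
  assumes "rat_iso V g V' h" "x0 \<in> V"
  shows "\<exists>\<alpha> \<beta> \<gamma> \<delta> \<alpha>' \<beta>' \<gamma>' \<delta>'. blow_data x0 (g x0) V g V' h \<alpha> \<beta> \<gamma> \<delta> \<alpha>' \<beta>' \<gamma>' \<delta>'"
proof -
  note D = rat_isoD[OF assms(1)]
  have y0: "g x0 \<in> V'" "h (g x0) = x0" using D assms by auto
  from rational_hadamard[OF D(3) assms(2)] obtain \<alpha> \<beta> where 1: "rational_on V \<alpha>" "rational_on V \<beta>"
    "\<forall>x\<in>V. fst (g x) = fst (g x0) + (fst x - fst x0) * \<alpha> x + (snd x - snd x0) * \<beta> x" by blast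
  from rational_hadamard[OF D(4) assms(2)] obtain \<gamma> \<delta> where 2: "rational_on V \<gamma>" "rational_on V \<delta>"
    "\<forall>x\<in>V. snd (g x) = snd (g x0) + (fst x - fst x0) * \<gamma> x + (snd x - snd x0) * \<delta> x" by blast
  from rational_hadamard[OF D(5) y0(1)] y0(2) obtain \<alpha>' \<beta>' where 3: "rational_on V' \<alpha>'" "rational_on V' \<beta>'"
    "\<forall>y\<in>V'. fst (h y) = fst x0 + (fst y - fst (g x0)) * \<alpha>' y + (snd y - snd (g x0)) * \<beta>' y" by auto
  from rational_hadamard[OF D(6) y0(1)] y0(2) obtain \<gamma>' \<delta>' where 4: "rational_on V' \<gamma>'" "rational_on V' \<delta>'"
    "\<forall>y\<in>V'. snd (h y) = snd x0 + (fst y - fst (g x0)) * \<gamma>' y + (snd y - snd (g x0)) * \<delta>' y" by auto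
  show ?thesis unfolding blow_data_def
    by (intro exI conjI) (fact assms y0 1 2 3 4)+
qed

lemma isCont_punctured_eq:
  fixes f :: "complex \<Rightarrow> complex"
  assumes "open S" "z \<in> S" "continuous_on S f" "\<And>w. w \<in> S \<Longrightarrow> w \<noteq> z \<Longrightarrow> f w = k"
  shows "f z = k"
proof -
  have "(f \<longlongrightarrow> f z) (at z)"
    using assms(1-3) continuous_on_eq_continuous_at isCont_def by blast
  moreover have "(f \<longlongrightarrow> k) (at z)"
    by (rule tendsto_eventually) (use assms in \<open>auto simp: eventually_at_topological\<close>)
  ultimately show ?thesis using tendsto_unique by (metis at_neq_bot)
qed

text \<open>\<open>\<alpha> + \<beta> Y\<close> is the first component of the matrix applied to the
  direction \<open>(1, Y)\<close>; where it vanishes, the image direction leaves the chart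
  \<open>(x, y / x)\<close>.\<close>

definition blow_dom where
  "blow_dom x0 V \<alpha> \<beta> = {q. blow_map x0 q \<in> V \<and> \<alpha> (blow_map x0 q) + \<beta> (blow_map x0 q) * snd q \<noteq> 0}"

text \<open>The lift of \<open>g\<close> to the blow-ups: along \<open>(X, X Y)\<close> the
  difference \<open>g x - g x0\<close> is \<open>X\<close> times the matrix applied to
  \<open>(1, Y)\<close>, and \<open>X\<close> cancels in the slope.\<close>

definition blow_fun where
  "blow_fun x0 \<alpha> \<beta> \<gamma> \<delta> q = (fst q * (\<alpha> (blow_map x0 q) + \<beta> (blow_map x0 q) * snd q),
     (\<gamma> (blow_map x0 q) + \<delta> (blow_map x0 q) * snd q) / (\<alpha> (blow_map x0 q) + \<beta> (blow_map x0 q) * snd q))"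

context
  fixes x0 y0 V g V' h \<alpha> \<beta> \<gamma> \<delta> \<alpha>' \<beta>' \<gamma>' \<delta>'
  assumes bd: "blow_data x0 y0 V g V' h \<alpha> \<beta> \<gamma> \<delta> \<alpha>' \<beta>' \<gamma>' \<delta>'"
begin

lemma bd_iso: "rat_iso V g V' h" and bd_x0: "x0 \<in> V" and bd_y0: "y0 \<in> V'"
  and bd_rat: "rational_on V \<alpha>" "rational_on V \<beta>" "rational_on V \<gamma>" "rational_on V \<delta>"
    "rational_on V' \<alpha>'" "rational_on V' \<beta>'" "rational_on V' \<gamma>'" "rational_on V' \<delta>'"
  and bd_g: "\<And>x. x \<in> V \<Longrightarrow> g x = (fst y0 + (fst x - fst x0) * \<alpha> x + (snd x - snd x0) * \<beta> x,
      snd y0 + (fst x - fst x0) * \<gamma> x + (snd x - snd x0) * \<delta> x)"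
  and bd_h: "\<And>y. y \<in> V' \<Longrightarrow> h y = (fst x0 + (fst y - fst y0) * \<alpha>' y + (snd y - snd y0) * \<beta>' y,
      snd x0 + (fst y - fst y0) * \<gamma>' y + (snd y - snd y0) * \<delta>' y)"
  using bd by (auto simp: blow_data_def prod_eq_iff)

lemma bd_g0: "g x0 = y0"
  using bd_g[OF bd_x0] by simp

text \<open>The two matrices of the decompositions are inverse to each other along the exceptional curve
  by continuity.\<close>

lemma blow_inverse_matrix:
  assumes "blow_map x0 (X, Y) \<in> V"
  defines "x \<equiv> blow_map x0 (X, Y)"
  shows "\<alpha>' (g x) * (\<alpha> x + \<beta> x * Y) + \<beta>' (g x) * (\<gamma> x + \<delta> x * Y) = 1"
    "\<gamma>' (g x) * (\<alpha> x + \<beta> x * Y) + \<delta>' (g x) * (\<gamma> x + \<delta> x * Y) = Y"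
proof -
  note D = rat_isoD[OF bd_iso]
  let ?e = "\<lambda>X. blow_map x0 (X, Y)"
  let ?S = "{X. ?e X \<in> V}"
  have ce: "continuous_on UNIV ?e" unfolding blow_map_def by (auto intro!: continuous_intros)
  have S: "open ?S" using continuous_open_vimage[OF D(1), of ?e] ce
    by (simp add: vimage_def continuous_on_eq_continuous_at)
  have comp: "continuous_on ?S (\<lambda>X. f (?e X))" if "rational_on V f" for f
    by (rule continuous_on_compose2[OF rational_on_continuous_on[OF that] continuous_on_subset[OF ce]]) auto
  have comp': "continuous_on ?S (\<lambda>X. f (g (?e X)))" if "rational_on V' f" for f
  proof -
    have "rational_on V (\<lambda>x. f (g x))"
      by (rule rational_on_compose[OF that D(3,4)]) (use D in auto)
    from comp[OF this] show ?thesis .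
  qed
  \<comment> \<open>Off the exceptional curve the identities are \<open>h (g x) = x\<close> with a
    factor \<open>X\<close> cancelled.\<close>
  have nz: "\<alpha>' (g (?e X)) * (\<alpha> (?e X) + \<beta> (?e X) * Y) + \<beta>' (g (?e X)) * (\<gamma> (?e X) + \<delta> (?e X) * Y) = 1 \<and>
    \<gamma>' (g (?e X)) * (\<alpha> (?e X) + \<beta> (?e X) * Y) + \<delta>' (g (?e X)) * (\<gamma> (?e X) + \<delta> (?e X) * Y) = Y"
    if "X \<in> ?S" "X \<noteq> 0" for X
  proof -
    let ?x = "?e X" and ?y = "g (?e X)"
    have x: "?x \<in> V" using that by simp
    have y: "?y \<in> V'" "h ?y = ?x" using D x by auto
    have gy: "fst ?y - fst y0 = X * (\<alpha> ?x + \<beta> ?x * Y)" "snd ?y - snd y0 = X * (\<gamma> ?x + \<delta> ?x * Y)"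
      unfolding bd_g[OF x] by (simp_all add: blow_map_def algebra_simps)
    have "fst x0 + X = fst x0 + X * (\<alpha> ?x + \<beta> ?x * Y) * \<alpha>' ?y + X * (\<gamma> ?x + \<delta> ?x * Y) * \<beta>' ?y"
      using bd_h[OF y(1)] y(2) gy by (simp add: blow_map_def)
    then have "X * (\<alpha>' ?y * (\<alpha> ?x + \<beta> ?x * Y) + \<beta>' ?y * (\<gamma> ?x + \<delta> ?x * Y)) = X * 1"
      by (simp add: algebra_simps)
    moreover have "snd x0 + X * Y = snd x0 + X * (\<alpha> ?x + \<beta> ?x * Y) * \<gamma>' ?y + X * (\<gamma> ?x + \<delta> ?x * Y) * \<delta>' ?y"
      using bd_h[OF y(1)] y(2) gy by (simp add: blow_map_def)
    then have "X * (\<gamma>' ?y * (\<alpha> ?x + \<beta> ?x * Y) + \<delta>' ?y * (\<gamma> ?x + \<delta> ?x * Y)) = X * Y"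
      by (simp add: algebra_simps)
    ultimately show ?thesis using that(2) mult_left_cancel[of X] by blast
  qed
  have c: "continuous_on ?S (\<lambda>X. \<alpha>' (g (?e X)) * (\<alpha> (?e X) + \<beta> (?e X) * Y) + \<beta>' (g (?e X)) * (\<gamma> (?e X) + \<delta> (?e X) * Y))"
    "continuous_on ?S (\<lambda>X. \<gamma>' (g (?e X)) * (\<alpha> (?e X) + \<beta> (?e X) * Y) + \<delta>' (g (?e X)) * (\<gamma> (?e X) + \<delta> (?e X) * Y))"
    by (intro continuous_intros comp comp' bd_rat)+
  have S0: "0 \<in> ?S" using bd_x0 by (simp add: blow_map_def)
  have z: "\<alpha>' (g (?e 0)) * (\<alpha> (?e 0) + \<beta> (?e 0) * Y) + \<beta>' (g (?e 0)) * (\<gamma> (?e 0) + \<delta> (?e 0) * Y) = 1"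
    "\<gamma>' (g (?e 0)) * (\<alpha> (?e 0) + \<beta> (?e 0) * Y) + \<delta>' (g (?e 0)) * (\<gamma> (?e 0) + \<delta> (?e 0) * Y) = Y"
    using isCont_punctured_eq[OF S S0 c(1)] isCont_punctured_eq[OF S S0 c(2)] nz by blast+
  show "\<alpha>' (g x) * (\<alpha> x + \<beta> x * Y) + \<beta>' (g x) * (\<gamma> x + \<delta> x * Y) = 1"
    "\<gamma>' (g x) * (\<alpha> x + \<beta> x * Y) + \<delta>' (g x) * (\<gamma> x + \<delta> x * Y) = Y"
    using nz[of X] z assms by (cases "X = 0"; simp)+
qed

text \<open>Over the centre the identities are affine in \<open>Y\<close>, so \<open>Y = 0\<close>
  and \<open>Y = 1\<close> isolate the entries of the matrix product.\<close>

lemma blow_inverse_matrix0: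
  "\<alpha>' y0 * \<alpha> x0 + \<beta>' y0 * \<gamma> x0 = 1" "\<alpha>' y0 * \<beta> x0 + \<beta>' y0 * \<delta> x0 = 0"
  "\<gamma>' y0 * \<alpha> x0 + \<delta>' y0 * \<gamma> x0 = 0" "\<gamma>' y0 * \<beta> x0 + \<delta>' y0 * \<delta> x0 = 1"
proof -
  have *: "\<alpha>' y0 * (\<alpha> x0 + \<beta> x0 * Y) + \<beta>' y0 * (\<gamma> x0 + \<delta> x0 * Y) = 1"
    "\<gamma>' y0 * (\<alpha> x0 + \<beta> x0 * Y) + \<delta>' y0 * (\<gamma> x0 + \<delta> x0 * Y) = Y" for Y
    using blow_inverse_matrix[of 0 Y] bd_x0 bd_g0 by (simp_all add: blow_map_def)
  show "\<alpha>' y0 * \<alpha> x0 + \<beta>' y0 * \<gamma> x0 = 1" "\<alpha>' y0 * \<beta> x0 + \<beta>' y0 * \<delta> x0 = 0"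
    using *(1)[of 0] *(1)[of 1] by algebra+
  show "\<gamma>' y0 * \<alpha> x0 + \<delta>' y0 * \<gamma> x0 = 0" "\<gamma>' y0 * \<beta> x0 + \<delta>' y0 * \<delta> x0 = 1"
    using *(2)[of 0] *(2)[of 1] by algebra+
qed

text \<open>By the first row identity the denominators \<open>\<alpha> + \<beta> Y\<close> and
  \<open>\<alpha>' + \<beta>' Y'\<close> at corresponding points are inverse to each other, so the
  image stays in the domain of the reverse lift; the second row returns the slope
  \<open>Y\<close>.\<close>

lemma blow_fun_map:
  assumes "q \<in> blow_dom x0 V \<alpha> \<beta>"
  shows "blow_map y0 (blow_fun x0 \<alpha> \<beta> \<gamma> \<delta> q) = g (blow_map x0 q)"
    "blow_fun x0 \<alpha> \<beta> \<gamma> \<delta> q \<in> blow_dom y0 V' \<alpha>' \<beta>'"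
    "blow_fun y0 \<alpha>' \<beta>' \<gamma>' \<delta>' (blow_fun x0 \<alpha> \<beta> \<gamma> \<delta> q) = q"
proof -
  obtain X Y where q: "q = (X, Y)" by (cases q)
  let ?x = "blow_map x0 q"
  have x: "?x \<in> V" and nz: "\<alpha> ?x + \<beta> ?x * Y \<noteq> 0" using assms by (auto simp: blow_dom_def q)
  show 1: "blow_map y0 (blow_fun x0 \<alpha> \<beta> \<gamma> \<delta> q) = g ?x"
  proof -
    have "X * n * (m / n) = X * m" if "n \<noteq> 0" for m n using that by simp
    from this[OF nz] show ?thesis
      unfolding bd_g[OF x] by (simp add: q blow_map_def[of y0] blow_fun_def) (simp add: blow_map_def algebra_simps)
  qed
  note I = blow_inverse_matrix[of X Y, folded q, OF x]
  have y: "g ?x \<in> V'" using rat_isoD[OF bd_iso] x by auto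
  let ?n = "\<alpha> ?x + \<beta> ?x * Y" and ?Y = "snd (blow_fun x0 \<alpha> \<beta> \<gamma> \<delta> q)"
  have Y': "?Y * ?n = \<gamma> ?x + \<delta> ?x * Y" using nz by (simp add: blow_fun_def q)
  have "(\<alpha>' (g ?x) + \<beta>' (g ?x) * ?Y) * ?n = \<alpha>' (g ?x) * ?n + \<beta>' (g ?x) * (?Y * ?n)" by (simp add: algebra_simps)
  then have 2: "(\<alpha>' (g ?x) + \<beta>' (g ?x) * ?Y) * ?n = 1" using I(1) unfolding Y' by simp
  then show "blow_fun x0 \<alpha> \<beta> \<gamma> \<delta> q \<in> blow_dom y0 V' \<alpha>' \<beta>'"
    unfolding blow_dom_def using y by (auto simp: 1)
  have "(\<gamma>' (g ?x) + \<delta>' (g ?x) * ?Y) * ?n = \<gamma>' (g ?x) * ?n + \<delta>' (g ?x) * (?Y * ?n)" by (simp add: algebra_simps)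
  then have 3: "(\<gamma>' (g ?x) + \<delta>' (g ?x) * ?Y) * ?n = Y" using I(2) unfolding Y' by simp
  have F: "fst (blow_fun x0 \<alpha> \<beta> \<gamma> \<delta> q) = X * ?n" by (simp add: blow_fun_def q)
  have nz': "\<alpha>' (g ?x) + \<beta>' (g ?x) * ?Y \<noteq> 0" using 2 by auto
  have "(\<gamma>' (g ?x) + \<delta>' (g ?x) * ?Y) / (\<alpha>' (g ?x) + \<beta>' (g ?x) * ?Y) = Y"
    using 2 3 nz nz' by (metis mult.commute mult_1 mult_divide_mult_cancel_left_if div_by_1)
  moreover have "X * ?n * (\<alpha>' (g ?x) + \<beta>' (g ?x) * ?Y) = X"
    using 2 by (metis mult.assoc mult.commute mult.right_neutral)
  ultimately show "blow_fun y0 \<alpha>' \<beta>' \<gamma>' \<delta>' (blow_fun x0 \<alpha> \<beta> \<gamma> \<delta> q) = q"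
    unfolding blow_fun_def[of y0] 1 F by (simp add: q)
qed

lemma blow_rational:
  "open (blow_dom x0 V \<alpha> \<beta>)"
  "rational_on (blow_dom x0 V \<alpha> \<beta>) (\<lambda>q. fst (blow_fun x0 \<alpha> \<beta> \<gamma> \<delta> q))"
  "rational_on (blow_dom x0 V \<alpha> \<beta>) (\<lambda>q. snd (blow_fun x0 \<alpha> \<beta> \<gamma> \<delta> q))"
proof -
  note D = rat_isoD[OF bd_iso]
  let ?U = "{q. blow_map x0 q \<in> V}"
  have bl: "rational_on W (\<lambda>q. fst (blow_map x0 q))" "rational_on W (\<lambda>q. snd (blow_map x0 q))" for W
    unfolding blow_map_def fst_conv snd_conv by (intro rational_on_intros)+
  have U: "open ?U" using rational_on_open_preimage[OF open_UNIV bl D(1)] by simp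
  have c: "rational_on ?U (\<lambda>q. f (blow_map x0 q))" if "rational_on V f" for f
    by (rule rational_on_compose[OF that bl]) simp
  have n: "rational_on ?U (\<lambda>q. \<alpha> (blow_map x0 q) + \<beta> (blow_map x0 q) * snd q)"
    "rational_on ?U (\<lambda>q. \<gamma> (blow_map x0 q) + \<delta> (blow_map x0 q) * snd q)"
    by (intro rational_on_intros c bd_rat)+
  show "open (blow_dom x0 V \<alpha> \<beta>)"
    using rational_on_open_nz[OF U n(1)] by (simp add: blow_dom_def)
  have sub: "blow_dom x0 V \<alpha> \<beta> \<subseteq> ?U" by (auto simp: blow_dom_def)
  show "rational_on (blow_dom x0 V \<alpha> \<beta>) (\<lambda>q. fst (blow_fun x0 \<alpha> \<beta> \<gamma> \<delta> q))"
    "rational_on (blow_dom x0 V \<alpha> \<beta>) (\<lambda>q. snd (blow_fun x0 \<alpha> \<beta> \<gamma> \<delta> q))"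
    unfolding blow_fun_def fst_conv snd_conv
    by (intro rational_on_intros rational_on_subset[OF n(1) sub] rational_on_subset[OF n(2) sub];
        simp add: blow_dom_def)+
qed

end

lemma blow_rat_iso:
  assumes "blow_data x0 y0 V g V' h \<alpha> \<beta> \<gamma> \<delta> \<alpha>' \<beta>' \<gamma>' \<delta>'"
  shows "rat_iso (blow_dom x0 V \<alpha> \<beta>) (blow_fun x0 \<alpha> \<beta> \<gamma> \<delta>) (blow_dom y0 V' \<alpha>' \<beta>') (blow_fun y0 \<alpha>' \<beta>' \<gamma>' \<delta>')"
  using blow_fun_map[OF assms] blow_rational[OF assms]
    blow_fun_map[OF blow_data_sym[OF assms]] blow_rational[OF blow_data_sym[OF assms]]
  by (intro rational_rat_isoI) blast+

section \<open>Directions as points of the projective line\<close>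

definition dirvec :: "complex option \<Rightarrow> complex \<times> complex" where
  "dirvec l = (case l of None \<Rightarrow> (0, 1) | Some s \<Rightarrow> (1, s))"

text \<open>The zero vector has no direction and gets the default \<open>None\<close>; statements
  about linear images therefore exclude it.\<close>

definition direction :: "complex \<times> complex \<Rightarrow> complex option" where
  "direction v = (if fst v = 0 then None else Some (snd v / fst v))"

lemma dirvec_simps [simp]: "dirvec None = (0, 1)" "dirvec (Some s) = (1, s)"
  by (simp_all add: dirvec_def)

lemma direction_dirvec [simp]: "direction (dirvec l) = l"
  by (cases l) (simp_all add: direction_def)

lemma direction_scale: "k \<noteq> 0 \<Longrightarrow> direction (k * a, k * b) = direction (a, b)"
  by (auto simp: direction_def)

lemma dirvec_direction:
  assumes "v \<noteq> 0"
  shows "\<exists>k. k \<noteq> 0 \<and> dirvec (direction v) = (k * fst v, k * snd v)"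
proof (cases "fst v = 0")
  case True
  then show ?thesis using assms by (intro exI[of _ "1 / snd v"]) (auto simp: direction_def prod_eq_iff)
next
  case False
  then show ?thesis by (intro exI[of _ "1 / fst v"]) (auto simp: direction_def)
qed

definition lin2 :: "complex \<Rightarrow> complex \<Rightarrow> complex \<Rightarrow> complex \<Rightarrow> complex \<times> complex \<Rightarrow> complex \<times> complex" where
  "lin2 a b c d v = (a * fst v + b * snd v, c * fst v + d * snd v)"

text \<open>The involution \<open>s \<mapsto> 1 / s\<close> of the projective line, exchanging 0
  with the point at infinity \<open>None\<close>.\<close>

definition swapdir :: "complex option \<Rightarrow> complex option" where
  "swapdir l = direction (prod.swap (dirvec l))"

lemma swapdir_eq: "swapdir None = Some 0" "swapdir (Some 0) = None" "s \<noteq> 0 \<Longrightarrow> swapdir (Some s) = Some (1 / s)"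
  by (simp_all add: swapdir_def direction_def)

lemma swapdir_swapdir [simp]: "swapdir (swapdir l) = l"
  by (cases l; cases "the l = 0") (auto simp: swapdir_eq)

lemma swapdir_eq_None: "swapdir l = None \<longleftrightarrow> l = Some 0"
  by (cases l; cases "the l = 0") (auto simp: swapdir_eq)

lemma direction_swap: "v \<noteq> 0 \<Longrightarrow> direction (prod.swap v) = swapdir (direction v)"
  by (cases v) (auto simp: direction_def swapdir_def zero_prod_def)

text \<open>The normalised representative of a direction is a nonzero multiple of the vector, and
  linear maps respect multiples; this is the action of matrices on the projective line.\<close>

lemma direction_lin_direction:
  assumes "v \<noteq> 0"
  shows "direction (lin2 a b c d (dirvec (direction v))) = direction (lin2 a b c d v)"
proof -
  obtain k where k: "k \<noteq> 0" "dirvec (direction v) = (k * fst v, k * snd v)"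
    using dirvec_direction[OF assms] by blast
  then have "lin2 a b c d (dirvec (direction v)) = (k * fst (lin2 a b c d v), k * snd (lin2 a b c d v))"
    by (simp add: lin2_def algebra_simps)
  then show ?thesis using direction_scale[OF k(1), of "fst (lin2 a b c d v)" "snd (lin2 a b c d v)"] by simp
qed

lemma dirvec_nz [simp]: "dirvec l \<noteq> 0"
  by (cases l) (auto simp: zero_prod_def)

text \<open>The chart with coordinates \<open>(x, y / x)\<close> of the blow-up at \<open>p\<close>, where the direction named \<open>l\<close>
  is \<open>\<mu> l\<close> in the coordinates of \<open>c\<close>.\<close>

definition blow_chart :: "'p bpoint \<Rightarrow> 'p bpoint chart \<Rightarrow> (complex option \<Rightarrow> complex option) \<Rightarrow> 'p bpoint chart" where
  "blow_chart p c \<mu> =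
     ({q \<in> fst c. fst (snd c q) \<noteq> fst (snd c p)} \<union> {Dir p l | l. \<mu> l \<noteq> None},
      \<lambda>q. if q \<in> range (Dir p) then (0, the (\<mu> (bpoint_dir q)))
           else (fst (snd c q) - fst (snd c p), (snd (snd c q) - snd (snd c p)) / (fst (snd c q) - fst (snd c p))))"

definition swap_chart :: "'p chart \<Rightarrow> 'p chart" where
  "swap_chart c = (fst c, \<lambda>q. prod.swap (snd c q))"

lemma swap_chart_simps [simp]: "fst (swap_chart c) = fst c" "snd (swap_chart c) q = prod.swap (snd c q)"
  by (simp_all add: swap_chart_def)

text \<open>Points of blow-ups are syntactic names, so it has to be proved that an exceptional curve
  is really new; only then are the two clauses of \<open>blow_chart\<close> disjoint.\<close>

definition fresh_dirs :: "'p bpoint \<Rightarrow> 'p bpoint chart \<Rightarrow> bool" where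
  "fresh_dirs p c \<longleftrightarrow> (\<forall>l. Dir p l \<notin> fst c)"

lemma fresh_dirs_swap [simp]: "fresh_dirs p (swap_chart c) = fresh_dirs p c"
  by (simp add: fresh_dirs_def)

lemma blow_chart_dom_Dir [simp]: "fresh_dirs p c \<Longrightarrow> Dir p l \<in> fst (blow_chart p c \<mu>) \<longleftrightarrow> \<mu> l \<noteq> None"
  and blow_chart_dom: "q \<notin> range (Dir p) \<Longrightarrow> q \<in> fst (blow_chart p c \<mu>) \<longleftrightarrow> q \<in> fst c \<and> fst (snd c q) \<noteq> fst (snd c p)"
  and blow_chart_Dir [simp]: "snd (blow_chart p c \<mu>) (Dir p l) = (0, the (\<mu> l))"
  and blow_chart_old: "q \<notin> range (Dir p) \<Longrightarrow> snd (blow_chart p c \<mu>) q =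
     (fst (snd c q) - fst (snd c p), (snd (snd c q) - snd (snd c p)) / (fst (snd c q) - fst (snd c p)))"
  by (auto simp: blow_chart_def fresh_dirs_def)

lemma blowup_chart1_eq:
  "fst (blowup_chart1 p c) = fst (blow_chart p c (\<lambda>l. l))"
  "q \<in> fst (blow_chart p c (\<lambda>l. l)) \<Longrightarrow> snd (blowup_chart1 p c) q = snd (blow_chart p c (\<lambda>l. l)) q"
  by (cases c; force simp: blowup_chart1_def blow_chart_def Let_def case_prod_unfold)+

text \<open>The chart \<open>(y, x / y)\<close> is the chart \<open>(x, y / x)\<close> of the
  swapped coordinates, so one analysis serves both. Freshness keeps \<open>Dir p (Some 0)\<close>,
  where \<open>swapdir\<close> gives \<open>None\<close>, out of the domain.\<close>

lemma blowup_chart2_eq: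
  assumes "fresh_dirs p c"
  shows "fst (blowup_chart2 p c) = fst (blow_chart p (swap_chart c) swapdir)"
    "q \<in> fst (blow_chart p (swap_chart c) swapdir) \<Longrightarrow> snd (blowup_chart2 p c) q = snd (blow_chart p (swap_chart c) swapdir) q"
proof -
  show "fst (blowup_chart2 p c) = fst (blow_chart p (swap_chart c) swapdir)"
    by (cases c) (auto simp: blowup_chart2_def blow_chart_def swapdir_eq_None)
  assume q: "q \<in> fst (blow_chart p (swap_chart c) swapdir)"
  show "snd (blowup_chart2 p c) q = snd (blow_chart p (swap_chart c) swapdir) q"
  proof (cases "q \<in> range (Dir p)")
    case True
    then obtain l where l: "q = Dir p l" by blast
    then have "l \<noteq> Some 0" using q assms by (simp add: swapdir_eq_None)
    then show ?thesis
      by (cases c; cases l) (auto simp: l blowup_chart2_def swapdir_eq)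
  next
    case False
    then show ?thesis
      by (cases c) (simp add: blowup_chart2_def blow_chart_old Let_def case_prod_unfold)
  qed
qed

text \<open>Off the exceptional curve this is the lift of \<open>g\<close>; on it the first
  coordinate is 0 and the lift acts on slopes by the matrix at the centre, which is how
  \<open>\<nu>\<close> renames directions.\<close>

lemma blow_chart_iso:
  assumes iso: "chart_iso c d V g V' h" and p: "p \<in> fst c" "p \<in> fst d"
    and bd: "blow_data (snd c p) (snd d p) V g V' h \<alpha> \<beta> \<gamma> \<delta> \<alpha>' \<beta>' \<gamma>' \<delta>'"
    and fr: "fresh_dirs p c" "fresh_dirs p d"
    and \<nu>: "\<And>l. \<nu> l = direction (lin2 (\<alpha> (snd c p)) (\<beta> (snd c p)) (\<gamma> (snd c p)) (\<delta> (snd c p)) (dirvec (\<mu> l)))"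
  shows "chart_iso (blow_chart p c \<mu>) (blow_chart p d \<nu>) (blow_dom (snd c p) V \<alpha> \<beta>) (blow_fun (snd c p) \<alpha> \<beta> \<gamma> \<delta>)
     (blow_dom (snd d p) V' \<alpha>' \<beta>') (blow_fun (snd d p) \<alpha>' \<beta>' \<gamma>' \<delta>')"
proof -
  let ?x = "snd c p" and ?y = "snd d p"
  let ?C = "blow_chart p c \<mu>" and ?D = "blow_chart p d \<nu>"
  note I = blow_inverse_matrix0[OF bd] and I' = blow_inverse_matrix0[OF blow_data_sym[OF bd]]
  have x0: "?x \<in> V" "?y \<in> V'" using bd by (auto simp: blow_data_def)
  \<comment> \<open>One inclusion for generic data, to be used from \<open>c\<close> to
    \<open>d\<close> and then, with the inverse data, from \<open>d\<close> to
    \<open>c\<close>.\<close>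
  have half: "r \<in> fst D \<and> snd D r \<in> blow_dom y V' \<alpha>' \<beta>' \<and> snd D r = blow_fun x \<alpha> \<beta> \<gamma> \<delta> (snd C r)"
    if "chart_iso c d V g V' h" and bd: "blow_data x y V g V' h \<alpha> \<beta> \<gamma> \<delta> \<alpha>' \<beta>' \<gamma>' \<delta>'"
      and [simp]: "x = snd c p" "y = snd d p" "C = blow_chart p c \<mu>" "D = blow_chart p d \<nu>"
      and fr: "fresh_dirs p c" "fresh_dirs p d"
      and dir: "\<And>l Y. \<mu> l = Some Y \<Longrightarrow> \<alpha> x + \<beta> x * Y \<noteq> 0 \<Longrightarrow>
         \<nu> l = Some ((\<gamma> x + \<delta> x * Y) / (\<alpha> x + \<beta> x * Y))"
      and r: "r \<in> fst C" "snd C r \<in> blow_dom x V \<alpha> \<beta>"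
    for c d V g V' h x y and \<alpha> \<beta> \<gamma> \<delta> \<alpha>' \<beta>' \<gamma>' \<delta>' :: "complex \<times> complex \<Rightarrow> complex"
      and C D \<mu> \<nu> and r :: "'a bpoint"
  proof (cases "r \<in> range (Dir p)")
    case True
    then obtain l where l: "r = Dir p l" by blast
    then obtain Y where Y: "\<mu> l = Some Y" using r fr by auto
    have "\<alpha> x + \<beta> x * Y \<noteq> 0" using r(2) Y by (simp add: l blow_dom_def blow_map_def)
    from dir[OF Y this] have "\<nu> l = Some ((\<gamma> x + \<delta> x * Y) / (\<alpha> x + \<beta> x * Y))" .
    then have "r \<in> fst D" "snd D r = blow_fun x \<alpha> \<beta> \<gamma> \<delta> (snd C r)"
      using fr Y by (auto simp: l blow_fun_def blow_map_def)
    then show ?thesis using blow_fun_map(2)[OF bd r(2)] by simp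
  next
    case False
    let ?X = "fst (snd c r) - fst x" and ?Y = "(snd (snd c r) - snd x) / (fst (snd c r) - fst x)"
    have rc: "r \<in> fst c" "?X \<noteq> 0" using r(1) False by (auto simp: blow_chart_dom)
    have sC: "snd C r = (?X, ?Y)" using False by (simp add: blow_chart_old)
    have bm: "blow_map x (snd C r) = snd c r" using rc(2) unfolding sC by (simp add: blow_map_def)
    then have V: "snd c r \<in> V" and nz: "\<alpha> (snd c r) + \<beta> (snd c r) * ?Y \<noteq> 0"
      using r(2) sC by (auto simp: blow_dom_def)
    have rd: "r \<in> fst d" "snd d r = g (snd c r)" using chart_isoD[OF that(1) rc(1) V] by auto
    define Z where "Z = blow_fun x \<alpha> \<beta> \<gamma> \<delta> (snd C r)"
    have "blow_map y Z = snd d r" using blow_fun_map(1)[OF bd r(2)] rd bm by (simp add: Z_def)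
    from this[symmetric] have Zd: "fst (snd d r) - fst y = fst Z" "snd (snd d r) - snd y = fst Z * snd Z"
      by (simp_all add: blow_map_def)
    have "fst Z \<noteq> 0" using rc nz sC bm by (simp add: Z_def blow_fun_def)
    then have "r \<in> fst D" "snd D r = Z" using rd False Zd
      by (auto simp: blow_chart_dom blow_chart_old prod_eq_iff)
    then show ?thesis using blow_fun_map(2)[OF bd r(2)] by (simp add: Z_def)
  qed
  have dir1: "\<nu> l = Some ((\<gamma> ?x + \<delta> ?x * Y) / (\<alpha> ?x + \<beta> ?x * Y))" if "\<mu> l = Some Y" "\<alpha> ?x + \<beta> ?x * Y \<noteq> 0" for l Y
    using that by (simp add: \<nu> direction_def lin2_def)
  have \<mu>: "\<mu> l = direction (lin2 (\<alpha>' ?y) (\<beta>' ?y) (\<gamma>' ?y) (\<delta>' ?y) (dirvec (\<nu> l)))" for l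
  proof -
    let ?v = "lin2 (\<alpha> ?x) (\<beta> ?x) (\<gamma> ?x) (\<delta> ?x) (dirvec (\<mu> l))"
    have inv: "lin2 (\<alpha>' ?y) (\<beta>' ?y) (\<gamma>' ?y) (\<delta>' ?y) ?v = dirvec (\<mu> l)"
    proof -
      have "\<alpha>' ?y * (\<alpha> ?x * a + \<beta> ?x * b) + \<beta>' ?y * (\<gamma> ?x * a + \<delta> ?x * b) =
         (\<alpha>' ?y * \<alpha> ?x + \<beta>' ?y * \<gamma> ?x) * a + (\<alpha>' ?y * \<beta> ?x + \<beta>' ?y * \<delta> ?x) * b"
        "\<gamma>' ?y * (\<alpha> ?x * a + \<beta> ?x * b) + \<delta>' ?y * (\<gamma> ?x * a + \<delta> ?x * b) =
         (\<gamma>' ?y * \<alpha> ?x + \<delta>' ?y * \<gamma> ?x) * a + (\<gamma>' ?y * \<beta> ?x + \<delta>' ?y * \<delta> ?x) * b" for a b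
        by (simp_all add: algebra_simps)
      then show ?thesis by (simp add: lin2_def I)
    qed
    have "?v \<noteq> 0" using inv dirvec_nz[of "\<mu> l"] by (auto simp: lin2_def zero_prod_def)
    then show ?thesis unfolding \<nu> by (simp add: direction_lin_direction inv)
  qed
  have dir2: "\<mu> l = Some ((\<gamma>' ?y + \<delta>' ?y * Y) / (\<alpha>' ?y + \<beta>' ?y * Y))" if "\<nu> l = Some Y" "\<alpha>' ?y + \<beta>' ?y * Y \<noteq> 0" for l Y
    using that by (simp add: \<mu>[of l] direction_def lin2_def)
  have h1: "r \<in> fst ?D \<and> snd ?D r \<in> blow_dom ?y V' \<alpha>' \<beta>' \<and> snd ?D r = blow_fun ?x \<alpha> \<beta> \<gamma> \<delta> (snd ?C r)"
    if "r \<in> fst ?C" "snd ?C r \<in> blow_dom ?x V \<alpha> \<beta>" for r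
    by (rule half[OF iso bd refl refl refl refl fr dir1 that])
  have h2: "r \<in> fst ?C \<and> snd ?C r \<in> blow_dom ?x V \<alpha> \<beta> \<and> snd ?C r = blow_fun ?y \<alpha>' \<beta>' \<gamma>' \<delta>' (snd ?D r)"
    if "r \<in> fst ?D" "snd ?D r \<in> blow_dom ?y V' \<alpha>' \<beta>'" for r
    by (rule half[OF chart_iso_sym[OF iso] blow_data_sym[OF bd] refl refl refl refl fr(2,1) dir2 that])
  show ?thesis
    unfolding chart_iso_def using blow_rat_iso[OF bd] h1 h2 by blast
qed


text \<open>Finiteness of both \<open>\<mu> l\<close> and \<open>\<nu> l\<close> says that the
  direction is visible in both charts, so the denominator of the lift does not vanish at the
  centre.\<close>

lemma blow_chart_rel:
  assumes iso: "chart_iso c d V g V' h" and p: "p \<in> fst c" "p \<in> fst d"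
    and bd: "blow_data (snd c p) (snd d p) V g V' h \<alpha> \<beta> \<gamma> \<delta> \<alpha>' \<beta>' \<gamma>' \<delta>'"
    and fr: "fresh_dirs p c" "fresh_dirs p d"
    and \<nu>: "\<And>l. \<nu> l = direction (lin2 (\<alpha> (snd c p)) (\<beta> (snd c p)) (\<gamma> (snd c p)) (\<delta> (snd c p)) (dirvec (\<mu> l)))"
    and l: "\<mu> l \<noteq> None" "\<nu> l \<noteq> None"
  shows "chart_rel (Dir p l) (blow_chart p c \<mu>) (blow_chart p d \<nu>)"
proof (rule chart_relI[OF blow_chart_iso[OF iso p bd fr \<nu>]])
  show "Dir p l \<in> fst (blow_chart p c \<mu>)" using fr l by simp
  obtain Y where Y: "\<mu> l = Some Y" using l by auto
  have "snd c p \<in> V" using bd by (simp add: blow_data_def)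
  moreover have "\<alpha> (snd c p) + \<beta> (snd c p) * Y \<noteq> 0"
    using l(2) Y by (auto simp: \<nu> direction_def lin2_def split: if_splits)
  ultimately show "snd (blow_chart p c \<mu>) (Dir p l) \<in> blow_dom (snd c p) V \<alpha> \<beta>"
    using Y by (simp add: blow_dom_def blow_map_def)
qed

lemma rat_iso_swap: "rat_iso V g V' h \<Longrightarrow> rat_iso {x. prod.swap x \<in> V} (\<lambda>x. g (prod.swap x)) V' (\<lambda>y. prod.swap (h y))"
proof -
  assume g: "rat_iso V g V' h"
  have "rat_iso UNIV prod.swap UNIV (prod.swap :: complex \<times> complex \<Rightarrow> _)"
    by (rule rational_rat_isoI) (auto intro: rational_on_intros)
  from rat_iso_compose[OF this g] show ?thesis by simp
qed

lemma chart_iso_swap: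
  assumes "chart_iso c d V g V' h"
  shows "chart_iso (swap_chart c) d {x. prod.swap x \<in> V} (\<lambda>x. g (prod.swap x)) V' (\<lambda>y. prod.swap (h y))"
  using assms rat_iso_swap unfolding chart_iso_def by (simp only: swap_chart_simps mem_Collect_eq swap_swap) blast

lemma chart_rel_swap: "q \<in> fst c \<Longrightarrow> chart_rel q (swap_chart c) c"
  using chart_iso_swap[of c c UNIV "\<lambda>p. p" UNIV "\<lambda>p. p"] rat_iso_id[OF open_UNIV]
  by (intro chart_relI) (auto simp: chart_iso_def)

text \<open>Swapping the source coordinates exchanges the columns of the matrix and the rows of its
  inverse.\<close>

lemma blow_data_swap:
  assumes "blow_data x0 y0 V g V' h \<alpha> \<beta> \<gamma> \<delta> \<alpha>' \<beta>' \<gamma>' \<delta>'"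
  shows "blow_data (prod.swap x0) y0 {x. prod.swap x \<in> V} (\<lambda>x. g (prod.swap x)) V' (\<lambda>y. prod.swap (h y))
    (\<lambda>x. \<beta> (prod.swap x)) (\<lambda>x. \<alpha> (prod.swap x)) (\<lambda>x. \<delta> (prod.swap x)) (\<lambda>x. \<gamma> (prod.swap x)) \<gamma>' \<delta>' \<alpha>' \<beta>'"
proof -
  have r: "rational_on {x. prod.swap x \<in> V} (\<lambda>x. f (prod.swap x))" if "rational_on V f" for f
    by (rule rational_on_compose[OF that]) (auto intro: rational_on_intros)
  show ?thesis
    using assms unfolding blow_data_def by (auto intro!: r rat_iso_swap)
qed

text \<open>The blow-up of a chart \<open>c\<close> is compatible with that of any other chart \<open>d\<close> around \<open>p\<close>, provided the
  directions are renamed by the differential \<open>\<mu>\<close> of the coordinate change.\<close>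

lemma blowup_compatible:
  assumes "chart_rel p c d" and fr: "fresh_dirs p c" "fresh_dirs p d"
  shows "\<exists>\<mu>. bij \<mu> \<and>
    (\<forall>l. l \<noteq> None \<longrightarrow> \<mu> l \<noteq> None \<longrightarrow> chart_rel (Dir p l) (blow_chart p c (\<lambda>l. l)) (blow_chart p d \<mu>)) \<and>
    (\<forall>l. l \<noteq> None \<longrightarrow> swapdir (\<mu> l) \<noteq> None \<longrightarrow> chart_rel (Dir p l) (blow_chart p c (\<lambda>l. l)) (blow_chart p (swap_chart d) (\<lambda>l. swapdir (\<mu> l)))) \<and>
    (\<forall>l. swapdir l \<noteq> None \<longrightarrow> \<mu> l \<noteq> None \<longrightarrow> chart_rel (Dir p l) (blow_chart p (swap_chart c) swapdir) (blow_chart p d \<mu>)) \<and>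
    (\<forall>l. swapdir l \<noteq> None \<longrightarrow> swapdir (\<mu> l) \<noteq> None \<longrightarrow> chart_rel (Dir p l) (blow_chart p (swap_chart c) swapdir) (blow_chart p (swap_chart d) (\<lambda>l. swapdir (\<mu> l))))"
proof -
  obtain V g V' h where iso: "chart_iso c d V g V' h" and p: "p \<in> fst c" "p \<in> fst d"
    and pV: "snd c p \<in> V" "snd d p = g (snd c p)"
    using assms(1) by (rule chart_relE)
  have "rat_iso V g V' h" using iso by (simp add: chart_iso_def)
  from blow_data_exists[OF this pV(1)] pV(2) obtain \<alpha> \<beta> \<gamma> \<delta> \<alpha>' \<beta>' \<gamma>' \<delta>' where
    bd: "blow_data (snd c p) (snd d p) V g V' h \<alpha> \<beta> \<gamma> \<delta> \<alpha>' \<beta>' \<gamma>' \<delta>'" by auto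
  let ?J = "lin2 (\<alpha> (snd c p)) (\<beta> (snd c p)) (\<gamma> (snd c p)) (\<delta> (snd c p))"
  let ?J' = "lin2 (\<alpha>' (snd d p)) (\<beta>' (snd d p)) (\<gamma>' (snd d p)) (\<delta>' (snd d p))"
  define \<mu> where "\<mu> l = direction (?J (dirvec l))" for l
  have lin2_lin2: "lin2 a' b' c' d' (lin2 a b c d v) = v"
    if "a' * a + b' * c = 1" "a' * b + b' * d = 0" "c' * a + d' * c = 0" "c' * b + d' * d = 1" for a b c d a' b' c' d' v
  proof -
    have "a' * (a * x + b * y) + b' * (c * x + d * y) = (a' * a + b' * c) * x + (a' * b + b' * d) * y"
      "c' * (a * x + b * y) + d' * (c * x + d * y) = (c' * a + d' * c) * x + (c' * b + d' * d) * y" for x y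
      by (simp_all add: algebra_simps)
    then show ?thesis using that by (simp add: lin2_def)
  qed
  have J'J: "?J' (?J v) = v" and JJ': "?J (?J' v) = v" for v
    using blow_inverse_matrix0[OF bd] blow_inverse_matrix0[OF blow_data_sym[OF bd]] by (auto intro!: lin2_lin2)
  have J0: "?J v \<noteq> 0" "?J' v \<noteq> 0" if "v \<noteq> 0" for v
    using J'J[of v] JJ'[of v] that by (auto simp: lin2_def zero_prod_def)
  have "bij \<mu>"
  proof (rule o_bij)
    show "(\<lambda>l. direction (?J' (dirvec l))) \<circ> \<mu> = id"
      by (rule ext) (simp add: \<mu>_def direction_lin_direction J0 J'J)
    show "\<mu> \<circ> (\<lambda>l. direction (?J' (dirvec l))) = id"
      by (rule ext) (simp add: \<mu>_def direction_lin_direction J0 JJ')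
  qed
  moreover
  have sw: "swapdir l = direction (prod.swap (dirvec l))" for l by (simp add: swapdir_def)
  have swl: "lin2 b a d c (prod.swap v) = lin2 a b c d v" and swl2: "prod.swap (lin2 a b c d v) = lin2 c d a b v" for a b c d v
    by (simp_all add: lin2_def)
  have dsw: "direction (lin2 b a d c (dirvec (swapdir l))) = direction (lin2 a b c d (dirvec l))" for a b c d l
    unfolding sw by (subst direction_lin_direction) (cases l, auto simp: swl zero_prod_def)
  \<comment> \<open>The four combinations of charts arise by swapping the source coordinates, the
    target coordinates (as a source swap of the inverse), both or neither.\<close>
  note bd1 = blow_data_swap[OF bd] and iso1 = chart_iso_swap[OF iso]
  note bd2 = blow_data_sym[OF blow_data_swap[OF blow_data_sym[OF bd]]]
    and iso2 = chart_iso_sym[OF chart_iso_swap[OF chart_iso_sym[OF iso]]]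
  note bd3 = blow_data_sym[OF blow_data_swap[OF blow_data_sym[OF bd1]]]
    and iso3 = chart_iso_sym[OF chart_iso_swap[OF chart_iso_sym[OF iso1]]]
  have "chart_rel (Dir p l) (blow_chart p c (\<lambda>l. l)) (blow_chart p d \<mu>)" if "l \<noteq> None" "\<mu> l \<noteq> None" for l
    by (rule blow_chart_rel[OF iso p bd fr]) (use that in \<open>simp_all add: \<mu>_def\<close>)
  moreover have "chart_rel (Dir p l) (blow_chart p c (\<lambda>l. l)) (blow_chart p (swap_chart d) (\<lambda>l. swapdir (\<mu> l)))"
    if "l \<noteq> None" "swapdir (\<mu> l) \<noteq> None" for l
    by (rule blow_chart_rel[OF iso2 _ _ bd2[folded swap_chart_simps(2)]])
      (use that p fr J0 in \<open>simp_all add: \<mu>_def direction_swap[symmetric] swl2\<close>)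
  moreover have "chart_rel (Dir p l) (blow_chart p (swap_chart c) swapdir) (blow_chart p d \<mu>)"
    if "swapdir l \<noteq> None" "\<mu> l \<noteq> None" for l
    by (rule blow_chart_rel[OF iso1 _ _ bd1[folded swap_chart_simps(2)]])
      (use that p fr in \<open>simp_all add: \<mu>_def dsw\<close>)
  moreover have "chart_rel (Dir p l) (blow_chart p (swap_chart c) swapdir) (blow_chart p (swap_chart d) (\<lambda>l. swapdir (\<mu> l)))"
    if "swapdir l \<noteq> None" "swapdir (\<mu> l) \<noteq> None" for l
    by (rule blow_chart_rel[OF iso3 _ _ bd3[folded swap_chart_simps(2)]])
      (use that p fr J0 in \<open>simp_all add: \<mu>_def direction_swap[symmetric] swl2 dsw\<close>)
  ultimately show ?thesis by blast
qed

text \<open>Away from the exceptional curve the blow-down has a rational inverse, so the new chart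
  is just another coordinate system there.\<close>

lemma blow_chart_rel_old:
  assumes "fresh_dirs p c" "q \<notin> range (Dir p)" "q \<in> fst (blow_chart p c \<mu>)"
  shows "chart_rel q (blow_chart p c \<mu>) (restrict_chart c (- {p}))"
proof (rule chart_relI)
  let ?V = "{x :: complex \<times> complex. fst x \<noteq> 0}" and ?V' = "{x :: complex \<times> complex. fst x \<noteq> fst (snd c p)}"
  let ?h = "\<lambda>x. (fst x - fst (snd c p), (snd x - snd (snd c p)) / (fst x - fst (snd c p)))"
  show "chart_iso (blow_chart p c \<mu>) (restrict_chart c (- {p})) ?V (blow_map (snd c p)) ?V' ?h"
    unfolding chart_iso_def
  proof (intro conjI allI ballI impI)
    show "rat_iso ?V (blow_map (snd c p)) ?V' ?h"
    proof (rule rational_rat_isoI)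
      show "open ?V" "open ?V'"
        using rational_on_open_nz[OF open_UNIV rational_on_intros(2)]
          rational_on_open_nz[OF open_UNIV rational_on_intros(5)[OF rational_on_intros(2,1)], of "fst (snd c p)"] by simp_all
    qed (auto simp: blow_map_def intro!: rational_on_intros)
    fix r
    show "(r \<in> fst (blow_chart p c \<mu>) \<and> snd (blow_chart p c \<mu>) r \<in> ?V) =
        (r \<in> fst (restrict_chart c (- {p})) \<and> snd (restrict_chart c (- {p})) r \<in> ?V')"
      using assms(1) by (cases "r \<in> range (Dir p)") (auto simp: blow_chart_dom blow_chart_old fresh_dirs_def)
  next
    fix r assume "r \<in> fst (blow_chart p c \<mu>)" "snd (blow_chart p c \<mu>) r \<in> ?V"
    then show "snd (restrict_chart c (- {p})) r = blow_map (snd c p) (snd (blow_chart p c \<mu>) r)"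
      by (cases "r \<in> range (Dir p)") (auto simp: blow_chart_dom blow_chart_old blow_map_def prod_eq_iff)
  qed
  show "q \<in> fst (blow_chart p c \<mu>)" by fact
  show "snd (blow_chart p c \<mu>) q \<in> ?V" using assms by (simp add: blow_chart_dom blow_chart_old)
qed

text \<open>The first coordinate vanishes on the exceptional curve and nowhere else, so new points
  cannot collide with old ones. Injectivity is relative to a set \<open>Z\<close> so that the torus
  fixed points can be left out.\<close>

lemma inj_on_blow_chart:
  assumes "inj_on (snd c) (fst c \<inter> Z)" "fresh_dirs p c" "inj \<mu>"
  shows "inj_on (snd (blow_chart p c \<mu>)) (fst (blow_chart p c \<mu>) \<inter> (Z \<union> range (Dir p)))"
proof (rule inj_onI)
  let ?x = "fst (snd c p)"
  fix q r assume q: "q \<in> fst (blow_chart p c \<mu>) \<inter> (Z \<union> range (Dir p))"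
    and r: "r \<in> fst (blow_chart p c \<mu>) \<inter> (Z \<union> range (Dir p))"
    and eq: "snd (blow_chart p c \<mu>) q = snd (blow_chart p c \<mu>) r"
  have old: "fst (snd (blow_chart p c \<mu>) s) \<noteq> 0" if "s \<in> fst (blow_chart p c \<mu>)" "s \<notin> range (Dir p)" for s
    using that by (simp add: blow_chart_dom blow_chart_old)
  consider "q \<in> range (Dir p)" "r \<in> range (Dir p)" | "q \<notin> range (Dir p)" "r \<notin> range (Dir p)"
  proof -
    have "fst (snd (blow_chart p c \<mu>) s) = 0" if "s \<in> range (Dir p)" for s using that by auto
    then show thesis using that old[of q] old[of r] q r eq by (metis IntD1)
  qed
  then show "q = r"
  proof cases
    case 1
    then obtain l m where lm: "q = Dir p l" "r = Dir p m" by blast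
    then have "\<mu> l = \<mu> m" using q r eq assms(2) by auto
    then show ?thesis using assms(3) lm by (auto dest: injD)
  next
    case 2
    then have qr: "q \<in> fst c \<inter> Z" "r \<in> fst c \<inter> Z" "fst (snd c q) \<noteq> ?x" "fst (snd c r) \<noteq> ?x"
      using q r by (auto simp: blow_chart_dom)
    have "fst (snd c q) = fst (snd c r)" "snd (snd c q) = snd (snd c r)"
      using eq qr(3,4) by (auto simp: blow_chart_old[OF 2(1)] blow_chart_old[OF 2(2)])
    then have "snd c q = snd c r" by (simp add: prod_eq_iff)
    then show ?thesis using inj_onD[OF assms(1) _ qr(1,2)] by simp
  qed
qed


section \<open>Iterated blow-ups\<close>

text \<open>The centres whose blow-ups produced a point. A surface containing no ancestor of its own
  points cannot contain \<open>Dir p l\<close> along with \<open>p\<close>, which is how new points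
  are recognised as new.\<close>

primrec ancestors :: "'p bpoint \<Rightarrow> 'p bpoint set" where
  "ancestors (Pt x) = {}"
| "ancestors (Dir p l) = insert p (ancestors p)"

lemma ancestors_trans: "q \<in> ancestors r \<Longrightarrow> ancestors q \<subseteq> ancestors r"
  by (induction r) auto

lemma ancestors_size: "q \<in> ancestors r \<Longrightarrow> size q < size r"
  by (induction r) auto

text \<open>The line \<open>fst x = 0\<close> is attained because every slope is
  \<open>\<mu> l\<close> for some \<open>l\<close>; the remaining points come from \<open>c\<close>
  through the blow-down.\<close>

lemma bij_betw_blow_chart:
  assumes c: "inj_on (snd c) (fst c)" "p \<in> fst c" "snd c p = (0, 0)" and fr: "fresh_dirs p c" and \<mu>: "bij \<mu>"
  shows "bij_betw (snd (blow_chart p c \<mu>)) (fst (blow_chart p c \<mu>)) {x. (fst x, fst x * snd x) \<in> snd c ` fst c}"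
proof (rule bij_betw_imageI)
  have "inj_on (snd (blow_chart p c \<mu>)) (fst (blow_chart p c \<mu>) \<inter> (UNIV \<union> range (Dir p)))"
    by (rule inj_on_blow_chart) (use c(1) fr \<mu> in \<open>auto simp: bij_def\<close>)
  then show "inj_on (snd (blow_chart p c \<mu>)) (fst (blow_chart p c \<mu>))" by simp
  have D: "r \<in> fst (blow_chart p c \<mu>) \<Longrightarrow> (fst (snd (blow_chart p c \<mu>) r), fst (snd (blow_chart p c \<mu>) r) * snd (snd (blow_chart p c \<mu>) r)) \<in> snd c ` fst c" for r
  proof (cases "r \<in> range (Dir p)")
    case True
    then have "(fst (snd (blow_chart p c \<mu>) r), fst (snd (blow_chart p c \<mu>) r) * snd (snd (blow_chart p c \<mu>) r)) = snd c p"
      using c by auto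
    then show ?thesis using c(2) by blast
  next
    case False
    assume r: "r \<in> fst (blow_chart p c \<mu>)"
    then have "(fst (snd (blow_chart p c \<mu>) r), fst (snd (blow_chart p c \<mu>) r) * snd (snd (blow_chart p c \<mu>) r)) = snd c r" "r \<in> fst c"
      using c False by (auto simp: blow_chart_old blow_chart_dom)
    then show ?thesis by blast
  qed
  show "snd (blow_chart p c \<mu>) ` fst (blow_chart p c \<mu>) = {x. (fst x, fst x * snd x) \<in> snd c ` fst c}"
  proof (intro set_eqI iffI)
    fix x assume "x \<in> snd (blow_chart p c \<mu>) ` fst (blow_chart p c \<mu>)"
    then show "x \<in> {x. (fst x, fst x * snd x) \<in> snd c ` fst c}" using D by blast
  next
    fix x assume x: "x \<in> {x. (fst x, fst x * snd x) \<in> snd c ` fst c}"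
    show "x \<in> snd (blow_chart p c \<mu>) ` fst (blow_chart p c \<mu>)"
    proof (cases "fst x = 0")
      case True
      obtain l where "\<mu> l = Some (snd x)" using \<mu> by (metis bij_pointE)
      then have "snd (blow_chart p c \<mu>) (Dir p l) = x" "Dir p l \<in> fst (blow_chart p c \<mu>)"
        using True fr by (simp_all add: prod_eq_iff)
      then show ?thesis by blast
    next
      case False
      obtain r where r: "r \<in> fst c" "snd c r = (fst x, fst x * snd x)" using x by force
      have "r \<notin> range (Dir p)" using r fr by (auto simp: fresh_dirs_def)
      then have "snd (blow_chart p c \<mu>) r = x" "r \<in> fst (blow_chart p c \<mu>)"
        using False r c by (simp_all add: prod_eq_iff blow_chart_old blow_chart_dom)
      then show ?thesis by blast
    qed
  qed
qed

lemma zero_in_closure_punctured_line: "(0, 0) \<in> closure {(s, 0 :: complex) | s :: complex. s \<noteq> 0 \<and> s \<noteq> 1}"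
  unfolding closure_approachable
proof (intro allI impI)
  fix e :: real assume e: "e > 0"
  \<comment> \<open>The half of \<open>e\<close> keeps it within distance \<open>e\<close>; the cap
    1/2 keeps it away from 1, which is excluded because \<open>s = z + 1\<close> with
    \<open>z\<close> nonzero.\<close>
  let ?s = "of_real (min (e / 2) (1 / 2)) :: complex"
  have m: "min (e / 2) (1 / 2) \<noteq> 0" "min (e / 2) (1 / 2) \<noteq> 1" using e by (auto simp: min_def)
  have "?s \<noteq> 0" "?s \<noteq> 1" unfolding of_real_eq_0_iff of_real_eq_1_iff by (fact m)+
  then have "(?s, 0) \<in> {(s, 0 :: complex) | s :: complex. s \<noteq> 0 \<and> s \<noteq> 1}" by blast
  moreover have "dist (?s, 0 :: complex) (0, 0) < e" using e by (simp add: dist_Pair_Pair)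
  ultimately show "\<exists>y\<in>{(s, 0 :: complex) | s :: complex. s \<noteq> 0 \<and> s \<noteq> 1}. dist y (0, 0) < e"
    by (rule bexI[rotated])
qed

lemma inj_on_swap_chart: "inj_on (snd c) A \<Longrightarrow> inj_on (snd (swap_chart c)) A"
  by (rule inj_onI) (metis inj_onD swap_chart_simps(2) swap_swap)

text \<open>The model of a stage of the blow-ups.  \<open>S v\<close> is the chart around the next centre over the special
  point of \<open>v\<close>, with coordinates \<open>(s, t) = (z + 1, w / (z + 1) ^ k v)\<close>, in which the strict transform
  of the divisor of \<open>v\<close> is \<open>t = 0\<close>; \<open>N v j\<close> is the chart with coordinates
  \<open>(u\<^sub>j, v\<^sub>j) = (w / (z + 1) ^ (j - 1), (z + 1) ^ j / w)\<close>.  \<open>J\<close> contains the toric fixed points.\<close>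

definition stage_models :: "'v set \<Rightarrow> 'c \<Rightarrow> ('v \<Rightarrow> nat) \<Rightarrow> ('v \<Rightarrow> 'c) \<Rightarrow> ('v \<Rightarrow> nat \<Rightarrow> 'c) \<Rightarrow> 'c set" where
  "stage_models V T k S N = {T} \<union> S ` V \<union> {N v j | v j. v \<in> V \<and> j \<in> {1..k v}}"

text \<open>The induction invariant, freed of toric geometry: \<open>ze\<close> and
  \<open>we\<close> stand for the functions z and w on the torus, \<open>sp v\<close> for lying over
  the special point of \<open>v\<close>. The atlas of \<open>B\<close> is unknown; compatibility and
  injectivity of its charts are claimed on \<open>Z\<close> only. The image
  \<open>fst x \<noteq> 1\<close> records \<open>z \<noteq> 0\<close> for \<open>s = z + 1\<close>,
  and \<open>fst x * snd x \<noteq> 1\<close> does so for \<open>u v = z + 1\<close>. In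
  \<open>T_S\<close> the torus points with \<open>z = -1\<close> leave \<open>S v\<close> with the
  first blow-up. \<open>E_T\<close> and \<open>E_disjoint\<close> will separate the normal forms of
  mirror points, and \<open>J_D\<close> makes the fixed points vanish with the divisors.\<close>

locale blowup_stage =
  fixes V :: "'v set" and T :: "'p bpoint chart" and ze we :: "'v \<Rightarrow> 'p bpoint \<Rightarrow> complex"
    and sp :: "'v \<Rightarrow> 'p bpoint \<Rightarrow> bool" and J :: "'p bpoint set"
    and k :: "'v \<Rightarrow> nat" and B :: "'p bpoint surface" and D :: "'v \<Rightarrow> 'p bpoint set"
    and S :: "'v \<Rightarrow> 'p bpoint chart" and N :: "'v \<Rightarrow> nat \<Rightarrow> 'p bpoint chart"
  fixes Mod Z
  defines "Mod \<equiv> stage_models V T k S N"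
    and "Z \<equiv> \<Union>(fst ` Mod)"
  assumes torus_nz: "v \<in> V \<Longrightarrow> q \<in> fst T \<Longrightarrow> ze v q \<noteq> 0 \<and> we v q \<noteq> 0"
    and J: "q \<in> J \<Longrightarrow> v \<in> V \<Longrightarrow> \<not> sp v q" "J \<subseteq> range Pt"
    and compat: "q \<in> Z \<Longrightarrow> c \<in> atlas B \<union> Mod \<Longrightarrow> d \<in> atlas B \<union> Mod \<Longrightarrow> q \<in> fst c \<Longrightarrow> q \<in> fst d \<Longrightarrow> chart_rel q c d"
    and inj: "c \<in> atlas B \<Longrightarrow> inj_on (snd c) (fst c \<inter> Z)"
    and ancestor_free: "q \<in> \<Union>(fst ` atlas B) \<Longrightarrow> q' \<in> \<Union>(fst ` atlas B) \<Longrightarrow> q' \<notin> ancestors q"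
    and T_atlas: "T \<in> atlas B"
    and Z_sub: "Z \<subseteq> \<Union>(fst ` atlas B)"
    and S_bij: "v \<in> V \<Longrightarrow> bij_betw (snd (S v)) (fst (S v)) {x. fst x \<noteq> 1}"
    and T_S: "v \<in> V \<Longrightarrow> q \<in> fst T \<Longrightarrow> q \<in> fst (S v) \<longleftrightarrow> k v = 0 \<or> ze v q \<noteq> -1"
      "v \<in> V \<Longrightarrow> q \<in> fst T \<Longrightarrow> q \<in> fst (S v) \<Longrightarrow> snd (S v) q = (ze v q + 1, we v q / (ze v q + 1) ^ k v)"
    and S_T: "v \<in> V \<Longrightarrow> k v = 0 \<Longrightarrow> q \<in> fst (S v) \<Longrightarrow> snd (snd (S v) q) \<noteq> 0 \<Longrightarrow> q \<in> fst T"
    and S_N: "v \<in> V \<Longrightarrow> k v \<ge> 1 \<Longrightarrow> q \<in> fst (S v) \<and> snd (snd (S v) q) \<noteq> 0 \<longleftrightarrow> q \<in> fst (N v (k v)) \<and> snd (snd (N v (k v)) q) \<noteq> 0"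
      "v \<in> V \<Longrightarrow> k v \<ge> 1 \<Longrightarrow> q \<in> fst (S v) \<Longrightarrow> snd (snd (S v) q) \<noteq> 0 \<Longrightarrow>
         snd (N v (k v)) q = (fst (snd (S v) q) * snd (snd (S v) q), 1 / snd (snd (S v) q))"
    and not_sp: "v \<in> V \<Longrightarrow> q \<in> fst (S v) \<Longrightarrow> snd (snd (S v) q) = 0 \<Longrightarrow> fst (snd (S v) q) \<noteq> 0 \<Longrightarrow> \<not> sp v q"
    and N_bij: "v \<in> V \<Longrightarrow> j \<in> {1..k v} \<Longrightarrow> bij_betw (snd (N v j)) (fst (N v j)) {x. fst x * snd x \<noteq> 1}"
    and T_N1: "v \<in> V \<Longrightarrow> k v \<ge> 1 \<Longrightarrow> q \<in> fst T \<longleftrightarrow> q \<in> fst (N v 1) \<and> fst (snd (N v 1) q) \<noteq> 0"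
      "v \<in> V \<Longrightarrow> k v \<ge> 1 \<Longrightarrow> q \<in> fst T \<Longrightarrow> snd (N v 1) q = (we v q, (ze v q + 1) / we v q)"
    and N_Suc: "v \<in> V \<Longrightarrow> 1 \<le> j \<Longrightarrow> j < k v \<Longrightarrow>
        q \<in> fst (N v j) \<and> snd (snd (N v j) q) \<noteq> 0 \<longleftrightarrow> q \<in> fst (N v (Suc j)) \<and> fst (snd (N v (Suc j)) q) \<noteq> 0"
      "v \<in> V \<Longrightarrow> 1 \<le> j \<Longrightarrow> j < k v \<Longrightarrow> q \<in> fst (N v j) \<Longrightarrow> snd (snd (N v j) q) \<noteq> 0 \<Longrightarrow>
        snd (N v (Suc j)) q = (1 / snd (snd (N v j) q), fst (snd (N v j) q) * (snd (snd (N v j) q))\<^sup>2)"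
    and E_T: "v \<in> V \<Longrightarrow> j \<in> {1..k v} \<Longrightarrow> q \<in> fst (N v j) \<Longrightarrow> fst (snd (N v j) q) = 0 \<Longrightarrow> q \<notin> fst T"
    and E_disjoint: "v \<in> V \<Longrightarrow> j \<in> {1..k v} \<Longrightarrow> v' \<in> V \<Longrightarrow> j' \<in> {1..k v'} \<Longrightarrow> q \<in> fst (N v j) \<Longrightarrow> fst (snd (N v j) q) = 0 \<Longrightarrow>
         q \<in> fst (N v' j') \<Longrightarrow> fst (snd (N v' j') q) = 0 \<Longrightarrow> v = v' \<and> j = j'"
    and D_Z: "v \<in> V \<Longrightarrow> D v \<inter> Z = {q \<in> fst (S v). snd (snd (S v) q) = 0}"
    and D_sub: "v \<in> V \<Longrightarrow> D v \<subseteq> Z \<union> J"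
    and atlas_sub: "c \<in> atlas B \<Longrightarrow> fst c \<subseteq> Z \<union> J"
    and J_D: "J \<subseteq> (\<Union>v\<in>V. D v)"
    and D_models: "v \<in> V \<Longrightarrow> q \<in> fst (S v) \<Longrightarrow> snd (snd (S v) q) = 0 \<Longrightarrow>
       q \<notin> fst T \<and> (\<forall>u\<in>V. \<forall>j\<in>{1..k u}. q \<notin> fst (N u j)) \<and> (\<forall>u\<in>V. u \<noteq> v \<longrightarrow> q \<notin> fst (S u))"
begin

lemma model_sub: "m \<in> Mod \<Longrightarrow> fst m \<subseteq> Z"
  by (auto simp: Z_def)

lemma models: "T \<in> Mod" "v \<in> V \<Longrightarrow> S v \<in> Mod" "v \<in> V \<Longrightarrow> j \<in> {1..k v} \<Longrightarrow> N v j \<in> Mod"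
  unfolding Mod_def stage_models_def by blast+

lemma model_cases:
  assumes "m \<in> Mod"
  obtains "m = T" | v where "v \<in> V" "m = S v" | v j where "v \<in> V" "j \<in> {1..k v}" "m = N v j"
  using assms that unfolding Mod_def stage_models_def by blast

context
  fixes v p c
  assumes v: "v \<in> V" and p: "p \<in> D v" "sp v p" and c: "c \<in> atlas B" "p \<in> fst c"
begin

text \<open>\<open>p\<close> avoids \<open>J\<close>, so it lies on the line \<open>t = 0\<close> of
  \<open>S v\<close>; by \<open>not_sp\<close> no point of that line with nonzero \<open>s\<close>
  is over the special point.\<close>

lemma center: "p \<in> fst (S v)" "snd (S v) p = (0, 0)"
proof -
  have "p \<in> Z" using atlas_sub[OF c(1)] c(2) J(1)[OF _ v] p(2) by blast
  then have "p \<in> fst (S v)" "snd (snd (S v) p) = 0" using D_Z[OF v] p(1) by auto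
  moreover have "fst (snd (S v) p) = 0" using not_sp[OF v] calculation p(2) by blast
  ultimately show "p \<in> fst (S v)" "snd (S v) p = (0, 0)" by (auto simp: prod_eq_iff)
qed

lemma center_Z: "p \<in> Z"
  using center(1) models(2)[OF v] model_sub by blast

lemma center_notin: "p \<notin> fst T" "u \<in> V \<Longrightarrow> j \<in> {1..k u} \<Longrightarrow> p \<notin> fst (N u j)" "u \<in> V \<Longrightarrow> u \<noteq> v \<Longrightarrow> p \<notin> fst (S u)"
proof -
  have "p \<notin> fst T \<and> (\<forall>u\<in>V. \<forall>j\<in>{1..k u}. p \<notin> fst (N u j)) \<and> (\<forall>u\<in>V. u \<noteq> v \<longrightarrow> p \<notin> fst (S u))"
    by (rule D_models[OF v center(1)]) (simp add: center(2))
  then show "p \<notin> fst T" "u \<in> V \<Longrightarrow> j \<in> {1..k u} \<Longrightarrow> p \<notin> fst (N u j)" "u \<in> V \<Longrightarrow> u \<noteq> v \<Longrightarrow> p \<notin> fst (S u)"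
    by blast+
qed

lemma center_notin_J: "p \<notin> J"
  using J(1)[OF _ v] p(2) by blast

text \<open>\<open>p\<close> is an ancestor of \<open>Dir p l\<close> and belongs to the surface, so
  \<open>ancestor_free\<close> keeps \<open>Dir p l\<close> out of it.\<close>

lemma fresh_Z: "Dir p l \<notin> Z" "Dir p l \<notin> \<Union>(fst ` atlas B)" "Dir p l \<notin> J"
proof -
  show 1: "Dir p l \<notin> \<Union>(fst ` atlas B)"
  proof
    assume "Dir p l \<in> \<Union>(fst ` atlas B)"
    from ancestor_free[OF this subsetD[OF Z_sub center_Z]] show False by simp
  qed
  show "Dir p l \<notin> Z" using 1 Z_sub by blast
  show "Dir p l \<notin> J" using J(2) by blast
qed

lemma fresh_chart: "m \<in> atlas B \<union> Mod \<Longrightarrow> fresh_dirs p m"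
  unfolding fresh_dirs_def using fresh_Z(1,2) model_sub[of m] by blast

lemma center_rel: "chart_rel p c (S v)"
  by (rule compat[OF center_Z _ _ c(2) center(1)]) (simp_all add: c(1) models(2)[OF v])

context
  fixes \<mu>
  assumes \<mu>: "bij \<mu>"
    "\<And>l. l \<noteq> None \<Longrightarrow> \<mu> l \<noteq> None \<Longrightarrow> chart_rel (Dir p l) (blow_chart p c (\<lambda>l. l)) (blow_chart p (S v) \<mu>)"
    "\<And>l. l \<noteq> None \<Longrightarrow> swapdir (\<mu> l) \<noteq> None \<Longrightarrow>
       chart_rel (Dir p l) (blow_chart p c (\<lambda>l. l)) (blow_chart p (swap_chart (S v)) (\<lambda>l. swapdir (\<mu> l)))"
    "\<And>l. swapdir l \<noteq> None \<Longrightarrow> \<mu> l \<noteq> None \<Longrightarrow> chart_rel (Dir p l) (blow_chart p (swap_chart c) swapdir) (blow_chart p (S v) \<mu>)"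
    "\<And>l. swapdir l \<noteq> None \<Longrightarrow> swapdir (\<mu> l) \<noteq> None \<Longrightarrow>
       chart_rel (Dir p l) (blow_chart p (swap_chart c) swapdir) (blow_chart p (swap_chart (S v)) (\<lambda>l. swapdir (\<mu> l)))"
begin

section \<open>The model after one further blow-up\<close>

definition "S1 = blow_chart p (S v) \<mu>"
definition "N1 = blow_chart p (swap_chart (S v)) (\<lambda>l. swapdir (\<mu> l))"
definition "S' = S(v := S1)"
definition "N' = N(v := (N v)(Suc (k v) := N1))"
definition "k' = k(v := Suc (k v))"
definition "B' = blowup B p c"
definition "D' u = strict_transform B p c (D u)"
definition "Mod' = stage_models V T k' S' N'"
definition "Z' = \<Union>(fst ` Mod')"

lemma S'_simps [simp]: "S' v = S1" "u \<noteq> v \<Longrightarrow> S' u = S u"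
  and N'_simps [simp]: "N' v (Suc (k v)) = N1" "u \<noteq> v \<Longrightarrow> N' u = N u" "j \<le> k v \<Longrightarrow> N' v j = N v j"
  and k'_simps [simp]: "k' v = Suc (k v)" "u \<noteq> v \<Longrightarrow> k' u = k u"
  by (auto simp: S'_def N'_def k'_def)

lemma N'_old: "u \<in> V \<Longrightarrow> j \<in> {1..k u} \<Longrightarrow> N' u j = N u j \<and> j \<in> {1..k' u}"
  by (cases "u = v") auto

lemma N'_cases:
  assumes "u \<in> V" "j \<in> {1..k' u}"
  obtains "j \<in> {1..k u}" "N' u j = N u j" | "u = v" "j = Suc (k v)" "N' u j = N1"
  using assms by (cases "u = v"; cases "j = Suc (k v)") auto

lemma fresh_S: "fresh_dirs p (S v)" "fresh_dirs p c"
  using fresh_chart models(2)[OF v] c by auto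

lemma S1_Dir: "Dir p l \<in> fst S1 \<longleftrightarrow> \<mu> l \<noteq> None" "snd S1 (Dir p l) = (0, the (\<mu> l))"
  and N1_Dir: "Dir p l \<in> fst N1 \<longleftrightarrow> \<mu> l \<noteq> Some 0" "snd N1 (Dir p l) = (0, the (swapdir (\<mu> l)))"
  using fresh_S by (simp_all add: S1_def N1_def swapdir_eq_None)

lemma S1_old: "q \<notin> range (Dir p) \<Longrightarrow> q \<in> fst S1 \<longleftrightarrow> q \<in> fst (S v) \<and> fst (snd (S v) q) \<noteq> 0"
    "q \<notin> range (Dir p) \<Longrightarrow> snd S1 q = (fst (snd (S v) q), snd (snd (S v) q) / fst (snd (S v) q))"
  and N1_old: "q \<notin> range (Dir p) \<Longrightarrow> q \<in> fst N1 \<longleftrightarrow> q \<in> fst (S v) \<and> snd (snd (S v) q) \<noteq> 0"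
    "q \<notin> range (Dir p) \<Longrightarrow> snd N1 q = (snd (snd (S v) q), fst (snd (S v) q) / snd (snd (S v) q))"
  using center(2) by (simp_all add: S1_def N1_def blow_chart_dom blow_chart_old)

lemma S_center: "q \<in> fst (S v) \<Longrightarrow> snd (S v) q = (0, 0) \<Longrightarrow> q = p"
  using inj_onD[OF bij_betw_imp_inj_on[OF S_bij[OF v]] _ _ center(1)] center(2) by simp

lemma S1_N1_dom: "fst S1 \<union> fst N1 = fst (S v) - {p} \<union> range (Dir p)"
proof (intro set_eqI)
  fix q
  show "q \<in> fst S1 \<union> fst N1 \<longleftrightarrow> q \<in> fst (S v) - {p} \<union> range (Dir p)"
  proof (cases "q \<in> range (Dir p)")
    case True
    then show ?thesis by (auto simp: S1_Dir N1_Dir)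
  next
    case False
    then show ?thesis using S_center[of q] center(2) by (auto simp: S1_old N1_old prod_eq_iff)
  qed
qed

text \<open>Every model chart except \<open>S v\<close> misses the centre and survives unchanged;
  \<open>S v\<close> gives way to its two blown-up charts.\<close>

lemma Mod'_cases:
  assumes "m \<in> Mod'"
  obtains "m \<in> Mod" "p \<notin> fst m" | "m = S1" | "m = N1"
proof -
  consider "m = T" | u where "u \<in> V" "m = S' u" | u j where "u \<in> V" "j \<in> {1..k' u}" "m = N' u j"
    using assms unfolding Mod'_def stage_models_def by blast
  then show thesis
  proof cases
    case 1
    then show ?thesis using that(1) models center_notin by simp
  next
    case (2 u)
    then show ?thesis using that models center_notin by (cases "u = v") auto
  next
    case (3 u j)
    show ?thesis
    proof (cases rule: N'_cases[OF 3(1,2)])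
      case 1
      then show ?thesis using that(1) models(3)[OF 3(1)] center_notin(2)[OF 3(1)] 3(3) by simp
    next
      case 2
      then show ?thesis using that(3) 3(3) by simp
    qed
  qed
qed

lemma models': "T \<in> Mod'" "u \<in> V \<Longrightarrow> S' u \<in> Mod'" "u \<in> V \<Longrightarrow> j \<in> {1..k' u} \<Longrightarrow> N' u j \<in> Mod'" "S1 \<in> Mod'" "N1 \<in> Mod'"
proof -
  show 1: "T \<in> Mod'" "u \<in> V \<Longrightarrow> S' u \<in> Mod'" "u \<in> V \<Longrightarrow> j \<in> {1..k' u} \<Longrightarrow> N' u j \<in> Mod'" for u j
    by (auto simp: Mod'_def stage_models_def)
  show "S1 \<in> Mod'" "N1 \<in> Mod'" using 1(2)[OF v] 1(3)[OF v, of "Suc (k v)"] by simp_all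
qed

lemma Z'_eq: "Z' = Z - {p} \<union> range (Dir p)"
proof
  show "Z' \<subseteq> Z - {p} \<union> range (Dir p)"
  proof
    fix q assume "q \<in> Z'"
    then obtain m where m: "m \<in> Mod'" "q \<in> fst m" by (auto simp: Z'_def)
    from m(1) show "q \<in> Z - {p} \<union> range (Dir p)"
      by (cases rule: Mod'_cases) (use m(2) S1_N1_dom model_sub models(2)[OF v] in blast)+
  qed
  show "Z - {p} \<union> range (Dir p) \<subseteq> Z'"
  proof
    fix q assume q: "q \<in> Z - {p} \<union> range (Dir p)"
    show "q \<in> Z'"
    proof (cases "q \<in> fst (S v) - {p} \<union> range (Dir p)")
      case True
      then show ?thesis using S1_N1_dom models'(4,5) unfolding Z'_def by blast
    next
      case False
      then obtain m where m: "m \<in> Mod" "q \<in> fst m" using q by (auto simp: Z_def)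
      from m(1) show ?thesis
      proof (cases rule: model_cases)
        case 1
        then show ?thesis using m models'(1) by (auto simp: Z'_def)
      next
        case (2 u)
        then show ?thesis using m False q models'(2)[of u] by (cases "u = v") (auto simp: Z'_def)
      next
        case (3 u j)
        then show ?thesis using m models'(3)[of u j] N'_old[of u j] by (auto simp: Z'_def)
      qed
    qed
  qed
qed

lemma atlas_B': "atlas B' = (\<lambda>d. restrict_chart d (- {p})) ` atlas B \<union> {blowup_chart1 p c, blowup_chart2 p c}"
  by (force simp: B'_def blowup_def restrict_chart_def Diff_eq)

abbreviation "C1 \<equiv> blow_chart p c (\<lambda>l. l)"
abbreviation "C2 \<equiv> blow_chart p (swap_chart c) swapdir"

lemma c1: "fst (blowup_chart1 p c) = fst C1" "q \<in> fst C1 \<Longrightarrow> snd (blowup_chart1 p c) q = snd C1 q"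
  and c2: "fst (blowup_chart2 p c) = fst C2" "q \<in> fst C2 \<Longrightarrow> snd (blowup_chart2 p c) q = snd C2 q"
  using blowup_chart1_eq blowup_chart2_eq[OF fresh_S(2)] by blast+

text \<open>Near an old point a blown-up chart amounts to its original with the centre removed,
  possibly with swapped coordinates. This reduces compatibility off the exceptional curve to the
  previous stage.\<close>

lemma rel_old:
  assumes q: "q \<notin> range (Dir p)" and x: "x \<in> atlas B' \<union> Mod'" "q \<in> fst x"
  shows "\<exists>x0\<in>atlas B \<union> Mod. q \<in> fst x0 \<and> q \<noteq> p \<and> chart_rel q x (restrict_chart x0 (- {p}))"
proof -
  have bl: "\<exists>x0\<in>atlas B \<union> Mod. q \<in> fst x0 \<and> q \<noteq> p \<and> chart_rel q x (restrict_chart x0 (- {p}))"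
    if "d \<in> atlas B \<union> Mod" "d' = d \<or> d' = swap_chart d" "q \<in> fst (blow_chart p d' \<nu>)" "chart_rel q x (blow_chart p d' \<nu>)" for d d' \<nu>
  proof (intro bexI conjI)
    have fr: "fresh_dirs p d'" using fresh_chart[OF that(1)] that(2) by auto
    have qd: "q \<in> fst d'" "q \<noteq> p" using that(3) q by (auto simp: blow_chart_dom)
    then show "q \<in> fst d" "q \<noteq> p" using that(2) by auto
    then have "chart_rel q (restrict_chart d' (- {p})) (restrict_chart d (- {p}))"
      using that(2) by (intro chart_rel_restrict) (auto intro: chart_rel_refl chart_rel_swap)
    then show "chart_rel q x (restrict_chart d (- {p}))"
      using chart_rel_trans[OF that(4) chart_rel_trans[OF blow_chart_rel_old[OF fr q that(3)]]] by blast
  qed (fact that)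
  consider (a) d where "d \<in> atlas B" "x = restrict_chart d (- {p})" | (b) "x = blowup_chart1 p c" | (c) "x = blowup_chart2 p c"
    | (d) "x \<in> Mod" "p \<notin> fst x" | (e) "x = S1" | (f) "x = N1"
    using x(1) Mod'_cases[of x] unfolding atlas_B' by blast
  then show ?thesis
  proof cases
    case a
    then show ?thesis using x(2) chart_rel_refl[of q x] by auto
  next
    case b
    then show ?thesis using x(2) c1 c by (intro bl[of c c "\<lambda>l. l"] chart_rel_cong) auto
  next
    case c
    then show ?thesis using x(2) c2 \<open>c \<in> atlas B\<close> by (intro bl[of c "swap_chart c" swapdir] chart_rel_cong) auto
  next
    case d
    then show ?thesis using x(2) restrict_chart_id[of x "- {p}"] chart_rel_refl[of q x] by (intro bexI[of _ x]) auto
  next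
    case e
    then show ?thesis using x(2) models(2)[OF v] chart_rel_refl[of q x]
      by (intro bl[of "S v" "S v" \<mu>]) (auto simp: S1_def)
  next
    case f
    then show ?thesis using x(2) models(2)[OF v] chart_rel_refl[of q x]
      by (intro bl[of "S v" "swap_chart (S v)" "\<lambda>l. swapdir (\<mu> l)"]) (auto simp: N1_def)
  qed
qed

lemma rel_new:
  assumes a: "a \<in> {blowup_chart1 p c, blowup_chart2 p c}" and b: "b \<in> {S1, N1}"
    and q: "Dir p l \<in> fst a" "Dir p l \<in> fst b"
  shows "chart_rel (Dir p l) a b"
proof -
  have "chart_rel (Dir p l) a (if a = blowup_chart1 p c then C1 else C2)"
    using a q c1 c2 by (intro chart_rel_cong) auto
  moreover have "chart_rel (Dir p l) (if a = blowup_chart1 p c then C1 else C2) b"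
    using a b q c1(1) c2(1) fresh_S \<mu>(2-5)[of l] by (auto simp: S1_def N1_def)
  ultimately show ?thesis by (rule chart_rel_trans)
qed

lemma cover_new: "\<exists>a\<in>{blowup_chart1 p c, blowup_chart2 p c}. Dir p l \<in> fst a" "\<exists>b\<in>{S1, N1}. Dir p l \<in> fst b"
  using fresh_S c1(1) c2(1) by (cases l; auto simp: S1_Dir N1_Dir swapdir_eq_None)+

lemma compat':
  assumes q: "q \<in> Z'" and x: "x \<in> atlas B' \<union> Mod'" "q \<in> fst x" and y: "y \<in> atlas B' \<union> Mod'" "q \<in> fst y"
  shows "chart_rel q x y"
proof (cases "q \<in> range (Dir p)")
  case False
  obtain x0 where x0: "x0 \<in> atlas B \<union> Mod" "q \<in> fst x0" "q \<noteq> p" "chart_rel q x (restrict_chart x0 (- {p}))"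
    using rel_old[OF False x] by blast
  obtain y0 where y0: "y0 \<in> atlas B \<union> Mod" "q \<in> fst y0" "chart_rel q y (restrict_chart y0 (- {p}))"
    using rel_old[OF False y] by blast
  have "q \<in> Z" using q False Z'_eq by blast
  then have "chart_rel q (restrict_chart x0 (- {p})) (restrict_chart y0 (- {p}))"
    using x0 y0 by (intro chart_rel_restrict compat) auto
  then show ?thesis using x0(4) y0(3) chart_rel_trans chart_rel_sym by metis
next
  case True
  then obtain l where l: "q = Dir p l" by blast
  let ?A = "{blowup_chart1 p c, blowup_chart2 p c}" and ?M = "{S1, N1}"
  have AM: "x \<in> ?A \<union> ?M" if "x \<in> atlas B' \<union> Mod'" "q \<in> fst x" for x
    using that(1)
  proof
    assume "x \<in> atlas B'"
    then consider d where "d \<in> atlas B" "x = restrict_chart d (- {p})" | "x \<in> ?A" unfolding atlas_B' by blast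
    then show ?thesis
    proof cases
      case (1 d)
      then have "q \<in> fst d" using that(2) by simp
      then show ?thesis using 1(1) fresh_Z(2)[of l] l by blast
    qed blast
  next
    assume "x \<in> Mod'"
    then show ?thesis
    proof (cases rule: Mod'_cases)
      case 1
      then show ?thesis using model_sub[OF 1(1)] that(2) fresh_Z(1)[of l] l by blast
    qed blast+
  qed
  obtain a b where ab: "a \<in> ?A" "q \<in> fst a" "b \<in> ?M" "q \<in> fst b" using cover_new[of l] l by blast
  have r: "chart_rel q x y" if "x \<in> ?A" "y \<in> ?M" "q \<in> fst x" "q \<in> fst y" for x y
    using rel_new[OF that(1,2)] that(3,4) unfolding l by blast
  \<comment> \<open>Comparisons are available only between a chart of the atlas and a model, so two
    charts of the same kind are compared through one of the other kind.\<close>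
  have via: "chart_rel q x b" if "x \<in> ?A \<union> ?M" "q \<in> fst x" for x
    using that(1)
  proof
    assume "x \<in> ?M"
    from chart_rel_trans[OF chart_rel_sym[OF r[OF ab(1) this ab(2) that(2)]] r[OF ab(1,3,2,4)]] show ?thesis .
  next
    assume "x \<in> ?A"
    from r[OF this ab(3) that(2) ab(4)] show ?thesis .
  qed
  show ?thesis
    by (rule chart_rel_trans[OF via[OF AM[OF x] x(2)] chart_rel_sym[OF via[OF AM[OF y] y(2)]]])
qed

lemma inj':
  assumes "x \<in> atlas B'"
  shows "inj_on (snd x) (fst x \<inter> Z')"
proof -
  have sub: "Z' \<subseteq> Z \<union> range (Dir p)" using Z'_eq by blast
  have bl: "inj_on (snd x) (fst x \<inter> Z')"
    if "inj_on (snd d) (fst d \<inter> Z)" "fresh_dirs p d" "inj \<nu>" "fst x = fst (blow_chart p d \<nu>)"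
      "\<And>q. q \<in> fst (blow_chart p d \<nu>) \<Longrightarrow> snd x q = snd (blow_chart p d \<nu>) q" for d \<nu>
  proof -
    have "inj_on (snd (blow_chart p d \<nu>)) (fst x \<inter> Z')"
      using inj_on_subset[OF inj_on_blow_chart[OF that(1-3)]] that(4) sub by blast
    then show ?thesis using that(4,5) by (auto simp: inj_on_def)
  qed
  consider d where "d \<in> atlas B" "x = restrict_chart d (- {p})" | "x = blowup_chart1 p c" | "x = blowup_chart2 p c"
    using assms unfolding atlas_B' by blast
  then show ?thesis
  proof cases
    case (1 d)
    have "fst x \<inter> Z' \<subseteq> fst d \<inter> Z" using 1 fresh_chart[of d] Z'_eq by (auto simp: fresh_dirs_def)
    then show ?thesis using inj_on_subset[OF inj[OF 1(1)]] 1 by simp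
  next
    case 2
    then show ?thesis using bl[OF inj[OF c(1)] fresh_S(2), of "\<lambda>l. l"] c1 by simp
  next
    case 3
    have "inj swapdir" by (rule injI) (metis swapdir_swapdir)
    moreover have "inj_on (snd (swap_chart c)) (fst (swap_chart c) \<inter> Z)"
      using inj_on_swap_chart[OF inj[OF c(1)]] by simp
    ultimately show ?thesis using bl[of "swap_chart c" swapdir] fresh_S(2) c2 3 by simp
  qed
qed

lemma atlas_dom': "\<Union>(fst ` atlas B') \<subseteq> (\<Union>(fst ` atlas B) - {p}) \<union> range (Dir p)"
proof -
  have "fst C1 \<subseteq> fst c - {p} \<union> range (Dir p)" "fst C2 \<subseteq> fst c - {p} \<union> range (Dir p)"
    by (auto simp: blow_chart_def)
  then show ?thesis unfolding atlas_B' using c c1 c2 by auto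
qed

text \<open>Ancestors of a new point are \<open>p\<close>, now removed, and ancestors of
  \<open>p\<close>, never in the surface; size excludes that one new point is an ancestor of
  another. A new point as ancestor of an old one would make \<open>p\<close> such an ancestor by
  transitivity.\<close>

lemma ancestor_free':
  assumes "q \<in> \<Union>(fst ` atlas B')" "q' \<in> \<Union>(fst ` atlas B')"
  shows "q' \<notin> ancestors q"
proof
  assume a: "q' \<in> ancestors q"
  let ?U = "\<Union>(fst ` atlas B)"
  have pU: "p \<in> ?U" using c by blast
  have q: "q \<in> ?U - {p} \<or> q \<in> range (Dir p)" and q': "q' \<in> ?U - {p} \<or> q' \<in> range (Dir p)"
    using assms atlas_dom' by blast+
  show False
  proof (cases "q \<in> range (Dir p)")
    case True
    then have q'': "q' = p \<or> q' \<in> ancestors p" using a by auto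
    show False
      using q'
    proof
      assume "q' \<in> ?U - {p}"
      then show False using q'' ancestor_free[OF pU, of q'] by blast
    next
      assume "q' \<in> range (Dir p)"
      then show False using q'' ancestors_size[of q' p] by auto
    qed
  next
    case False
    then have qU: "q \<in> ?U" using q by blast
    show False
      using q'
    proof
      assume "q' \<in> range (Dir p)"
      then have "p \<in> ancestors q" using ancestors_trans[OF a] by auto
      then show False using ancestor_free[OF qU pU] by blast
    qed (use a ancestor_free[OF qU] in blast)
  qed
qed

lemma Z'_sub: "Z' \<subseteq> \<Union>(fst ` atlas B')"
proof
  fix q assume "q \<in> Z'"
  then consider "q \<in> Z" "q \<noteq> p" | l where "q = Dir p l" using Z'_eq by blast
  then show "q \<in> \<Union>(fst ` atlas B')"
  proof cases
    case 1
    then obtain d where "d \<in> atlas B" "q \<in> fst d" using Z_sub by blast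
    then show ?thesis using 1(2) unfolding atlas_B' by (intro UN_I[of "restrict_chart d (- {p})"]) auto
  next
    case (2 l)
    then show ?thesis using cover_new(1)[of l] unfolding atlas_B' by blast
  qed
qed

text \<open>The condition \<open>fst x \<noteq> 1\<close> is unaffected by the substitution
  \<open>(x, x y)\<close>; for the swapped chart the condition \<open>snd x \<noteq> 1\<close>
  becomes \<open>fst x * snd x \<noteq> 1\<close>.\<close>

lemma S1_bij: "bij_betw (snd S1) (fst S1) {x. fst x \<noteq> 1}"
  and N1_bij: "bij_betw (snd N1) (fst N1) {x. fst x * snd x \<noteq> 1}"
proof -
  have im: "snd (S v) ` fst (S v) = {x. fst x \<noteq> 1}" and i: "inj_on (snd (S v)) (fst (S v))"
    using S_bij[OF v] by (auto simp: bij_betw_def)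
  show "bij_betw (snd S1) (fst S1) {x. fst x \<noteq> 1}"
    using bij_betw_blow_chart[OF i center fresh_S(1) \<mu>(1)] unfolding im S1_def by simp
  have im': "snd (swap_chart (S v)) ` fst (swap_chart (S v)) = {x. snd x \<noteq> 1}"
  proof -
    have "snd (swap_chart (S v)) ` fst (swap_chart (S v)) = prod.swap ` snd (S v) ` fst (S v)"
      by (simp add: image_image)
    also have "\<dots> = {x. snd x \<noteq> 1}" unfolding im by (auto simp: image_iff)
    finally show ?thesis .
  qed
  have i': "inj_on (snd (swap_chart (S v))) (fst (swap_chart (S v)))"
    using inj_on_swap_chart[OF i] by simp
  have "bij (\<lambda>l. swapdir (\<mu> l))"
    using bij_comp[OF \<mu>(1), of swapdir] o_bij[of swapdir swapdir] by (simp add: comp_def id_def)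
  from bij_betw_blow_chart[OF i' _ _ _ this, of p] show "bij_betw (snd N1) (fst N1) {x. fst x * snd x \<noteq> 1}"
    unfolding im' N1_def using center fresh_S(1) by simp
qed

text \<open>On the exceptional curve \<open>t / s = 0\<close> singles out the tangent direction of
  the old divisor, the one whose name \<open>l\<close> satisfies
  \<open>\<mu> l = Some 0\<close>.\<close>

lemma S1_zero_iff: "q \<in> fst S1 \<and> snd (snd S1 q) = 0 \<longleftrightarrow>
    q \<in> fst (S v) \<and> q \<noteq> p \<and> snd (snd (S v) q) = 0 \<or> (\<exists>l. q = Dir p l \<and> \<mu> l = Some 0)"
proof (cases "q \<in> range (Dir p)")
  case True
  then obtain l where "q = Dir p l" by blast
  moreover have "Dir p l \<notin> fst (S v)" using fresh_S by (simp add: fresh_dirs_def)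
  ultimately show ?thesis by (cases "\<mu> l") (auto simp: S1_Dir)
next
  case False
  then show ?thesis using S_center[of q] center(2) by (auto simp: S1_old prod_eq_iff)
qed

lemma N'_notin:
  assumes "\<And>u j. u \<in> V \<Longrightarrow> j \<in> {1..k u} \<Longrightarrow> q \<notin> fst (N u j)" "q \<notin> fst N1" "w \<in> V" "j \<in> {1..k' w}"
  shows "q \<notin> fst (N' w j)"
proof (cases rule: N'_cases[OF assms(3,4)])
  case 1
  then show ?thesis using assms(1)[OF assms(3) 1(1)] by simp
qed (use assms(2) in simp)

lemma D_models':
  assumes u: "u \<in> V" and q: "q \<in> fst (S' u)" "snd (snd (S' u) q) = 0"
  shows "q \<notin> fst T \<and> (\<forall>w\<in>V. \<forall>j\<in>{1..k' w}. q \<notin> fst (N' w j)) \<and> (\<forall>w\<in>V. w \<noteq> u \<longrightarrow> q \<notin> fst (S' w))"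
proof -
  have notDir: "q' \<notin> range (Dir p)" if "m \<in> Mod" "q' \<in> fst m" for m q'
    using that fresh_chart[of m] by (auto simp: fresh_dirs_def)
  consider (old) w where "w \<in> V" "q \<in> fst (S w)" "snd (snd (S w) q) = 0" "w = u" | (new) l where "u = v" "q = Dir p l" "\<mu> l = Some 0"
    using q S1_zero_iff[of q] u by (cases "u = v") auto
  then show ?thesis
  proof cases
    case (old w)
    note O = D_models[OF old(1-3)]
    have nD: "q \<notin> range (Dir p)" using notDir models(2) old(1,2) by blast
    have N1: "q \<notin> fst N1" using nD N1_old(1) O v old by (cases "w = v") auto
    have "q \<notin> fst (N' w j)" if "w \<in> V" "j \<in> {1..k' w}" for w j
      using N'_notin[OF _ N1 that] O by blast
    moreover have "q \<notin> fst (S' x)" if "x \<in> V" "x \<noteq> u" for x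
      using that O old nD S1_old(1) by (cases "x = v") auto
    ultimately show ?thesis using O by blast
  next
    case (new l)
    have "q \<notin> fst m" if "m \<in> Mod" for m using notDir[OF that] new by blast
    moreover have "q \<notin> fst N1" using new by (simp add: N1_Dir)
    ultimately have "q \<notin> fst (N' w j)" if "w \<in> V" "j \<in> {1..k' w}" for w j
      using N'_notin[OF _ _ that] models(3) by blast
    then show ?thesis using \<open>\<And>m. m \<in> Mod \<Longrightarrow> q \<notin> fst m\<close> models new by simp
  qed
qed

lemma S1_nz: "q \<in> fst S1 \<and> snd (snd S1 q) \<noteq> 0 \<longleftrightarrow> q \<in> fst N1 \<and> snd (snd N1 q) \<noteq> 0"
    "q \<in> fst S1 \<Longrightarrow> snd (snd S1 q) \<noteq> 0 \<Longrightarrow> snd N1 q = (fst (snd S1 q) * snd (snd S1 q), 1 / snd (snd S1 q))"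
proof -
  have "(q \<in> fst S1 \<and> snd (snd S1 q) \<noteq> 0 \<longleftrightarrow> q \<in> fst N1 \<and> snd (snd N1 q) \<noteq> 0) \<and>
    (q \<in> fst S1 \<longrightarrow> snd (snd S1 q) \<noteq> 0 \<longrightarrow> snd N1 q = (fst (snd S1 q) * snd (snd S1 q), 1 / snd (snd S1 q)))"
  proof (cases "q \<in> range (Dir p)")
    case True
    then obtain l where l: "q = Dir p l" by blast
    show ?thesis
      by (cases "\<mu> l"; cases "the (\<mu> l) = 0") (auto simp: l S1_Dir N1_Dir swapdir_eq)
  next
    case False
    then show ?thesis by (auto simp: S1_old N1_old)
  qed
  then show "q \<in> fst S1 \<and> snd (snd S1 q) \<noteq> 0 \<longleftrightarrow> q \<in> fst N1 \<and> snd (snd N1 q) \<noteq> 0"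
    "q \<in> fst S1 \<Longrightarrow> snd (snd S1 q) \<noteq> 0 \<Longrightarrow> snd N1 q = (fst (snd S1 q) * snd (snd S1 q), 1 / snd (snd S1 q))" by blast+
qed

text \<open>The strict transform is a closure taken in the unknown atlas;
  \<open>chart_rel_closure\<close> moves the question to model charts. There the divisor is
  \<open>t = 0\<close>, and its only possible new point is the origin of \<open>S1\<close>.\<close>

lemma D_Z':
  assumes u: "u \<in> V"
  shows "D' u \<inter> Z' = {q \<in> fst (S' u). snd (snd (S' u) q) = 0}"
proof
  let ?R = "{q \<in> fst (S' u). snd (snd (S' u) q) = 0}"
  have D': "D' u = surface_closure B' (D u - {p})" by (simp add: D'_def strict_transform_def B'_def)
  have S'_eq: "q \<in> ?R \<longleftrightarrow> q \<in> fst (S u) \<and> q \<noteq> p \<and> snd (snd (S u) q) = 0 \<or> (u = v \<and> (\<exists>l. q = Dir p l \<and> \<mu> l = Some 0))" for q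
    using S1_zero_iff[of q] center_notin(3)[OF u] by (cases "u = v") auto
  have DR: "D u - {p} \<subseteq> ?R \<union> J"
    using D_sub[OF u] D_Z[OF u] S'_eq by blast
  have JZ': "q \<in> ?R" if "q \<in> D u - {p}" "q \<in> Z'" for q
  proof -
    have "q \<notin> range (Dir p)" using that(1) D_sub[OF u] fresh_Z by blast
    then have "q \<in> Z" using that(2) Z'_eq by blast
    then show ?thesis using that(1) D_Z[OF u] S'_eq by blast
  qed
  show "D' u \<inter> Z' \<subseteq> ?R"
  proof
    fix q assume q: "q \<in> D' u \<inter> Z'"
    show "q \<in> ?R"
    proof (rule ccontr)
      assume nR: "q \<notin> ?R"
      then have "q \<notin> D u - {p}" using JZ' q by blast
      then obtain x where x: "x \<in> atlas B'" "q \<in> fst x" "snd x q \<in> closure (snd x ` (fst x \<inter> (D u - {p})))"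
        using q unfolding D' surface_closure_def by auto
      \<comment> \<open>Of the model charts only \<open>S' u\<close> meets \<open>?R\<close>, and a
        point of it with nonzero second coordinate also lies in the last chart \<open>N'\<close> of
        \<open>u\<close> or, before any blow-up over \<open>u\<close>, in the torus.\<close>
      have "\<exists>m\<in>Mod'. q \<in> fst m \<and> fst m \<inter> ?R = {}"
      proof -
        obtain m where m: "m \<in> Mod'" "q \<in> fst m" using q by (auto simp: Z'_def)
        then consider "m = T" | w where "w \<in> V" "w \<noteq> u" "m = S' w" | "m = S' u" | w j where "w \<in> V" "j \<in> {1..k' w}" "m = N' w j"
          by (auto simp: Mod'_def stage_models_def)
        then show ?thesis
        proof cases
          case 1
          then show ?thesis using m D_models'[OF u] by blast
        next
          case (2 w)
          then show ?thesis using m D_models'[OF u] by blast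
        next
          case 4
          then show ?thesis using m D_models'[OF u] by blast
        next
          case 3
          then have nz: "q \<in> fst (S' u)" "snd (snd (S' u) q) \<noteq> 0" using nR m by auto
          show ?thesis
          proof (cases "k' u = 0")
            case True
            then have "u \<noteq> v" by auto
            then have "q \<in> fst T" using S_T[OF u] True nz by simp
            then show ?thesis using models'(1) D_models'[OF u] by blast
          next
            case False
            then have "q \<in> fst (N' u (k' u))"
              using S1_nz(1)[of q] S_N(1)[OF u, of q] nz by (cases "u = v") auto
            then show ?thesis using False models'(3)[OF u, of "k' u"] u D_models'[OF u] by (intro bexI[of _ "N' u (k' u)"]) auto
          qed
        qed
      qed
      then obtain m where m: "m \<in> Mod'" "q \<in> fst m" "fst m \<inter> ?R = {}" by blast
      have "fst m \<inter> (D u - {p}) = {}"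
        using m JZ' unfolding Z'_def by blast
      moreover have "chart_rel q x m"
        by (rule compat'[OF _ _ x(2) _ m(2)]) (use q x(1) m(1) in simp_all)
      ultimately show False using chart_rel_closure[OF _ x(3), of m] by simp
    qed
  qed
  show "?R \<subseteq> D' u \<inter> Z'"
  proof
    fix q assume q: "q \<in> ?R"
    then have qZ': "q \<in> Z'" using models'(2)[OF u] by (auto simp: Z'_def)
    from q consider "q \<in> fst (S u)" "q \<noteq> p" "snd (snd (S u) q) = 0" | l where "u = v" "q = Dir p l" "\<mu> l = Some 0"
      using S'_eq by blast
    then show "q \<in> D' u \<inter> Z'"
    proof cases
      case 1
      then have "q \<in> D u - {p}" using D_Z[OF u] by auto
      then show ?thesis using qZ' unfolding D' surface_closure_def by blast
    next
      case (2 l)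
      obtain a where a: "a \<in> {blowup_chart1 p c, blowup_chart2 p c}" "q \<in> fst a"
        using cover_new(1)[of l] 2(2) by blast
      have aB: "a \<in> atlas B'" using a unfolding atlas_B' by blast
      have qS1: "q \<in> fst S1" "snd S1 q = (0, 0)" using 2 by (simp_all add: S1_Dir)
      \<comment> \<open>The line \<open>t = 0\<close> of \<open>S1\<close>, away from
        \<open>s = 0\<close> and the omitted value \<open>s = 1\<close>, consists of points of the
        old divisor, and it accumulates at the origin.\<close>
      have "{(s, 0) | s. s \<noteq> 0 \<and> s \<noteq> 1} \<subseteq> snd S1 ` (fst S1 \<inter> (D v - {p}))"
      proof
        fix x :: "complex \<times> complex" assume "x \<in> {(s, 0) | s. s \<noteq> 0 \<and> s \<noteq> 1}"
        then have x: "snd x = 0" "fst x \<noteq> 0" "fst x \<noteq> 1" by auto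
        then have "x \<in> snd S1 ` fst S1" using S1_bij by (auto simp: bij_betw_def)
        then obtain r where r: "r \<in> fst S1" "x = snd S1 r" by blast
        have "r \<notin> range (Dir p)" using x r by (auto simp: S1_Dir)
        then have "r \<in> fst (S v) \<and> r \<noteq> p \<and> snd (snd (S v) r) = 0" using r x S1_zero_iff[of r] by auto
        then have "r \<in> D v - {p}" using D_Z[OF v] by auto
        then show "x \<in> snd S1 ` (fst S1 \<inter> (D v - {p}))" using r by blast
      qed
      then have "snd S1 q \<in> closure (snd S1 ` (fst S1 \<inter> (D v - {p})))"
        unfolding qS1(2) using subsetD[OF closure_mono zero_in_closure_punctured_line] by blast
      moreover have "chart_rel q S1 a"
        by (rule compat'[OF qZ' _ qS1(1) _ a(2)]) (simp_all add: aB models'(4))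
      ultimately have "snd a q \<in> closure (snd a ` (fst a \<inter> (D v - {p})))"
        by (rule chart_rel_closure[rotated])
      moreover have "q \<in> points B'" using 2 by (simp add: B'_def blowup_def)
      moreover have "\<exists>(U, \<phi>)\<in>atlas B'. q \<in> U \<and> \<phi> q \<in> closure (\<phi> ` (U \<inter> (D v - {p})))"
        by (rule bexI[OF _ aB]) (use calculation a(2) in \<open>simp add: case_prod_unfold\<close>)
      ultimately show ?thesis
        using qZ' 2(1) unfolding D' surface_closure_def by blast
    qed
  qed
qed

lemma stage_step: "blowup_stage V T ze we sp J k' B' D' S' N'"
proof (unfold_locales, unfold Mod'_def[symmetric] Z'_def[symmetric])
  show "ze u q \<noteq> 0 \<and> we u q \<noteq> 0" if "u \<in> V" "q \<in> fst T" for u q by (rule torus_nz[OF that])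
  show "\<not> sp u q" if "q \<in> J" "u \<in> V" for u q by (rule J(1)[OF that])
  show "J \<subseteq> range Pt" by (rule J(2))
  show "chart_rel q x y" if "q \<in> Z'" "x \<in> atlas B' \<union> Mod'" "y \<in> atlas B' \<union> Mod'" "q \<in> fst x" "q \<in> fst y" for q x y
    using compat' that by blast
  show "inj_on (snd x) (fst x \<inter> Z')" if "x \<in> atlas B'" for x by (rule inj'[OF that])
  show "q' \<notin> ancestors q" if "q \<in> \<Union> (fst ` atlas B')" "q' \<in> \<Union> (fst ` atlas B')" for q q'
    by (rule ancestor_free'[OF that])
  show "T \<in> atlas B'"
    using T_atlas restrict_chart_id[of T "- {p}"] center_notin(1) unfolding atlas_B' by (metis ComplI Un_iff image_eqI singletonD subsetI)
  show "Z' \<subseteq> \<Union> (fst ` atlas B')" by (rule Z'_sub)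
  show "bij_betw (snd (S' u)) (fst (S' u)) {x. fst x \<noteq> 1}" if "u \<in> V" for u
    using S_bij[OF that] S1_bij by (cases "u = v") auto
  have Tn: "q \<notin> range (Dir p)" if "q \<in> fst T" for q
    using that fresh_chart[of T] models(1) by (auto simp: fresh_dirs_def)
  show "(q \<in> fst (S' u)) = (k' u = 0 \<or> ze u q \<noteq> - 1)" if "u \<in> V" "q \<in> fst T" for u q
    using T_S[OF that] S1_old(1)[OF Tn[OF that(2)]] by (cases "u = v") (auto simp: add_eq_0_iff2)
  show "snd (S' u) q = (ze u q + 1, we u q / (ze u q + 1) ^ k' u)" if "u \<in> V" "q \<in> fst T" "q \<in> fst (S' u)" for u q
    using T_S[OF that(1,2)] that S1_old[OF Tn[OF that(2)]] by (cases "u = v") auto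
  show "q \<in> fst T" if "u \<in> V" "k' u = 0" "q \<in> fst (S' u)" "snd (snd (S' u) q) \<noteq> 0" for u q
    using S_T[of u q] that by (cases "u = v") auto
  show "(q \<in> fst (S' u) \<and> snd (snd (S' u) q) \<noteq> 0) = (q \<in> fst (N' u (k' u)) \<and> snd (snd (N' u (k' u)) q) \<noteq> 0)"
    if "u \<in> V" "1 \<le> k' u" for u q
    using S_N(1)[of u q] S1_nz(1)[of q] that by (cases "u = v") auto
  show "snd (N' u (k' u)) q = (fst (snd (S' u) q) * snd (snd (S' u) q), 1 / snd (snd (S' u) q))"
    if "u \<in> V" "1 \<le> k' u" "q \<in> fst (S' u)" "snd (snd (S' u) q) \<noteq> 0" for u q
    using S_N(2)[of u q] S1_nz(2)[of q] that by (cases "u = v") auto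
  show "\<not> sp u q" if "u \<in> V" "q \<in> fst (S' u)" "snd (snd (S' u) q) = 0" "fst (snd (S' u) q) \<noteq> 0" for u q
  proof (cases "u = v")
    case True
    have nD: "q \<notin> range (Dir p)" using that True by (auto simp: S1_Dir)
    then show ?thesis using that True not_sp[OF v, of q] by (auto simp: S1_old)
  qed (use that not_sp[of u q] in auto)
  show "bij_betw (snd (N' u j)) (fst (N' u j)) {x. fst x * snd x \<noteq> 1}" if "u \<in> V" "j \<in> {1..k' u}" for u j
    by (rule N'_cases[OF that]) (use N_bij[OF that(1)] N1_bij in simp_all)
  show "(q \<in> fst T) = (q \<in> fst (N' u 1) \<and> fst (snd (N' u 1) q) \<noteq> 0)" if "u \<in> V" "1 \<le> k' u" for u q
  \<comment> \<open>The first blow-up over \<open>v\<close> is the only case in which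
    \<open>N' u 1\<close> is new; at that stage the second coordinate of \<open>S v\<close> is w
    itself.\<close>
  proof (cases "u = v \<and> k v = 0")
    case True
    have "q \<in> fst T \<longleftrightarrow> q \<in> fst N1 \<and> fst (snd N1 q) \<noteq> 0"
    proof (cases "q \<in> range (Dir p)")
      case True
      then show ?thesis using Tn by (auto simp: N1_Dir)
    next
      case False
      show ?thesis
      proof
        assume q: "q \<in> fst T"
        then have "q \<in> fst (S v)" using T_S(1)[OF v q] True by simp
        moreover have "snd (snd (S v) q) \<noteq> 0"
          using T_S(2)[OF v q calculation] torus_nz[OF v q] True by simp
        ultimately show "q \<in> fst N1 \<and> fst (snd N1 q) \<noteq> 0" by (simp add: N1_old[OF False])
      next
        assume "q \<in> fst N1 \<and> fst (snd N1 q) \<noteq> 0"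
        then have "q \<in> fst (S v)" "snd (snd (S v) q) \<noteq> 0" by (simp_all add: N1_old[OF False])
        then show "q \<in> fst T" using S_T[OF v] True by blast
      qed
    qed
    then show ?thesis using True N'_simps(1) by simp
  next
    case False
    then have "k u \<ge> 1" using that by (cases "u = v") auto
    then show ?thesis using T_N1(1)[OF that(1)] N'_old[OF that(1), of 1] by simp
  qed
  show "snd (N' u 1) q = (we u q, (ze u q + 1) / we u q)" if "u \<in> V" "1 \<le> k' u" "q \<in> fst T" for u q
  proof (cases "u = v \<and> k v = 0")
    case True
    then have "snd N1 q = (we u q, (ze u q + 1) / we u q)"
      using T_S[OF v that(3)] N1_old(2)[OF Tn[OF that(3)]] by simp
    then show ?thesis using True N'_simps(1) by simp
  next
    case False
    then have "k u \<ge> 1" using that by (cases "u = v") auto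
    then show ?thesis using T_N1(2)[OF that(1) _ that(3)] N'_old[OF that(1), of 1] by simp
  qed
  \<comment> \<open>In the coordinates \<open>(s, t)\<close> of \<open>S v\<close> the previous last
    chart is \<open>(s t, 1 / t)\<close> and the new one \<open>(t, s / t)\<close>, which yields the
    recursion \<open>1 / v\<close>, \<open>u v^2\<close>.\<close>
  have N1_N: "(q \<in> fst (N v (k v)) \<and> snd (snd (N v (k v)) q) \<noteq> 0 \<longleftrightarrow> q \<in> fst N1 \<and> fst (snd N1 q) \<noteq> 0) \<and>
      (q \<in> fst (N v (k v)) \<longrightarrow> snd (snd (N v (k v)) q) \<noteq> 0 \<longrightarrow>
        snd N1 q = (1 / snd (snd (N v (k v)) q), fst (snd (N v (k v)) q) * (snd (snd (N v (k v)) q))\<^sup>2))"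
    if "k v \<ge> 1" for q
  proof (cases "q \<in> range (Dir p)")
    case True
    then have "q \<notin> fst (N v (k v))" using fresh_chart[of "N v (k v)"] models(3)[OF v, of "k v"] that
      by (auto simp: fresh_dirs_def)
    then show ?thesis using True by (auto simp: N1_Dir)
  next
    case False
    show ?thesis using S_N[OF v that, of q] by (auto simp: N1_old[OF False] power2_eq_square)
  qed
  show "(q \<in> fst (N' u j) \<and> snd (snd (N' u j) q) \<noteq> 0) = (q \<in> fst (N' u (Suc j)) \<and> fst (snd (N' u (Suc j)) q) \<noteq> 0)"
    if "u \<in> V" "1 \<le> j" "j < k' u" for u j q
  proof (cases "u = v \<and> j = k v")
    case True
    then show ?thesis using N1_N[of q] that by simp
  next
    case False
    then have "j < k u" using that by (cases "u = v") auto
    then show ?thesis using N_Suc(1)[OF that(1,2), of q] N'_old[OF that(1), of j] N'_old[OF that(1), of "Suc j"] that by simp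
  qed
  show "snd (N' u (Suc j)) q = (1 / snd (snd (N' u j) q), fst (snd (N' u j) q) * (snd (snd (N' u j) q))\<^sup>2)"
    if "u \<in> V" "1 \<le> j" "j < k' u" "q \<in> fst (N' u j)" "snd (snd (N' u j) q) \<noteq> 0" for u j q
  proof (cases "u = v \<and> j = k v")
    case True
    then show ?thesis using N1_N[of q] that by simp
  next
    case False
    then have "j < k u" using that by (cases "u = v") auto
    then show ?thesis using N_Suc(2)[OF that(1,2), of q] N'_old[OF that(1), of j] N'_old[OF that(1), of "Suc j"] that by simp
  qed
  \<comment> \<open>The curve \<open>u = 0\<close> of the new chart lies in the exceptional curve
    just created, hence is disjoint from every earlier chart.\<close>
  have N1_zero: "q \<in> range (Dir p)" if "q \<in> fst N1" "fst (snd N1 q) = 0" for q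
    using that N1_old[of q] by (cases "q \<in> range (Dir p)") auto
  have N_notDir: "q \<notin> range (Dir p)" if "u \<in> V" "j \<in> {1..k u}" "q \<in> fst (N u j)" for u j q
    using that fresh_chart[of "N u j"] models(3)[of u j] by (auto simp: fresh_dirs_def)
  show "q \<notin> fst T" if "u \<in> V" "j \<in> {1..k' u}" "q \<in> fst (N' u j)" "fst (snd (N' u j) q) = 0" for u j q
    using that(1,2)
  proof (cases rule: N'_cases)
    case 1
    then show ?thesis using E_T[of u j q] that by simp
  next
    case 2
    then show ?thesis using N1_zero[of q] Tn[of q] that by auto
  qed
  show "u = u' \<and> j = j'" if u: "u \<in> V" "j \<in> {1..k' u}" and u': "u' \<in> V" "j' \<in> {1..k' u'}"
    and q: "q \<in> fst (N' u j)" "fst (snd (N' u j) q) = 0" "q \<in> fst (N' u' j')" "fst (snd (N' u' j') q) = 0" for u j u' j' q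
    using u
  proof (cases rule: N'_cases)
    case 1
    note a = 1
    from u' show ?thesis
    proof (cases rule: N'_cases)
      case 1
      then show ?thesis using E_disjoint[of u j u' j' q] a u u' q by simp
    next
      case 2
      then show ?thesis using N1_zero[of q] N_notDir[of u j q] a u q by simp
    qed
  next
    case 2
    note a = 2
    from u' show ?thesis
    proof (cases rule: N'_cases)
      case 1
      then show ?thesis using N1_zero[of q] N_notDir[of u' j' q] a u' q by simp
    next
      case 2
      then show ?thesis using a by simp
    qed
  qed
  show "D' u \<inter> Z' = {q \<in> fst (S' u). snd (snd (S' u) q) = 0}" if "u \<in> V" for u by (rule D_Z'[OF that])
  have dom: "\<Union>(fst ` atlas B') \<subseteq> Z' \<union> J"
    using atlas_dom' atlas_sub Z'_eq center_notin_J by blast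
  then show "fst x \<subseteq> Z' \<union> J" if "x \<in> atlas B'" for x using that by blast
  show "D' u \<subseteq> Z' \<union> J" if "u \<in> V" for u
  proof
    fix q assume "q \<in> D' u"
    then have "q \<in> D u - {p} \<or> q \<in> \<Union>(fst ` atlas B')"
      unfolding D'_def strict_transform_def surface_closure_def B'_def by force
    then show "q \<in> Z' \<union> J" using D_sub[OF that] Z'_eq dom by blast
  qed
  show "J \<subseteq> (\<Union>u\<in>V. D' u)"
  proof
    fix q assume "q \<in> J"
    then obtain u where "u \<in> V" "q \<in> D u" "q \<noteq> p" using J_D center_notin_J by blast
    then show "q \<in> (\<Union>u\<in>V. D' u)"
      by (auto simp: D'_def strict_transform_def surface_closure_def)
  qed
  show "q \<notin> fst T \<and> (\<forall>w\<in>V. \<forall>j\<in>{1..k' w}. q \<notin> fst (N' w j)) \<and> (\<forall>w\<in>V. w \<noteq> u \<longrightarrow> q \<notin> fst (S' w))"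
    if "u \<in> V" "q \<in> fst (S' u)" "snd (snd (S' u) q) = 0" for u q
    by (rule D_models'[OF that])
qed

lemma stage_step_exists:
  "\<exists>S' N'. blowup_stage V T ze we sp J (k(v := Suc (k v))) (blowup B p c) (\<lambda>u. strict_transform B p c (D u)) S' N'"
  using stage_step unfolding k'_def B'_def D'_def[abs_def] by blast

end

lemma stage_Suc:
  "\<exists>S' N'. blowup_stage V T ze we sp J (k(v := Suc (k v))) (blowup B p c) (\<lambda>u. strict_transform B p c (D u)) S' N'"
proof -
  obtain \<mu> where \<mu>: "bij \<mu>"
    "\<And>l. l \<noteq> None \<Longrightarrow> \<mu> l \<noteq> None \<Longrightarrow> chart_rel (Dir p l) (blow_chart p c (\<lambda>l. l)) (blow_chart p (S v) \<mu>)"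
    "\<And>l. l \<noteq> None \<Longrightarrow> swapdir (\<mu> l) \<noteq> None \<Longrightarrow>
       chart_rel (Dir p l) (blow_chart p c (\<lambda>l. l)) (blow_chart p (swap_chart (S v)) (\<lambda>l. swapdir (\<mu> l)))"
    "\<And>l. swapdir l \<noteq> None \<Longrightarrow> \<mu> l \<noteq> None \<Longrightarrow> chart_rel (Dir p l) (blow_chart p (swap_chart c) swapdir) (blow_chart p (S v) \<mu>)"
    "\<And>l. swapdir l \<noteq> None \<Longrightarrow> swapdir (\<mu> l) \<noteq> None \<Longrightarrow>
       chart_rel (Dir p l) (blow_chart p (swap_chart c) swapdir) (blow_chart p (swap_chart (S v)) (\<lambda>l. swapdir (\<mu> l)))"
    using blowup_compatible[OF center_rel fresh_chart[of c] fresh_chart[of "S v"]] c models(2)[OF v] by blast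
  show ?thesis by (rule stage_step_exists[OF \<mu>])
qed

end

end


section \<open>Faces of the polar dual\<close>

lemma lat_real_simps: "lat_real (m + m') = lat_real m + lat_real m'" "lat_real (- m) = - lat_real m" "lat_real 0 = 0"
  "lat_real (lat_scale i m) = of_int i *\<^sub>R lat_real m"
  by (simp_all add: lat_real_def lat_scale_def prod_eq_iff)

lemma inner_lat_real: "lat_real m \<bullet> lat_real n = of_int (lat_pair m n)"
  by (simp add: lat_real_def lat_pair_def)

lemma inj_lat_real: "inj lat_real"
  by (auto simp: inj_def lat_real_def prod_eq_iff)

lemma lat_pair_simps: "lat_pair v (m + m') = lat_pair v m + lat_pair v m'" "lat_pair v (- m) = - lat_pair v m"
  "lat_pair v 0 = 0" "lat_pair v (lat_scale i m) = i * lat_pair v m"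
  by (simp_all add: lat_pair_def lat_scale_def algebra_simps)

text \<open>Rounding down moves each coordinate by less than 1; 2 is the error for which the
  constants in later estimates leave room.\<close>

lemma lat_round: "\<exists>m. norm (lat_real m - x) \<le> 2"
proof -
  let ?m = "(\<lfloor>fst x\<rfloor>, \<lfloor>snd x\<rfloor>)"
  have "lat_real ?m - x = (of_int \<lfloor>fst x\<rfloor> - fst x, of_int \<lfloor>snd x\<rfloor> - snd x)"
    by (simp add: lat_real_def prod_eq_iff)
  then have "norm (lat_real ?m - x) \<le> \<bar>of_int \<lfloor>fst x\<rfloor> - fst x\<bar> + \<bar>of_int \<lfloor>snd x\<rfloor> - snd x\<bar>"
    using norm_Pair_le[of "of_int \<lfloor>fst x\<rfloor> - fst x" "of_int \<lfloor>snd x\<rfloor> - snd x"] by (simp only: real_norm_def)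
  also have "\<dots> \<le> 2" by linarith
  finally show ?thesis by blast
qed

text \<open>Cramer's rule, where a determinant of absolute value 1 is its own inverse.\<close>

lemma lat_basis:
  assumes "\<bar>lat_det a b\<bar> = 1"
  shows "m = lat_scale (lat_det m b * lat_det a b) a + lat_scale (lat_det a m * lat_det a b) b"
proof -
  have D: "lat_det a b * lat_det a b = 1" using assms by (metis abs_mult_self_eq mult_1)
  have "fst m * (lat_det a b * lat_det a b) = (lat_det m b * lat_det a b) * fst a + (lat_det a m * lat_det a b) * fst b"
    "snd m * (lat_det a b * lat_det a b) = (lat_det m b * lat_det a b) * snd a + (lat_det a m * lat_det a b) * snd b"
    by (simp_all add: lat_det_def algebra_simps)
  then show ?thesis unfolding D by (simp add: prod_eq_iff lat_scale_def)
qed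

text \<open>A ball around \<open>q + d\<close> inside \<open>P\<close> spans a cone at
  \<open>q\<close> that widens linearly, so it contains every lattice point within
  \<open>t * r\<close> of \<open>t d\<close>. With \<open>lat_round\<close> this produces elements
  of the monoid in a prescribed approximate direction.\<close>

lemma face_monoid_approx:
  assumes "q \<in> F" "ball (q + d) r \<subseteq> P" "t > 0" "norm (lat_real m - t *\<^sub>R d) < t * r"
  shows "m \<in> face_monoid P F"
proof -
  let ?p = "q + (1 / t) *\<^sub>R lat_real m"
  have "(1 / t) *\<^sub>R lat_real m - d = (1 / t) *\<^sub>R (lat_real m - t *\<^sub>R d)"
    using assms(3) by (simp add: algebra_simps)
  then have "norm ((1 / t) *\<^sub>R lat_real m - d) = norm (lat_real m - t *\<^sub>R d) / t"
    using assms(3) by (simp only: norm_scaleR) simp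
  then have "norm ((1 / t) *\<^sub>R lat_real m - d) < r"
    using assms(3,4) by (simp add: pos_divide_less_eq mult.commute)
  then have "?p \<in> ball (q + d) r" by (simp add: dist_norm norm_minus_commute algebra_simps)
  then have "?p \<in> P" using assms(2) by blast
  moreover have "lat_real m = t *\<^sub>R (?p - q)" using assms(3) by simp
  moreover have "t \<ge> 0" using assms(3) by simp
  ultimately show ?thesis using assms(1) unfolding face_monoid_def by blast
qed

lemma face_monoid_add:
  assumes "convex P" "convex F" "m \<in> face_monoid P F" "m' \<in> face_monoid P F"
  shows "m + m' \<in> face_monoid P F"
proof -
  obtain t p q where 1: "t \<ge> 0" "p \<in> P" "q \<in> F" "lat_real m = t *\<^sub>R (p - q)"
    using assms(3) by (auto simp: face_monoid_def)
  obtain t' p' q' where 2: "t' \<ge> 0" "p' \<in> P" "q' \<in> F" "lat_real m' = t' *\<^sub>R (p' - q')"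
    using assms(4) by (auto simp: face_monoid_def)
  show ?thesis
  proof (cases "t + t' = 0")
    case True
    then have "t = 0" "t' = 0" using 1 2 by auto
    then have "lat_real (m + m') = 0 *\<^sub>R (p - q)" using 1 2 by (simp add: lat_real_simps)
    then show ?thesis using 1 unfolding face_monoid_def by blast
  next
    case False
    let ?a = "t / (t + t')" and ?b = "t' / (t + t')"
    have ab: "?a \<ge> 0" "?b \<ge> 0" "?a + ?b = 1" using 1(1) 2(1) False by (auto simp: add_divide_distrib[symmetric])
    have "lat_real (m + m') = (t + t') *\<^sub>R ((?a *\<^sub>R p + ?b *\<^sub>R p') - (?a *\<^sub>R q + ?b *\<^sub>R q'))"
      using False 1(4) 2(4) by (simp add: lat_real_simps scaleR_right_diff_distrib scaleR_add_right)
    moreover have "?a *\<^sub>R p + ?b *\<^sub>R p' \<in> P" "?a *\<^sub>R q + ?b *\<^sub>R q' \<in> F"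
      using assms(1,2) 1 2 ab by (auto intro: convexD)
    moreover have "t + t' \<ge> 0" using 1 2 by simp
    ultimately show ?thesis unfolding face_monoid_def by blast
  qed
qed

lemma convex_polar_dual: "convex (polar_dual \<Delta>)"
proof (rule convexI)
  fix x y :: "real \<times> real" and u w :: real
  assume *: "x \<in> polar_dual \<Delta>" "y \<in> polar_dual \<Delta>" "0 \<le> u" "0 \<le> w" "u + w = 1"
  have "z \<bullet> (u *\<^sub>R x + w *\<^sub>R y) \<ge> -1" if "z \<in> \<Delta>" for z
  proof -
    have "u * (z \<bullet> x) + w * (z \<bullet> y) \<ge> u * (-1) + w * (-1)"
      using * that by (intro add_mono mult_left_mono) (auto simp: polar_dual_def)
    then show ?thesis using * by (simp add: inner_add_right)
  qed
  then show "u *\<^sub>R x + w *\<^sub>R y \<in> polar_dual \<Delta>" by (simp add: polar_dual_def)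
qed

locale dual_polygon =
  fixes \<Delta> :: "(real \<times> real) set" and e f :: "lat \<Rightarrow> lat" and V P
  defines "V \<equiv> lattice_vertices \<Delta>" and "P \<equiv> polar_dual \<Delta>"
  assumes polygon: "lattice_polygon \<Delta>" and zero: "0 \<in> interior \<Delta>" and coords: "toric_coordinates \<Delta> e f"
begin

lemma coord: "v \<in> V \<Longrightarrow> lat_pair v (e v) = 0" "v \<in> V \<Longrightarrow> lat_pair v (f v) = 1" "v \<in> V \<Longrightarrow> \<bar>lat_det (e v) (f v)\<bar> = 1"
  using coords by (auto simp: toric_coordinates_def V_def)

lemma hull: "\<exists>X. finite X \<and> \<Delta> = convex hull (lat_real ` X)"
  using polygon by (auto simp: lattice_polygon_def)

lemma polytope_\<Delta>: "polytope \<Delta>"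
  using hull unfolding polytope_def by blast

lemma vertex_in: "v \<in> V \<Longrightarrow> lat_real v \<in> \<Delta>"
  by (simp add: V_def lattice_vertices_def extreme_point_of_def)

lemma extreme_points: "{x. x extreme_point_of \<Delta>} = lat_real ` V" "finite V"
proof -
  obtain X where X: "finite X" "\<Delta> = convex hull (lat_real ` X)" using hull by blast
  have sub: "x extreme_point_of \<Delta> \<Longrightarrow> x \<in> lat_real ` X" for x
    using extreme_point_of_convex_hull X by blast
  show "{x. x extreme_point_of \<Delta>} = lat_real ` V"
    using sub unfolding V_def lattice_vertices_def by blast
  have "lat_real ` V \<subseteq> lat_real ` X" using sub unfolding V_def lattice_vertices_def by blast
  then have "finite (lat_real ` V)" using X(1) finite_subset by blast
  then show "finite V" using inj_lat_real by (meson finite_imageD inj_on_subset subset_UNIV)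
qed

lemma \<Delta>_hull: "\<Delta> = convex hull (lat_real ` V)"
  using Krein_Milman_Minkowski[of \<Delta>] polytope_\<Delta> extreme_points(1)
  by (simp add: polytope_imp_compact polytope_imp_convex)

text \<open>The polar inequality is linear in the point of \<open>\<Delta>\<close>, so it passes
  from the vertices to their convex hull; only finitely many constraints remain.\<close>

lemma P_iff: "y \<in> P \<longleftrightarrow> (\<forall>v\<in>V. lat_real v \<bullet> y \<ge> -1)"
proof
  assume "\<forall>v\<in>V. lat_real v \<bullet> y \<ge> -1"
  then have "lat_real ` V \<subseteq> {x. y \<bullet> x \<ge> -1}" by (auto simp: inner_commute)
  then have "\<Delta> \<subseteq> {x. y \<bullet> x \<ge> -1}"
    unfolding \<Delta>_hull by (intro hull_minimal) (auto simp: convex_halfspace_ge)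
  then show "y \<in> P" by (auto simp: P_def polar_dual_def inner_commute)
qed (use vertex_in in \<open>auto simp: P_def polar_dual_def\<close>)

text \<open>Constraints that are not tight leave room for a small step, and finitely many of them
  leave room for a common one.\<close>

lemma P_perturb:
  assumes "y \<in> P" "\<And>v. v \<in> V \<Longrightarrow> lat_real v \<bullet> y = -1 \<Longrightarrow> lat_real v \<bullet> d \<ge> 0"
  shows "\<exists>r>0. y + r *\<^sub>R d \<in> P"
proof -
  have "eventually (\<lambda>r. lat_real v \<bullet> (y + r *\<^sub>R d) \<ge> -1) (at_right 0)" if v: "v \<in> V" for v
  proof (cases "lat_real v \<bullet> y = -1")
    case True
    have "eventually (\<lambda>r::real. r > 0) (at_right 0)" by (rule eventually_at_right_less)
    then show ?thesis
      by eventually_elim (use True assms(2)[OF v True] in \<open>simp add: inner_add_right\<close>)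
  next
    case False
    then have gt: "lat_real v \<bullet> y > -1" using assms(1) v unfolding P_iff by (metis order_le_less)
    have "((\<lambda>r. lat_real v \<bullet> (y + r *\<^sub>R d)) \<longlongrightarrow> lat_real v \<bullet> (y + 0 *\<^sub>R d)) (at_right 0)"
      by (intro tendsto_intros)
    from order_tendstoD(1)[OF this, of "-1"] gt have "eventually (\<lambda>r. lat_real v \<bullet> (y + r *\<^sub>R d) > -1) (at_right 0)"
      by simp
    then show ?thesis by eventually_elim simp
  qed
  then have "eventually (\<lambda>r. \<forall>v\<in>V. lat_real v \<bullet> (y + r *\<^sub>R d) \<ge> -1) (at_right 0)"
    by (intro eventually_ball_finite extreme_points(2) ballI)
  then have "eventually (\<lambda>r. r > 0 \<and> y + r *\<^sub>R d \<in> P) (at_right (0::real))"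
    unfolding P_iff by (intro eventually_conj eventually_at_right_less)
  from eventually_happens[OF this] show ?thesis by auto
qed

lemma zero_interior: obtains r where "r > 0" "ball 0 r \<subseteq> P"
proof -
  have "bounded \<Delta>" using polytope_\<Delta> polytope_imp_bounded by blast
  then obtain K where K: "K > 0" "\<And>x. x \<in> \<Delta> \<Longrightarrow> norm x \<le> K" by (auto simp: bounded_pos)
  have "ball 0 (1 / K) \<subseteq> P"
  proof
    fix y :: "real \<times> real" assume "y \<in> ball 0 (1 / K)"
    then have y: "norm y < 1 / K" by simp
    have "x \<bullet> y \<ge> -1" if "x \<in> \<Delta>" for x
    proof -
      have "\<bar>x \<bullet> y\<bar> \<le> norm x * norm y" by (rule Cauchy_Schwarz_ineq2)
      also have "\<dots> \<le> K * (1 / K)" using K(2)[OF that] y K(1) by (intro mult_mono) auto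
      finally show ?thesis using K(1) by simp
    qed
    then show "y \<in> P" by (simp add: P_def polar_dual_def)
  qed
  then show ?thesis using that[of "1 / K"] K(1) by simp
qed

lemma zero_in: "0 \<in> P"
  by (simp add: P_iff)

lemma convex_P: "convex P"
  unfolding P_def by (rule convex_polar_dual)

text \<open>A line \<open>a \<bullet> x = b\<close> exposing \<open>v\<close> has
  \<open>b > 0\<close> because the origin is an interior point; scaling \<open>a\<close> by
  \<open>- 1 / b\<close> turns it into a dual point at which the constraint of \<open>v\<close>
  alone is tight.\<close>

lemma vertex_exposed:
  assumes v: "v \<in> V"
  obtains y where "y \<in> P" "lat_real v \<bullet> y = -1" "\<And>u. u \<in> V \<Longrightarrow> lat_real u \<bullet> y = -1 \<Longrightarrow> u = v"
proof -
  have "{lat_real v} face_of \<Delta>" using v by (simp add: face_of_singleton V_def lattice_vertices_def)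
  then have "{lat_real v} exposed_face_of \<Delta>"
    using exposed_face_of_polyhedron polytope_imp_polyhedron[OF polytope_\<Delta>] by blast
  then obtain a b where ab: "\<Delta> \<subseteq> {x. a \<bullet> x \<le> b}" "{lat_real v} = \<Delta> \<inter> {x. a \<bullet> x = b}"
    unfolding exposed_face_of_def by blast
  obtain r where r: "r > 0" "ball 0 r \<subseteq> \<Delta>" using zero by (auto simp: mem_interior)
  have b: "b > 0"
  proof (cases "a = 0")
    case True
    have "lat_real v \<in> {x. a \<bullet> x = b}" using ab(2) by blast
    then have "b = 0" using True by (auto split: if_splits)
    then have "\<Delta> = {lat_real v}" using ab True by auto
    then show ?thesis using zero by simp
  next
    case False
    let ?x = "(r / (2 * norm a)) *\<^sub>R a"
    have "norm ?x < r" using r False by simp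
    then have "?x \<in> \<Delta>" using r(2) by auto
    then have "a \<bullet> ?x \<le> b" using ab(1) by blast
    moreover have "a \<bullet> ?x > 0" using r(1) False by (simp add: inner_gt_zero_iff)
    ultimately show ?thesis by linarith
  qed
  let ?y = "(- (1 / b)) *\<^sub>R a"
  have xy: "x \<bullet> ?y = - (a \<bullet> x) / b" for x by (simp add: inner_commute)
  show ?thesis
  proof (rule that[of ?y])
    show "?y \<in> P" unfolding P_iff xy using vertex_in ab(1) b by (auto simp: field_simps)
    have "a \<bullet> lat_real v = b" using ab(2) by blast
    then show "lat_real v \<bullet> ?y = -1" unfolding xy using b by simp
    show "u = v" if u: "u \<in> V" "lat_real u \<bullet> ?y = -1" for u
    proof -
      have "a \<bullet> lat_real u = b" using u(2) b unfolding xy by (simp add: field_simps)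
      then have "lat_real u \<in> {lat_real v}" unfolding ab(2) using vertex_in[OF u(1)] by simp
      then show ?thesis using inj_lat_real by (auto dest: injD)
    qed
  qed
qed

lemma dual_edge_face: "v \<in> V \<Longrightarrow> dual_edge \<Delta> v face_of P"
proof -
  assume v: "v \<in> V"
  have "P \<inter> {x. lat_real v \<bullet> x = -1} face_of P"
    by (rule face_of_Int_supporting_hyperplane_ge[OF convex_P]) (use P_iff v in blast)
  then show ?thesis by (simp add: dual_edge_def P_def Int_def)
qed

lemma dual_edge_nonempty: "v \<in> V \<Longrightarrow> dual_edge \<Delta> v \<noteq> {}"
  by (erule vertex_exposed) (auto simp: dual_edge_def P_def)

text \<open>For the inclusion from right to left, start at the dual point where only
  \<open>v\<close> is tight: a short step in a direction of nonnegative pairing stays in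
  \<open>P\<close>.\<close>

lemma half_plane_monoid:
  assumes v: "v \<in> V"
  shows "face_monoid P (dual_edge \<Delta> v) = {m. lat_pair v m \<ge> 0}"
proof (intro set_eqI iffI)
  fix m assume "m \<in> face_monoid P (dual_edge \<Delta> v)"
  then obtain t p q where *: "t \<ge> 0" "p \<in> P" "lat_real v \<bullet> q = -1" "lat_real m = t *\<^sub>R (p - q)"
    by (auto simp: face_monoid_def dual_edge_def)
  have "lat_real v \<bullet> p \<ge> -1" using * v P_iff by blast
  then have "real_of_int (lat_pair v m) \<ge> 0"
    using * by (simp flip: inner_lat_real add: inner_diff_right)
  then show "m \<in> {m. lat_pair v m \<ge> 0}" by simp
next
  fix m assume "m \<in> {m. lat_pair v m \<ge> 0}"
  then have m: "lat_real v \<bullet> lat_real m \<ge> 0" by (simp add: inner_lat_real)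
  obtain y where y: "y \<in> P" "lat_real v \<bullet> y = -1" "\<And>u. u \<in> V \<Longrightarrow> lat_real u \<bullet> y = -1 \<Longrightarrow> u = v"
    using vertex_exposed[OF v] by blast
  then obtain r where r: "r > 0" "y + r *\<^sub>R lat_real m \<in> P"
    using P_perturb[OF y(1), of "lat_real m"] m by blast
  have "lat_real m = (1 / r) *\<^sub>R ((y + r *\<^sub>R lat_real m) - y)" using r(1) by simp
  moreover have "y \<in> dual_edge \<Delta> v" using y by (simp add: dual_edge_def P_def)
  ultimately show "m \<in> face_monoid P (dual_edge \<Delta> v)"
    using r unfolding face_monoid_def by (metis (mono_tags, lifting) divide_nonneg_pos less_eq_real_def mem_Collect_eq zero_le_one)
qed

lemma torus_monoid: "face_monoid P P = UNIV"
proof -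
  obtain r where r: "r > 0" "ball 0 r \<subseteq> P" using zero_interior .
  have "m \<in> face_monoid P P" for m
  proof (rule face_monoid_approx[of 0 P 0 r P "norm (lat_real m) / r + 1"])
    show "norm (lat_real m - (norm (lat_real m) / r + 1) *\<^sub>R 0) < (norm (lat_real m) / r + 1) * r"
      using r(1) by (simp add: field_simps)
  qed (use r zero_in in \<open>auto intro: add_nonneg_pos\<close>)
  then show ?thesis by blast
qed

text \<open>Deep enough inside the cone there is room for a translation by any \<open>w\<close>;
  hence the monoid generates the lattice as a group.\<close>

lemma face_monoid_generates:
  assumes "q \<in> F"
  shows "\<exists>m\<in>face_monoid P F. m + w \<in> face_monoid P F"
proof -
  obtain r where r: "r > 0" "ball 0 r \<subseteq> P" using zero_interior .
  \<comment> \<open>The direction \<open>- q\<close> points from \<open>q\<close> to the origin,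
    around which \<open>P\<close> contains a ball. The margin 3 plus the norm of \<open>w\<close>
    strictly exceeds the rounding error 2 both for \<open>m\<close> and for
    \<open>m + w\<close>.\<close>
  define t where "t = (3 + norm (lat_real w)) / r"
  have t: "t > 0" "t * r = 3 + norm (lat_real w)" using r(1) by (auto simp: t_def add_pos_nonneg)
  obtain m where m: "norm (lat_real m - t *\<^sub>R (- q)) \<le> 2" using lat_round by blast
  have b: "ball (q + - q) r \<subseteq> P" using r(2) by simp
  have "m \<in> face_monoid P F"
    by (rule face_monoid_approx[OF assms b t(1)]) (use m t(2) norm_ge_zero[of "lat_real w"] in linarith)
  moreover have "m + w \<in> face_monoid P F"
  proof (rule face_monoid_approx[OF assms b t(1)])
    have "norm (lat_real (m + w) - t *\<^sub>R (- q)) = norm ((lat_real m - t *\<^sub>R (- q)) + lat_real w)"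
      by (simp add: lat_real_simps algebra_simps)
    also have "\<dots> \<le> norm (lat_real m - t *\<^sub>R (- q)) + norm (lat_real w)" by (rule norm_triangle_ineq)
    also have "\<dots> < t * r" using m t(2) by simp
    finally show "norm (lat_real (m + w) - t *\<^sub>R (- q)) < t * r" .
  qed
  ultimately show ?thesis by blast
qed

text \<open>At a point \<open>q\<close> of \<open>F\<close> off the edge of \<open>v\<close>, the
  cone has an interior direction with negative pairing, and rounding a long multiple of it gives a
  monoid element outside the half-plane.\<close>

lemma face_monoid_half_plane:
  assumes v: "v \<in> V" and F: "F \<subseteq> P" "face_monoid P F \<subseteq> {m. lat_pair v m \<ge> 0}"
  shows "F \<subseteq> dual_edge \<Delta> v"
proof
  fix q assume q: "q \<in> F"
  show "q \<in> dual_edge \<Delta> v"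
  proof (rule ccontr)
    assume "q \<notin> dual_edge \<Delta> v"
    then have vq: "lat_real v \<bullet> q > -1"
      using q F(1) P_iff[of q] v by (force simp: dual_edge_def P_def)
    obtain y where y: "y \<in> P" "lat_real v \<bullet> y = -1" using vertex_exposed[OF v] by blast
    obtain r where r: "r > 0" "ball 0 r \<subseteq> P" using zero_interior .
    \<comment> \<open>Moving \<open>y\<close> towards the origin by the fraction
      \<open>\<epsilon>\<close> leaves a ball of radius \<open>\<epsilon> r\<close> inside
      \<open>P\<close>; taking at most half the gap at \<open>q\<close> keeps the pairing of
      \<open>d\<close> with \<open>v\<close> negative.\<close>
    define \<epsilon> where "\<epsilon> = min 1 ((lat_real v \<bullet> q + 1) / 2)"
    have \<epsilon>: "\<epsilon> > 0" "\<epsilon> \<le> 1" "- (1 - \<epsilon>) < lat_real v \<bullet> q" using vq by (auto simp: \<epsilon>_def min_def field_simps)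
    define d where "d = (1 - \<epsilon>) *\<^sub>R y - q"
    have b: "ball (q + d) (\<epsilon> * r) \<subseteq> P"
    proof
      fix x assume "x \<in> ball (q + d) (\<epsilon> * r)"
      then have "norm (x - (1 - \<epsilon>) *\<^sub>R y) < \<epsilon> * r" by (simp add: d_def dist_norm norm_minus_commute)
      then have "norm ((1 / \<epsilon>) *\<^sub>R (x - (1 - \<epsilon>) *\<^sub>R y)) < r"
        unfolding norm_scaleR using \<epsilon>(1) by (simp add: pos_divide_less_eq mult.commute)
      then have "(1 / \<epsilon>) *\<^sub>R (x - (1 - \<epsilon>) *\<^sub>R y) \<in> ball 0 r" by (simp only: mem_ball dist_0_norm)
      then have "(1 - \<epsilon>) *\<^sub>R y + \<epsilon> *\<^sub>R ((1 / \<epsilon>) *\<^sub>R (x - (1 - \<epsilon>) *\<^sub>R y)) \<in> P"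
        using r(2) y(1) \<epsilon> by (intro convexD[OF convex_P]) auto
      then show "x \<in> P" using \<epsilon>(1) by simp
    qed
    have vd: "lat_real v \<bullet> d < 0" using \<epsilon>(3) y(2) by (simp add: d_def inner_diff_right)
    \<comment> \<open>The first term makes the rounding error 2 smaller than the radius
      \<open>t \<epsilon> r\<close>, the second makes the negative pairing outweigh the effect of
      that error on the pairing.\<close>
    define t where "t = max (3 / (\<epsilon> * r)) ((2 * norm (lat_real v) + 1) / (- (lat_real v \<bullet> d)))"
    have er: "\<epsilon> * r > 0" using \<epsilon> r by simp
    have t1: "t * (\<epsilon> * r) \<ge> 3"
    proof -
      have "t \<ge> 3 / (\<epsilon> * r)" by (simp add: t_def)
      then show ?thesis using er by (simp add: pos_divide_le_eq)
    qed
    have t2: "t * (- (lat_real v \<bullet> d)) \<ge> 2 * norm (lat_real v) + 1"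
    proof -
      have "t \<ge> (2 * norm (lat_real v) + 1) / (- (lat_real v \<bullet> d))" by (simp add: t_def)
      then show ?thesis using vd by (metis neg_0_less_iff_less pos_divide_le_eq)
    qed
    have t: "t > 0" using er by (auto simp: t_def less_max_iff_disj)
    obtain m where m: "norm (lat_real m - t *\<^sub>R d) \<le> 2" using lat_round by blast
    have "m \<in> face_monoid P F"
      by (rule face_monoid_approx[OF q b t]) (use m t1 in linarith)
    then have "lat_real v \<bullet> lat_real m \<ge> 0" using F(2) by (auto simp: inner_lat_real)
    moreover have "lat_real v \<bullet> lat_real m = t * (lat_real v \<bullet> d) + lat_real v \<bullet> (lat_real m - t *\<^sub>R d)"
      by (simp add: inner_diff_right)
    moreover have "lat_real v \<bullet> (lat_real m - t *\<^sub>R d) \<le> norm (lat_real v) * norm (lat_real m - t *\<^sub>R d)"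
      by (rule norm_cauchy_schwarz)
    moreover have "\<dots> \<le> norm (lat_real v) * 2" by (intro mult_left_mono m) simp
    ultimately show False using t2 by simp
  qed
qed

text \<open>The edge contains a point other than \<open>q\<close>; the difference is orthogonal to
  \<open>v\<close>, hence a multiple of \<open>e v\<close>, and its sign decides between the two
  cases.\<close>

lemma edge_direction:
  assumes v: "v \<in> V" and F: "F \<subseteq> dual_edge \<Delta> v" "F \<noteq> {}"
  shows "e v \<in> face_monoid P F \<or> - e v \<in> face_monoid P F"
proof -
  obtain q where q: "q \<in> F" using F by blast
  obtain y where y: "y \<in> P" "lat_real v \<bullet> y = -1" "\<And>u. u \<in> V \<Longrightarrow> lat_real u \<bullet> y = -1 \<Longrightarrow> u = v"
    using vertex_exposed[OF v] by blast
  have ve: "lat_real v \<bullet> lat_real (e v) = 0" using coord(1)[OF v] by (simp add: inner_lat_real)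
  obtain r where r: "r > 0" "y + r *\<^sub>R lat_real (e v) \<in> P"
    using P_perturb[OF y(1), of "lat_real (e v)"] y(3) ve by force
  have e0: "lat_real (e v) \<noteq> 0"
    using coord(3)[OF v] by (auto simp: lat_real_def lat_det_def prod_eq_iff)
  define z where "z = (if y = q then y + r *\<^sub>R lat_real (e v) else y)"
  have z: "z \<in> P" "z \<noteq> q" "lat_real v \<bullet> (z - q) = 0"
    using r y q F(1) e0 ve by (auto simp: z_def inner_diff_right inner_add_right dual_edge_def)
  have v0: "lat_real v \<noteq> 0" using y(2) by auto
  have "\<exists>s. z - q = s *\<^sub>R lat_real (e v)"
  proof -
    obtain v1 v2 where v12: "lat_real v = (v1, v2)" by (cases "lat_real v")
    obtain e1 e2 where e12: "lat_real (e v) = (e1, e2)" by (cases "lat_real (e v)")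
    obtain z1 z2 where z12: "z - q = (z1, z2)" by (cases "z - q")
    have 1: "v1 * e1 + v2 * e2 = 0" "v1 * z1 + v2 * z2 = 0" using ve z(3) by (simp_all add: v12 e12 z12)
    have "v1 * (e1 * z2 - e2 * z1) = 0" "v2 * (e1 * z2 - e2 * z1) = 0" using 1 by algebra+
    then have d: "e1 * z2 = e2 * z1" using v0 by (auto simp: v12 zero_prod_def)
    show ?thesis
    proof (cases "e1 = 0")
      case True
      then have "e2 \<noteq> 0" "z1 = 0" using e0 d by (auto simp: e12 zero_prod_def)
      then show ?thesis using True by (intro exI[of _ "z2 / e2"]) (simp add: e12 z12)
    next
      case False
      then show ?thesis using d by (intro exI[of _ "z1 / e1"]) (simp add: e12 z12 field_simps)
    qed
  qed
  then obtain s where s: "z - q = s *\<^sub>R lat_real (e v)" by blast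
  then have "s \<noteq> 0" using z(2) by auto
  then consider "s > 0" | "s < 0" by linarith
  then show ?thesis
  proof cases
    case 1
    then have "lat_real (e v) = (1 / s) *\<^sub>R (z - q)" unfolding s by simp
    then have "e v \<in> face_monoid P F" using 1 z(1) q unfolding face_monoid_def
      by (metis (mono_tags, lifting) divide_nonneg_pos mem_Collect_eq zero_le_one)
    then show ?thesis ..
  next
    case 2
    then have "lat_real (- e v) = (- 1 / s) *\<^sub>R (z - q)" unfolding s by (simp add: lat_real_simps)
    moreover have "- 1 / s \<ge> 0" using 2 by simp
    ultimately have "- e v \<in> face_monoid P F" using z(1) q unfolding face_monoid_def by blast
    then show ?thesis ..
  qed
qed

text \<open>If no constraint were tight at a relative interior point of \<open>F\<close>, that point
  would be interior to \<open>P\<close>, which proper faces avoid. A tight constraint puts the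
  point, and with it all of \<open>F\<close>, on an edge.\<close>

lemma proper_face:
  assumes F: "F face_of P" "F \<noteq> {}" "F \<noteq> P"
  shows "\<exists>v\<in>V. F \<subseteq> dual_edge \<Delta> v"
proof -
  have "convex F" using F(1) face_of_imp_convex by blast
  then obtain q where q: "q \<in> rel_interior F" using F(2) rel_interior_eq_empty by blast
  then have qF: "q \<in> F" using rel_interior_subset by blast
  have qP: "q \<in> P" using qF F(1) face_of_imp_subset by blast
  have "\<exists>v\<in>V. lat_real v \<bullet> q = -1"
  proof (rule ccontr)
    assume "\<not> ?thesis"
    then have *: "\<forall>v\<in>V. lat_real v \<bullet> q > -1" using qP unfolding P_iff by (metis order_le_less)
    have "open (\<Inter>v\<in>V. {x. lat_real v \<bullet> x > -1})"
      by (intro open_INT extreme_points(2) ballI open_halfspace_gt)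
    moreover have "(\<Inter>v\<in>V. {x. lat_real v \<bullet> x > -1}) \<subseteq> P"
      unfolding subset_iff P_iff by (auto intro: less_imp_le)
    ultimately have "q \<in> interior P" using * by (intro interiorI[of "\<Inter>v\<in>V. {x. lat_real v \<bullet> x > -1}"]) auto
    moreover have "F \<inter> interior P = {}" using face_of_disjoint_interior F by blast
    ultimately show False using qF by blast
  qed
  then obtain v where v: "v \<in> V" "lat_real v \<bullet> q = -1" by blast
  have "q \<in> dual_edge \<Delta> v" using v qP by (simp add: dual_edge_def P_def)
  then have "F \<subseteq> dual_edge \<Delta> v"
    using subset_of_face_of[OF dual_edge_face[OF v(1)]] face_of_imp_subset[OF F(1)] q by blast
  then show ?thesis using v(1) by blast
qed

end


section \<open>The toric surface of the polar dual\<close>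

text \<open>Both coordinate domains are swept out by points of \<open>W\<close>, so the identities
  between \<open>g\<close> and \<open>h\<close> need checking on points only.\<close>

lemma chart_rel_via:
  assumes W: "W \<subseteq> fst c" "W \<subseteq> fst d" "q \<in> W" and op: "open V" "open V'"
    and dom: "\<And>r. r \<in> fst c \<Longrightarrow> snd c r \<in> V \<longleftrightarrow> r \<in> W" "\<And>r. r \<in> fst d \<Longrightarrow> snd d r \<in> V' \<longleftrightarrow> r \<in> W"
    and sur: "V \<subseteq> snd c ` W" "V' \<subseteq> snd d ` W"
    and rat: "rational_on V (\<lambda>p. fst (g p))" "rational_on V (\<lambda>p. snd (g p))"
      "rational_on V' (\<lambda>p. fst (h p))" "rational_on V' (\<lambda>p. snd (h p))"
    and eq: "\<And>r. r \<in> W \<Longrightarrow> snd d r = g (snd c r)" "\<And>r. r \<in> W \<Longrightarrow> snd c r = h (snd d r)"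
  shows "chart_rel q c d"
proof (rule chart_relI)
  have "rat_iso V g V' h"
  proof (rule rational_rat_isoI[OF op rat])
    fix p assume "p \<in> V"
    then obtain r where r: "r \<in> W" "p = snd c r" using sur(1) by blast
    have 1: "g p = snd d r" using eq(1)[OF r(1)] r(2) by simp
    show "h (g p) = p" unfolding 1 using eq(2)[OF r(1)] r(2) by simp
    show "g p \<in> V'" unfolding 1 using dom(2) r(1) W(2) by blast
  next
    fix p assume "p \<in> V'"
    then obtain r where r: "r \<in> W" "p = snd d r" using sur(2) by blast
    have 1: "h p = snd c r" using eq(2)[OF r(1)] r(2) by simp
    show "g (h p) = p" unfolding 1 using eq(1)[OF r(1)] r(2) by simp
    show "h p \<in> V" unfolding 1 using dom(1) r(1) W(1) by blast
  qed
  then show "chart_iso c d V g V' h"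
    unfolding chart_iso_def using dom eq(1) W by blast
  show "q \<in> fst c" "snd c q \<in> V" using W dom by blast+
qed

lemma open_fst_ne: "open {x :: complex \<times> complex. fst x \<noteq> k}" and open_snd_ne: "open {x :: complex \<times> complex. snd x \<noteq> k}"
proof -
  have "open (fst -` (- {k}) :: (complex \<times> complex) set)" "open (snd -` (- {k}) :: (complex \<times> complex) set)"
    by (intro open_vimage_fst open_vimage_snd open_Compl; simp)+
  then show "open {x :: complex \<times> complex. fst x \<noteq> k}" "open {x :: complex \<times> complex. snd x \<noteq> k}"
    by (simp_all add: vimage_def)
qed

lemma lat_scale_simps [simp]: "lat_scale 0 m = 0" "lat_scale 1 m = m" "lat_scale i 0 = 0"
  by (simp_all add: lat_scale_def zero_prod_def prod_eq_iff)

lemma lat_scale_add: "lat_scale (i + j) m = lat_scale i m + lat_scale j m"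
  and lat_scale_minus: "lat_scale (- i) m = - lat_scale i m" "lat_scale i (- m) = - lat_scale i m"
  by (simp_all add: lat_scale_def prod_eq_iff algebra_simps)

lemma lat_det_simps: "lat_det (m + m') n = lat_det m n + lat_det m' n" "lat_det n (m + m') = lat_det n m + lat_det n m'"
  "lat_det (lat_scale i m) n = i * lat_det m n" "lat_det n (lat_scale i m) = i * lat_det n m" "lat_det m m = 0"
  "lat_det (- m) n = - lat_det m n" "lat_det n (- m) = - lat_det n m" "lat_det 0 m = 0" "lat_det m 0 = 0"
  by (simp_all add: lat_det_def lat_scale_def algebra_simps)

lemma lat_det_swap: "lat_det b a = - lat_det a b"
  by (simp add: lat_det_def)

definition mon :: "lat \<Rightarrow> lat \<Rightarrow> tpoint \<Rightarrow> complex \<times> complex" where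
  "mon a b = (\<lambda>x. (the (x a), the (x b))) \<circ> bpoint_base"

lemma mon_Pt [simp]: "mon a b (Pt x) = (the (x a), the (x b))"
  by (simp add: mon_def)

lemma Pt_image_iff: "Pt x \<in> Pt ` A \<longleftrightarrow> x \<in> A"
  by auto

lemma torus_orbit_cong: "face_monoid P F = face_monoid P G \<Longrightarrow> torus_orbit P F = torus_orbit P G"
  by (simp add: torus_orbit_def)

lemma torus_orbitD:
  assumes "x \<in> torus_orbit P F"
  shows "dom x = face_monoid P F" "x 0 = Some 1"
    "\<And>m m'. m \<in> dom x \<Longrightarrow> m' \<in> dom x \<Longrightarrow> the (x (m + m')) = the (x m) * the (x m')"
    "\<And>m. m \<in> dom x \<Longrightarrow> the (x m) \<noteq> 0 \<longleftrightarrow> - m \<in> dom x"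
proof -
  have *: "dom x = face_monoid P F \<and> x 0 = Some 1 \<and>
      (\<forall>m\<in>dom x. \<forall>m'\<in>dom x. the (x (m + m')) = the (x m) * the (x m')) \<and>
      (\<forall>m\<in>dom x. the (x m) \<noteq> 0 \<longleftrightarrow> - m \<in> dom x)"
    using assms unfolding torus_orbit_def by (rule CollectD)
  show "dom x = face_monoid P F" "x 0 = Some 1"
    "\<And>m m'. m \<in> dom x \<Longrightarrow> m' \<in> dom x \<Longrightarrow> the (x (m + m')) = the (x m) * the (x m')"
    "\<And>m. m \<in> dom x \<Longrightarrow> the (x m) \<noteq> 0 \<longleftrightarrow> - m \<in> dom x"
    using * by (elim conjE; blast)+
qed

section \<open>Points of the toric variety as characters on monoids\<close>

context dual_polygon
begin

abbreviation "torus \<equiv> torus_orbit P P"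
abbreviation "orbit v \<equiv> torus_orbit P (dual_edge \<Delta> v)"

lemma P_nonempty: "P \<noteq> {}"
  using zero_in by blast

lemma varietyE:
  assumes "x \<in> toric_variety P"
  obtains F where "F face_of P" "F \<noteq> {}" "F \<subseteq> P" "dom x = face_monoid P F" "x \<in> torus_orbit P F"
  using assms face_of_imp_subset by (auto simp: toric_variety_def torus_orbit_def)

lemma torus_sub: "torus \<subseteq> toric_variety P"
  using P_nonempty convex_P face_of_refl by (auto simp: toric_variety_def)

lemma orbit_sub: "v \<in> V \<Longrightarrow> orbit v \<subseteq> toric_variety P"
  using dual_edge_face[of v] dual_edge_nonempty[of v] unfolding toric_variety_def by blast

lemma variety_zero: "x \<in> toric_variety P \<Longrightarrow> x 0 = Some 1"
  by (auto simp: toric_variety_def torus_orbit_def)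

lemma variety_add:
  assumes "x \<in> toric_variety P" "m \<in> dom x" "m' \<in> dom x"
  shows "m + m' \<in> dom x" "the (x (m + m')) = the (x m) * the (x m')"
proof -
  obtain F where F: "F face_of P" "F \<noteq> {}" "F \<subseteq> P" "dom x = face_monoid P F" "x \<in> torus_orbit P F"
    by (rule varietyE[OF assms(1)])
  show "m + m' \<in> dom x"
    using face_monoid_add[OF convex_P face_of_imp_convex[OF F(1)]] assms(2,3) unfolding F(4) by blast
  show "the (x (m + m')) = the (x m) * the (x m')" by (rule torus_orbitD(3)[OF F(5) assms(2,3)])
qed

lemma variety_unit:
  assumes "x \<in> toric_variety P" "m \<in> dom x"
  shows "the (x m) \<noteq> 0 \<longleftrightarrow> - m \<in> dom x"
proof -
  obtain F where F: "F face_of P" "F \<noteq> {}" "F \<subseteq> P" "dom x = face_monoid P F" "x \<in> torus_orbit P F"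
    by (rule varietyE[OF assms(1)])
  show ?thesis by (rule torus_orbitD(4)[OF F(5) assms(2)])
qed

lemma variety_power:
  assumes "x \<in> toric_variety P" "m \<in> dom x"
  shows "lat_scale (int n) m \<in> dom x \<and> the (x (lat_scale (int n) m)) = the (x m) ^ n"
proof (induction n)
  case 0
  then show ?case using variety_zero[OF assms(1)] by auto
next
  case (Suc n)
  have "lat_scale (int (Suc n)) m = m + lat_scale (int n) m" by (simp add: lat_scale_add)
  then show ?case using variety_add[OF assms(1,2)] Suc by simp
qed

lemma variety_powi:
  assumes x: "x \<in> toric_variety P" "m \<in> dom x" and i: "the (x m) \<noteq> 0 \<or> i \<ge> 0"
  shows "lat_scale i m \<in> dom x \<and> the (x (lat_scale i m)) = the (x m) powi i"
proof (cases "i \<ge> 0")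
  case True
  then obtain n where "i = int n" using nonneg_int_cases by blast
  then show ?thesis using variety_power[OF x, of n] by simp
next
  case False
  define n where "n = nat (- i)"
  have n: "i = - int n" using False by (simp add: n_def)
  have nz: "the (x m) \<noteq> 0" using i False by simp
  then have m: "- m \<in> dom x" using variety_unit[OF x] by simp
  have "the (x m) * the (x (- m)) = 1" using variety_add(2)[OF x m] variety_zero[OF x(1)] by simp
  then have "the (x (- m)) = inverse (the (x m))" by (simp add: inverse_unique)
  moreover have "lat_scale i m = lat_scale (int n) (- m)" by (simp add: n lat_scale_minus)
  ultimately have "lat_scale i m \<in> dom x \<and> the (x (lat_scale i m)) = inverse (the (x m)) ^ n"
    using variety_power[OF x(1) m, of n] by simp
  then show ?thesis by (simp add: n power_int_minus power_inverse)
qed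

lemma variety_combo:
  assumes x: "x \<in> toric_variety P" and a: "a \<in> dom x" "the (x a) \<noteq> 0 \<or> i \<ge> 0" and b: "b \<in> dom x" "the (x b) \<noteq> 0 \<or> j \<ge> 0"
  shows "lat_scale i a + lat_scale j b \<in> dom x"
    "the (x (lat_scale i a + lat_scale j b)) = the (x a) powi i * the (x b) powi j"
proof -
  note A = variety_powi[OF x a] and B = variety_powi[OF x b]
  note AB = variety_add[OF x A[THEN conjunct1] B[THEN conjunct1]]
  show "lat_scale i a + lat_scale j b \<in> dom x" by (rule AB(1))
  show "the (x (lat_scale i a + lat_scale j b)) = the (x a) powi i * the (x b) powi j"
    unfolding AB(2) A[THEN conjunct2] B[THEN conjunct2] ..
qed

lemma torus_iff: "x \<in> torus \<longleftrightarrow> dom x = UNIV \<and> x 0 = Some 1 \<and> (\<forall>m m'. the (x (m + m')) = the (x m) * the (x m')) \<and> (\<forall>m. the (x m) \<noteq> 0)"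
proof
  assume x: "x \<in> torus"
  note D = torus_orbitD[OF x, unfolded torus_monoid]
  have "m \<in> dom x" for m using D(1) by blast
  then show "dom x = UNIV \<and> x 0 = Some 1 \<and> (\<forall>m m'. the (x (m + m')) = the (x m) * the (x m')) \<and> (\<forall>m. the (x m) \<noteq> 0)"
    using D by blast
next
  assume "dom x = UNIV \<and> x 0 = Some 1 \<and> (\<forall>m m'. the (x (m + m')) = the (x m) * the (x m')) \<and> (\<forall>m. the (x m) \<noteq> 0)"
  then show "x \<in> torus"
    unfolding torus_orbit_def torus_monoid mem_Collect_eq by (elim conjE) (intro conjI ballI; simp only: UNIV_I simp_thms)
qed

lemma torus_dom: "x \<in> torus \<Longrightarrow> m \<in> dom x"
  using torus_iff by blast

lemma torus_nonzero: "x \<in> torus \<Longrightarrow> the (x m) \<noteq> 0"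
  using torus_iff by blast

lemma torusI:
  assumes "x \<in> toric_variety P" "dom x = UNIV"
  shows "x \<in> torus"
proof -
  obtain F where F: "F face_of P" "F \<noteq> {}" "F \<subseteq> P" "dom x = face_monoid P F" "x \<in> torus_orbit P F"
    by (rule varietyE[OF assms(1)])
  have "face_monoid P F = face_monoid P P" using F(4) assms(2) torus_monoid by simp
  then show ?thesis using F(5) torus_orbit_cong by blast
qed

lemma orbit_dom: "v \<in> V \<Longrightarrow> x \<in> orbit v \<Longrightarrow> dom x = {m. lat_pair v m \<ge> 0}"
  using torus_orbitD(1) half_plane_monoid by simp

lemma orbitI:
  assumes "v \<in> V" "x \<in> toric_variety P" "dom x = {m. lat_pair v m \<ge> 0}"
  shows "x \<in> orbit v"
proof -
  obtain F where F: "F face_of P" "F \<noteq> {}" "F \<subseteq> P" "dom x = face_monoid P F" "x \<in> torus_orbit P F"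
    by (rule varietyE[OF assms(2)])
  have "face_monoid P F = face_monoid P (dual_edge \<Delta> v)" using F(4) assms(3) half_plane_monoid[OF assms(1)] by simp
  then show ?thesis using F(5) torus_orbit_cong by blast
qed

lemma orbit_unit:
  assumes "v \<in> V" "x \<in> orbit v" "lat_pair v m \<ge> 0"
  shows "the (x m) \<noteq> 0 \<longleftrightarrow> lat_pair v m = 0"
proof -
  have "m \<in> dom x" using orbit_dom[OF assms(1,2)] assms(3) by blast
  then have "the (x m) \<noteq> 0 \<longleftrightarrow> - m \<in> dom x" by (rule torus_orbitD(4)[OF assms(2)])
  also have "\<dots> \<longleftrightarrow> lat_pair v m = 0"
    unfolding orbit_dom[OF assms(1,2)] mem_Collect_eq lat_pair_simps using assms(3) by linarith
  finally show ?thesis .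
qed

lemma torus_of_nz:
  assumes x: "x \<in> toric_variety P" "a \<in> dom x" "b \<in> dom x" "\<bar>lat_det a b\<bar> = 1" "the (x a) \<noteq> 0" "the (x b) \<noteq> 0"
  shows "x \<in> torus"
proof (rule torusI[OF x(1)])
  have "m \<in> dom x" for m
    using variety_combo(1)[OF x(1,2) disjI1[OF x(5)] x(3) disjI1[OF x(6)]] by (subst lat_basis[OF x(4), of m])
  then show "dom x = UNIV" by blast
qed

text \<open>The domain contains the half-plane of \<open>v\<close>. If it is larger, adding a
  suitable element of the half-plane to one outside it yields \<open>- b\<close>, which makes the
  value at \<open>b\<close> nonzero.\<close>

lemma torus_or_orbit:
  assumes x: "x \<in> toric_variety P" "a \<in> dom x" "b \<in> dom x" "\<bar>lat_det a b\<bar> = 1" "the (x a) \<noteq> 0"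
    and v: "v \<in> V" "lat_pair v a = 0" "lat_pair v b = 1"
  shows "x \<in> torus \<or> x \<in> orbit v"
proof -
  let ?i = "\<lambda>m. lat_det m b * lat_det a b"
  have m: "m = lat_scale (?i m) a + lat_scale (lat_pair v m) b" for m
  proof -
    note L = lat_basis[OF x(4), of m]
    have "lat_pair v m = lat_det a m * lat_det a b" by (subst L) (simp add: lat_pair_simps v)
    then show ?thesis using L by simp
  qed
  have half: "m \<in> dom x" if "lat_pair v m \<ge> 0" for m
    using variety_combo(1)[OF x(1,2) disjI1[OF x(5)] x(3) disjI2[OF that]] by (subst m)
  show ?thesis
  proof (cases "dom x = {m. lat_pair v m \<ge> 0}")
    case True
    then show ?thesis using orbitI[OF v(1) x(1)] by blast
  next
    case False
    then obtain m where "m \<in> dom x" "lat_pair v m < 0" using half by force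
    moreover have "lat_pair v (- b - m) \<ge> 0"
      using calculation(2) v(3) lat_pair_simps(1)[of v "- b" "- m"] by (simp add: lat_pair_simps(2))
    then have "- b - m \<in> dom x" by (rule half)
    ultimately have "m + (- b - m) \<in> dom x" using variety_add(1)[OF x(1)] by blast
    then have "the (x b) \<noteq> 0" using variety_unit[OF x(1,3)] by simp
    then show ?thesis using torus_of_nz[OF x(1-5)] by blast
  qed
qed

text \<open>The inclusion makes \<open>v\<close> vanish on \<open>e u\<close>, so as functionals
  \<open>v = k u\<close> with \<open>k \<ge> 0\<close>; evaluation at \<open>f v\<close> exhibits
  \<open>k\<close> as a divisor of 1.\<close>

lemma half_plane_unique:
  assumes u: "u \<in> V" and v: "v \<in> V" and sub: "\<And>m. lat_pair u m \<ge> 0 \<Longrightarrow> lat_pair v m \<ge> 0"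
  shows "u = v"
proof -
  have ve: "lat_pair v (e u) = 0"
    using sub[of "e u"] sub[of "- e u"] coord(1)[OF u] by (simp add: lat_pair_simps)
  define k where "k = lat_pair v (f u)"
  have k: "k \<ge> 0" using sub[of "f u"] coord(2)[OF u] by (simp add: k_def)
  have proportional: "lat_pair v m = k * lat_pair u m" for m
  proof -
    note L = lat_basis[OF coord(3)[OF u], of m]
    have "lat_pair v m = lat_det (e u) m * lat_det (e u) (f u) * k"
      by (subst L) (simp add: lat_pair_simps ve k_def)
    moreover have "lat_pair u m = lat_det (e u) m * lat_det (e u) (f u)"
      by (subst L) (simp add: lat_pair_simps coord[OF u])
    ultimately show ?thesis by simp
  qed
  have "k * lat_pair u (f v) = 1" using proportional[of "f v"] coord(2)[OF v] by simp
  then have "k = 1" using k by (auto simp: zmult_eq_1_iff)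
  then show ?thesis using proportional[of "(1, 0)"] proportional[of "(0, 1)"] by (simp add: lat_pair_def prod_eq_iff)
qed

lemma orbit_unique: "u \<in> V \<Longrightarrow> v \<in> V \<Longrightarrow> x \<in> orbit u \<Longrightarrow> x \<in> orbit v \<Longrightarrow> u = v"
  using half_plane_unique[of u v] orbit_dom by blast

lemma torus_orbit_disjoint: "v \<in> V \<Longrightarrow> x \<in> orbit v \<Longrightarrow> x \<notin> torus"
  using torus_dom[of x "- f v"] orbit_dom[of v x] coord(2)[of v] by (auto simp: lat_pair_simps)

lemma orbit_point_coords:
  assumes "v \<in> V" "x \<in> orbit v"
  shows "e v \<in> dom x" "f v \<in> dom x" "the (x (e v)) \<noteq> 0" "the (x (f v)) = 0"
  using orbit_unit[OF assms, of "e v"] orbit_unit[OF assms, of "f v"] orbit_dom[OF assms] coord[OF assms(1)] by auto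

lemma torus_point_exists:
  assumes d: "\<bar>lat_det a b\<bar> = 1" and X: "X \<noteq> 0" "Y \<noteq> 0"
  shows "\<exists>x\<in>torus. the (x a) = X \<and> the (x b) = Y"
proof -
  let ?x = "\<lambda>m. Some (X powi (lat_det m b * lat_det a b) * Y powi (lat_det a m * lat_det a b))"
  have D: "lat_det a b * lat_det a b = 1" using d by (metis abs_mult_self_eq mult_1)
  have "?x \<in> torus"
    unfolding torus_iff using X by (auto simp: lat_det_simps distrib_right power_int_add)
  moreover have "the (?x a) = X" "the (?x b) = Y" using D by (simp_all add: lat_det_simps)
  ultimately show ?thesis by (intro bexI[of _ ?x] conjI)
qed

lemma orbit_point_exists:
  assumes v: "v \<in> V" "lat_pair v a = 0" "lat_pair v b = 1" and d: "\<bar>lat_det a b\<bar> = 1" and X: "X \<noteq> 0"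
  shows "\<exists>x\<in>orbit v. the (x a) = X \<and> the (x b) = 0"
proof -
  let ?x = "\<lambda>m. if lat_pair v m < 0 then None else Some (if lat_pair v m = 0 then X powi (lat_det m b * lat_det a b) else 0)"
  have D: "lat_det a b * lat_det a b = 1" using d by (metis abs_mult_self_eq mult_1)
  have dm: "dom ?x = {m. lat_pair v m \<ge> 0}" by (auto simp: dom_def split: if_splits)
  have "the (?x (m + m')) = the (?x m) * the (?x m')" if "m \<in> dom ?x" "m' \<in> dom ?x" for m m'
    using that X unfolding dm by (auto simp: lat_pair_simps lat_det_simps distrib_right power_int_add)
  moreover have "the (?x m) \<noteq> 0 \<longleftrightarrow> - m \<in> dom ?x" if "m \<in> dom ?x" for m
    using that X unfolding dm by (auto simp: lat_pair_simps)
  moreover have "?x 0 = Some 1" by (simp add: lat_pair_simps lat_det_simps)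
  ultimately have "?x \<in> orbit v"
    unfolding torus_orbit_def half_plane_monoid[OF v(1)] using dm by blast
  moreover have "the (?x a) = X" "the (?x b) = 0" using v D by simp_all
  ultimately show ?thesis by (intro bexI[of _ ?x] conjI)
qed

section \<open>Charts around the divisors\<close>

abbreviation "ze v q \<equiv> the (bpoint_base q (e v))"
abbreviation "we v q \<equiv> the (bpoint_base q (f v))"

text \<open>z is shifted by 1 so that the special point becomes the origin, as in the later charts
  \<open>S v\<close>.\<close>

definition S0 :: "lat \<Rightarrow> tpoint chart" where
  "S0 v = (Pt ` (torus \<union> orbit v), \<lambda>q. (ze v q + 1, we v q))"

lemma torus_chart_eq: "torus_chart P = (Pt ` torus, mon (1, 0) (0, 1))"
  by (simp add: torus_chart_def mon_def)

lemma monomial: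
  assumes "x \<in> toric_variety P" "a \<in> dom x" "b \<in> dom x" "\<bar>lat_det a b\<bar> = 1" "the (x a) \<noteq> 0" "the (x b) \<noteq> 0"
  shows "the (x m) = the (x a) powi (lat_det m b * lat_det a b) * the (x b) powi (lat_det a m * lat_det a b)"
  using variety_combo(2)[OF assms(1,2) disjI1[OF assms(5)] assms(3) disjI1[OF assms(6)]]
  by (subst lat_basis[OF assms(4), of m])

lemma torus_monomial:
  assumes "x \<in> torus" "\<bar>lat_det a b\<bar> = 1"
  shows "the (x m) = the (x a) powi (lat_det m b * lat_det a b) * the (x b) powi (lat_det a m * lat_det a b)"
  using torus_sub assms(1) by (intro monomial[OF _ torus_dom torus_dom assms(2) torus_nonzero torus_nonzero]) blast+

text \<open>Stated for any set \<open>U\<close> of points on which both monomials are defined,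
  because it serves the toric charts and the charts around the divisors alike.\<close>

lemma mon_torus_rel:
  assumes U: "U \<subseteq> toric_variety P" "torus \<subseteq> U" and ab: "\<And>x. x \<in> U \<Longrightarrow> a \<in> dom x \<and> b \<in> dom x" "\<bar>lat_det a b\<bar> = 1"
    and q: "q \<in> Pt ` torus"
  shows "chart_rel q (Pt ` U, mon a b) (torus_chart P)"
proof -
  let ?V = "{p :: complex \<times> complex. fst p \<noteq> 0} \<inter> {p. snd p \<noteq> 0}"
  let ?g = "\<lambda>m p. fst p powi (lat_det m b * lat_det a b) * snd p powi (lat_det a m * lat_det a b)"
  let ?h = "\<lambda>m p. fst p powi (lat_det m (0, 1) * lat_det (1, 0) (0, 1)) * snd p powi (lat_det (1, 0) m * lat_det (1, 0) (0, 1))"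
  have d1: "\<bar>lat_det (1, 0) (0, 1)\<bar> = 1" by (simp add: lat_det_def)
  have sur: "?V \<subseteq> mon a b ` Pt ` torus" if d: "\<bar>lat_det a b\<bar> = 1" for a b
  proof
    fix p :: "complex \<times> complex" assume "p \<in> ?V"
    then have "fst p \<noteq> 0" "snd p \<noteq> 0" by simp_all
    from torus_point_exists[OF d this] obtain x where x: "x \<in> torus" "the (x a) = fst p" "the (x b) = snd p" by blast
    then have "p = mon a b (Pt x)" by simp
    then show "p \<in> mon a b ` Pt ` torus" using x(1) by blast
  qed
  have tor: "x \<in> torus \<longleftrightarrow> the (x a) \<noteq> 0 \<and> the (x b) \<noteq> 0" if "x \<in> U" for x
    using torus_of_nz[of x a b, OF _ _ _ ab(2)] ab(1)[OF that] that U(1) torus_nonzero[of x] by blast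
  show ?thesis
    unfolding torus_chart_eq
  proof (rule chart_rel_via[where W = "Pt ` torus" and V = ?V and V' = ?V
        and g = "\<lambda>p. (?g (1, 0) p, ?g (0, 1) p)" and h = "\<lambda>p. (?h a p, ?h b p)"])
    show "open ?V" "open ?V" by (intro open_Int open_fst_ne open_snd_ne)+
    show "?V \<subseteq> snd (Pt ` U, mon a b) ` Pt ` torus" "?V \<subseteq> snd (Pt ` torus, mon (1, 0) (0, 1)) ` Pt ` torus"
      using sur[OF ab(2)] sur[OF d1] by simp_all
    show "snd (Pt ` torus, mon (1, 0) (0, 1)) r = (?g (1, 0) (snd (Pt ` U, mon a b) r), ?g (0, 1) (snd (Pt ` U, mon a b) r))"
      if r: "r \<in> Pt ` torus" for r
    proof -
      obtain x where x: "r = Pt x" "x \<in> torus" using r by blast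
      show ?thesis using torus_monomial[OF x(2) ab(2), of "(1, 0)"] torus_monomial[OF x(2) ab(2), of "(0, 1)"] by (simp add: x(1))
    qed
    show "snd (Pt ` U, mon a b) r = (?h a (snd (Pt ` torus, mon (1, 0) (0, 1)) r), ?h b (snd (Pt ` torus, mon (1, 0) (0, 1)) r))"
      if r: "r \<in> Pt ` torus" for r
    proof -
      obtain x where x: "r = Pt x" "x \<in> torus" using r by blast
      show ?thesis using torus_monomial[OF x(2) d1, of a] torus_monomial[OF x(2) d1, of b] by (simp add: x(1))
    qed
    show "(snd (Pt ` U, mon a b) r \<in> ?V) = (r \<in> Pt ` torus)" if r: "r \<in> fst (Pt ` U, mon a b)" for r
    proof -
      obtain x where x: "r = Pt x" "x \<in> U" using r by auto
      have "(r \<in> Pt ` torus) = (x \<in> torus)" by (simp add: x(1) image_iff)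
      then show ?thesis using tor[OF x(2)] by (simp add: x(1))
    qed
    show "(snd (Pt ` torus, mon (1, 0) (0, 1)) r \<in> ?V) = (r \<in> Pt ` torus)" if "r \<in> fst (Pt ` torus, mon (1, 0) (0, 1))" for r
      using that by (auto simp: torus_nonzero torus_dom)
    show "rational_on ?V (\<lambda>p. fst (?g (1, 0) p, ?g (0, 1) p))" "rational_on ?V (\<lambda>p. snd (?g (1, 0) p, ?g (0, 1) p))"
      "rational_on ?V (\<lambda>p. fst (?h a p, ?h b p))" "rational_on ?V (\<lambda>p. snd (?h a p, ?h b p))"
      unfolding fst_conv snd_conv by (intro rational_on_intros; simp)+
    show "Pt ` torus \<subseteq> fst (Pt ` U, mon a b)" "Pt ` torus \<subseteq> fst (Pt ` torus, mon (1, 0) (0, 1))" "q \<in> Pt ` torus"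
      using U(2) q unfolding fst_conv by blast+
  qed
qed

lemma S0_torus_rel:
  assumes v: "v \<in> V" and q: "q \<in> Pt ` torus"
  shows "chart_rel q (S0 v) (torus_chart P)"
proof -
  let ?U = "torus \<union> orbit v"
  have "chart_rel q (Pt ` ?U, mon (e v) (f v)) (torus_chart P)"
  proof (rule mon_torus_rel)
    show "e v \<in> dom x \<and> f v \<in> dom x" if "x \<in> ?U" for x
      using that orbit_point_coords[OF v] torus_dom by blast
  qed (use torus_sub orbit_sub[OF v] coord(3)[OF v] q in blast)+
  moreover have "chart_rel q (S0 v) (Pt ` ?U, mon (e v) (f v))"
  proof (rule chart_relI)
    show "chart_iso (S0 v) (Pt ` ?U, mon (e v) (f v)) UNIV (\<lambda>p. (fst p - 1, snd p)) UNIV (\<lambda>p. (fst p + 1, snd p))"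
      unfolding chart_iso_def
    proof (intro conjI)
      show "rat_iso UNIV (\<lambda>p. (fst p - 1, snd p)) UNIV (\<lambda>p. (fst p + 1, snd p))"
      proof (rule rational_rat_isoI)
        show "rational_on UNIV (\<lambda>p :: complex \<times> complex. fst (fst p - 1, snd p))" "rational_on UNIV (\<lambda>p :: complex \<times> complex. snd (fst p - 1 :: complex, snd p))"
          "rational_on UNIV (\<lambda>p :: complex \<times> complex. fst (fst p + 1, snd p))" "rational_on UNIV (\<lambda>p :: complex \<times> complex. snd (fst p + 1 :: complex, snd p))"
          unfolding fst_conv snd_conv by (intro rational_on_intros)+
      qed simp_all
      show "\<forall>r. (r \<in> fst (S0 v) \<and> snd (S0 v) r \<in> UNIV) = (r \<in> fst (Pt ` ?U, mon (e v) (f v)) \<and> snd (Pt ` ?U, mon (e v) (f v)) r \<in> UNIV)"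
        by (simp add: S0_def)
      show "\<forall>r\<in>fst (S0 v). snd (S0 v) r \<in> UNIV \<longrightarrow> snd (Pt ` ?U, mon (e v) (f v)) r = (fst (snd (S0 v) r) - 1, snd (snd (S0 v) r))"
        by (simp add: S0_def mon_def)
    qed
    show "q \<in> fst (S0 v)" using q by (auto simp: S0_def)
  qed simp
  from chart_rel_trans[OF this calculation] show ?thesis .
qed

text \<open>In the basis \<open>a, b\<close> the exponent of \<open>b\<close> in a monomial is its
  pairing with \<open>v\<close>. This is nonnegative for the monomials that occur, so the change of
  coordinates extends over the divisor, where only \<open>a\<close> is invertible.\<close>

lemma mon_S0_rel:
  assumes U: "U \<subseteq> toric_variety P" "torus \<subseteq> U" "orbit v \<subseteq> U"
    and ab: "\<And>x. x \<in> U \<Longrightarrow> a \<in> dom x \<and> b \<in> dom x" "\<bar>lat_det a b\<bar> = 1"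
    and v: "v \<in> V" "lat_pair v a = 0" "lat_pair v b = 1"
    and q: "q \<in> Pt ` orbit v"
  shows "chart_rel q (Pt ` U, mon a b) (S0 v)"
proof -
  let ?W = "Pt ` (torus \<union> orbit v)"
  let ?V = "{p :: complex \<times> complex. fst p \<noteq> 0}" and ?V' = "{p :: complex \<times> complex. fst p \<noteq> 1}"
  have coef: "the (x m) = the (x a) powi (lat_det m b * lat_det a b) * the (x b) powi (lat_pair v m)"
    if "x \<in> torus \<union> orbit v" "a \<in> dom x" "b \<in> dom x" "the (x a) \<noteq> 0" "lat_pair v m \<ge> 0" "\<bar>lat_det a b\<bar> = 1" "lat_pair v a = 0" "lat_pair v b = 1" for x m a b
  proof -
    have m: "m = lat_scale (lat_det m b * lat_det a b) a + lat_scale (lat_pair v m) b"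
    proof -
      note L = lat_basis[OF that(6), of m]
      have "lat_pair v m = lat_det a m * lat_det a b" by (subst L) (simp add: lat_pair_simps that)
      then show ?thesis using L by simp
    qed
    have "x \<in> toric_variety P" using that(1) torus_sub orbit_sub[OF v(1)] by blast
    from variety_combo(2)[OF this that(2) _ that(3)] that(4,5) show ?thesis by (subst m) blast
  qed
  have nz: "the (x a) \<noteq> 0" if "x \<in> torus \<union> orbit v" for x
    using that orbit_unit[OF v(1), of x a] v(2) torus_nonzero[of x a] by auto
  have nz': "the (x (e v)) \<noteq> 0" "e v \<in> dom x" "f v \<in> dom x" if "x \<in> torus \<union> orbit v" for x
    using that orbit_point_coords[OF v(1), of x] torus_dom[of x] torus_nonzero[of x] by blast+
  have W: "x \<in> torus \<union> orbit v \<longleftrightarrow> the (x a) \<noteq> 0" if "x \<in> U" for x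
    using nz[of x] torus_or_orbit[of x a b v] that U(1) ab v by blast
  have sur: "\<exists>x\<in>torus \<union> orbit v. the (x a) = fst p \<and> the (x b) = snd p"
    if "fst p \<noteq> 0" "\<bar>lat_det a b\<bar> = 1" "lat_pair v a = 0" "lat_pair v b = 1" for p a b
    using torus_point_exists[OF that(2), of "fst p" "snd p"] orbit_point_exists[OF v(1) that(3,4,2), of "fst p"] that(1)
    by (cases "snd p = 0") auto
  let ?g = "\<lambda>p. (fst p powi (lat_det (e v) b * lat_det a b) + 1, fst p powi (lat_det (f v) b * lat_det a b) * snd p)"
  let ?h = "\<lambda>p. ((fst p - 1) powi (lat_det a (f v) * lat_det (e v) (f v)),
     (fst p - 1) powi (lat_det b (f v) * lat_det (e v) (f v)) * snd p)"
  show ?thesis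
  proof (rule chart_rel_via[where W = ?W and V = ?V and V' = ?V' and g = ?g and h = ?h])
    show "open ?V" "open ?V'" by (rule open_fst_ne)+
    show "?V \<subseteq> snd (Pt ` U, mon a b) ` ?W"
    proof
      fix p assume "p \<in> ?V"
      then obtain x where "x \<in> torus \<union> orbit v" "the (x a) = fst p" "the (x b) = snd p"
        using sur[OF _ ab(2) v(2,3), of p] by blast
      then show "p \<in> snd (Pt ` U, mon a b) ` ?W" by (intro image_eqI[of _ _ "Pt x"]) auto
    qed
    show "?V' \<subseteq> snd (S0 v) ` ?W"
    proof
      fix p assume "p \<in> ?V'"
      then obtain x where "x \<in> torus \<union> orbit v" "the (x (e v)) = fst p - 1" "the (x (f v)) = snd p"
        using sur[OF _ coord(3,1,2)[OF v(1)], of "(fst p - 1, snd p)"] by auto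
      then show "p \<in> snd (S0 v) ` ?W" by (intro image_eqI[of _ _ "Pt x"]) (auto simp: S0_def prod_eq_iff)
    qed
    show "(snd (Pt ` U, mon a b) r \<in> ?V) = (r \<in> ?W)" if r: "r \<in> fst (Pt ` U, mon a b)" for r
    proof -
      obtain x where x: "r = Pt x" "x \<in> U" using r by auto
      have "(r \<in> ?W) = (x \<in> torus \<union> orbit v)" unfolding x(1) by blast
      then show ?thesis using W[OF x(2)] by (simp add: x(1))
    qed
    show "(snd (S0 v) r \<in> ?V') = (r \<in> ?W)" if r: "r \<in> fst (S0 v)" for r
    proof -
      obtain x where x: "r = Pt x" "x \<in> torus \<union> orbit v" using r by (auto simp: S0_def)
      then show ?thesis using nz'(1)[OF x(2)] by (auto simp: S0_def)
    qed
    show "snd (S0 v) r = ?g (snd (Pt ` U, mon a b) r)" if "r \<in> ?W" for r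
    proof -
      obtain x where x: "r = Pt x" "x \<in> torus \<union> orbit v" using \<open>r \<in> ?W\<close> by blast
      then have d: "a \<in> dom x" "b \<in> dom x" using U ab(1)[of x] by blast+
      show ?thesis
        using coef[OF x(2) d nz[OF x(2)] _ ab(2) v(2,3), of "e v"] coef[OF x(2) d nz[OF x(2)] _ ab(2) v(2,3), of "f v"] coord[OF v(1)]
        by (simp add: x S0_def)
    qed
    show "snd (Pt ` U, mon a b) r = ?h (snd (S0 v) r)" if "r \<in> ?W" for r
    proof -
      obtain x where x: "r = Pt x" "x \<in> torus \<union> orbit v" using \<open>r \<in> ?W\<close> by blast
      note C = coef[OF x(2) nz'(2,3)[OF x(2)] nz'(1)[OF x(2)] _ coord(3,1,2)[OF v(1)]]
      show ?thesis using C[of a] C[of b] v by (simp add: x S0_def)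
    qed
    show "rational_on ?V (\<lambda>p. fst (?g p))" "rational_on ?V (\<lambda>p. snd (?g p))"
      "rational_on ?V' (\<lambda>p. fst (?h p))" "rational_on ?V' (\<lambda>p. snd (?h p))"
      unfolding fst_conv snd_conv by (intro rational_on_intros; simp)+
    show "?W \<subseteq> fst (Pt ` U, mon a b)" "?W \<subseteq> fst (S0 v)" "q \<in> ?W"
      using U(2,3) q unfolding fst_conv S0_def by blast+
  qed
qed

lemma S0_bij:
  assumes v: "v \<in> V"
  shows "bij_betw (snd (S0 v)) (fst (S0 v)) {x. fst x \<noteq> 1}"
proof (rule bij_betw_imageI)
  show "inj_on (snd (S0 v)) (fst (S0 v))"
  proof (rule inj_onI)
    fix q r assume q: "q \<in> fst (S0 v)" and r: "r \<in> fst (S0 v)" and eq: "snd (S0 v) q = snd (S0 v) r"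
    obtain x y where xy: "q = Pt x" "r = Pt y" "x \<in> torus \<union> orbit v" "y \<in> torus \<union> orbit v"
      using q r by (auto simp: S0_def)
    have ef: "the (x (e v)) = the (y (e v))" "the (x (f v)) = the (y (f v))" using eq by (auto simp: xy S0_def)
    consider "x \<in> torus" "y \<in> torus" | "x \<in> orbit v" "y \<in> orbit v"
      using ef(2) xy(3,4) orbit_point_coords(4)[OF v] by (auto simp: torus_nonzero torus_dom)
    then have "x = y"
    proof cases
      case 1
      have "the (x m) = the (y m)" for m
        using torus_monomial[OF 1(1) coord(3)[OF v], of m] torus_monomial[OF 1(2) coord(3)[OF v], of m] ef by simp
      then show ?thesis using torus_dom[OF 1(1)] torus_dom[OF 1(2)] by (metis domD ext option.sel)
    next
      case 2
      have "the (x m) = the (y m)" if m: "lat_pair v m \<ge> 0" for m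
      proof (cases "lat_pair v m = 0")
        case False
        then show ?thesis using orbit_unit[OF v 2(1) m] orbit_unit[OF v 2(2) m] by metis
      next
        case True
        note L = lat_basis[OF coord(3)[OF v], of m]
        have "lat_det (e v) m * lat_det (e v) (f v) = lat_pair v m" by (subst (2) L) (simp add: lat_pair_simps coord[OF v])
        then have z: "lat_det (e v) m * lat_det (e v) (f v) = 0" unfolding True .
        have m: "m = lat_scale (lat_det m (f v) * lat_det (e v) (f v)) (e v)" using L unfolding z by simp
        have var: "x \<in> toric_variety P" "y \<in> toric_variety P" using 2 orbit_sub[OF v] by blast+
        show ?thesis
          by (subst (1 2) m) (use variety_powi[OF var(1)] variety_powi[OF var(2)] orbit_point_coords[OF v] 2 ef in simp)
      qed
      note eq = this
      show ?thesis
      proof (rule ext)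
        fix m
        show "x m = y m"
        proof (cases "lat_pair v m \<ge> 0")
          case True
          then have "m \<in> dom x" "m \<in> dom y" using orbit_dom[OF v 2(1)] orbit_dom[OF v 2(2)] by blast+
          then show ?thesis using eq[OF True] by (metis domD option.sel)
        next
          case False
          then have "m \<notin> dom x" "m \<notin> dom y" using orbit_dom[OF v 2(1)] orbit_dom[OF v 2(2)] by blast+
          then show ?thesis by (simp add: domIff)
        qed
      qed
    qed
    then show "q = r" using xy by simp
  qed
  show "snd (S0 v) ` fst (S0 v) = {x. fst x \<noteq> 1}"
  proof
    show "snd (S0 v) ` fst (S0 v) \<subseteq> {x. fst x \<noteq> 1}"
      using orbit_point_coords(3)[OF v] by (auto simp: S0_def torus_nonzero)
    show "{x. fst x \<noteq> 1} \<subseteq> snd (S0 v) ` fst (S0 v)"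
    proof
      fix p :: "complex \<times> complex" assume p: "p \<in> {x. fst x \<noteq> 1}"
      then have p1: "fst p - 1 \<noteq> 0" by simp
      have "\<exists>x\<in>torus \<union> orbit v. the (x (e v)) = fst p - 1 \<and> the (x (f v)) = snd p"
        using torus_point_exists[OF coord(3)[OF v] p1, of "snd p"] orbit_point_exists[OF v coord(1,2,3)[OF v] p1]
        by (cases "snd p = 0") auto
      then show "p \<in> snd (S0 v) ` fst (S0 v)" by (auto simp: S0_def image_iff prod_eq_iff Bex_def)
    qed
  qed
qed

text \<open>Every lattice vector is a difference of two monoid elements, hence an integer
  combination of \<open>a\<close> and \<open>b\<close>; expressing the standard basis this way shows
  that the determinant divides 1.\<close>

lemma toric_chart_basis:
  assumes F: "F \<noteq> {}" and IJ: "I \<in> {UNIV, {0..}}" "J \<in> {UNIV, {0..}}"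
    "face_monoid P F = {lat_scale i a + lat_scale j b | i j. i \<in> I \<and> j \<in> J}"
  shows "a \<in> face_monoid P F" "b \<in> face_monoid P F" "\<bar>lat_det a b\<bar> = 1"
proof -
  have "(0::int) \<in> I" "1 \<in> I" "(0::int) \<in> J" "1 \<in> J" using IJ by auto
  moreover have "a = lat_scale 1 a + lat_scale 0 b" "b = lat_scale 0 a + lat_scale 1 b" by simp_all
  ultimately show "a \<in> face_monoid P F" "b \<in> face_monoid P F" unfolding IJ(3) by blast+
  obtain q where q: "q \<in> F" using F by blast
  have gen: "\<exists>i j. w = lat_scale i a + lat_scale j b" for w
  proof -
    obtain m where "m \<in> face_monoid P F" "m + w \<in> face_monoid P F" using face_monoid_generates[OF q] by blast
    then obtain i j i' j' where "m = lat_scale i a + lat_scale j b" "m + w = lat_scale i' a + lat_scale j' b"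
      unfolding IJ(3) by blast
    then have "w = lat_scale (i' - i) a + lat_scale (j' - j) b"
      by (simp add: lat_scale_def prod_eq_iff algebra_simps)
    then show ?thesis by blast
  qed
  obtain i j where 1: "(1, 0) = lat_scale i a + lat_scale j b" using gen by blast
  obtain k l where 2: "(0, 1) = lat_scale k a + lat_scale l b" using gen by blast
  have "lat_det (1, 0) (0, 1) = (i * l - j * k) * lat_det a b"
    unfolding 1 2 by (simp add: lat_det_simps lat_det_swap[of b a] algebra_simps)
  then have "(i * l - j * k) * lat_det a b = 1" by (simp add: lat_det_def)
  then show "\<bar>lat_det a b\<bar> = 1" by (auto simp: zmult_eq_1_iff)
qed

text \<open>The monoid contains \<open>e v\<close> or its negative, a nonzero element of pairing 0.
  If both generators paired positively, neither could be inverted and this element would have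
  coefficients 0. The generator left over pairs to 1 since \<open>f v\<close> does.\<close>

lemma toric_chart_edge:
  assumes F: "F \<noteq> {}" "F \<subseteq> P" and IJ: "I \<in> {UNIV, {0..}}" "J \<in> {UNIV, {0..}}"
    "face_monoid P F = {lat_scale i a + lat_scale j b | i j. i \<in> I \<and> j \<in> J}"
    and v: "v \<in> V" "face_monoid P F \<subseteq> {m. lat_pair v m \<ge> 0}"
  shows "lat_pair v a = 0 \<and> lat_pair v b = 1 \<or> lat_pair v b = 0 \<and> lat_pair v a = 1"
proof -
  note ab = toric_chart_basis[OF F(1) IJ]
  have ge: "lat_pair v a \<ge> 0" "lat_pair v b \<ge> 0" using ab v(2) by blast+
  have "F \<subseteq> dual_edge \<Delta> v" using face_monoid_half_plane[OF v(1) F(2) v(2)] .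
  from edge_direction[OF v(1) this F(1)] obtain s where s: "s = e v \<or> s = - e v" "s \<in> face_monoid P F" by blast
  then obtain i j where ij: "s = lat_scale i a + lat_scale j b" "i \<in> I" "j \<in> J" unfolding IJ(3) by blast
  have s0: "lat_pair v s = 0" "s \<noteq> 0"
    using s(1) coord[OF v(1)] by (auto simp: lat_pair_simps lat_det_simps)
  have I: "lat_pair v a = 0" if "I = UNIV"
  proof -
    have "lat_scale (-1) a + lat_scale 0 b \<in> face_monoid P F" unfolding IJ(3) using that IJ(2) by blast
    then show ?thesis using v(2) ge by (auto simp: lat_pair_simps)
  qed
  have J: "lat_pair v b = 0" if "J = UNIV"
  proof -
    have "lat_scale 0 a + lat_scale (-1) b \<in> face_monoid P F" unfolding IJ(3) using that IJ(1) by blast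
    then show ?thesis using v(2) ge by (auto simp: lat_pair_simps)
  qed
  have z: "lat_pair v a = 0 \<or> lat_pair v b = 0"
  proof (rule ccontr)
    assume n: "\<not> ?thesis"
    then have "i \<ge> 0" "j \<ge> 0" using I J IJ(1,2) ij by auto
    moreover have "i * lat_pair v a + j * lat_pair v b = 0" using s0(1) ij(1) by (simp add: lat_pair_simps)
    ultimately have "i * lat_pair v a = 0" "j * lat_pair v b = 0" using ge
      by (metis add_nonneg_eq_0_iff mult_nonneg_nonneg)+
    then show False using n s0(2) ij(1) by simp
  qed
  obtain k l where kl: "f v = lat_scale k a + lat_scale l b" using lat_basis[OF ab(3)] by blast
  have "k * lat_pair v a + l * lat_pair v b = 1" using coord(2)[OF v(1)] kl by (simp add: lat_pair_simps)
  then show ?thesis using z ge by (auto simp: zmult_eq_1_iff)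
qed

text \<open>The torus fixed points, the only points at which the surface may be singular.\<close>

definition "junk = Pt ` {x \<in> toric_variety P. x \<notin> torus \<and> (\<forall>v\<in>V. x \<notin> orbit v)}"

lemma toric_atlasE:
  assumes "c \<in> atlas (toric_surface P)"
  obtains F a b I J where "F face_of P" "F \<noteq> {}" "F \<subseteq> P" "I \<in> {UNIV, {0..}}" "J \<in> {UNIV, {0..}}"
    "face_monoid P F = {lat_scale i a + lat_scale j b | i j. i \<in> I \<and> j \<in> J}"
    "c = (Pt ` {x \<in> toric_variety P. face_monoid P F \<subseteq> dom x}, mon a b)"
proof -
  from assms obtain U \<phi> where 1: "(U, \<phi>) \<in> toric_charts P" "c = (Pt ` U, \<phi> \<circ> bpoint_base)"
    unfolding toric_surface_def by auto
  from 1(1) obtain F a b where F: "U = {x \<in> toric_variety P. face_monoid P F \<subseteq> dom x}" "\<phi> = (\<lambda>x. (the (x a), the (x b)))"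
      "F face_of P" "F \<noteq> {}"
    and IJ: "\<exists>I\<in>{UNIV, {0..}}. \<exists>J\<in>{UNIV, {0..}}. face_monoid P F = {lat_scale i a + lat_scale j b | i j. i \<in> I \<and> j \<in> J}"
    unfolding toric_charts_def by blast
  from IJ obtain I J where "I \<in> {UNIV, {0..}}" "J \<in> {UNIV, {0..}}"
    "face_monoid P F = {lat_scale i a + lat_scale j b | i j. i \<in> I \<and> j \<in> J}" by blast
  from that[OF F(3,4) face_of_imp_subset[OF F(3)] this] show ?thesis by (simp add: 1(2) F(1,2) mon_def)
qed

lemma toric_chart_props:
  assumes c: "c \<in> atlas (toric_surface P)"
  obtains U a b where "c = (Pt ` U, mon a b)" "U \<subseteq> toric_variety P" "torus \<subseteq> U"
    "\<forall>x\<in>U. a \<in> dom x \<and> b \<in> dom x" "\<bar>lat_det a b\<bar> = 1"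
    "\<forall>v\<in>V. \<forall>x\<in>U \<inter> orbit v. orbit v \<subseteq> U \<and>
       (lat_pair v a = 0 \<and> lat_pair v b = 1 \<or> lat_pair v b = 0 \<and> lat_pair v a = 1)"
proof -
  obtain F a b I J where F: "F face_of P" "F \<noteq> {}" "F \<subseteq> P" and IJ: "I \<in> {UNIV, {0..}}" "J \<in> {UNIV, {0..}}"
    "face_monoid P F = {lat_scale i a + lat_scale j b | i j. i \<in> I \<and> j \<in> J}"
    and ceq: "c = (Pt ` {x \<in> toric_variety P. face_monoid P F \<subseteq> dom x}, mon a b)"
    by (rule toric_atlasE[OF c])
  note ab = toric_chart_basis[OF F(2) IJ]
  show ?thesis
  proof (rule that[OF ceq _ _ _ ab(3)])
    show "torus \<subseteq> {x \<in> toric_variety P. face_monoid P F \<subseteq> dom x}" using torus_sub torus_dom by blast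
    show "\<forall>x\<in>{x \<in> toric_variety P. face_monoid P F \<subseteq> dom x}. a \<in> dom x \<and> b \<in> dom x" using ab by blast
    show "\<forall>v\<in>V. \<forall>x\<in>{x \<in> toric_variety P. face_monoid P F \<subseteq> dom x} \<inter> orbit v.
       orbit v \<subseteq> {x \<in> toric_variety P. face_monoid P F \<subseteq> dom x} \<and>
       (lat_pair v a = 0 \<and> lat_pair v b = 1 \<or> lat_pair v b = 0 \<and> lat_pair v a = 1)"
    proof (intro ballI)
      fix v x assume v: "v \<in> V" and x': "x \<in> {x \<in> toric_variety P. face_monoid P F \<subseteq> dom x} \<inter> orbit v"
      then have x: "x \<in> {x \<in> toric_variety P. face_monoid P F \<subseteq> dom x}" "x \<in> orbit v" by blast+
      have sub: "face_monoid P F \<subseteq> {m. lat_pair v m \<ge> 0}" using x orbit_dom[OF v x(2)] by blast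
      then have "orbit v \<subseteq> {x \<in> toric_variety P. face_monoid P F \<subseteq> dom x}"
        using orbit_sub[OF v] orbit_dom[OF v] by blast
      then show "orbit v \<subseteq> {x \<in> toric_variety P. face_monoid P F \<subseteq> dom x} \<and>
          (lat_pair v a = 0 \<and> lat_pair v b = 1 \<or> lat_pair v b = 0 \<and> lat_pair v a = 1)"
        using toric_chart_edge[OF F(2,3) IJ v sub] by blast
    qed
  qed blast
qed

text \<open>Either coordinate of the toric chart may be the one that vanishes on the divisor, whence
  the swap.\<close>

lemma toric_chart_S0_rel:
  assumes c: "c \<in> atlas (toric_surface P)" and v: "v \<in> V" and q: "q \<in> fst c" "q \<in> Pt ` orbit v"
  shows "chart_rel q c (S0 v)"
proof -
  obtain U a b where *: "c = (Pt ` U, mon a b)" "U \<subseteq> toric_variety P" "torus \<subseteq> U"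
    "\<forall>x\<in>U. a \<in> dom x \<and> b \<in> dom x" "\<bar>lat_det a b\<bar> = 1"
    "\<forall>v\<in>V. \<forall>x\<in>U \<inter> orbit v. orbit v \<subseteq> U \<and>
       (lat_pair v a = 0 \<and> lat_pair v b = 1 \<or> lat_pair v b = 0 \<and> lat_pair v a = 1)"
    by (rule toric_chart_props[OF c])
  obtain x where x: "q = Pt x" "x \<in> U" "x \<in> orbit v" using q *(1) by auto
  from *(6) v x(2,3) have U: "orbit v \<subseteq> U" and "lat_pair v a = 0 \<and> lat_pair v b = 1 \<or> lat_pair v b = 0 \<and> lat_pair v a = 1"
    by blast+
  have dm: "a \<in> dom x \<and> b \<in> dom x" "b \<in> dom x \<and> a \<in> dom x" if "x \<in> U" for x using *(4) that by blast+
  from \<open>lat_pair v a = 0 \<and> lat_pair v b = 1 \<or> lat_pair v b = 0 \<and> lat_pair v a = 1\<close> show ?thesis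
  proof
    assume "lat_pair v a = 0 \<and> lat_pair v b = 1"
    then show ?thesis unfolding *(1) using mon_S0_rel[OF *(2,3) U dm(1) *(5) v _ _ q(2)] by blast
  next
    assume l: "lat_pair v b = 0 \<and> lat_pair v a = 1"
    have d: "\<bar>lat_det b a\<bar> = 1" using *(5) by (simp add: lat_det_swap[of b a])
    have "chart_rel q (Pt ` U, mon b a) (S0 v)" using mon_S0_rel[OF *(2,3) U dm(2) d v _ _ q(2)] l by blast
    moreover have "swap_chart c = (Pt ` U, mon b a)" by (simp add: *(1) swap_chart_def mon_def fun_eq_iff)
    ultimately show ?thesis using chart_rel_trans[OF chart_rel_sym[OF chart_rel_swap[OF q(1)]]] by simp
  qed
qed

lemma base_stage:
  "blowup_stage V (torus_chart P) ze we (\<lambda>v q. special_point \<Delta> e v (bpoint_base q)) junk (\<lambda>_. 0)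
     (toric_surface P) (\<lambda>v. Pt ` toric_divisor \<Delta> v) S0 N"
proof -
  let ?T = "torus_chart P" and ?B = "toric_surface P"
  let ?Mod = "stage_models V ?T (\<lambda>_. 0) S0 N"
  have Mod: "?Mod = {?T} \<union> S0 ` V" unfolding stage_models_def by simp
  have Z: "\<Union>(fst ` ?Mod) = Pt ` torus \<union> (\<Union>v\<in>V. Pt ` orbit v)"
  proof -
    have "\<Union>(fst ` ?Mod) = fst ?T \<union> (\<Union>v\<in>V. fst (S0 v))" unfolding Mod by simp
    also have "\<dots> = Pt ` torus \<union> (\<Union>v\<in>V. Pt ` orbit v)" unfolding torus_chart_eq S0_def fst_conv image_Un by blast
    finally show ?thesis .
  qed
  \<comment> \<open>All charts are compared with one reference chart: the torus chart on the torus,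
    \<open>S0 v\<close> on the orbit of \<open>v\<close>.\<close>
  have relT: "chart_rel q c ?T" if r: "c \<in> atlas ?B \<union> ?Mod" "q \<in> Pt ` torus" "q \<in> fst c" for c q
  proof -
    consider "c \<in> atlas ?B" | "c = ?T" | v where "v \<in> V" "c = S0 v" using r(1) unfolding Mod by blast
    then show ?thesis
    proof cases
      case 1
      obtain U a b where *: "c = (Pt ` U, mon a b)" "U \<subseteq> toric_variety P" "torus \<subseteq> U"
        "\<forall>x\<in>U. a \<in> dom x \<and> b \<in> dom x" "\<bar>lat_det a b\<bar> = 1"
        "\<forall>v\<in>V. \<forall>x\<in>U \<inter> orbit v. orbit v \<subseteq> U \<and>
           (lat_pair v a = 0 \<and> lat_pair v b = 1 \<or> lat_pair v b = 0 \<and> lat_pair v a = 1)"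
        by (rule toric_chart_props[OF 1])
      show ?thesis unfolding *(1) by (rule mon_torus_rel[OF *(2,3) _ *(5) r(2)]) (use *(4) in blast)
    next
      case 2
      then show ?thesis using chart_rel_refl[OF r(3)] by simp
    next
      case (3 v)
      then show ?thesis using S0_torus_rel[OF 3(1) r(2)] by simp
    qed
  qed
  have relS: "chart_rel q c (S0 v)" if r: "c \<in> atlas ?B \<union> ?Mod" "v \<in> V" "q \<in> Pt ` orbit v" "q \<in> fst c" for c q v
  proof -
    consider "c \<in> atlas ?B" | "c = ?T" | u where "u \<in> V" "c = S0 u" using r(1) unfolding Mod by blast
    then show ?thesis
    proof cases
      case 1
      then show ?thesis using toric_chart_S0_rel[OF _ r(2,4,3)] by blast
    next
      case 2
      then show ?thesis using r(3,4) torus_orbit_disjoint[OF r(2)]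
        by (force simp: torus_chart_eq Pt_image_iff)
    next
      case (3 u)
      obtain x where x: "q = Pt x" "x \<in> orbit v" using r(3) by blast
      have "x \<in> torus \<union> orbit u" using r(4) unfolding 3 S0_def fst_conv x Pt_image_iff .
      then have "u = v" using torus_orbit_disjoint[OF r(2) x(2)] orbit_unique[OF 3(1) r(2)] x(2) by blast
      then show ?thesis using 3(2) chart_rel_refl[OF r(4)] by simp
    qed
  qed
  have mono: "face_monoid P G \<subseteq> face_monoid P H" if "G \<subseteq> H" for G H
    using that unfolding face_monoid_def by blast
  have divisor: "x \<in> toric_divisor \<Delta> v \<longleftrightarrow> (\<exists>G. G face_of P \<and> G \<noteq> {} \<and> G \<subseteq> dual_edge \<Delta> v \<and> x \<in> torus_orbit P G)" for x v
    unfolding toric_divisor_def P_def by blast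
  have divisor_dom: "dom x \<subseteq> {m. lat_pair v m \<ge> 0}" if x: "v \<in> V" "x \<in> toric_divisor \<Delta> v" for v x
  proof -
    obtain G where G: "G \<subseteq> dual_edge \<Delta> v" "x \<in> torus_orbit P G" using x(2) divisor by blast
    show ?thesis unfolding torus_orbitD(1)[OF G(2)] half_plane_monoid[OF x(1), symmetric] by (rule mono[OF G(1)])
  qed
  have divisor_torus: "x \<notin> torus" if "v \<in> V" "x \<in> toric_divisor \<Delta> v" for v x
  proof
    assume "x \<in> torus"
    then have "lat_pair v (- f v) \<ge> 0" using divisor_dom[OF that] torus_dom by blast
    then show False using coord(2)[OF that(1)] by (simp add: lat_pair_simps)
  qed
  have divisor_orbit: "u = v" if "v \<in> V" "u \<in> V" "x \<in> toric_divisor \<Delta> v" "x \<in> orbit u" for u v x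
    using divisor_dom[OF that(1,3)] orbit_dom[OF that(2,4)] by (intro half_plane_unique that) blast
  have orbit_divisor: "x \<in> toric_divisor \<Delta> v" if "v \<in> V" "x \<in> orbit v" for v x
    unfolding divisor using dual_edge_face[OF that(1)] dual_edge_nonempty[OF that(1)] that(2) by blast
  have divisor_variety: "toric_divisor \<Delta> v \<subseteq> toric_variety P" for v
    unfolding subset_iff divisor toric_variety_def by blast
  have variety: "Pt ` toric_variety P \<subseteq> \<Union>(fst ` ?Mod) \<union> junk"
    unfolding Z junk_def by blast
  have S_zero: "{q \<in> fst (S0 v). snd (snd (S0 v) q) = 0} = Pt ` orbit v" if "v \<in> V" for v
  proof (intro set_eqI)
    fix q
    show "q \<in> {q \<in> fst (S0 v). snd (snd (S0 v) q) = 0} \<longleftrightarrow> q \<in> Pt ` orbit v"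
    proof (cases "q \<in> fst (S0 v)")
      case True
      then obtain x where x: "q = Pt x" "x \<in> torus \<union> orbit v" unfolding S0_def fst_conv by blast
      then show ?thesis using True orbit_point_coords(4)[OF that, of x] torus_nonzero[of x "f v"] torus_orbit_disjoint[OF that, of x]
        by (auto simp: S0_def Pt_image_iff)
    next
      case False
      then show ?thesis unfolding S0_def fst_conv by blast
    qed
  qed
  have atlas_sub: "fst c \<subseteq> Pt ` toric_variety P" if "c \<in> atlas ?B" for c
    by (rule toric_chart_props[OF that]) auto
  show ?thesis
  proof (unfold_locales)
    show "ze v q \<noteq> 0 \<and> we v q \<noteq> 0" if q: "v \<in> V" "q \<in> fst ?T" for v q
    proof -
      obtain x where "q = Pt x" "x \<in> torus" using q unfolding torus_chart_eq fst_conv by blast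
      then show ?thesis by (simp add: torus_nonzero)
    qed
    show "\<not> special_point \<Delta> e v (bpoint_base q)" if q: "q \<in> junk" "v \<in> V" for v q
    proof -
      obtain x where x: "q = Pt x" "x \<notin> orbit v" using q unfolding junk_def by blast
      show ?thesis using x(2) unfolding x(1) bpoint_base.simps special_point_def P_def by blast
    qed
    show "junk \<subseteq> range Pt" by (auto simp: junk_def)
    show "chart_rel q c d" if "q \<in> \<Union>(fst ` ?Mod)" "c \<in> atlas ?B \<union> ?Mod" "d \<in> atlas ?B \<union> ?Mod" "q \<in> fst c" "q \<in> fst d" for q c d
    proof -
      from that(1) consider "q \<in> Pt ` torus" | v where "v \<in> V" "q \<in> Pt ` orbit v" unfolding Z by blast
      then show ?thesis
      proof cases
        case 1
        show ?thesis
          by (rule chart_rel_trans[OF relT[OF that(2) 1 that(4)] chart_rel_sym[OF relT[OF that(3) 1 that(5)]]])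
      next
        case (2 v)
        show ?thesis
          by (rule chart_rel_trans[OF relS[OF that(2) 2 that(4)] chart_rel_sym[OF relS[OF that(3) 2 that(5)]]])
      qed
    qed
    show "inj_on (snd c) (fst c \<inter> \<Union>(fst ` ?Mod))" if c: "c \<in> atlas ?B" for c
    proof (rule inj_onI)
      fix q r assume q: "q \<in> fst c \<inter> \<Union>(fst ` ?Mod)" and r: "r \<in> fst c \<inter> \<Union>(fst ` ?Mod)" and eq: "snd c q = snd c r"
      obtain U a b where *: "c = (Pt ` U, mon a b)" "U \<subseteq> toric_variety P" "torus \<subseteq> U"
        "\<forall>x\<in>U. a \<in> dom x \<and> b \<in> dom x" "\<bar>lat_det a b\<bar> = 1"
        "\<forall>v\<in>V. \<forall>x\<in>U \<inter> orbit v. orbit v \<subseteq> U \<and>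
           (lat_pair v a = 0 \<and> lat_pair v b = 1 \<or> lat_pair v b = 0 \<and> lat_pair v a = 1)"
        by (rule toric_chart_props[OF c])
      obtain x y where xy: "q = Pt x" "r = Pt y" "x \<in> U" "y \<in> U" using q r *(1) by auto
      have vals: "the (x a) = the (y a)" "the (x b) = the (y b)" using eq xy *(1) by auto
      have orb: "x \<in> orbit v \<Longrightarrow> v \<in> V \<Longrightarrow> x \<in> U \<Longrightarrow> (the (x a) \<noteq> 0 \<and> the (x b) = 0 \<and> lat_pair v a = 0 \<and> lat_pair v b = 1) \<or>
          (the (x b) \<noteq> 0 \<and> the (x a) = 0 \<and> lat_pair v b = 0 \<and> lat_pair v a = 1)" for x v
        using bspec[OF bspec[OF *(6), of v], of x] orbit_unit[of v x a] orbit_unit[of v x b] by auto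
      have cs: "x \<in> torus \<or> (\<exists>v\<in>V. x \<in> orbit v)" "y \<in> torus \<or> (\<exists>v\<in>V. y \<in> orbit v)"
        using q r unfolding Z xy(1,2) by (simp_all add: Pt_image_iff)
      show "q = r"
      proof (cases "the (x a) \<noteq> 0 \<and> the (x b) \<noteq> 0")
        case True
        then have t: "x \<in> torus" "y \<in> torus"
          using torus_of_nz[of x a b] torus_of_nz[of y a b] *(2,4,5) xy(3,4) vals by auto
        have "the (x m) = the (y m)" for m
          using torus_monomial[OF t(1) *(5), of m] torus_monomial[OF t(2) *(5), of m] vals by simp
        then have "x = y" using torus_dom[OF t(1)] torus_dom[OF t(2)] by (metis domD ext option.sel)
        then show ?thesis using xy by simp
      next
        case False
        then have nt: "x \<notin> torus" "y \<notin> torus" using vals by (auto simp: torus_nonzero torus_dom)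
        then obtain v u where vu: "v \<in> V" "x \<in> orbit v" "u \<in> V" "y \<in> orbit u" using cs by blast
        \<comment> \<open>The vanishing coordinate tells which generator pairs to 1, so equal values
          determine the pairings and thereby the vertex; injectivity then comes from
          \<open>S0 v\<close>.\<close>
        have same: "lat_pair v a = lat_pair u a" "lat_pair v b = lat_pair u b"
          using orb[OF vu(2,1) xy(3)] orb[OF vu(4,3) xy(4)] vals by auto
        have "lat_pair v m = lat_pair u m" for m
          by (subst (1 2) lat_basis[OF *(5), of m]) (simp add: lat_pair_simps same)
        then have uv: "v = u" by (intro half_plane_unique vu) simp
        have "chart_rel q c (S0 v)" "chart_rel r c (S0 v)"
          using toric_chart_S0_rel[OF c vu(1)] q r vu(2,4) uv xy by blast+
        then obtain W g W' h where W: "chart_iso c (S0 v) W g W' h" "snd c q \<in> W" by (auto elim: chart_relE)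
        have "snd (S0 v) q = snd (S0 v) r" "q \<in> fst (S0 v)" "r \<in> fst (S0 v)"
          using chart_isoD[OF W(1), of q] chart_isoD[OF W(1), of r] W(2) eq q r by auto
        then show ?thesis using bij_betw_imp_inj_on[OF S0_bij[OF vu(1)]] by (auto dest: inj_onD)
      qed
    qed
    show "q' \<notin> ancestors q" if q: "q \<in> \<Union> (fst ` atlas ?B)" "q' \<in> \<Union> (fst ` atlas ?B)" for q q'
    proof -
      have "q \<in> range Pt" using q(1) atlas_sub by blast
      then show ?thesis by auto
    qed
    have chartI: "(Pt ` {x \<in> toric_variety P. face_monoid P F \<subseteq> dom x}, mon a b) \<in> atlas ?B"
      if "F face_of P" "F \<noteq> {}" "I \<in> {UNIV, {0..}}" "J \<in> {UNIV, {0..}}" "face_monoid P F = {lat_scale i a + lat_scale j b | i j. i \<in> I \<and> j \<in> J}" for F a b I J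
    proof -
      have "({x \<in> toric_variety P. face_monoid P F \<subseteq> dom x}, \<lambda>x. (the (x a), the (x b))) \<in> toric_charts P"
        unfolding toric_charts_def mem_Collect_eq using that by (intro exI[of _ F] exI[of _ a] exI[of _ b] conjI refl bexI[of _ I] bexI[of _ J])
      then show ?thesis unfolding toric_surface_def surface.simps mon_def by blast
    qed
    show T: "?T \<in> atlas ?B"
    proof -
      have "face_monoid P P = {lat_scale i (1, 0) + lat_scale j (0, 1) | i j. i \<in> UNIV \<and> j \<in> UNIV}"
        unfolding torus_monoid by (force simp: lat_scale_def)
      from chartI[OF face_of_refl[OF convex_P] P_nonempty _ _ this]
      have "(Pt ` {x \<in> toric_variety P. face_monoid P P \<subseteq> dom x}, mon (1, 0) (0, 1)) \<in> atlas ?B" by simp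
      moreover have "{x \<in> toric_variety P. face_monoid P P \<subseteq> dom x} = torus"
        using torusI torus_sub torus_dom unfolding torus_monoid by blast
      ultimately show ?thesis by (simp add: torus_chart_eq)
    qed
    show "\<Union>(fst ` ?Mod) \<subseteq> \<Union> (fst ` atlas ?B)"
    proof -
      have "Pt ` torus \<subseteq> \<Union> (fst ` atlas ?B)" using T by (auto simp: torus_chart_eq intro!: bexI[of _ ?T])
      moreover have "Pt ` orbit v \<subseteq> \<Union> (fst ` atlas ?B)" if v: "v \<in> V" for v
      proof -
        have "face_monoid P (dual_edge \<Delta> v) = {lat_scale i (e v) + lat_scale j (f v) | i j. i \<in> UNIV \<and> j \<in> {0..}}"
        proof -
          have "\<exists>i j. m = lat_scale i (e v) + lat_scale j (f v) \<and> j \<ge> 0" if "lat_pair v m \<ge> 0" for m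
          proof -
            note L = lat_basis[OF coord(3)[OF v], of m]
            have "lat_pair v m = lat_det (e v) m * lat_det (e v) (f v)" by (subst L) (simp add: lat_pair_simps coord[OF v])
            then show ?thesis using L that by metis
          qed
          moreover have "lat_pair v (lat_scale i (e v) + lat_scale j (f v)) = j" for i j
            by (simp add: lat_pair_simps coord[OF v])
          ultimately show ?thesis unfolding half_plane_monoid[OF v] by auto
        qed
        from chartI[OF dual_edge_face[OF v] dual_edge_nonempty[OF v] _ _ this]
        have "(Pt ` {x \<in> toric_variety P. face_monoid P (dual_edge \<Delta> v) \<subseteq> dom x}, mon (e v) (f v)) \<in> atlas ?B" by simp
        moreover have "orbit v \<subseteq> {x \<in> toric_variety P. face_monoid P (dual_edge \<Delta> v) \<subseteq> dom x}"
          using orbit_sub[OF v] orbit_dom[OF v] half_plane_monoid[OF v] by blast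
        ultimately show ?thesis by (metis (no_types, lifting) UN_upper fst_conv image_mono order_trans)
      qed
      ultimately show ?thesis unfolding Z by blast
    qed
    show "bij_betw (snd (S0 v)) (fst (S0 v)) {x. fst x \<noteq> 1}" if "v \<in> V" for v by (rule S0_bij[OF that])
    show "(q \<in> fst (S0 v)) = (0 = (0::nat) \<or> ze v q \<noteq> - 1)" if "v \<in> V" "q \<in> fst ?T" for v q
      using that by (auto simp: S0_def torus_chart_eq)
    show "snd (S0 v) q = (ze v q + 1, we v q / (ze v q + 1) ^ 0)" for v q by (simp add: S0_def)
    show "q \<in> fst ?T" if "v \<in> V" "q \<in> fst (S0 v)" "snd (snd (S0 v) q) \<noteq> 0" for v q
      using that S_zero[OF that(1)] by (auto simp: S0_def torus_chart_eq)
    show "\<not> special_point \<Delta> e v (bpoint_base q)" if "v \<in> V" "q \<in> fst (S0 v)" "snd (snd (S0 v) q) = 0" "fst (snd (S0 v) q) \<noteq> 0" for v q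
      using that by (auto simp: S0_def special_point_def)
    show "Pt ` toric_divisor \<Delta> v \<inter> \<Union>(fst ` ?Mod) = {q \<in> fst (S0 v). snd (snd (S0 v) q) = 0}" if "v \<in> V" for v
      unfolding S_zero[OF that] Z using divisor_torus[OF that] divisor_orbit[OF that] orbit_divisor[OF that] that by blast
    show "Pt ` toric_divisor \<Delta> v \<subseteq> \<Union>(fst ` ?Mod) \<union> junk" for v
      using variety divisor_variety by blast
    show "fst c \<subseteq> \<Union>(fst ` ?Mod) \<union> junk" if "c \<in> atlas ?B" for c using variety atlas_sub[OF that] by blast
    show "junk \<subseteq> (\<Union>v\<in>V. Pt ` toric_divisor \<Delta> v)"
    proof
      fix q assume "q \<in> junk"
      then obtain x where x: "q = Pt x" "x \<in> toric_variety P" "x \<notin> torus" by (auto simp: junk_def)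
      obtain F where F: "F face_of P" "F \<noteq> {}" "x \<in> torus_orbit P F" using varietyE[OF x(2)] by metis
      then have "F \<noteq> P" using x(3) by auto
      then obtain v where "v \<in> V" "F \<subseteq> dual_edge \<Delta> v" using proper_face F by blast
      then show "q \<in> (\<Union>v\<in>V. Pt ` toric_divisor \<Delta> v)" using F x(1) divisor by blast
    qed
    show "q \<notin> fst ?T \<and> (\<forall>u\<in>V. \<forall>j\<in>{1..0}. q \<notin> fst (N u j)) \<and> (\<forall>u\<in>V. u \<noteq> v \<longrightarrow> q \<notin> fst (S0 u))"
      if "v \<in> V" "q \<in> fst (S0 v)" "snd (snd (S0 v) q) = 0" for v q
    proof -
      have q: "q \<in> Pt ` orbit v" using S_zero[OF that(1)] that by blast
      then have "q \<notin> fst ?T" using torus_orbit_disjoint[OF that(1)] by (auto simp: torus_chart_eq)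
      moreover have "q \<notin> fst (S0 u)" if "u \<in> V" "u \<noteq> v" for u
        using q torus_orbit_disjoint[OF \<open>v \<in> V\<close>] orbit_unique[OF \<open>v \<in> V\<close> that(1)] that(2) by (auto simp: S0_def)
      ultimately show ?thesis by simp
    qed
  qed auto
qed

end


section \<open>The mirror space\<close>

lemma holonomy_nrat:
  "nrat ({p. fst p \<noteq> 0} \<inter> {p. snd p \<noteq> 0}) (\<lambda>p. fst p powi fst m * snd p powi snd m) (\<lambda>P. holonomy P m)"
  unfolding holonomy_def by (intro nrat.nrat_mult nrat_powi nrat.nrat_fst nrat.nrat_snd) auto

lemma torus_deformations: "P \<in> deformations Torus \<longleftrightarrow> P \<in> thickening ({p. fst p \<noteq> 0} \<inter> {p. snd p \<noteq> 0})"
  by (cases P) (auto simp: deformations_def Lam0_units_eq thickening_def residue2_def)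

lemma sphere_deformations:
  "(x, y) \<in> deformations (Sphere v j) \<longleftrightarrow> x \<in> Lam0 \<and> y \<in> Lam0 \<and> residue x * residue y = 0"
  by (auto simp: deformations_def nval_pos_iff)

text \<open>The equations are inverted by Cramer exponents in the multiplicative group; the
  resulting monomials have nonzero residues because \<open>z\<close> and \<open>x\<close>
  do.\<close>

lemma holonomy_solution:
  assumes d: "\<bar>lat_det a b\<bar> = 1" and z: "z \<in> Lam0" "residue z \<noteq> 0" and x: "x \<in> Lam0" "residue x \<noteq> 0"
  obtains P where "P \<in> deformations Torus" "holonomy P a = z" "holonomy P b = x"
proof -
  define h where "h m = holonomy (z, x) (lat_det m b * lat_det a b, lat_det a m * lat_det a b)" for m
  have nz: "z \<noteq> 0" "x \<noteq> 0" using z x by auto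
  have D: "lat_det a b * lat_det a b = 1" using d by (metis abs_mult_self_eq mult_1)
  have ab: "h a = z" "h b = x" using D by (simp_all add: h_def holonomy_def lat_det_simps)
  have "(z, x) \<in> thickening ({p. fst p \<noteq> 0} \<inter> {p. snd p \<noteq> 0})"
    using z x by (simp add: thickening_def residue2_def)
  then have "h m \<in> Lam0 \<and> residue (h m) \<noteq> 0" for m
    using nrat_residue[OF holonomy_nrat, of "(z, x)"] z x by (simp add: h_def residue2_def)
  then have "(h (1, 0), h (0, 1)) \<in> deformations Torus"
    by (simp add: torus_deformations thickening_def residue2_def)
  moreover have "holonomy (h (1, 0), h (0, 1)) m = h m" for m
  proof -
    have "lat_det m b = fst m * lat_det (1, 0) b + snd m * lat_det (0, 1) b"
      "lat_det a m = fst m * lat_det a (1, 0) + snd m * lat_det a (0, 1)"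
      by (simp_all add: lat_det_def algebra_simps)
    then show ?thesis using nz
      by (simp add: h_def holonomy_def power_int_mult_distrib power_int_mult[symmetric] power_int_add ring_distribs mult_ac)
  qed
  ultimately show ?thesis using that ab by metis
qed

text \<open>Openness is inherited from \<open>d\<close>: a value near that of \<open>q\<close> whose
  image under \<open>g\<close> is attained in \<open>d\<close> is attained in \<open>c\<close>,
  since there the two charts have the same points.\<close>

lemma chart_rel_open:
  assumes "chart_rel q c d" "open (snd d ` fst d)"
  shows "\<exists>U. open U \<and> snd c q \<in> U \<and> U \<subseteq> snd c ` fst c"
proof -
  obtain V g V' h where *: "chart_iso c d V g V' h" "q \<in> fst c" "snd c q \<in> V" "q \<in> fst d" "snd d q = g (snd c q)"
    using assms(1) by (elim chart_relE)
  then have iso: "rat_iso V g V' h"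
    and dom: "\<forall>r. r \<in> fst c \<and> snd c r \<in> V \<longleftrightarrow> r \<in> fst d \<and> snd d r \<in> V'"
    and eq: "\<forall>r\<in>fst c. snd c r \<in> V \<longrightarrow> snd d r = g (snd c r)"
    unfolding chart_iso_def by blast+
  note I = rat_isoD[OF iso]
  let ?U = "{p \<in> V. g p \<in> snd d ` fst d}"
  have "?U \<subseteq> snd c ` fst c"
  proof
    fix p assume p: "p \<in> ?U"
    then obtain r where r: "r \<in> fst d" "g p = snd d r" by blast
    then have "snd d r \<in> V'" using I(7)[of p] p by simp
    then have "r \<in> fst c" "snd c r \<in> V" using dom r(1) by blast+
    moreover from this have "p = snd c r" using eq r(2) I(9)[of p] I(9)[of "snd c r"] p by auto
    ultimately show "p \<in> snd c ` fst c" by blast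
  qed
  moreover have "open ?U" by (rule rational_on_open_preimage[OF I(1,3,4) assms(2)])
  ultimately show ?thesis using *(3,4,5) by (intro exI[of _ ?U]) force
qed

lemma open_product_ne_one: "open {x :: complex \<times> complex. fst x * snd x \<noteq> 1}"
proof -
  have "open {x \<in> UNIV. fst x * snd x - 1 \<noteq> (0 :: complex)}"
    by (rule rational_on_open_nz[OF open_UNIV]) (intro rational_on_intros)
  then show ?thesis by simp
qed

context dual_polygon
begin

lemma torus_chart_bij: "bij_betw (snd (torus_chart P)) (fst (torus_chart P)) ({p. fst p \<noteq> 0} \<inter> {p. snd p \<noteq> 0})"
proof (rule bij_betw_imageI)
  have d: "\<bar>lat_det (1, 0) (0, 1)\<bar> = 1" by (simp add: lat_det_def)
  show "inj_on (snd (torus_chart P)) (fst (torus_chart P))"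
  proof (rule inj_onI)
    fix q r assume qr: "q \<in> fst (torus_chart P)" "r \<in> fst (torus_chart P)" "snd (torus_chart P) q = snd (torus_chart P) r"
    then obtain x y where xy: "q = Pt x" "x \<in> torus" "r = Pt y" "y \<in> torus" unfolding torus_chart_eq fst_conv by blast
    have vals: "the (x (1, 0)) = the (y (1, 0))" "the (x (0, 1)) = the (y (0, 1))"
      using qr(3) xy by (simp_all add: torus_chart_eq)
    have "the (x m) = the (y m)" for m
      using torus_monomial[OF xy(2) d, of m] torus_monomial[OF xy(4) d, of m] vals by simp
    then have "x = y" using torus_dom[OF xy(2)] torus_dom[OF xy(4)] by (metis domD ext option.sel)
    then show "q = r" using xy by simp
  qed
  show "snd (torus_chart P) ` fst (torus_chart P) = {p. fst p \<noteq> 0} \<inter> {p. snd p \<noteq> 0}"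
  proof (intro set_eqI iffI)
    fix p assume "p \<in> snd (torus_chart P) ` fst (torus_chart P)"
    then obtain x where "x \<in> torus" "p = mon (1, 0) (0, 1) (Pt x)" unfolding torus_chart_eq by auto
    then show "p \<in> {p. fst p \<noteq> 0} \<inter> {p. snd p \<noteq> 0}" by (simp add: torus_nonzero)
  next
    fix p :: "complex \<times> complex" assume "p \<in> {p. fst p \<noteq> 0} \<inter> {p. snd p \<noteq> 0}"
    then have "fst p \<noteq> 0" "snd p \<noteq> 0" by simp_all
    from torus_point_exists[OF d this] obtain x where x: "x \<in> torus" "the (x (1, 0)) = fst p" "the (x (0, 1)) = snd p" by blast
    then have "p = mon (1, 0) (0, 1) (Pt x)" by simp
    then show "p \<in> snd (torus_chart P) ` fst (torus_chart P)" unfolding torus_chart_eq using x(1) by force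
  qed
qed

lemma torus_chart_monomial:
  assumes "q \<in> fst (torus_chart P)"
  shows "the (bpoint_base q m) = fst (snd (torus_chart P) q) powi fst m * snd (snd (torus_chart P) q) powi snd m"
proof -
  obtain x where x: "q = Pt x" "x \<in> torus" using assms unfolding torus_chart_eq fst_conv by blast
  have "\<bar>lat_det (1, 0) (0, 1)\<bar> = 1" by (simp add: lat_det_def)
  from torus_monomial[OF x(2) this, of m] show ?thesis by (simp add: x(1) torus_chart_eq lat_det_def)
qed

lemma special_blowups_stage:
  "special_blowups \<Delta> e k B D \<Longrightarrow> \<exists>S N. blowup_stage V (torus_chart P) ze we
     (\<lambda>v q. special_point \<Delta> e v (bpoint_base q)) junk k B D S N"
proof (induction rule: special_blowups.induct)
  case start
  show ?case using base_stage unfolding P_def by blast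
next
  case (step k B D v p c)
  then obtain S N where "blowup_stage V (torus_chart P) ze we (\<lambda>v q. special_point \<Delta> e v (bpoint_base q)) junk k B D S N"
    by blast
  from blowup_stage.stage_Suc[OF this] step(2-6) show ?case unfolding V_def by blast
qed

context
  fixes n :: "lat \<Rightarrow> nat" and B :: "tpoint surface" and D S N
  assumes stage: "blowup_stage V (torus_chart P) ze we (\<lambda>v q. special_point \<Delta> e v (bpoint_base q)) junk
    (\<lambda>v. if v \<in> V then n v + 1 else 0) B D S N"
begin

interpretation blowup_stage V "torus_chart P" ze we "\<lambda>v q. special_point \<Delta> e v (bpoint_base q)" junk
    "\<lambda>v. if v \<in> V then n v + 1 else 0" B D S N
    "stage_models V (torus_chart P) (\<lambda>v. if v \<in> V then n v + 1 else 0) S N"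
    "\<Union>(fst ` stage_models V (torus_chart P) (\<lambda>v. if v \<in> V then n v + 1 else 0) S N)"
  by (rule stage reflexive)+

section \<open>The Lagrangian charts inside the complement of the divisors\<close>

abbreviation "T \<equiv> torus_chart P"
abbreviation "W \<equiv> - (\<Union>v\<in>V. D v)"
abbreviation "M \<equiv> restrict_surface B W"
abbreviation "A \<equiv> mirror_points \<Delta> n"
abbreviation "R \<equiv> mirror_gluing \<Delta> n e f"

definition lagrangian_chart :: "lagrangian \<Rightarrow> tpoint chart" where
  "lagrangian_chart l = (case l of Torus \<Rightarrow> T | Sphere v j \<Rightarrow> N v j)"

definition lagrangians :: "lagrangian set" where
  "lagrangians = {Torus} \<union> {Sphere v j | v j. v \<in> V \<and> j \<in> {1..n v + 1}}"

abbreviation "charts \<equiv> atlas M \<union> lagrangian_chart ` lagrangians"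

lemma lagrangian_chart_simps [simp]: "lagrangian_chart Torus = T" "lagrangian_chart (Sphere v j) = N v j"
  by (simp_all add: lagrangian_chart_def)

lemma lagrangians_simps [simp]: "Torus \<in> lagrangians" "Sphere v j \<in> lagrangians \<longleftrightarrow> v \<in> V \<and> 1 \<le> j \<and> j \<le> n v + 1"
  unfolding lagrangians_def by blast (unfold atLeastAtMost_iff[symmetric], blast)

lemma lagrangiansE:
  assumes "l \<in> lagrangians"
  obtains "l = Torus" | v j where "l = Sphere v j" "v \<in> V" "1 \<le> j" "j \<le> n v + 1"
  using assms unfolding lagrangians_def by auto

lemma mirror_point_iff: "(l, Q) \<in> A \<longleftrightarrow> l \<in> lagrangians \<and> Q \<in> deformations l"
  unfolding mirror_points_def lagrangians_def V_def by auto

lemma models_lagrangian: "l \<in> lagrangians \<Longrightarrow> lagrangian_chart l \<in> stage_models V T (\<lambda>v. if v \<in> V then n v + 1 else 0) S N"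
  by (elim lagrangiansE) (use models in auto)

lemma lagrangian_chart_sub:
  assumes "l \<in> lagrangians"
  shows "fst (lagrangian_chart l) \<subseteq> W"
proof
  fix q assume q: "q \<in> fst (lagrangian_chart l)"
  show "q \<in> W"
  proof
    assume "q \<in> (\<Union>v\<in>V. D v)"
    then obtain v where v: "v \<in> V" "q \<in> D v" by blast
    have "q \<in> {q \<in> fst (S v). snd (snd (S v) q) = 0}"
      using v(2) q model_sub[OF models_lagrangian[OF assms]] unfolding D_Z[OF v(1), symmetric] by blast
    then have *: "q \<notin> fst T" "\<forall>u\<in>V. \<forall>j\<in>{1..n u + 1}. q \<notin> fst (N u j)"
      using D_models[OF v(1), of q] by auto
    show False using assms by (cases rule: lagrangiansE) (use q * in auto)
  qed
qed

lemma lagrangian_chart_image: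
  assumes "l \<in> lagrangians"
  shows "inj_on (snd (lagrangian_chart l)) (fst (lagrangian_chart l))" "open (snd (lagrangian_chart l) ` fst (lagrangian_chart l))"
proof -
  have "\<exists>U. bij_betw (snd (lagrangian_chart l)) (fst (lagrangian_chart l)) U \<and> open U"
    using assms
  proof (cases rule: lagrangiansE)
    case 1
    then show ?thesis using torus_chart_bij open_Int[OF open_fst_ne[of 0] open_snd_ne[of 0]] by auto
  next
    case (2 v j)
    then show ?thesis using N_bij[of v j] open_product_ne_one by auto
  qed
  then show "inj_on (snd (lagrangian_chart l)) (fst (lagrangian_chart l))" "open (snd (lagrangian_chart l) ` fst (lagrangian_chart l))"
    by (auto simp: bij_betw_def)
qed

text \<open>By the recursion the coordinates with index \<open>j + 1\<close> are
  \<open>1 / v\<close> and \<open>u v^2\<close> in those with index \<open>j\<close>, so both stay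
  nonzero on the way down to \<open>j = 1\<close>, where a nonzero first coordinate means the
  torus.\<close>

lemma overlap_torus:
  assumes v: "v \<in> V" "1 \<le> j" "j \<le> n v + 1"
    and q: "q \<in> fst (N v j)" "fst (snd (N v j) q) \<noteq> 0" "snd (snd (N v j) q) \<noteq> 0"
  shows "q \<in> fst T"
  using v(2,3) q
proof (induction j rule: dec_induct)
  case base
  then show ?case using T_N1(1)[OF v(1), of q] v(1) by simp
next
  case (step j)
  have j: "j < (if v \<in> V then n v + 1 else 0)" using step v(1) by simp
  have 1: "q \<in> fst (N v j)" "snd (snd (N v j) q) \<noteq> 0" using N_Suc(1)[OF v(1) step(1) j, of q] step by auto
  have "fst (snd (N v j) q) \<noteq> 0" using N_Suc(2)[OF v(1) step(1) j 1] step by auto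
  then show ?case using step 1 by simp
qed

text \<open>Outside the torus \<open>u v = 0\<close>, which is precisely the residue condition on
  deformations of a sphere; hence whole residue fibres are available. Points of \<open>S v\<close>
  off the divisor are covered by the last sphere of \<open>v\<close>.\<close>

lemma lagrangian_cover:
  assumes c: "c \<in> atlas M" "q \<in> fst c"
  shows "\<exists>l\<in>lagrangians. q \<in> fst (lagrangian_chart l) \<and>
    (\<forall>Q\<in>Lam0 \<times> Lam0. residue2 Q = snd (lagrangian_chart l) q \<longrightarrow> (l, Q) \<in> A)"
proof (cases "q \<in> fst T")
  case True
  have "snd T q \<in> {p. fst p \<noteq> 0} \<inter> {p. snd p \<noteq> 0}" using bij_betw_apply[OF torus_chart_bij True] .
  then have "\<forall>Q\<in>Lam0 \<times> Lam0. residue2 Q = snd T q \<longrightarrow> (Torus, Q) \<in> A"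
    unfolding mirror_point_iff torus_deformations thickening_def by auto
  then show ?thesis using True by (intro bexI[of _ Torus]) auto
next
  case False
  obtain c' where c': "c' \<in> atlas B" "q \<in> fst c'" "q \<in> W" using c unfolding restrict_surface_def by auto
  have sphere: ?thesis if vj: "v \<in> V" "1 \<le> j" "j \<le> n v + 1" "q \<in> fst (N v j)" for v j
  proof -
    have l: "Sphere v j \<in> lagrangians" using vj by auto
    have "fst (snd (N v j) q) * snd (snd (N v j) q) = 0" using overlap_torus[OF vj] False by auto
    then have "\<forall>Q\<in>Lam0 \<times> Lam0. residue2 Q = snd (N v j) q \<longrightarrow> (Sphere v j, Q) \<in> A"
      unfolding mirror_point_iff using l
      by (metis SigmaE fst_conv residue2_def snd_conv sphere_deformations)
    then show ?thesis using l vj by (intro bexI[of _ "Sphere v j"]) auto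
  qed
  have "q \<in> \<Union>(fst ` stage_models V T (\<lambda>v. if v \<in> V then n v + 1 else 0) S N)"
    using subsetD[OF atlas_sub[OF c'(1)] c'(2)] subsetD[OF J_D, of q] c'(3) by blast
  then obtain m where m: "m \<in> stage_models V T (\<lambda>v. if v \<in> V then n v + 1 else 0) S N" "q \<in> fst m" by blast
  from m(1) show ?thesis
  proof (cases rule: model_cases)
    case 1
    then show ?thesis using m(2) False by simp
  next
    case (2 v)
    have "q \<in> D v" if "snd (snd (S v) q) = 0"
      using D_Z[OF 2(1)] m(2) that unfolding 2(2) by blast
    then have "snd (snd (S v) q) \<noteq> 0" using c'(3) 2(1) by blast
    then have "q \<in> fst (N v (n v + 1))" using S_N(1)[OF 2(1), of q] 2 m(2) by simp
    then show ?thesis using sphere[of v "n v + 1"] 2(1) by simp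
  next
    case (3 v j)
    then show ?thesis using sphere[of v j] m(2) by simp
  qed
qed

lemma mirror_atlas: "atlas M = (\<lambda>c. restrict_chart c W) ` atlas B"
  by (auto simp: restrict_surface_def restrict_chart_def image_iff) force

text \<open>Charts of the surface become injective once the divisors are removed, because the fixed
  points go with them; their images are open because the Lagrangian charts cover them and have open
  images.\<close>

lemma rat_atlas_charts: "rat_atlas charts"
proof -
  let ?Mod = "stage_models V T (\<lambda>v. if v \<in> V then n v + 1 else 0) S N"
  have chart: "\<exists>c'\<in>atlas B \<union> ?Mod. c = restrict_chart c' W" if "c \<in> charts" for c
    using that unfolding mirror_atlas
  proof
    assume "c \<in> lagrangian_chart ` lagrangians"
    then obtain l where l: "l \<in> lagrangians" "c = lagrangian_chart l" by blast
    show ?thesis unfolding l(2)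
      by (intro bexI[of _ "lagrangian_chart l"] UnI2 models_lagrangian l(1) restrict_chart_id[symmetric] lagrangian_chart_sub)
  qed blast
  have sub: "fst c \<subseteq> W \<inter> \<Union>(fst ` ?Mod)" if c: "c \<in> charts" for c
  proof -
    obtain c' where c': "c' \<in> atlas B \<union> ?Mod" "c = restrict_chart c' W" using chart[OF c] by blast
    from c'(1) have "fst c' \<subseteq> \<Union>(fst ` ?Mod) \<union> junk" using atlas_sub by blast
    moreover have "junk \<inter> W = {}" using J_D by blast
    ultimately show ?thesis unfolding c'(2) restrict_chart_simps by blast
  qed
  have rel: "chart_rel q c d" if cd: "c \<in> charts" "d \<in> charts" "q \<in> fst c" "q \<in> fst d" for c d q
  proof -
    obtain c' d' where c': "c' \<in> atlas B \<union> ?Mod" "c = restrict_chart c' W" and d': "d' \<in> atlas B \<union> ?Mod" "d = restrict_chart d' W"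
      using chart[OF cd(1)] chart[OF cd(2)] by blast
    have q: "q \<in> \<Union>(fst ` ?Mod)" "q \<in> W" using sub[OF cd(1)] cd(3) by blast+
    have "chart_rel q c' d'" using compat[OF q(1) c'(1) d'(1)] cd(3,4) unfolding c'(2) d'(2) by simp
    from chart_rel_restrict[OF this q(2)] show ?thesis unfolding c'(2) d'(2) .
  qed
  have "inj_on (snd c) (fst c) \<and> open (snd c ` fst c)" if c: "c \<in> charts" for c
  proof (cases "c \<in> lagrangian_chart ` lagrangians")
    case True
    then show ?thesis using lagrangian_chart_image by blast
  next
    case False
    then have cM: "c \<in> atlas M" using c by blast
    then obtain c' where c': "c' \<in> atlas B" "c = restrict_chart c' W" unfolding mirror_atlas by blast
    have "inj_on (snd c) (fst c)"
      using sub[OF c] unfolding c'(2) restrict_chart_simps by (intro inj_on_subset[OF inj[OF c'(1)]]) blast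
    moreover have "open (snd c ` fst c)"
    proof (subst open_subopen, intro ballI)
      fix p assume "p \<in> snd c ` fst c"
      then obtain q where q: "q \<in> fst c" "p = snd c q" by blast
      obtain l where l: "l \<in> lagrangians" "q \<in> fst (lagrangian_chart l)" using lagrangian_cover[OF cM q(1)] by blast
      have "chart_rel q c (lagrangian_chart l)" by (rule rel[OF c UnI2[OF imageI[OF l(1)]] q(1) l(2)])
      from chart_rel_open[OF this lagrangian_chart_image(2)[OF l(1)]]
      show "\<exists>U. open U \<and> p \<in> U \<and> U \<subseteq> snd c ` fst c" unfolding q(2) .
    qed
    ultimately show ?thesis by blast
  qed
  then have "\<forall>c\<in>charts. inj_on (snd c) (fst c) \<and> open (snd c ` fst c)" by (rule ballI)
  moreover have "\<forall>c\<in>charts. \<forall>d\<in>charts. \<forall>q\<in>fst c \<inter> fst d. chart_rel q c d" by (intro ballI, erule IntE, rule rel)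
  ultimately show ?thesis unfolding rat_atlas_def by (rule conjI)
qed

lemma mirror_point_chart:
  assumes "(l, Q) \<in> A"
  shows "lagrangian_chart l \<in> charts" "Q \<in> thickening (snd (lagrangian_chart l) ` fst (lagrangian_chart l))"
proof -
  have l: "l \<in> lagrangians" "Q \<in> deformations l" using assms by (simp_all add: mirror_point_iff)
  then show "lagrangian_chart l \<in> charts" by blast
  show "Q \<in> thickening (snd (lagrangian_chart l) ` fst (lagrangian_chart l))"
    using l(1)
  proof (cases rule: lagrangiansE)
    case 1
    then show ?thesis using l(2) torus_deformations bij_betw_imp_surj_on[OF torus_chart_bij] by simp
  next
    case (2 v j)
    have "snd (N v j) ` fst (N v j) = {x. fst x * snd x \<noteq> 1}" using bij_betw_imp_surj_on[OF N_bij] 2 by auto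
    then show ?thesis using l(2) 2(1) by (cases Q) (auto simp: sphere_deformations thickening_def residue2_def)
  qed
qed

lemma mirror_point_residue:
  assumes "(l, Q) \<in> A"
  obtains q where "q \<in> fst (lagrangian_chart l)" "residue2 Q = snd (lagrangian_chart l) q" "Q \<in> Lam0 \<times> Lam0"
  using mirror_point_chart(2)[OF assms] unfolding thickening_def by auto

text \<open>Solved for \<open>y\<close>, the gluing equations are the rational map
  \<open>(w, (z + 1) / w)\<close>, the transition from the torus to \<open>N v 1\<close>; division
  by w is legitimate since its residue is nonzero.\<close>

lemma gluing_torus_sphere:
  assumes v: "v \<in> V" and A: "(Torus, Q) \<in> A"
    and x: "holonomy Q (f v) = x" "holonomy Q (e v) = x * y - 1"
  shows "extension_rel T (N v 1) Q (x, y)"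
proof -
  let ?V = "{p :: complex \<times> complex. fst p \<noteq> 0} \<inter> {p. snd p \<noteq> 0}"
  let ?h = "\<lambda>m p. fst p powi fst m * snd p powi snd m :: complex"
  have k: "(if v \<in> V then n v + 1 else 0) \<ge> 1" using v by simp
  obtain q where q: "q \<in> fst T" "residue2 Q = snd T q" "Q \<in> Lam0 \<times> Lam0"
    using mirror_point_residue[OF A] by auto
  have qV: "snd T r \<in> ?V" if "r \<in> fst T" for r using bij_betw_apply[OF torus_chart_bij that] .
  have "rat_map ?V (\<lambda>p. (?h (f v) p, (?h (e v) p + 1) / ?h (f v) p))
      (\<lambda>P. (holonomy P (f v), (holonomy P (e v) + 1) / holonomy P (f v)))"
    by (intro rat_map_pair holonomy_nrat nrat_divide nrat.nrat_add nrat_one) auto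
  moreover have "snd (N v 1) r = (?h (f v) (snd T r), (?h (e v) (snd T r) + 1) / ?h (f v) (snd T r))"
    if "r \<in> fst T" "snd T r \<in> ?V" for r
    using T_N1(2)[OF v k that(1)] torus_chart_monomial[OF that(1)] by simp
  moreover have "q \<in> fst (N v 1)" using T_N1(1)[OF v k] q(1) by blast
  ultimately have "extension_rel T (N v 1) Q (holonomy Q (f v), (holonomy Q (e v) + 1) / holonomy Q (f v))"
    using mirror_point_chart(1)[OF A] q qV open_Int[OF open_fst_ne[of 0] open_snd_ne[of 0]]
    by (intro extension_relI[OF rat_atlas_charts, where V = ?V and q = q]) auto
  moreover have "x \<noteq> 0"
  proof -
    have "Q \<in> thickening ?V" using A by (simp add: mirror_point_iff torus_deformations)
    from nrat_residue[OF holonomy_nrat this, of "f v"] show ?thesis using qV[OF q(1)] x(1) q(2) by auto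
  qed
  ultimately show ?thesis using x by simp
qed

lemma gluing_sphere_sphere:
  assumes v: "v \<in> V" "1 \<le> j" "j < n v + 1" and A: "(Sphere v j, (x, y)) \<in> A" "(Sphere v (Suc j), (x', y')) \<in> A"
    and x: "x' \<noteq> 0" "y = inverse x'" "x = x'\<^sup>2 * y'"
  shows "extension_rel (N v j) (N v (Suc j)) (x, y) (x', y')"
proof -
  let ?V = "{p :: complex \<times> complex. snd p \<noteq> 0}"
  have k: "j < (if v \<in> V then n v + 1 else 0)" using v by simp
  obtain q where q: "q \<in> fst (N v j)" "residue2 (x, y) = snd (N v j) q" "(x, y) \<in> Lam0 \<times> Lam0"
    using mirror_point_residue[OF A(1)] by auto
  \<comment> \<open>\<open>x'\<close> and \<open>y\<close> both lie in \<open>Lam0\<close> and are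
    inverse to each other, so neither residue vanishes.\<close>
  have "residue x' * residue y = 1"
    using A x by (subst residue_mult[symmetric]) (auto simp: mirror_point_iff sphere_deformations)
  then have y: "snd (snd (N v j) q) \<noteq> 0" using q(2) unfolding residue2_def by (metis mult_zero_right snd_conv zero_neq_one)
  have "rat_map ?V (\<lambda>p. (1 / snd p, fst p * (snd p)\<^sup>2)) (\<lambda>P. (1 / snd P, fst P * (snd P)\<^sup>2))"
    by (intro rat_map_pair nrat_divide nrat_one nrat.nrat_mult nrat_power nrat.nrat_fst nrat.nrat_snd) auto
  moreover have "snd (N v (Suc j)) r = (1 / snd (snd (N v j) r), fst (snd (N v j) r) * (snd (snd (N v j) r))\<^sup>2)"
    if "r \<in> fst (N v j)" "snd (N v j) r \<in> ?V" for r
    using N_Suc(2)[OF v(1,2) k that(1)] that(2) by simp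
  moreover have "q \<in> fst (N v (Suc j))" using N_Suc(1)[OF v(1,2) k, of q] q(1) y by blast
  ultimately have "extension_rel (N v j) (N v (Suc j)) (x, y) (1 / snd (x, y), fst (x, y) * (snd (x, y))\<^sup>2)"
    using mirror_point_chart(1)[OF A(1)] q y open_snd_ne[of 0]
    by (intro extension_relI[OF rat_atlas_charts, where V = ?V and q = q]) auto
  moreover have "1 / y = x'" "x * y\<^sup>2 = y'"
    unfolding x(2,3) using x(1) by (simp_all add: power2_eq_square field_simps)
  ultimately show ?thesis by simp
qed

lemma gluing_sub: "R \<subseteq> A \<times> A"
  unfolding mirror_gluing_def by (rule Int_lower1)

lemma gluing_extension_rel:
  assumes "((l, Q), (l', Q')) \<in> R"
  shows "extension_rel (lagrangian_chart l) (lagrangian_chart l') Q Q'"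
proof -
  have A: "(l, Q) \<in> A" "(l', Q') \<in> A" using assms gluing_sub by blast+
  consider v x y where "l = Torus" "l' = Sphere v 1" "Q' = (x, y)" "holonomy Q (f v) = x" "holonomy Q (e v) = x * y - 1"
    | v j x y x' y' where "l = Sphere v j" "Q = (x, y)" "l' = Sphere v (Suc j)" "Q' = (x', y')" "x' \<noteq> 0" "y = inverse x'" "x = x'\<^sup>2 * y'"
    using assms unfolding mirror_gluing_def by blast
  then show ?thesis
  proof cases
    case (1 v x y)
    have "v \<in> V" using A(2) 1 by (auto simp: mirror_point_iff)
    from gluing_torus_sphere[OF this A(1)[unfolded 1(1)] 1(4,5)]
    show ?thesis unfolding 1(1-3) lagrangian_chart_simps .
  next
    case (2 v j x y x' y')
    have "v \<in> V" "1 \<le> j" "j < n v + 1" using A 2 by (auto simp: mirror_point_iff)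
    from gluing_sphere_sphere[OF this A(1)[unfolded 2(1,2)] A(2)[unfolded 2(3,4)] 2(5-7)]
    show ?thesis unfolding 2(1-4) lagrangian_chart_simps .
  qed
qed

lemma glued_extension_rel:
  assumes "((l, Q), z) \<in> (R \<union> R\<inverse>)\<^sup>*" "(l, Q) \<in> A"
  shows "z \<in> A \<and> extension_rel (lagrangian_chart l) (lagrangian_chart (fst z)) Q (snd z)"
  using assms(1)
proof (induction rule: rtrancl_induct)
  case base
  show ?case using assms(2) extension_rel_refl[OF rat_atlas_charts mirror_point_chart[OF assms(2)]] by simp
next
  case (step y z)
  have A: "y \<in> A" "z \<in> A" using step(2) gluing_sub by blast+
  then have c: "lagrangian_chart (fst y) \<in> charts" "lagrangian_chart (fst z) \<in> charts"
    using mirror_point_chart(1)[of "fst y" "snd y"] mirror_point_chart(1)[of "fst z" "snd z"] by simp_all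
  have "extension_rel (lagrangian_chart (fst y)) (lagrangian_chart (fst z)) (snd y) (snd z)"
    using step(2)
  proof
    assume "(y, z) \<in> R"
    then show ?thesis by (intro gluing_extension_rel) (simp only: prod.collapse)
  next
    assume "(y, z) \<in> R\<inverse>"
    then show ?thesis
      by (intro extension_rel_sym[OF rat_atlas_charts c(2,1)] gluing_extension_rel) (simp only: prod.collapse converse_iff)
  qed
  from extension_rel_trans[OF rat_atlas_charts mirror_point_chart(1)[OF assms(2)] c conjunct2[OF step(3)] this] A(2)
  show ?case by (rule conjI[rotated])
qed

text \<open>The curves \<open>u = 0\<close> of the charts of the \<open>L\<^sub>v\<^sub>,\<^sub>j\<close> are disjoint from each other and from the torus,
  so two points in normal form are glued only if they are equal.\<close>

lemma normal_form:
  assumes "(l, Q) \<in> A"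
  obtains l' Q' where "((l, Q), (l', Q')) \<in> (R \<union> R\<inverse>)\<^sup>*" "(l', Q') \<in> A"
    "l' = Torus \<or> (\<exists>v j. l' = Sphere v j \<and> residue (fst Q') = 0)"
proof -
  have l: "l \<in> lagrangians" "Q \<in> deformations l" using assms by (simp_all add: mirror_point_iff)
  show ?thesis
  proof (cases "l = Torus \<or> residue (fst Q) = 0")
    case True
    then have "l = Torus \<or> (\<exists>v j. l = Sphere v j \<and> residue (fst Q) = 0)" by (metis lagrangian.exhaust)
    then show ?thesis by (rule that[OF rtrancl.rtrancl_refl assms])
  next
    case False
    then obtain v j where vj: "l = Sphere v j" "v \<in> V" "1 \<le> j" "j \<le> n v + 1" using l(1) by (elim lagrangiansE) auto
    obtain x y where Q: "Q = (x, y)" by force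
    have x: "x \<in> Lam0" "residue x \<noteq> 0" and y: "y \<in> Lam0" "residue y = 0"
      using l(2) False by (auto simp: vj(1) Q sphere_deformations)
    show ?thesis
    proof (cases "j = 1")
      case True
      \<comment> \<open>Here z has residue -1, so together with \<open>x\<close> it is realised as a
        pair of holonomies.\<close>
      have "x * y - 1 \<in> Lam0" "residue (x * y - 1) \<noteq> 0" using x y by simp_all
      from holonomy_solution[OF coord(3)[OF vj(2)] this x] obtain P'
        where P': "P' \<in> deformations Torus" "holonomy P' (e v) = x * y - 1" "holonomy P' (f v) = x" by metis
      have A: "(Torus, P') \<in> A" using P'(1) by (simp add: mirror_point_iff)
      have "((Torus, P'), (l, Q)) \<in> R" unfolding mirror_gluing_def
        using A assms P'(2,3) unfolding vj(1) Q True by (intro IntI SigmaI UnI1) blast+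
      then have "((l, Q), (Torus, P')) \<in> (R \<union> R\<inverse>)\<^sup>*" by (intro r_into_rtrancl UnI2 converseI)
      then show ?thesis by (rule that[OF _ A disjI1]) (rule refl)
    next
      case False
      then obtain i where i: "j = Suc i" "1 \<le> i" using vj(3) by (cases j) auto
      \<comment> \<open>One step down suffices: \<open>y\<close> has residue 0, hence so has the new
        first coordinate \<open>x^2 y\<close>.\<close>
      have A: "(Sphere v i, (x\<^sup>2 * y, inverse x)) \<in> A"
        using x y vj i by (auto simp: mirror_point_iff sphere_deformations Lam0_inverse)
      have "x \<noteq> 0" using x by auto
      then have "((Sphere v i, (x\<^sup>2 * y, inverse x)), (l, Q)) \<in> R"
        unfolding mirror_gluing_def
        using A assms unfolding vj(1) Q i(1) by (intro IntI SigmaI UnI2) blast+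
      then have "((l, Q), (Sphere v i, (x\<^sup>2 * y, inverse x))) \<in> (R \<union> R\<inverse>)\<^sup>*" by (intro r_into_rtrancl UnI2 converseI)
      moreover have "residue (fst (x\<^sup>2 * y, inverse x)) = 0" using x y by (simp add: power2_eq_square)
      then have "Sphere v i = Torus \<or> (\<exists>v' j'. Sphere v i = Sphere v' j' \<and> residue (fst (x\<^sup>2 * y, inverse x)) = 0)"
        by (intro disjI2 exI[of _ v] exI[of _ i] conjI refl)
      ultimately show ?thesis by (rule that[OF _ A])
    qed
  qed
qed

text \<open>After passing to normal forms, the two points still lie over a common point
  \<open>q\<close> of the surface, which is on the torus or on a curve \<open>u = 0\<close>.
  Disjointness of these pieces forces the same chart, and within one chart
  \<open>extension_rel\<close> is equality.\<close>

lemma extension_rel_glued: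
  assumes A: "(l, Q) \<in> A" "(l', Q') \<in> A" and rel: "extension_rel (lagrangian_chart l) (lagrangian_chart l') Q Q'"
  shows "((l, Q), (l', Q')) \<in> (R \<union> R\<inverse>)\<^sup>*"
proof -
  have sym: "sym ((R \<union> R\<inverse>)\<^sup>*)" by (intro sym_rtrancl sym_Un_converse)
  obtain m P1 where 1: "((l, Q), (m, P1)) \<in> (R \<union> R\<inverse>)\<^sup>*" "(m, P1) \<in> A"
    "m = Torus \<or> (\<exists>v j. m = Sphere v j \<and> residue (fst P1) = 0)" by (rule normal_form[OF A(1)])
  obtain m' P2 where 2: "((l', Q'), (m', P2)) \<in> (R \<union> R\<inverse>)\<^sup>*" "(m', P2) \<in> A"
    "m' = Torus \<or> (\<exists>v j. m' = Sphere v j \<and> residue (fst P2) = 0)" by (rule normal_form[OF A(2)])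
  note c = mirror_point_chart(1)[OF A(1)] mirror_point_chart(1)[OF A(2)] mirror_point_chart(1)[OF 1(2)] mirror_point_chart(1)[OF 2(2)]
  have "extension_rel (lagrangian_chart m) (lagrangian_chart l) P1 Q"
    using glued_extension_rel[OF 1(1) A(1)] extension_rel_sym[OF rat_atlas_charts c(1,3)] by simp
  moreover have "extension_rel (lagrangian_chart l') (lagrangian_chart m') Q' P2"
    using glued_extension_rel[OF 2(1) A(2)] by simp
  ultimately have ext: "extension_rel (lagrangian_chart m) (lagrangian_chart m') P1 P2"
    using rel extension_rel_trans[OF rat_atlas_charts c(3,1,2)] extension_rel_trans[OF rat_atlas_charts c(3,2,4)] by blast
  obtain q where q: "q \<in> fst (lagrangian_chart m)" "q \<in> fst (lagrangian_chart m')"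
    "residue2 P1 = snd (lagrangian_chart m) q" "residue2 P2 = snd (lagrangian_chart m') q"
    using extension_rel_point(3)[OF rat_atlas_charts c(3,4) ext] by blast
  have sph: "v \<in> V \<and> j \<in> {1..if v \<in> V then n v + 1 else 0}" if "(Sphere v j, Q) \<in> A" for v j Q
    using that by (auto simp: mirror_point_iff)
  have z1: "fst (snd (N v j) q) = 0" if "m = Sphere v j" for v j using 1(3) q(3) that by (auto simp: residue2_def prod_eq_iff)
  have z2: "fst (snd (N v j) q) = 0" if "m' = Sphere v j" for v j using 2(3) q(4) that by (auto simp: residue2_def prod_eq_iff)
  have "m = m'"
  proof (cases m)
    case m: Torus
    show ?thesis
    proof (cases m')
      case (Sphere v j)
      then show ?thesis using E_T[of v j q] sph[of v j P2] 2(2) q z2 m by auto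
    qed (use m in simp)
  next
    case m: (Sphere v j)
    show ?thesis
    proof (cases m')
      case Torus
      then show ?thesis using E_T[of v j q] sph[of v j P1] 1(2) q z1 m by auto
    next
      case (Sphere v' j')
      have "v = v' \<and> j = j'"
        by (rule E_disjoint[of v j v' j' q]) (use sph[of v j P1] sph[of v' j' P2] 1(2) 2(2) q z1 z2 m Sphere in auto)
      then show ?thesis using m Sphere by simp
    qed
  qed
  then have "P1 = P2"
    using ext extension_rel_refl[OF rat_atlas_charts mirror_point_chart[OF 1(2)]] unfolding extension_rel_def by simp
  then show ?thesis using 1(1) symD[OF sym 2(1)] \<open>m = m'\<close> by (simp add: rtrancl_trans)
qed

lemma mirror_isomorphism:
  "\<exists>\<Phi>. extension_isomorphism A R M \<Phi> \<and>
     (\<forall>Q\<in>Lam0_units \<times> Lam0_units. \<Phi> (mirror_class \<Delta> n e f (Torus, Q)) = extension_class M (T, Q))"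
proof -
  have "\<exists>\<Phi>. extension_isomorphism A R M \<Phi> \<and>
     (\<forall>l Q. (l, Q) \<in> A \<longrightarrow> lagrangian_chart l \<in> atlas M \<longrightarrow> \<Phi> (glue_class A R (l, Q)) = extension_class M (lagrangian_chart l, Q))"
  proof (rule extension_isomorphism_exists[OF rat_atlas_charts])
    show "atlas M \<subseteq> charts" by blast
    show "R \<subseteq> A \<times> A" by (rule gluing_sub)
    show "lagrangian_chart l \<in> charts \<and> Q \<in> thickening (snd (lagrangian_chart l) ` fst (lagrangian_chart l))"
      if "(l, Q) \<in> A" for l Q using mirror_point_chart[OF that] by blast
    show "extension_rel (lagrangian_chart l) (lagrangian_chart l') Q Q'" if "((l, Q), (l', Q')) \<in> R" for l Q l' Q'
      by (rule gluing_extension_rel[OF that])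
    show "((l, Q), (l', Q')) \<in> (R \<union> R\<inverse>)\<^sup>*"
      if "(l, Q) \<in> A" "(l', Q') \<in> A" "extension_rel (lagrangian_chart l) (lagrangian_chart l') Q Q'" for l Q l' Q'
      by (rule extension_rel_glued[OF that])
    show "\<exists>c\<in>atlas M. q \<in> fst c" if "(l, Q) \<in> A" "q \<in> fst (lagrangian_chart l)" for l Q q
    proof -
      have l: "l \<in> lagrangians" using that(1) by (simp add: mirror_point_iff)
      then have "q \<in> \<Union> (fst ` atlas B)" using that(2) model_sub[OF models_lagrangian] Z_sub by blast
      moreover have "q \<in> W" using lagrangian_chart_sub[OF l] that(2) by blast
      ultimately show ?thesis unfolding mirror_atlas by force
    qed
    show "\<exists>l. lagrangian_chart l \<in> charts \<and> q \<in> fst (lagrangian_chart l) \<and>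
         (\<forall>P\<in>Lam0 \<times> Lam0. residue2 P = snd (lagrangian_chart l) q \<longrightarrow> (l, P) \<in> A)"
      if "c \<in> atlas M" "q \<in> fst c" for c q using lagrangian_cover[OF that] by blast
  qed
  then obtain \<Phi> where \<Phi>: "extension_isomorphism A R M \<Phi>"
    "\<And>l Q. (l, Q) \<in> A \<Longrightarrow> lagrangian_chart l \<in> atlas M \<Longrightarrow> \<Phi> (glue_class A R (l, Q)) = extension_class M (lagrangian_chart l, Q)"
    by blast
  have T: "Torus \<in> lagrangians" by simp
  have "T \<in> atlas M"
    unfolding mirror_atlas using T_atlas restrict_chart_id[OF lagrangian_chart_sub[OF T]] by (metis image_eqI lagrangian_chart_simps(1))
  moreover have "(Torus, Q) \<in> A" if "Q \<in> Lam0_units \<times> Lam0_units" for Q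
    using that T by (simp add: mirror_point_iff deformations_def)
  ultimately show ?thesis using \<Phi> by (intro exI[of _ \<Phi>] conjI ballI) (use \<Phi>(2)[of Torus] in auto)
qed

end

end

text \<open>The second conjunct ties \<open>\<Phi>\<close> to the geometry: a flat connection on the
  torus goes to the point of the torus chart whose toric coordinates are its holonomies.\<close>

theorem theorem6p19:
  fixes \<Delta> :: "(real \<times> real) set" and n :: "int \<times> int \<Rightarrow> nat" and e f :: "int \<times> int \<Rightarrow> int \<times> int"
    and B :: "tpoint surface" and D :: "int \<times> int \<Rightarrow> tpoint set"
  assumes "lattice_polygon \<Delta>"
    and "interior \<Delta> \<inter> range lat_real = {0}"
    and "\<forall>v\<in>lattice_vertices \<Delta>. A_singularity \<Delta> v (n v)"
    and "toric_coordinates \<Delta> e f"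
    and "special_blowups \<Delta> e (\<lambda>v. if v \<in> lattice_vertices \<Delta> then n v + 1 else 0) B D"
  defines "Xcheck \<equiv> restrict_surface B (- (\<Union>v\<in>lattice_vertices \<Delta>. D v))"
  shows "\<exists>\<Phi>. extension_isomorphism (mirror_points \<Delta> n) (mirror_gluing \<Delta> n e f) Xcheck \<Phi> \<and>
     (\<forall>P\<in>Lam0_units \<times> Lam0_units.
        \<Phi> (mirror_class \<Delta> n e f (Torus, P)) = extension_class Xcheck (torus_chart (polar_dual \<Delta>), P))"
proof -
  interpret dual_polygon \<Delta> e f "lattice_vertices \<Delta>" "polar_dual \<Delta>"
    using assms(1,2,4) by unfold_locales auto
  show ?thesis
    unfolding Xcheck_def using special_blowups_stage[OF assms(5)] mirror_isomorphism by blast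
qed

end
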